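(* Let $g\colon J\to\mathbb R$ be a difference of two convex functions. Assume that $Y$ exits $J$ at $l$, that there exists a finite limit $g(l):=\lim_{x\downarrow l}g(x)$, and that $Y$ does not exit $J$ at $r$. Let $g(Y)$ be a semimartingale. Then $$\frac{s-s(l)}{\rho}\,(g')^2\in L^1_{\mathrm{loc}}(l+),$$ i.e. $\int_l^z\frac{s(y)-s(l)}{\rho(y)}\,(g'(y))^2\,dy<\infty$ for some $z\in J$.
   Context: Let $J=(l,r)$, $-\infty\le l<r\le\infty$, and let $\mu,\sigma\colon J\to\mathbb R$ be Borel functions with $\sigma(x)\ne0$ for all $x\in J$ and $\frac1{\sigma^2},\frac{\mu}{\sigma^2}\in L^1_{\mathrm{loc}}(J)$ (integrable on compact subsets of $J$ with respect to Lebesgue measure). On a filtered probability space $(\Omega,\mathcal F,(\mathcal F_t)_{t\in[0,\infty)},\mathsf P)$ with an $(\mathcal F_t,\mathsf P)$-Brownian motion $W$, let $Y=(Y_t)_{t\in[0,\infty)}$ be a solution of $dY_t=\mu(Y_t)\,dt+\sigma(Y_t)\,dW_t$, $Y_0=x_0\in J$, which may exit $J$ continuously at a finite time; $\zeta$ denotes its exit time from $J$. That is, $\mathsf P$-a.s. on $\{\zeta=\infty\}$ the trajectories do not exit $J$, and $\mathsf P$-a.s. on $\{\zeta<\infty\}$ either $\lim_{t\uparrow\zeta}Y_t=r$ or $\lim_{t\uparrow\zeta}Y_t=l$; on $\{\zeta<\infty\}$ the process $Y$ stays after $\zeta$ at the endpoint where it exits. "$Y$ exits $J$ at $l$" means $\mathsf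 P(\zeta<\infty,\lim_{t\uparrow\zeta}Y_t=l)>0$; "$Y$ exits $J$ at $r$" is defined analogously. With the value $g(l)$ given by the limit, $g(Y)=(g(Y_t))_{t\in[0,\infty)}$ is a well-defined finite process; "semimartingale" means semimartingale on $[0,\infty)$ with respect to $(\mathcal F_t)$. Fix $c\in J$ and put $\rho(x)=\exp\{-\int_c^x\frac{2\mu}{\sigma^2}(y)\,dy\}$ for $x\in J$ and $s(x)=\int_c^x\rho(y)\,dy$ for $x\in[l,r]$ (values $\pm\infty$ allowed at the endpoints). The derivative $g'$ exists on $J$ except possibly on a countable set, where it may be defined arbitrarily. $L^1_{\mathrm{loc}}(l+)$ is the set of Borel functions $f\colon J\to[-\infty,\infty]$ with $\int_{(l,z)}|f(y)|\,dy<\infty$ for some $z\in J$. *)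

theory Defs
  imports "HOL-Probability.Probability"
begin

text \<open>
  Time is the half-line \<open>[0, \<infinity>)\<close>. Processes and filtrations are indexed by \<^typ>\<open>real\<close>, but only their
  values at times \<open>t \<ge> 0\<close> matter: a filtration on \<open>[0, \<infinity>)\<close> extends to negative times by its value
  at \<open>0\<close>. Neither completeness nor right-continuity of the filtration is assumed; path properties
  are therefore always understood almost surely.
\<close>

locale filtered_prob_space = prob_space M + filtration "space M" F
  for M :: "'a measure" and F :: "real \<Rightarrow> 'a measure" +
  assumes sets_F_subset: "sets (F t) \<subseteq> sets M"

definition adapted :: "(real \<Rightarrow> 'a measure) \<Rightarrow> (real \<Rightarrow> 'a \<Rightarrow> 'b::topological_space) \<Rightarrow> bool" where
  "adapted F X \<longleftrightarrow> (\<forall>t\<ge>0. X t \<in> borel_measurable (F t))"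

definition brownian_motion ::
    "'a measure \<Rightarrow> (real \<Rightarrow> 'a measure) \<Rightarrow> (real \<Rightarrow> 'a \<Rightarrow> real) \<Rightarrow> bool" where
  "brownian_motion M F W \<longleftrightarrow>
     adapted F W \<and>
     (AE \<omega> in M. W 0 \<omega> = 0) \<and>
     (AE \<omega> in M. continuous_on {0..} (\<lambda>t. W t \<omega>)) \<and>
     (\<forall>s t. 0 \<le> s \<and> s < t \<longrightarrow>
        distributed M lborel (\<lambda>\<omega>. W t \<omega> - W s \<omega>) (\<lambda>x. ennreal (normal_density 0 (sqrt (t - s)) x)) \<and>
        prob_space.indep_set M (sets (F s))
          (sets (vimage_algebra (space M) (\<lambda>\<omega>. W t \<omega> - W s \<omega>) borel)))"


section \<open>Semimartingales\<close>

definition martingale ::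
    "'a measure \<Rightarrow> (real \<Rightarrow> 'a measure) \<Rightarrow> (real \<Rightarrow> 'a \<Rightarrow> real) \<Rightarrow> bool" where
  "martingale M F X \<longleftrightarrow>
     adapted F X \<and> (\<forall>t\<ge>0. integrable M (X t)) \<and>
     (\<forall>s t. 0 \<le> s \<and> s \<le> t \<longrightarrow> (AE \<omega> in M. real_cond_exp M (F s) (X t) \<omega> = X s \<omega>))"

definition cadlag :: "(real \<Rightarrow> real) \<Rightarrow> bool" where
  "cadlag f \<longleftrightarrow>
     (\<forall>t\<ge>0. (f \<longlongrightarrow> f t) (at_right t)) \<and> (\<forall>t>0. \<exists>L. (f \<longlongrightarrow> L) (at_left t))"

definition locally_finite_variation :: "(real \<Rightarrow> real) \<Rightarrow> bool" where
  "locally_finite_variation f \<longleftrightarrow>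
     (\<forall>T\<ge>0. \<exists>B. \<forall>n. \<forall>p :: nat \<Rightarrow> real.
        mono_on {..n} p \<and> p ` {..n} \<subseteq> {0..T} \<longrightarrow> (\<Sum>i<n. \<bar>f (p (Suc i)) - f (p i)\<bar>) \<le> B)"

text \<open>
  Localizing times may be taken real-valued: a localizing sequence \<open>\<tau>\<^sub>n\<close> with values in \<open>[0, \<infinity>]\<close> can
  be replaced by \<open>min \<tau>\<^sub>n n\<close>.
\<close>

definition local_martingale ::
    "'a measure \<Rightarrow> (real \<Rightarrow> 'a measure) \<Rightarrow> (real \<Rightarrow> 'a \<Rightarrow> real) \<Rightarrow> bool" where
  "local_martingale M F X \<longleftrightarrow>
     adapted F X \<and> (AE \<omega> in M. cadlag (\<lambda>t. X t \<omega>)) \<and>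
     (\<exists>\<tau> :: nat \<Rightarrow> 'a \<Rightarrow> real.
        (\<forall>n. stopping_time F (\<tau> n) \<and> (\<forall>\<omega>\<in>space M. 0 \<le> \<tau> n \<omega>)) \<and>
        (AE \<omega> in M. incseq (\<lambda>n. \<tau> n \<omega>) \<and> filterlim (\<lambda>n. \<tau> n \<omega>) at_top sequentially) \<and>
        (\<forall>n. martingale M F (\<lambda>t \<omega>. X (min t (\<tau> n \<omega>)) \<omega> - X 0 \<omega>)))"

definition semimartingale ::
    "'a measure \<Rightarrow> (real \<Rightarrow> 'a measure) \<Rightarrow> (real \<Rightarrow> 'a \<Rightarrow> real) \<Rightarrow> bool" where
  "semimartingale M F X \<longleftrightarrow>
     adapted F X \<and> (AE \<omega> in M. cadlag (\<lambda>t. X t \<omega>)) \<and>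
     (\<exists>N A. local_martingale M F N \<and>
        adapted F A \<and> (AE \<omega> in M. cadlag (\<lambda>t. A t \<omega>) \<and> locally_finite_variation (\<lambda>t. A t \<omega>)) \<and>
        (AE \<omega> in M. N 0 \<omega> = 0 \<and> A 0 \<omega> = 0 \<and> (\<forall>t\<ge>0. X t \<omega> = X 0 \<omega> + N t \<omega> + A t \<omega>)))"


section \<open>The Ito integral\<close>

text \<open>
  A list of triples \<open>(u, v, \<xi>)\<close> represents the simple process \<open>\<Sum> \<xi> 1\<^bsub>(u,v]\<^esub>\<close>; the intervals need not
  be disjoint.
\<close>

type_synonym 'a simple_process = "(real \<times> real \<times> ('a \<Rightarrow> real)) list"

definition simple_process ::
    "'a measure \<Rightarrow> (real \<Rightarrow> 'a measure) \<Rightarrow> 'a simple_process \<Rightarrow> bool" where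
  "simple_process M F S \<longleftrightarrow>
     (\<forall>(u, v, \<xi>)\<in>set S. 0 \<le> u \<and> u \<le> v \<and> \<xi> \<in> borel_measurable (F u) \<and> bounded (\<xi> ` space M))"

definition simple_value :: "'a simple_process \<Rightarrow> real \<Rightarrow> 'a \<Rightarrow> real" where
  "simple_value S t \<omega> = (\<Sum>(u, v, \<xi>)\<leftarrow>S. \<xi> \<omega> * indicator {u<..v} t)"

definition simple_integral_wrt ::
    "(real \<Rightarrow> 'a \<Rightarrow> real) \<Rightarrow> 'a simple_process \<Rightarrow> real \<Rightarrow> 'a \<Rightarrow> real" where
  "simple_integral_wrt W S t \<omega> = (\<Sum>(u, v, \<xi>)\<leftarrow>S. \<xi> \<omega> * (W (min v t) \<omega> - W (min u t) \<omega>))"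

text \<open>The outer measure makes the definition meaningful without measurability of the \<open>X\<^sub>n\<close>.\<close>

definition tendsto_0_in_prob :: "'a measure \<Rightarrow> (nat \<Rightarrow> 'a \<Rightarrow> ennreal) \<Rightarrow> bool" where
  "tendsto_0_in_prob M X \<longleftrightarrow>
     (\<forall>\<epsilon>>0. (\<lambda>n. outer_measure_of M {\<omega>\<in>space M. \<epsilon> < X n \<omega>}) \<longlonglongrightarrow> 0)"

text \<open>
  \<open>I\<close> is (a version of) the process \<open>\<integral>\<^sub>0\<^sup>t H\<^sub>u dW\<^sub>u\<close>, \<open>t \<ge> 0\<close>: the limit, uniformly on compact time intervals
  in probability, of the integrals of simple processes \<open>S\<^sub>n\<close> with \<open>\<integral>\<^sub>0\<^sup>T (S\<^sub>n - H)\<^sup>2 du \<rightarrow> 0\<close> in probability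
  for all \<open>T\<close>. This determines \<open>I\<close> up to indistinguishability.
\<close>

definition has_ito_integral ::
    "'a measure \<Rightarrow> (real \<Rightarrow> 'a measure) \<Rightarrow> (real \<Rightarrow> 'a \<Rightarrow> real) \<Rightarrow> (real \<Rightarrow> 'a \<Rightarrow> real) \<Rightarrow>
     (real \<Rightarrow> 'a \<Rightarrow> real) \<Rightarrow> bool" where
  "has_ito_integral M F W H I \<longleftrightarrow>
     (AE \<omega> in M. (\<lambda>u. H u \<omega>) \<in> borel_measurable (restrict_space borel {0..})) \<and>
     (\<exists>S :: nat \<Rightarrow> 'a simple_process.
        (\<forall>n. simple_process M F (S n)) \<and>
        (\<forall>T\<ge>0.
           tendsto_0_in_prob M
             (\<lambda>n \<omega>. \<integral>\<^sup>+u\<in>{0..T}. ennreal ((simple_value (S n) u \<omega> - H u \<omega>)\<^sup>2) \<partial>lborel) \<and>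
           tendsto_0_in_prob M
             (\<lambda>n \<omega>. SUP t\<in>{0..T}. ennreal \<bar>simple_integral_wrt W (S n) t \<omega> - I t \<omega>\<bar>)))"


section \<open>Diffusions with exit\<close>

text \<open>State processes take values in the extended reals, so that an exit at \<open>\<plusminus>\<infinity>\<close> is possible.\<close>

definition exit_time :: "(real \<Rightarrow> 'a \<Rightarrow> ereal) \<Rightarrow> ereal \<Rightarrow> ereal \<Rightarrow> 'a \<Rightarrow> ereal" where
  "exit_time Y a b \<omega> = Inf (ereal ` {t. 0 \<le> t \<and> Y t \<omega> \<notin> {a<..<b}})"

definition exits_through ::
    "(real \<Rightarrow> 'a \<Rightarrow> ereal) \<Rightarrow> ereal \<Rightarrow> ereal \<Rightarrow> ereal \<Rightarrow> 'a \<Rightarrow> bool" where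
  "exits_through Y l r e \<omega> \<longleftrightarrow>
     exit_time Y l r \<omega> < \<infinity> \<and>
     ((\<lambda>t. Y t \<omega>) \<longlongrightarrow> e) (at_left (real_of_ereal (exit_time Y l r \<omega>)))"

text \<open>
  For paths that are continuous only almost surely the event below need be measurable only with respect
  to the completion of \<open>M\<close>; the outer measure is its probability there.
\<close>

definition exits_at ::
    "'a measure \<Rightarrow> (real \<Rightarrow> 'a \<Rightarrow> ereal) \<Rightarrow> ereal \<Rightarrow> ereal \<Rightarrow> ereal \<Rightarrow> bool" where
  "exits_at M Y l r e \<longleftrightarrow> outer_measure_of M {\<omega>\<in>space M. exits_through Y l r e \<omega>} > 0"

text \<open>
  \<open>Y\<close> solves \<open>dY = \<mu>(Y) dt + \<sigma>(Y) dW\<close>, \<open>Y\<^sub>0 = x\<^sub>0\<close>, up to its exit time from \<open>(l, r)\<close>, and is absorbed at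
  the endpoint through which it exits. The equation is required up to the exit time from every
  interval \<open>(a, b)\<close> with \<open>l < a < x\<^sub>0 < b < r\<close>.
\<close>

definition sde_solution_with_exit ::
    "'a measure \<Rightarrow> (real \<Rightarrow> 'a measure) \<Rightarrow> (real \<Rightarrow> 'a \<Rightarrow> real) \<Rightarrow> (real \<Rightarrow> real) \<Rightarrow> (real \<Rightarrow> real) \<Rightarrow>
     ereal \<Rightarrow> ereal \<Rightarrow> real \<Rightarrow> (real \<Rightarrow> 'a \<Rightarrow> ereal) \<Rightarrow> bool" where
  "sde_solution_with_exit M F W \<mu> \<sigma> l r x\<^sub>0 Y \<longleftrightarrow>
     adapted F Y \<and>
     (AE \<omega> in M. Y 0 \<omega> = ereal x\<^sub>0) \<and>
     (AE \<omega> in M. continuous_on {t. 0 \<le> t \<and> ereal t < exit_time Y l r \<omega>} (\<lambda>t. Y t \<omega>)) \<and>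
     (AE \<omega> in M. exit_time Y l r \<omega> < \<infinity> \<longrightarrow>
        (\<exists>e\<in>{l, r}. exits_through Y l r e \<omega> \<and> (\<forall>t. exit_time Y l r \<omega> \<le> ereal t \<longrightarrow> Y t \<omega> = e))) \<and>
     (\<forall>a b. l < ereal a \<and> a < x\<^sub>0 \<and> x\<^sub>0 < b \<and> ereal b < r \<longrightarrow>
        (let \<tau> = exit_time Y (ereal a) (ereal b); y = (\<lambda>t \<omega>. real_of_ereal (Y t \<omega>)) in
         (AE \<omega> in M. \<forall>t\<ge>0.
            (\<integral>\<^sup>+u\<in>einterval 0 (min (ereal t) (\<tau> \<omega>)). ennreal (\<bar>\<mu> (y u \<omega>)\<bar> + (\<sigma> (y u \<omega>))\<^sup>2) \<partial>lborel) < \<infinity>) \<and>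
         (\<exists>I. has_ito_integral M F W (\<lambda>u \<omega>. if ereal u < \<tau> \<omega> then \<sigma> (y u \<omega>) else 0) I \<and>
            (AE \<omega> in M. \<forall>t\<ge>0.
               Y (real_of_ereal (min (ereal t) (\<tau> \<omega>))) \<omega> =
               ereal (x\<^sub>0 + (LBINT u=0..min (ereal t) (\<tau> \<omega>). \<mu> (y u \<omega>)) + I t \<omega>)))))"


section \<open>Scale function and function classes\<close>

definition locally_integrable_on :: "(real \<Rightarrow> real) \<Rightarrow> real set \<Rightarrow> bool" where
  "locally_integrable_on f J \<longleftrightarrow> (\<forall>K. compact K \<and> K \<subseteq> J \<longrightarrow> set_integrable lborel K f)"

definition scale_density :: "(real \<Rightarrow> real) \<Rightarrow> (real \<Rightarrow> real) \<Rightarrow> real \<Rightarrow> real \<Rightarrow> real" where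
  "scale_density \<mu> \<sigma> c x = exp (- (LBINT y=ereal c..ereal x. 2 * \<mu> y / (\<sigma> y)\<^sup>2))"

definition scale_function :: "(real \<Rightarrow> real) \<Rightarrow> (real \<Rightarrow> real) \<Rightarrow> real \<Rightarrow> ereal \<Rightarrow> ereal" where
  "scale_function \<mu> \<sigma> c x =
     (if ereal c \<le> x
      then enn2ereal (\<integral>\<^sup>+y\<in>einterval (ereal c) x. ennreal (scale_density \<mu> \<sigma> c y) \<partial>lborel)
      else - enn2ereal (\<integral>\<^sup>+y\<in>einterval x (ereal c). ennreal (scale_density \<mu> \<sigma> c y) \<partial>lborel))"

text \<open>The class \<open>L\<^sup>1\<^sub>l\<^sub>o\<^sub>c(l+)\<close> of functions on \<open>(l, r)\<close>.\<close>

definition L1_loc_right :: "ereal \<Rightarrow> ereal \<Rightarrow> (real \<Rightarrow> ereal) set" where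
  "L1_loc_right l r =
     {f \<in> borel_measurable (restrict_space borel (einterval l r)).
        \<exists>z\<in>einterval l r. (\<integral>\<^sup>+y\<in>einterval l (ereal z). e2ennreal \<bar>f y\<bar> \<partial>lborel) < \<infinity>}"

definition difference_of_convex_on :: "real set \<Rightarrow> (real \<Rightarrow> real) \<Rightarrow> bool" where
  "difference_of_convex_on J g \<longleftrightarrow>
     (\<exists>g1 g2. convex_on J g1 \<and> convex_on J g2 \<and> (\<forall>x\<in>J. g x = g1 x - g2 x))"

text \<open>
  The extension of \<open>g\<close> from \<open>(l, r)\<close> to \<open>[l, r)\<close> by the value \<open>gl\<close> at \<open>l\<close>; elsewhere, in particular at \<open>r\<close>,
  the value is a dummy.
\<close>

definition extend_at_left ::
    "ereal \<Rightarrow> ereal \<Rightarrow> (real \<Rightarrow> real) \<Rightarrow> real \<Rightarrow> ereal \<Rightarrow> real" where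
  "extend_at_left l r g gl y =
     (if y = l then gl else if y \<in> {l<..<r} then g (real_of_ereal y) else 0)"

end

theory Submission
  imports Defs
begin

text \<open>
  Let \<open>X\<close> be \<open>Y\<close> stopped on leaving \<open>(a, b)\<close>, where \<open>l < a < x\<^sub>0 < b < r\<close>. Comparing exponential
  functionals of \<open>X\<close> with those of the Brownian integral shows that \<open>s(X)\<close> is a bounded martingale; no
  Ito formula is needed. Let \<open>f\<close> be the local infimum, over scale \<open>d\<close>, of the squared difference quotients
  of \<open>g\<close> with respect to \<open>s\<close>, cut off at \<open>m\<close>. The concave function \<open>V\<close> of \<open>s\<close> with second derivative
  \<open>- 2 f\<close> and a maximum \<open>0\<close> at \<open>x\<^sub>0\<close> decreases, up to a martingale term, by at most \<open>(g(y) - g(x))\<^sup>2\<close> in a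
  step from \<open>x\<close> to \<open>y\<close>. Summing over a grid of times bounds \<open>- V(a) P(X\<^sub>T = a)\<close> by the sum of the squared
  increments of \<open>g(Y)\<close>, stopped at a level that does not depend on \<open>a\<close>: these sums are tight, since \<open>g(Y)\<close>
  is a semimartingale. As \<open>Y\<close> exits at \<open>l\<close>, \<open>P(X\<^sub>T = a)\<close> is bounded away from \<open>0\<close> for some \<open>T\<close> and \<open>b\<close>, and
  \<open>- V(a)\<close> tends to \<open>2 \<integral> (s - s(a)) g'\<^sup>2 / \<rho>\<close> over \<open>(a, x\<^sub>0)\<close> as \<open>d\<close> tends to \<open>0\<close> and \<open>m\<close> to infinity; it
  remains to let \<open>a\<close> tend to \<open>l\<close>.
\<close>

text \<open>The scale function has only an absolutely continuous derivative, and the coefficients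
  are merely measurable. The expectation of \<open>f(X)\<close> is therefore followed in time only
  for \<open>f = exp(i v x)\<close>, where Gaussian characteristic functions suffice. Expanding in
  \<open>v\<close> at \<open>0\<close> gives polynomials; continuity in the second derivative, in
  \<open>L^1\<close> of Lebesgue measure and of the occupation measure at once, gives
  \<open>s\<close>. The integral of \<open>\<sigma>(X)^2\<close> over time is finite but not
  bounded, so everything is discounted at a rate proportional to a small \<open>\<eta>\<close>; for
  \<open>s\<close> the discount costs at most a constant times the mass it removes, which vanishes
  with \<open>\<eta>\<close>. The second derivative of \<open>g\<close> never enters. An infimum of
  squared quotients lies below each of them, which is all that one step of the potential needs, and
  asymptotically it is at least \<open>(g'/\<rho>)^2\<close> wherever \<open>g\<close> is strictly
  differentiable, that is, off a countable set. No constant of the estimate may depend on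
  \<open>a\<close>: the bound for the squared increments of \<open>g\<close>, their tightness level
  and the hitting probability are fixed before \<open>a\<close> is chosen.\<close>

lemmas Bochner_bound = Bochner_Integration.integrable_bound
  and Bochner_cong = Bochner_Integration.integral_cong
  and Bochner_nonneg = Bochner_Integration.integral_nonneg

section \<open>Simultaneous approximation by continuous functions in the \<open>L^1\<close> spaces
  of two measures\<close>

lemma compact_open_sandwich:
  fixes m :: "real measure"
  assumes "finite_measure m" "sets m = sets borel" "D \<in> sets borel" "0 < e"
  obtains K U where "compact K" "open U" "K \<subseteq> D" "D \<subseteq> U" "measure m (U - K) < e"
proof -
  interpret finite_measure m by fact
  have f: "emeasure m (space m) \<noteq> \<infinity>" by simp
  have D: "D \<in> sets borel" by fact
  have "emeasure m D < emeasure m D + ennreal (e/2)"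
    using \<open>0 < e\<close> by (auto simp: emeasure_eq_measure ennreal_plus[symmetric] ennreal_less_iff simp del: ennreal_plus)
  then have "(INF U\<in>{U. D \<subseteq> U \<and> open U}. emeasure m U) < emeasure m D + ennreal (e/2)"
    using outer_regular[OF assms(2) f D] by simp
  then obtain U where U: "D \<subseteq> U" "open U" "emeasure m U < emeasure m D + ennreal (e/2)" by (auto simp: INF_less_iff)
  have e4: "emeasure m D \<le> (SUP K\<in>{K. K \<subseteq> D \<and> compact K}. emeasure m K)" using inner_regular[OF assms(2) f D] by simp
  have "\<exists>K. K \<subseteq> D \<and> compact K \<and> emeasure m D < emeasure m K + ennreal (e/4)"
  proof (cases "emeasure m D = 0")
    \<comment> \<open>Truncated subtraction leaves \<open>0 - e/4 = 0\<close>, which is not below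
      \<open>0\<close>, so a null set cannot be handled through the supremum.\<close>
    case True then show ?thesis using \<open>0 < e\<close> by (intro exI[of _ "{}"]) auto
  next
    case False
    then have "0 < emeasure m D" by (simp add: zero_less_iff_neq_zero)
    then have "emeasure m D - ennreal (e/4) < emeasure m D"
      using \<open>0 < e\<close> by (intro ennreal_between) (auto simp: less_top[symmetric])
    with e4 have "emeasure m D - ennreal (e/4) < (SUP K\<in>{K. K \<subseteq> D \<and> compact K}. emeasure m K)" by simp
    then obtain K where "K \<subseteq> D" "compact K" "emeasure m D - ennreal (e/4) < emeasure m K" by (auto simp: less_SUP_iff)
    then show ?thesis using \<open>0 < e\<close>
      by (intro exI[of _ K]) (auto simp: emeasure_eq_measure ennreal_minus_if ennreal_plus[symmetric] ennreal_less_iff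
           simp del: ennreal_plus split: if_splits)
  qed
  then obtain K where K: "K \<subseteq> D" "compact K" "emeasure m D < emeasure m K + ennreal (e/4)" by blast
  have [measurable]: "K \<in> sets m" "U \<in> sets m" "D \<in> sets m" using K U D by (auto simp: assms(2) borel_compact)
  have 1: "measure m U < measure m D + e/2" "measure m D < measure m K + e/4"
    using U K \<open>0 < e\<close> by (auto simp: emeasure_eq_measure ennreal_plus[symmetric] ennreal_less_iff simp del: ennreal_plus)
  have "measure m (U - K) = measure m U - measure m K" using K U by (intro finite_measure_Diff) auto
  with 1 \<open>0 < e\<close> show ?thesis using that[OF K(2) U(2) K(1) U(1)] by simp
qed

text \<open>A single \<open>h\<close> has to serve both measures: the test functions of the weak
  identity are approximated at once for Lebesgue measure on an interval and for an occupation
  measure. The index type \<open>bool\<close> also covers one measure, as a constant family.\<close>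

definition L1_approximable :: "(bool \<Rightarrow> real measure) \<Rightarrow> (real \<Rightarrow> 'b::{banach, second_countable_topology}) \<Rightarrow> bool" where
  "L1_approximable m f \<longleftrightarrow> (\<forall>e>0. \<exists>h B. continuous_on UNIV h \<and> (\<forall>x. norm (h x) \<le> B) \<and> (\<forall>i. (\<integral>x. norm (f x - h x) \<partial>m i) < e))"

lemma L1_approximableE:
  assumes "L1_approximable m f" "0 < e"
  obtains h B where "continuous_on UNIV h" "\<And>x. norm (h x) \<le> B" "\<And>i. (\<integral>x. norm (f x - h x) \<partial>m i) < e"
  using assms unfolding L1_approximable_def by blast

context
  fixes m :: "bool \<Rightarrow> real measure"
  assumes fin: "\<And>i. finite_measure (m i)" and sets_m [measurable_cong]: "\<And>i. sets (m i) = sets borel"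
begin

lemma integrable_bounded_continuous:
  fixes h :: "real \<Rightarrow> 'b::{banach, second_countable_topology}"
  assumes "continuous_on UNIV h" "\<And>x. norm (h x) \<le> B"
  shows "integrable (m i) h"
proof -
  interpret finite_measure "m i" by (rule fin)
  have [measurable]: "h \<in> borel_measurable borel" using assms(1) by (rule borel_measurable_continuous_onI)
  show ?thesis by (rule integrable_const_bound[of _ B]) (auto simp: assms(2))
qed

lemma integral_norm_diff_less:
  fixes f g h :: "real \<Rightarrow> 'b::{banach, second_countable_topology}"
  assumes i: "integrable M f" "integrable M g" "integrable M h"
    and "(\<integral>x. norm (f x - g x) \<partial>M) < e / 2" "(\<integral>x. norm (g x - h x) \<partial>M) < e / 2"
  shows "(\<integral>x. norm (f x - h x) \<partial>M) < e"
proof -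
  have "(\<integral>x. norm (f x - h x) \<partial>M) \<le> (\<integral>x. norm (f x - g x) + norm (g x - h x) \<partial>M)"
    using i norm_triangle_ineq[of "f x - g x" "g x - h x" for x] by (intro integral_mono) auto
  also have "\<dots> < e" using assms by (subst Bochner_Integration.integral_add) auto
  finally show ?thesis .
qed

lemma L1_approximable_step:
  assumes f: "\<And>i. integrable (m i) f"
    and *: "\<And>e. 0 < e \<Longrightarrow> \<exists>g. (\<forall>i. integrable (m i) g \<and> (\<integral>x. norm (f x - g x) \<partial>m i) < e) \<and> L1_approximable m g"
  shows "L1_approximable m f"
  unfolding L1_approximable_def
proof (intro allI impI)
  fix e :: real assume "0 < e"
  then have e2: "0 < e / 2" by simp
  obtain g where g: "\<And>i. integrable (m i) g" "\<And>i. (\<integral>x. norm (f x - g x) \<partial>m i) < e / 2" "L1_approximable m g"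
    using *[OF e2] by blast
  obtain h B where h: "continuous_on UNIV h" "\<And>x. norm (h x) \<le> B" "\<And>i. (\<integral>x. norm (g x - h x) \<partial>m i) < e / 2"
    by (rule L1_approximableE[OF g(3) e2]) (rule that)
  have "(\<integral>x. norm (f x - h x) \<partial>m i) < e" for i
    by (rule integral_norm_diff_less[OF f g(1) integrable_bounded_continuous[OF h(1,2)] g(2) h(3)])
  then show "\<exists>h B. continuous_on UNIV h \<and> (\<forall>x. norm (h x) \<le> B) \<and> (\<forall>i. (\<integral>x. norm (f x - h x) \<partial>m i) < e)"
    using h(1,2) by blast
qed

text \<open>The union of the two compact sets and the intersection of the two open sets sandwich
  \<open>D\<close> for both measures, and a Urysohn function between them differs from the indicator
  only on the small gap.\<close>

lemma L1_approximable_indicator: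
  assumes D: "D \<in> sets borel"
  shows "L1_approximable m (\<lambda>x. indicator D x *\<^sub>R y)"
  unfolding L1_approximable_def
proof (intro allI impI)
  fix e :: real assume "0 < e"
  \<comment> \<open>The \<open>+ 1\<close> keeps the quotient defined for \<open>y = 0\<close> and
    makes the last inequality of the estimate strict.\<close>
  define d where "d = e / (norm y + 1)"
  have "0 < d" using \<open>0 < e\<close> by (auto simp: d_def intro!: divide_pos_pos add_nonneg_pos)
  have "\<forall>i. \<exists>K U. compact K \<and> open U \<and> K \<subseteq> D \<and> D \<subseteq> U \<and> measure (m i) (U - K) < d"
    using compact_open_sandwich[OF fin sets_m D \<open>0 < d\<close>] by metis
  then obtain K0 U0 where KU0: "\<And>i. compact (K0 i)" "\<And>i. open (U0 i)" "\<And>i. K0 i \<subseteq> D" "\<And>i. D \<subseteq> U0 i" "\<And>i. measure (m i) (U0 i - K0 i) < d"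
    by metis
  define K U where "K = (\<Union>i. K0 i)" and "U = (\<Inter>i. U0 i)"
  have "open U" unfolding U_def by (rule open_INT) (auto intro: KU0(2))
  then have "closed (- U)" and Ub: "U \<in> sets borel" by auto
  moreover have "closed K" unfolding K_def by (rule closed_UN) (auto intro: compact_imp_closed KU0(1))
  moreover have "K \<inter> - U = {}" "K \<subseteq> D" "D \<subseteq> U" using KU0(3,4) by (fastforce simp: K_def U_def)+
  ultimately have KU: "closed K" "closed (- U)" "K \<inter> - U = {}" "K \<subseteq> D" "D \<subseteq> U" by simp_all
  obtain h :: "real \<Rightarrow> real" where h: "continuous_on UNIV h" "\<And>x. h x \<in> closed_segment 1 0"
    "\<And>x. x \<in> K \<Longrightarrow> h x = 1" "\<And>x. x \<in> - U \<Longrightarrow> h x = 0" using Urysohn[OF KU(1-3), of 1 0] by blast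
  have h01: "0 \<le> h x" "h x \<le> 1" for x using h(2)[of x] by (auto simp: closed_segment_eq_real_ivl)
  have hc: "continuous_on UNIV (\<lambda>x. h x *\<^sub>R y)" using h(1) by (intro continuous_intros)
  have hb: "norm (h x *\<^sub>R y) \<le> norm y" for x using h01[of x] mult_right_mono[of "h x" 1 "norm y"] by simp
  have le: "norm (indicator D x *\<^sub>R y - h x *\<^sub>R y) \<le> norm y * indicator (U - K) x" for x
    using h01[of x] h(3,4)[of x] KU mult_right_mono[of "1 - h x" 1 "norm y"] mult_right_mono[of "h x" 1 "norm y"]
    by (auto simp: indicator_def scaleR_left_diff_distrib[symmetric] mult.commute)
  have "(\<integral>x. norm (indicator D x *\<^sub>R y - h x *\<^sub>R y) \<partial>m i) < e" for i
  proof -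
    interpret finite_measure "m i" by (rule fin)
    have UK [measurable]: "U - K \<in> sets borel" "U0 i - K0 i \<in> sets borel"
      using Ub borel_closed[OF KU(1)] borel_compact[OF KU0(1)[of i]] borel_open[OF KU0(2)[of i]] by (auto intro: sets.Diff)
    have "(\<integral>x. norm (indicator D x *\<^sub>R y - h x *\<^sub>R y) \<partial>m i) \<le> (\<integral>x. norm y * indicator (U - K) x \<partial>m i)"
      using D by (intro integral_mono le integrable_norm Bochner_Integration.integrable_diff integrable_bounded_continuous[OF hc hb]
          integrable_mult_right integrable_scaleR_left integrable_real_indicator) (auto simp: sets_m less_top[symmetric])
    also have "\<dots> = norm y * measure (m i) (U - K)" by (simp add: sets_eq_imp_space_eq[OF sets_m])
    also have "\<dots> \<le> norm y * d"
    proof (rule mult_left_mono)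
      have "U - K \<subseteq> U0 i - K0 i" by (auto simp: U_def K_def)
      then have "measure (m i) (U - K) \<le> measure (m i) (U0 i - K0 i)"
        by (rule finite_measure_mono) (use UK(2) in \<open>simp add: sets_m\<close>)
      then show "measure (m i) (U - K) \<le> d" using KU0(5)[of i] by simp
    qed simp
    also have "\<dots> < (norm y + 1) * d" using \<open>0 < d\<close> by simp
    also have "\<dots> = e" using norm_ge_zero[of y] unfolding d_def by (auto simp del: norm_ge_zero)
    finally show ?thesis .
  qed
  then show "\<exists>h B. continuous_on UNIV h \<and> (\<forall>x. norm (h x) \<le> B) \<and> (\<forall>i. (\<integral>x. norm (indicator D x *\<^sub>R y - h x) \<partial>m i) < e)"
    using hc hb by blast
qed

lemma L1_approximable_add:
  assumes f: "\<And>i. integrable (m i) f" "L1_approximable m f" and g: "\<And>i. integrable (m i) g" "L1_approximable m g"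
  shows "L1_approximable m (\<lambda>x. f x + g x)"
  unfolding L1_approximable_def
proof (intro allI impI)
  fix e :: real assume "0 < e"
  then have e2: "0 < e / 2" by simp
  obtain h B where h: "continuous_on UNIV h" "\<And>x. norm (h x) \<le> B" "\<And>i. (\<integral>x. norm (f x - h x) \<partial>m i) < e / 2"
    by (rule L1_approximableE[OF f(2) e2]) (rule that)
  obtain k C where k: "continuous_on UNIV k" "\<And>x. norm (k x) \<le> C" "\<And>i. (\<integral>x. norm (g x - k x) \<partial>m i) < e / 2"
    by (rule L1_approximableE[OF g(2) e2]) (rule that)
  note hi = integrable_bounded_continuous[OF h(1,2)] integrable_bounded_continuous[OF k(1,2)]
  have "(\<integral>x. norm ((f x + g x) - (h x + k x)) \<partial>m i) < e" for i
  proof (rule integral_norm_diff_less[where g = "\<lambda>x. h x + g x"])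
    show "(\<integral>x. norm (f x + g x - (h x + g x)) \<partial>m i) < e / 2" "(\<integral>x. norm (h x + g x - (h x + k x)) \<partial>m i) < e / 2"
      using h(3)[of i] k(3)[of i] by simp_all
  qed (use f g hi in auto)
  moreover have "continuous_on UNIV (\<lambda>x. h x + k x)" using h(1) k(1) by (intro continuous_intros)
  moreover have "norm (h x + k x) \<le> B + C" for x by (rule norm_triangle_mono[OF h(2) k(2)])
  ultimately show "\<exists>h B. continuous_on UNIV h \<and> (\<forall>x. norm (h x) \<le> B) \<and> (\<forall>i. (\<integral>x. norm (f x + g x - h x) \<partial>m i) < e)"
    by blast
qed

lemma L1_approximable_simple:
  assumes "simple_function borel f"
  shows "L1_approximable m f"
proof -
  have im: "finite (range f)" using assms by (auto simp: simple_function_def)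
  have st: "f -` {y} \<in> sets borel" if "y \<in> range f" for y using assms that by (auto simp: simple_function_def)
  have I: "(\<forall>i. integrable (m i) (\<lambda>x. \<Sum>y\<in>Y. indicator (f -` {y}) x *\<^sub>R y)) \<and> L1_approximable m (\<lambda>x. \<Sum>y\<in>Y. indicator (f -` {y}) x *\<^sub>R y)" if "Y \<subseteq> range f" for Y
    using finite_subset[OF that im] that
  proof (induction Y rule: finite_induct)
    case empty
    then show ?case using L1_approximable_indicator[of "{}" 0] by simp
  next
    case (insert y Y)
    have s: "f -` {y} \<in> sets borel" using insert st by auto
    have i: "integrable (m i) (\<lambda>x. indicator (f -` {y}) x *\<^sub>R y)" for i
    proof -
      interpret finite_measure "m i" by (rule fin)
      show ?thesis using s by (intro integrable_scaleR_left integrable_real_indicator) (auto simp: sets_m less_top[symmetric])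
    qed
    have "Y \<subseteq> range f" using insert by auto
    note IH = insert.IH[OF this]
    show ?case unfolding sum.insert[OF insert.hyps]
      using IH i by (intro conjI allI L1_approximable_add L1_approximable_indicator s Bochner_Integration.integrable_add) auto
  qed
  have "(\<Sum>y\<in>range f. indicator (f -` {y}) x *\<^sub>R y) = f x" for x
  proof -
    have "(\<Sum>y\<in>range f. indicator (f -` {y}) x *\<^sub>R y) = (\<Sum>y\<in>{f x}. indicator (f -` {y}) x *\<^sub>R y)"
      by (rule sum.mono_neutral_right) (use im in \<open>auto simp: indicator_def\<close>)
    then show ?thesis by simp
  qed
  with I[of "range f"] show ?thesis by simp
qed

text \<open>Simple functions dominated by \<open>2 * norm (f x)\<close> converge pointwise, hence in
  \<open>L^1\<close> of both measures; as the index type is finite, one \<open>j\<close> is good for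
  both.\<close>

lemma L1_approximable_integrable:
  assumes f: "\<And>i. integrable (m i) f"
  shows "L1_approximable m f"
proof (rule L1_approximable_step[OF f])
  fix e :: real assume "0 < e"
  have fm [measurable]: "f \<in> borel_measurable borel" using borel_measurable_integrable[OF f] by simp
  obtain F where F: "\<And>i. simple_function borel (F i)" "\<And>x. (\<lambda>i. F i x) \<longlonglongrightarrow> f x"
    "\<And>i x. norm (F i x) \<le> 2 * norm (f x)" using borel_measurable_implies_sequence_metric[OF fm, of 0] by auto
  have [measurable]: "F i \<in> borel_measurable borel" for i using borel_measurable_simple_function[OF F(1)] .
  have conv: "(\<lambda>j. \<integral>x. norm (f x - F j x) \<partial>m i) \<longlonglongrightarrow> (\<integral>x. 0 \<partial>m i)" for i
  proof (rule integral_dominated_convergence[where w = "\<lambda>x. 3 * norm (f x)"])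
    show "AE x in m i. (\<lambda>j. norm (f x - F j x)) \<longlonglongrightarrow> 0"
    proof (rule AE_I2)
      fix x
      have "(\<lambda>j. norm (f x - F j x)) \<longlonglongrightarrow> norm (f x - f x)" by (intro tendsto_intros F(2))
      then show "(\<lambda>j. norm (f x - F j x)) \<longlonglongrightarrow> 0" by simp
    qed
    show "AE x in m i. norm (norm (f x - F j x)) \<le> 3 * norm (f x)" for j
    proof (rule AE_I2)
      fix x show "norm (norm (f x - F j x)) \<le> 3 * norm (f x)" using F(3)[of j x] norm_triangle_ineq4[of "f x" "F j x"] by simp
    qed
  qed (use f in auto)
  have inte: "integrable (m i) (F j)" for i j by (rule Bochner_bound[of _ "\<lambda>x. 2 * norm (f x)"]) (use f F(3) in auto)
  have "\<forall>\<^sub>F j in sequentially. (\<integral>x. norm (f x - F j x) \<partial>m i) < e" for i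
    using conv[of i] \<open>0 < e\<close> by (auto intro: order_tendstoD)
  then have "\<forall>\<^sub>F j in sequentially. \<forall>i. (\<integral>x. norm (f x - F j x) \<partial>m i) < e" by (simp add: eventually_all_finite)
  then obtain j where "\<And>i. (\<integral>x. norm (f x - F j x) \<partial>m i) < e" unfolding eventually_sequentially by blast
  then show "\<exists>g. (\<forall>i. integrable (m i) g \<and> (\<integral>x. norm (f x - g x) \<partial>m i) < e) \<and> L1_approximable m g"
    by (intro exI[of _ "F j"] conjI allI inte L1_approximable_simple F(1))
qed

end

section \<open>The chain rule for exponentials of absolutely continuous functions\<close>

lemma set_integral_mono_set_nonneg:
  fixes f :: "real \<Rightarrow> real"
  assumes "set_integrable lborel T f" "S \<subseteq> T" "S \<in> sets borel" "\<And>x. 0 \<le> f x"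
  shows "(LINT u:S|lborel. f u) \<le> (LINT u:T|lborel. f u)"
proof -
  have "set_integrable lborel S f" using assms by (intro set_integrable_subset[OF assms(1)]) auto
  then show ?thesis using assms unfolding set_lebesgue_integral_def set_integrable_def by (intro integral_mono) (auto simp: indicator_def)
qed

lemma continuous_L1_approximation:
  fixes k :: "real \<Rightarrow> complex"
  assumes k: "set_integrable lborel {a..b} k" and "0 < e"
  obtains h where "continuous_on UNIV h" "(LINT u:{a..b}|lborel. cmod (k u - h u)) < e"
proof -
  define m where "m = density lborel (\<lambda>x. ennreal (indicator {a..b} x))"
  have sm: "sets m = sets borel" by (simp add: m_def)
  have fm: "finite_measure m"
    by (rule finite_measureI) (simp add: m_def emeasure_density nn_integral_indicator ennreal_indicator emeasure_lborel_Icc_eq)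
  define k' where "k' = (\<lambda>u. indicator {a..b} u *\<^sub>R k u)"
  have k': "integrable lborel k'" using k by (simp add: set_integrable_def k'_def)
  then have k'm [measurable]: "k' \<in> borel_measurable borel" by simp
  have "integrable m k'" unfolding m_def by (subst integrable_density) (use integrable_mult_indicator[OF _ k', of "{a..b}"] in auto)
  then obtain h where h: "continuous_on UNIV h" "(\<integral>x. cmod (k' x - h x) \<partial>m) < e"
    by (rule L1_approximableE[OF L1_approximable_integrable[of "\<lambda>_. m", OF fm sm] \<open>0 < e\<close>]) (rule that)
  have [measurable]: "h \<in> borel_measurable borel" using h(1) by (rule borel_measurable_continuous_onI)
  have "(LINT u:{a..b}|lborel. cmod (k u - h u)) = (LINT u:{a..b}|lborel. cmod (k' u - h u))"
    by (rule set_lebesgue_integral_cong) (auto simp: k'_def)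
  also have "\<dots> = (\<integral>x. cmod (k' x - h x) \<partial>m)" unfolding m_def set_lebesgue_integral_def by (subst integral_density) auto
  finally show ?thesis using that h by simp
qed

lemma set_integral_atLeastAtMost_continuous:
  fixes k :: "real \<Rightarrow> 'b::euclidean_space"
  assumes "set_integrable lborel {a..b} k"
  shows "continuous_on {a..b} (\<lambda>u. LINT v:{a..u}|lborel. k v)"
proof -
  have "k integrable_on {a..b}" using set_borel_integral_eq_integral(1)[OF assms] .
  then have "continuous_on {a..b} (\<lambda>u. integral {a..u} k)" by (rule indefinite_integral_continuous_1)
  also have "?this \<longleftrightarrow> continuous_on {a..b} (\<lambda>u. LINT v:{a..u}|lborel. k v)"
  proof (rule continuous_on_cong[OF refl])
    fix u assume "u \<in> {a..b}"
    then have "set_integrable lborel {a..u} k" using assms by (rule_tac set_integrable_subset) auto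
    then show "integral {a..u} k = (LINT v:{a..u}|lborel. k v)" using set_borel_integral_eq_integral(2) by metis
  qed
  finally show ?thesis .
qed

lemma exp_set_integral_continuous:
  fixes h :: "real \<Rightarrow> complex"
  assumes h: "continuous_on UNIV h" and st: "a \<le> s" "s \<le> t"
  shows "(LINT u:{s..t}|lborel. h u * exp (LINT v:{a..u}|lborel. h v))
     = exp (LINT v:{a..t}|lborel. h v) - exp (LINT v:{a..s}|lborel. h v)"
proof -
  have hc: "continuous_on S h" for S using h continuous_on_subset by blast
  have si: "set_integrable lborel {a..u} h" for u by (rule borel_integrable_atLeastAtMost') (rule hc)
  have D: "((\<lambda>u. LINT v:{a..u}|lborel. h v) has_vector_derivative h u) (at u within {a..t})" if "u \<in> {a..t}" for u
  proof -
    have "((\<lambda>u. integral {a..u} h) has_vector_derivative h u) (at u within {a..t})" by (rule integral_has_vector_derivative[OF hc that])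
    then show ?thesis using set_borel_integral_eq_integral(2)[OF si] by simp
  qed
  have "(LINT u:{s..t}|lborel. h u * exp (LINT v:{a..u}|lborel. h v))
     = (\<integral>u. indicator {s..t} u *\<^sub>R (h u * exp (LINT v:{a..u}|lborel. h v)) \<partial>lborel)"
    by (simp add: set_lebesgue_integral_def)
  also have "\<dots> = exp (LINT v:{a..t}|lborel. h v) - exp (LINT v:{a..s}|lborel. h v)"
  proof (rule integral_FTC_Icc[OF st(2)])
    show "((\<lambda>t. exp (LINT v:{a..t}|lborel. h v)) has_vector_derivative h x * exp (LINT v:{a..x}|lborel. h v)) (at x within {s..t})"
      if "s \<le> x" "x \<le> t" for x
    proof (rule has_vector_derivative_within_subset)
      have "(exp has_field_derivative exp (LINT v:{a..x}|lborel. h v)) (at (LINT v:{a..x}|lborel. h v) within (\<lambda>t. LINT v:{a..t}|lborel. h v) ` {a..t})"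
        by (rule DERIV_subset[OF DERIV_exp]) simp
      from field_vector_diff_chain_within[OF D this] that st
      show "((\<lambda>t. exp (LINT v:{a..t}|lborel. h v)) has_vector_derivative h x * exp (LINT v:{a..x}|lborel. h v)) (at x within {a..t})"
        by (auto simp: o_def)
    qed (use st in auto)
    have "continuous_on {s..t} (\<lambda>u. LINT v:{a..u}|lborel. h v)"
      by (rule continuous_on_subset[OF set_integral_atLeastAtMost_continuous[OF si[of t]]]) (use st in auto)
    then show "continuous_on {s..t} (\<lambda>x. h x * exp (LINT v:{a..x}|lborel. h v))" by (intro continuous_intros hc)
  qed
  finally show ?thesis .
qed

lemma set_integrable_bounded_mult:
  fixes f g :: "real \<Rightarrow> complex"
  assumes f: "set_integrable lborel A f" and g: "set_borel_measurable lborel A g" and b: "\<And>u. u \<in> A \<Longrightarrow> cmod (g u) \<le> B"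
  shows "set_integrable lborel A (\<lambda>u. f u * g u)"
  unfolding set_integrable_def
proof (rule Bochner_bound)
  show "integrable lborel (\<lambda>x. B *\<^sub>R (indicator A x *\<^sub>R f x))"
    using f unfolding set_integrable_def by (rule integrable_scaleR_right)
  have "(\<lambda>x. (indicator A x *\<^sub>R f x) * (indicator A x *\<^sub>R g x)) \<in> borel_measurable lborel"
    using f g by (intro borel_measurable_times) (auto simp: set_integrable_def set_borel_measurable_def)
  also have "(\<lambda>x. (indicator A x *\<^sub>R f x) * (indicator A x *\<^sub>R g x)) = (\<lambda>x. indicator A x *\<^sub>R (f x * g x))"
    by (auto simp: indicator_def)
  finally show "(\<lambda>x. indicator A x *\<^sub>R (f x * g x)) \<in> borel_measurable lborel" .
  have "cmod (f x * g x) \<le> \<bar>B\<bar> * cmod (f x)" if "x \<in> A" for x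
    using b[OF that] by (subst norm_mult, subst mult.commute) (intro mult_right_mono, auto)
  then show "AE x in lborel. norm (indicator A x *\<^sub>R (f x * g x)) \<le> norm (B *\<^sub>R (indicator A x *\<^sub>R f x))"
    by (auto simp: indicator_def)
qed

text \<open>\<open>b\<close> stands for the drift, \<open>q\<close> for the squared volatility and
  \<open>c\<close> for the rate of the discount. The rate dominates both, so the coefficient of the
  exponential is at most a constant times the rate, and its discounted integral can be
  bounded.\<close>

lemma norm_exponent_le:
  fixes b v q c \<eta> :: real
  assumes "0 \<le> \<eta>" "\<bar>b\<bar> \<le> c" "0 \<le> q" "q \<le> c"
  shows "cmod (\<i> * of_real (v * b) - of_real (v\<^sup>2 / 2 * q) - of_real (\<eta> * c)) \<le> (\<bar>v\<bar> + v\<^sup>2 / 2 + \<eta>) * c"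
proof -
  have "cmod (\<i> * of_real (v * b) - of_real (v\<^sup>2 / 2 * q) - of_real (\<eta> * c)) \<le> \<bar>v\<bar> * \<bar>b\<bar> + v\<^sup>2 / 2 * q + \<eta> * c"
    by (intro order_trans[OF norm_triangle_ineq4] add_mono) (use assms in \<open>auto simp: norm_mult abs_mult norm_power norm_divide\<close>)
  also have "\<dots> \<le> \<bar>v\<bar> * c + v\<^sup>2 / 2 * c + \<eta> * c" using assms by (intro add_mono mult_left_mono) auto
  finally show ?thesis by (simp add: distrib_right)
qed

lemma inverse_Suc_tendsto_0: "(\<lambda>n. 1 / real (Suc n)) \<longlonglongrightarrow> 0"
  using LIMSEQ_inverse_real_of_nat by (simp add: inverse_eq_divide)

text \<open>The chain rule for \<open>exp\<close> of the integral of a merely integrable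
  \<open>k\<close>. For continuous \<open>k\<close> it is the fundamental theorem of calculus; in
  general \<open>k\<close> is replaced by continuous functions \<open>h n\<close> close to it in
  \<open>L^1\<close>, which moves the primitive uniformly by at most \<open>1 / Suc n\<close>, so
  that both sides converge.\<close>

lemma exp_set_integral:
  fixes k :: "real \<Rightarrow> complex"
  assumes k: "set_integrable lborel {a..b} k" and st: "a \<le> s" "s \<le> t" "t \<le> b"
  shows "set_integrable lborel {s..t} (\<lambda>u. k u * exp (LINT v:{a..u}|lborel. k v))"
    and "(LINT u:{s..t}|lborel. k u * exp (LINT v:{a..u}|lborel. k v))
     = exp (LINT v:{a..t}|lborel. k v) - exp (LINT v:{a..s}|lborel. k v)"
proof -
  define K where "K = (\<lambda>u. LINT v:{a..u}|lborel. k v)"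
  have "\<forall>n. \<exists>h. continuous_on UNIV h \<and> (LINT u:{a..b}|lborel. cmod (k u - h u)) < 1 / Suc n"
  proof
    fix n
    show "\<exists>h. continuous_on UNIV h \<and> (LINT u:{a..b}|lborel. cmod (k u - h u)) < 1 / Suc n"
      by (rule continuous_L1_approximation[OF k, of "1 / Suc n"]) auto
  qed
  from choice[OF this] obtain h where h: "\<And>n. continuous_on UNIV (h n)" "\<And>n. (LINT u:{a..b}|lborel. cmod (k u - h n u)) < 1 / Suc n"
    by auto
  define H where "H n = (\<lambda>u. LINT v:{a..u}|lborel. h n v)" for n
  have hi: "set_integrable lborel {a..u} (h n)" for n u
    using h(1)[of n] by (intro borel_integrable_atLeastAtMost' continuous_on_subset[OF h(1)]) auto
  have ki: "set_integrable lborel S k" if "S \<subseteq> {a..b}" "S \<in> sets borel" for S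
    using that by (intro set_integrable_subset[OF k]) auto
  have di: "set_integrable lborel {a..b} (\<lambda>u. cmod (k u - h n u))" for n by (intro set_integrable_norm set_integral_diff k hi)
  have KH: "cmod (K u - H n u) \<le> 1 / Suc n" if "u \<in> {a..b}" for u n
  proof -
    have "K u - H n u = (LINT v:{a..u}|lborel. k v - h n v)"
      unfolding K_def H_def using that by (intro set_integral_diff(2)[symmetric] ki hi) auto
    also have "cmod \<dots> \<le> (LINT v:{a..u}|lborel. cmod (k v - h n v))"
      by (rule set_integral_norm_bound) (use that in \<open>intro set_integral_diff ki hi, auto\<close>)
    also have "\<dots> \<le> (LINT u:{a..b}|lborel. cmod (k u - h n u))" by (rule set_integral_mono_set_nonneg[OF di]) (use that in auto)
    finally show ?thesis using h(2)[of n] by simp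
  qed
  define C where "C = (LINT v:{a..b}|lborel. cmod (k v))"
  have Kb: "cmod (K u) \<le> C" if "u \<in> {a..b}" for u
  proof -
    have "cmod (K u) \<le> (LINT v:{a..u}|lborel. cmod (k v))"
      unfolding K_def by (rule set_integral_norm_bound) (use that in \<open>intro ki, auto\<close>)
    also have "\<dots> \<le> C" unfolding C_def by (rule set_integral_mono_set_nonneg[OF set_integrable_norm[OF k]]) (use that in auto)
    finally show ?thesis .
  qed
  have Hb: "cmod (H n u) \<le> C + 1" if "u \<in> {a..b}" for u n
  proof -
    have "cmod (H n u) \<le> cmod (K u) + cmod (H n u - K u)" by (rule norm_triangle_sub)
    moreover have "1 / real (Suc n) \<le> 1" by simp
    ultimately show ?thesis using Kb[OF that] KH[OF that, of n] unfolding norm_minus_commute[of "H n u"] by linarith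
  qed
  have eb: "cmod (exp (K u)) \<le> exp (C + 1)" "cmod (exp (H n u)) \<le> exp (C + 1)" if "u \<in> {a..b}" for u n
    using Kb[OF that] Hb[OF that, of n] by (intro order_trans[OF norm_exp]; simp)+
  have HK: "(\<lambda>n. H n u) \<longlonglongrightarrow> K u" if "u \<in> {a..b}" for u
  proof -
    have "\<forall>\<^sub>F n in sequentially. cmod (H n u - K u) \<le> 1 / real (Suc n)"
      using KH[OF that] unfolding norm_minus_commute[of "H _ u"] by (intro always_eventually) auto
    then have "(\<lambda>n. H n u - K u) \<longlonglongrightarrow> 0" by (rule Lim_null_comparison) (rule inverse_Suc_tendsto_0)
    then show ?thesis by (rule LIM_zero_cancel)
  qed
  have Kc: "continuous_on {a..b} K" unfolding K_def by (rule set_integral_atLeastAtMost_continuous[OF k])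
  have Hc: "continuous_on {a..b} (H n)" for n unfolding H_def by (rule set_integral_atLeastAtMost_continuous[OF hi])
  have sub: "{s..t} \<subseteq> {a..b}" using st by auto
  have Km: "set_borel_measurable lborel {s..t} (\<lambda>u. exp (K u))" using continuous_on_subset[OF Kc sub]
    by (auto intro!: borel_measurable_continuous_on_indicator continuous_intros simp: set_borel_measurable_def)
  have Hm: "set_borel_measurable lborel {s..t} (\<lambda>u. exp (H n u))" for n using continuous_on_subset[OF Hc sub]
    by (auto intro!: borel_measurable_continuous_on_indicator continuous_intros simp: set_borel_measurable_def)
  note bi = set_integrable_bounded_mult
  have int: "set_integrable lborel {s..t} (\<lambda>u. k u * exp (K u))" by (rule bi[OF ki[OF sub] Km eb(1)]) (use sub in auto)
  then show "set_integrable lborel {s..t} (\<lambda>u. k u * exp (LINT v:{a..u}|lborel. k v))" unfolding K_def .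
  have e1: "(LINT u:{s..t}|lborel. h n u * exp (H n u)) = exp (H n t) - exp (H n s)" for n
    unfolding H_def by (rule exp_set_integral_continuous[OF h(1) st(1,2)])
  have hi': "set_integrable lborel {s..t} (h n)" for n by (rule set_integrable_subset[OF hi[of t]]) (use st in auto)
  have hk: "(\<lambda>n. LINT u:{s..t}|lborel. h n u * exp (H n u)) \<longlonglongrightarrow> (LINT u:{s..t}|lborel. k u * exp (K u))"
  proof -
    \<comment> \<open>The error of the integrand is small in \<open>L^1\<close> and multiplies a
      bounded exponential; what remains, with \<open>k\<close> fixed, is dominated
      convergence.\<close>
    have A: "(\<lambda>n. LINT u:{s..t}|lborel. (h n u - k u) * exp (H n u)) \<longlonglongrightarrow> 0"
    proof (rule Lim_null_comparison)
      have "cmod (LINT u:{s..t}|lborel. (h n u - k u) * exp (H n u)) \<le> 1 / Suc n * exp (C + 1)" for n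
      proof -
        have "cmod (LINT u:{s..t}|lborel. (h n u - k u) * exp (H n u)) \<le> (LINT u:{s..t}|lborel. cmod ((h n u - k u) * exp (H n u)))"
          by (rule set_integral_norm_bound, rule bi[OF set_integral_diff(1)[OF hi' ki[OF sub]] Hm eb(2)]) (use sub in auto)
        also have "\<dots> \<le> (LINT u:{s..t}|lborel. cmod (k u - h n u) * exp (C + 1))"
        proof (rule set_integral_mono)
          show "set_integrable lborel {s..t} (\<lambda>u. cmod ((h n u - k u) * exp (H n u)))"
            by (rule set_integrable_norm, rule bi[OF set_integral_diff(1)[OF hi' ki[OF sub]] Hm eb(2)]) (use sub in auto)
          show "set_integrable lborel {s..t} (\<lambda>u. cmod (k u - h n u) * exp (C + 1))"
            by (intro set_integrable_mult_left set_integrable_subset[OF di]) (use sub in auto)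
          show "cmod ((h n u - k u) * exp (H n u)) \<le> cmod (k u - h n u) * exp (C + 1)" if "u \<in> {s..t}" for u
            unfolding norm_mult norm_minus_commute[of "h n u"] using eb(2)[of u n] that sub by (intro mult_left_mono) auto
        qed
        also have "\<dots> = (LINT u:{s..t}|lborel. cmod (k u - h n u)) * exp (C + 1)" by simp
        also have "\<dots> \<le> (LINT u:{a..b}|lborel. cmod (k u - h n u)) * exp (C + 1)"
          by (intro mult_right_mono set_integral_mono_set_nonneg[OF di]) (use sub in auto)
        also have "\<dots> \<le> 1 / Suc n * exp (C + 1)" using h(2)[of n] by (intro mult_right_mono) auto
        finally show ?thesis .
      qed
      then show "\<forall>\<^sub>F n in sequentially. cmod (LINT u:{s..t}|lborel. (h n u - k u) * exp (H n u)) \<le> 1 / Suc n * exp (C + 1)" by simp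
      show "(\<lambda>n. 1 / real (Suc n) * exp (C + 1)) \<longlonglongrightarrow> 0" using inverse_Suc_tendsto_0 by (rule tendsto_mult_left_zero)
    qed
    have B: "(\<lambda>n. LINT u:{s..t}|lborel. k u * exp (H n u)) \<longlonglongrightarrow> (LINT u:{s..t}|lborel. k u * exp (K u))"
      unfolding set_lebesgue_integral_def
    proof (rule integral_dominated_convergence[where w = "\<lambda>u. exp (C + 1) * (indicator {s..t} u * cmod (k u))"])
      have i: "set_integrable lborel {s..t} (\<lambda>u. k u * exp (H n u))" for n by (rule bi[OF ki[OF sub] Hm eb(2)]) (use sub in auto)
      show "(\<lambda>u. indicator {s..t} u *\<^sub>R (k u * exp (H n u))) \<in> borel_measurable lborel" for n
        using i[of n] by (simp add: set_integrable_def borel_measurable_integrable)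
      show "(\<lambda>u. indicator {s..t} u *\<^sub>R (k u * exp (K u))) \<in> borel_measurable lborel"
        using int unfolding K_def by (simp add: set_integrable_def borel_measurable_integrable)
      show "integrable lborel (\<lambda>u. exp (C + 1) * (indicator {s..t} u * cmod (k u)))"
        using set_integrable_norm[OF ki[OF sub]] by (simp add: set_integrable_def)
      show "AE x in lborel. (\<lambda>n. indicator {s..t} x *\<^sub>R (k x * exp (H n x))) \<longlonglongrightarrow> indicator {s..t} x *\<^sub>R (k x * exp (K x))"
        using HK sub by (intro AE_I2) (auto simp: indicator_def intro!: tendsto_intros)
      show "AE x in lborel. norm (indicator {s..t} x *\<^sub>R (k x * exp (H n x))) \<le> exp (C + 1) * (indicator {s..t} x * cmod (k x))" for n
      proof (intro AE_I2)
        fix x show "norm (indicator {s..t} x *\<^sub>R (k x * exp (H n x))) \<le> exp (C + 1) * (indicator {s..t} x * cmod (k x))"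
        proof (cases "x \<in> {s..t}")
          case True
          then have "cmod (k x) * cmod (exp (H n x)) \<le> cmod (k x) * exp (C + 1)" using eb(2)[of x n] sub by (intro mult_left_mono) auto
          then show ?thesis using True by (simp add: norm_mult mult.commute)
        qed simp
      qed
    qed
    have "(LINT u:{s..t}|lborel. h n u * exp (H n u)) = (LINT u:{s..t}|lborel. (h n u - k u) * exp (H n u)) + (LINT u:{s..t}|lborel. k u * exp (H n u))" for n
    proof (subst set_integral_add(2)[symmetric])
      show "set_integrable lborel {s..t} (\<lambda>u. (h n u - k u) * exp (H n u))"
        by (rule bi[OF set_integral_diff(1)[OF hi' ki[OF sub]] Hm eb(2)]) (use sub in auto)
      show "set_integrable lborel {s..t} (\<lambda>u. k u * exp (H n u))" by (rule bi[OF ki[OF sub] Hm eb(2)]) (use sub in auto)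
    qed (simp add: algebra_simps)
    then show ?thesis using tendsto_add[OF A B] by simp
  qed
  have "(\<lambda>n. exp (H n t) - exp (H n s)) \<longlonglongrightarrow> exp (K t) - exp (K s)"
    using HK[of t] HK[of s] st by (auto intro!: tendsto_intros)
  from LIMSEQ_unique[OF hk[unfolded e1] this]
  show "(LINT u:{s..t}|lborel. k u * exp (LINT v:{a..u}|lborel. k v))
     = exp (LINT v:{a..t}|lborel. k v) - exp (LINT v:{a..s}|lborel. k v)" by (simp add: K_def)
qed

section \<open>A weak identity for diffusions\<close>

text \<open>In the application \<open>\<pi>1\<close> and \<open>\<pi>2\<close> are the laws of the
  diffusion at two times, on an event of the past, and \<open>\<nu>\<close> is its occupation
  measure between them with the squared volatility as weight, all discounted at the rate
  \<open>\<eta> * (\<bar>\<beta>\<bar> + 1)\<close> per unit of quadratic variation;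
  \<open>\<beta>\<close> is drift over squared volatility. Because of the weight the second order
  term has the constant coefficient \<open>1/2\<close>, and \<open>\<beta>\<close>, which is
  integrable over \<open>[A, B]\<close>, is the only rough coefficient.\<close>

locale weak_diffusion_identity =
  fixes A B \<eta> :: real and \<beta> :: "real \<Rightarrow> real" and \<nu> \<pi>1 \<pi>2 :: "real measure"
  assumes AB: "A < B" and eta: "0 < \<eta>"
    and fin: "finite_measure \<nu>" "finite_measure \<pi>1" "finite_measure \<pi>2"
    and sets_borel [measurable_cong]: "sets \<nu> = sets borel" "sets \<pi>1 = sets borel" "sets \<pi>2 = sets borel"
    and supp: "AE x in \<nu>. x \<in> {A..B}" "AE x in \<pi>1. x \<in> {A..B}" "AE x in \<pi>2. x \<in> {A..B}"
    and beta [measurable]: "\<beta> \<in> borel_measurable borel"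
    and beta_nu: "integrable \<nu> \<beta>" and beta_lborel: "set_integrable lborel {A..B} \<beta>"
    and exp_identity: "\<And>v. (\<integral>x. iexp (v * x) \<partial>\<pi>2) - (\<integral>x. iexp (v * x) \<partial>\<pi>1) =
       (\<integral>x. (\<i> * of_real (v * \<beta> x) - of_real (v\<^sup>2 / 2) - of_real (\<eta> * (\<bar>\<beta> x\<bar> + 1))) * iexp (v * x) \<partial>\<nu>)"
begin

interpretation nu: finite_measure \<nu> by (rule fin)
interpretation pi1: finite_measure \<pi>1 by (rule fin)
interpretation pi2: finite_measure \<pi>2 by (rule fin)

text \<open>The defect of the weak identity for the test function \<open>f0\<close>. The derivatives
  \<open>f1\<close> and \<open>f2\<close> are separate arguments, so that \<open>L\<close> is
  plainly linear in the triple and no differentiability has to be carried along.\<close>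

definition L :: "(real \<Rightarrow> 'b::{banach, second_countable_topology}) \<Rightarrow> (real \<Rightarrow> 'b) \<Rightarrow> (real \<Rightarrow> 'b) \<Rightarrow> 'b" where
  "L f0 f1 f2 = (\<integral>x. f0 x \<partial>\<pi>2) - (\<integral>x. f0 x \<partial>\<pi>1)
     - (\<integral>x. \<beta> x *\<^sub>R f1 x + (1/2) *\<^sub>R f2 x - (\<eta> * (\<bar>\<beta> x\<bar> + 1)) *\<^sub>R f0 x \<partial>\<nu>)"

definition bounded_fun :: "real \<Rightarrow> (real \<Rightarrow> 'b::real_normed_vector) \<Rightarrow> bool" where
  "bounded_fun c f \<longleftrightarrow> f \<in> borel_measurable borel \<and> (\<forall>x\<in>{A..B}. norm (f x) \<le> c)"

lemma bounded_fun_integrable: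
  fixes f :: "real \<Rightarrow> 'b::{banach, second_countable_topology}"
  assumes "bounded_fun c f"
  shows "integrable \<pi>1 f" "integrable \<pi>2 f" "integrable \<nu> f" "integrable \<nu> (\<lambda>x. \<beta> x *\<^sub>R f x)"
    "integrable \<nu> (\<lambda>x. (\<eta> * (\<bar>\<beta> x\<bar> + 1)) *\<^sub>R f x)"
proof -
  have [measurable]: "f \<in> borel_measurable borel" and b: "\<And>x. x \<in> {A..B} \<Longrightarrow> norm (f x) \<le> c"
    using assms by (auto simp: bounded_fun_def)
  show "integrable \<pi>1 f" by (rule pi1.integrable_const_bound[of _ c]) (use supp(2) b in auto)
  show "integrable \<pi>2 f" by (rule pi2.integrable_const_bound[of _ c]) (use supp(3) b in auto)
  show "integrable \<nu> f" by (rule nu.integrable_const_bound[of _ c]) (use supp(1) b in auto)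
  show "integrable \<nu> (\<lambda>x. \<beta> x *\<^sub>R f x)"
  proof (rule Bochner_bound)
    show "integrable \<nu> (\<lambda>x. c * \<beta> x)" using beta_nu by simp
    show "AE x in \<nu>. norm (\<beta> x *\<^sub>R f x) \<le> norm (c * \<beta> x)" using supp(1)
    proof eventually_elim
      case (elim x)
      then have "norm (f x) \<le> \<bar>c\<bar>" using b[of x] by auto
      from mult_right_mono[OF this, of "\<bar>\<beta> x\<bar>"] show ?case by (simp add: abs_mult mult.commute)
    qed
  qed simp
  show "integrable \<nu> (\<lambda>x. (\<eta> * (\<bar>\<beta> x\<bar> + 1)) *\<^sub>R f x)"
  proof (rule Bochner_bound)
    show "integrable \<nu> (\<lambda>x. c * (\<eta> * (\<bar>\<beta> x\<bar> + 1)))" using beta_nu by simp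
    show "AE x in \<nu>. norm ((\<eta> * (\<bar>\<beta> x\<bar> + 1)) *\<^sub>R f x) \<le> norm (c * (\<eta> * (\<bar>\<beta> x\<bar> + 1)))"
      using supp(1)
    proof eventually_elim
      case (elim x)
      then have "norm (f x) \<le> \<bar>c\<bar>" using b[of x] by auto
      then show ?case by (simp add: abs_mult mult.commute mult_right_mono)
    qed
  qed simp
qed

text \<open>Only integrability is asked of the second derivatives, since that of the scale function,
  \<open>-2 \<beta> \<rho>\<close>, is in general unbounded.\<close>

lemma L_add:
  assumes "bounded_fun c f0" "bounded_fun c f1" "integrable \<nu> f2"
    "bounded_fun d g0" "bounded_fun d g1" "integrable \<nu> g2"
  shows "L (\<lambda>x. f0 x + g0 x) (\<lambda>x. f1 x + g1 x) (\<lambda>x. f2 x + g2 x) = L f0 f1 f2 + L g0 g1 g2"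
proof -
  note i = bounded_fun_integrable[OF assms(1)] bounded_fun_integrable[OF assms(2)]
    bounded_fun_integrable[OF assms(4)] bounded_fun_integrable[OF assms(5)] assms(3,6)
  have "(\<integral>x. \<beta> x *\<^sub>R (f1 x + g1 x) + (1/2) *\<^sub>R (f2 x + g2 x) - (\<eta> * (\<bar>\<beta> x\<bar> + 1)) *\<^sub>R (f0 x + g0 x) \<partial>\<nu>)
    = (\<integral>x. (\<beta> x *\<^sub>R f1 x + (1/2) *\<^sub>R f2 x - (\<eta> * (\<bar>\<beta> x\<bar> + 1)) *\<^sub>R f0 x)
        + (\<beta> x *\<^sub>R g1 x + (1/2) *\<^sub>R g2 x - (\<eta> * (\<bar>\<beta> x\<bar> + 1)) *\<^sub>R g0 x) \<partial>\<nu>)"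
    by (rule Bochner_cong) (auto simp: scaleR_add_right)
  also have "\<dots> = (\<integral>x. \<beta> x *\<^sub>R f1 x + (1/2) *\<^sub>R f2 x - (\<eta> * (\<bar>\<beta> x\<bar> + 1)) *\<^sub>R f0 x \<partial>\<nu>)
        + (\<integral>x. \<beta> x *\<^sub>R g1 x + (1/2) *\<^sub>R g2 x - (\<eta> * (\<bar>\<beta> x\<bar> + 1)) *\<^sub>R g0 x \<partial>\<nu>)"
    by (intro Bochner_Integration.integral_add Bochner_Integration.integrable_add Bochner_Integration.integrable_diff
        integrable_scaleR_right i)
  finally show ?thesis unfolding L_def using i by (simp add: Bochner_Integration.integral_add)
qed

lemma L_mult:
  fixes f0 :: "real \<Rightarrow> 'b::{banach, second_countable_topology, real_normed_field}"
  shows "L (\<lambda>x. a * f0 x) (\<lambda>x. a * f1 x) (\<lambda>x. a * f2 x) = a * L f0 f1 f2"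
proof (cases "a = 0")
  case False
  have "(\<integral>x. \<beta> x *\<^sub>R (a * f1 x) + (1/2) *\<^sub>R (a * f2 x) - (\<eta> * (\<bar>\<beta> x\<bar> + 1)) *\<^sub>R (a * f0 x) \<partial>\<nu>)
    = (\<integral>x. a * (\<beta> x *\<^sub>R f1 x + (1/2) *\<^sub>R f2 x - (\<eta> * (\<bar>\<beta> x\<bar> + 1)) *\<^sub>R f0 x) \<partial>\<nu>)"
    by (rule Bochner_cong) (auto simp: algebra_simps)
  also have "\<dots> = a * (\<integral>x. \<beta> x *\<^sub>R f1 x + (1/2) *\<^sub>R f2 x - (\<eta> * (\<bar>\<beta> x\<bar> + 1)) *\<^sub>R f0 x \<partial>\<nu>)"
    by (rule integral_mult_right_zero)
  finally show ?thesis unfolding L_def by (simp only: integral_mult_right_zero right_diff_distrib)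
qed (simp add: L_def)

lemma L_of_real: "L (\<lambda>x. complex_of_real (f0 x)) (\<lambda>x. of_real (f1 x)) (\<lambda>x. of_real (f2 x)) = of_real (L f0 f1 f2)"
proof -
  have "(\<integral>x. \<beta> x *\<^sub>R complex_of_real (f1 x) + (1/2) *\<^sub>R of_real (f2 x) - (\<eta> * (\<bar>\<beta> x\<bar> + 1)) *\<^sub>R of_real (f0 x) \<partial>\<nu>)
    = (\<integral>x. of_real (\<beta> x *\<^sub>R f1 x + (1/2) *\<^sub>R f2 x - (\<eta> * (\<bar>\<beta> x\<bar> + 1)) *\<^sub>R f0 x) \<partial>\<nu>)"
    by (rule Bochner_cong) (auto simp: scaleR_conv_of_real)
  also have "\<dots> = of_real (\<integral>x. \<beta> x *\<^sub>R f1 x + (1/2) *\<^sub>R f2 x - (\<eta> * (\<bar>\<beta> x\<bar> + 1)) *\<^sub>R f0 x \<partial>\<nu>)"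
    by (rule integral_complex_of_real)
  finally show ?thesis unfolding L_def by simp
qed

lemma bounded_fun_0: "bounded_fun 0 (\<lambda>x. 0)" by (auto simp: bounded_fun_def)

lemma bounded_fun_mono: "bounded_fun c f \<Longrightarrow> c \<le> d \<Longrightarrow> bounded_fun d f"
  unfolding bounded_fun_def by force

lemma bounded_fun_mult:
  fixes f :: "real \<Rightarrow> 'b::{real_normed_field, second_countable_topology}"
  assumes "bounded_fun c f" shows "bounded_fun (norm a * c) (\<lambda>x. a * f x)"
  using assms by (auto simp: bounded_fun_def norm_mult mult_left_mono)

lemma bounded_fun_add:
  fixes f :: "real \<Rightarrow> 'b::{real_normed_field, second_countable_topology}"
  assumes "bounded_fun c f" "bounded_fun d g" shows "bounded_fun (c + d) (\<lambda>x. f x + g x)"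
  using assms by (auto simp: bounded_fun_def intro!: norm_triangle_mono)

lemma L_sum:
  fixes f0 :: "nat \<Rightarrow> real \<Rightarrow> 'b::{banach, second_countable_topology, real_normed_field}"
  assumes "finite I" "\<And>i. i \<in> I \<Longrightarrow> bounded_fun (c i) (f0 i)" "\<And>i. i \<in> I \<Longrightarrow> bounded_fun (c i) (f1 i)"
    "\<And>i. i \<in> I \<Longrightarrow> bounded_fun (c i) (f2 i)"
  shows "L (\<lambda>x. \<Sum>i\<in>I. a i * f0 i x) (\<lambda>x. \<Sum>i\<in>I. a i * f1 i x) (\<lambda>x. \<Sum>i\<in>I. a i * f2 i x) = (\<Sum>i\<in>I. a i * L (f0 i) (f1 i) (f2 i)) \<and>
    bounded_fun (\<Sum>i\<in>I. norm (a i) * c i) (\<lambda>x. \<Sum>i\<in>I. a i * f0 i x) \<and>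
    bounded_fun (\<Sum>i\<in>I. norm (a i) * c i) (\<lambda>x. \<Sum>i\<in>I. a i * f1 i x) \<and>
    bounded_fun (\<Sum>i\<in>I. norm (a i) * c i) (\<lambda>x. \<Sum>i\<in>I. a i * f2 i x)" using assms
proof (induction I rule: finite_induct)
  case empty then show ?case by (simp add: bounded_fun_0 L_def)
next
  case (insert i I)
  have m: "bounded_fun (norm (a i) * c i) (\<lambda>x. a i * f0 i x)" "bounded_fun (norm (a i) * c i) (\<lambda>x. a i * f1 i x)"
    "bounded_fun (norm (a i) * c i) (\<lambda>x. a i * f2 i x)" using insert by (auto intro!: bounded_fun_mult)
  have s: "L (\<lambda>x. \<Sum>i\<in>I. a i * f0 i x) (\<lambda>x. \<Sum>i\<in>I. a i * f1 i x) (\<lambda>x. \<Sum>i\<in>I. a i * f2 i x) = (\<Sum>i\<in>I. a i * L (f0 i) (f1 i) (f2 i))"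
    "bounded_fun (\<Sum>i\<in>I. norm (a i) * c i) (\<lambda>x. \<Sum>i\<in>I. a i * f0 i x)"
    "bounded_fun (\<Sum>i\<in>I. norm (a i) * c i) (\<lambda>x. \<Sum>i\<in>I. a i * f1 i x)"
    "bounded_fun (\<Sum>i\<in>I. norm (a i) * c i) (\<lambda>x. \<Sum>i\<in>I. a i * f2 i x)" using insert by auto
  show ?case unfolding sum.insert[OF insert.hyps] by (intro conjI bounded_fun_add m s)
      (subst L_add[OF m(1,2) bounded_fun_integrable(3)[OF m(3)] s(2,3) bounded_fun_integrable(3)[OF s(4)]], simp only: L_mult s)
qed

definition LC :: real where
  "LC = measure \<pi>1 (space \<pi>1) + measure \<pi>2 (space \<pi>2) + (\<integral>x. \<bar>\<beta> x\<bar> \<partial>\<nu>) + \<eta> * (\<integral>x. \<bar>\<beta> x\<bar> + 1 \<partial>\<nu>) + 1"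

lemma LC_ge_1: "1 \<le> LC"
proof -
  have "0 \<le> measure \<pi>1 (space \<pi>1) + measure \<pi>2 (space \<pi>2) + (\<integral>x. \<bar>\<beta> x\<bar> \<partial>\<nu>) + \<eta> * (\<integral>x. \<bar>\<beta> x\<bar> + 1 \<partial>\<nu>)"
    using eta by (intro add_nonneg_nonneg mult_nonneg_nonneg Bochner_nonneg) auto
  then show ?thesis unfolding LC_def by simp
qed

text \<open>Continuity of \<open>L\<close> in the supremum norm of \<open>f0\<close> and
  \<open>f1\<close> and the \<open>L^1(\<nu>)\<close> norm of \<open>f2\<close>. That the weak norm
  suffices for the second derivative is what makes the later density argument possible.\<close>

lemma L_bound:
  fixes f0 :: "real \<Rightarrow> 'b::{banach, second_countable_topology, real_normed_field}"
  assumes f: "bounded_fun c f0" "bounded_fun c f1" "integrable \<nu> f2" and c: "0 \<le> c"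
  shows "norm (L f0 f1 f2) \<le> LC * (c + (\<integral>x. norm (f2 x) \<partial>\<nu>))"
proof -
  let ?c = "\<lambda>x. \<eta> * (\<bar>\<beta> x\<bar> + 1)"
  let ?h = "\<lambda>x. \<beta> x *\<^sub>R f1 x + (1/2) *\<^sub>R f2 x - ?c x *\<^sub>R f0 x"
  note i = bounded_fun_integrable[OF f(1)] bounded_fun_integrable[OF f(2)]
  have b: "norm (f0 x) \<le> c" "norm (f1 x) \<le> c" if "x \<in> {A..B}" for x using f that by (auto simp: bounded_fun_def)
  have 1: "norm (\<integral>x. f0 x \<partial>\<pi>) \<le> c * measure \<pi> (space \<pi>)"
    if "finite_measure \<pi>" "integrable \<pi> f0" "AE x in \<pi>. x \<in> {A..B}" for \<pi>
  proof -
    interpret finite_measure \<pi> by fact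
    have "norm (\<integral>x. f0 x \<partial>\<pi>) \<le> (\<integral>x. norm (f0 x) \<partial>\<pi>)" by (rule integral_norm_bound)
    also have "\<dots> \<le> (\<integral>x. c \<partial>\<pi>)" using that b(1) by (intro integral_mono_AE) auto
    finally show ?thesis by (simp add: mult.commute)
  qed
  have 3: "norm (\<integral>x. ?h x \<partial>\<nu>)
     \<le> c * (\<integral>x. \<bar>\<beta> x\<bar> \<partial>\<nu>) + (\<integral>x. norm (f2 x) \<partial>\<nu>) + c * (\<eta> * (\<integral>x. \<bar>\<beta> x\<bar> + 1 \<partial>\<nu>))"
  proof -
    have "norm (\<integral>x. ?h x \<partial>\<nu>) \<le> (\<integral>x. norm (?h x) \<partial>\<nu>)" by (rule integral_norm_bound)
    also have "\<dots> \<le> (\<integral>x. c * \<bar>\<beta> x\<bar> + norm (f2 x) + c * ?c x \<partial>\<nu>)"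
    proof (rule integral_mono_AE)
      show "integrable \<nu> (\<lambda>x. norm (?h x))"
        by (intro integrable_norm Bochner_Integration.integrable_add Bochner_Integration.integrable_diff integrable_scaleR_right i f)
      show "integrable \<nu> (\<lambda>x. c * \<bar>\<beta> x\<bar> + norm (f2 x) + c * ?c x)" using beta_nu f(3) by auto
      show "AE x in \<nu>. norm (?h x) \<le> c * \<bar>\<beta> x\<bar> + norm (f2 x) + c * ?c x" using supp(1)
      proof eventually_elim
        case (elim x)
        have p: "0 \<le> \<eta> * (\<bar>\<beta> x\<bar> + 1)" using eta by auto
        have "norm (?h x) \<le> norm (\<beta> x *\<^sub>R f1 x) + norm ((1/2) *\<^sub>R f2 x) + norm (?c x *\<^sub>R f0 x)"
          by (intro order_trans[OF norm_triangle_ineq4] add_right_mono norm_triangle_ineq)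
        also have "norm (\<beta> x *\<^sub>R f1 x) \<le> c * \<bar>\<beta> x\<bar>"
          using mult_right_mono[OF b(2)[OF elim], of "\<bar>\<beta> x\<bar>"] by (simp add: mult.commute)
        also have "norm ((1/2) *\<^sub>R f2 x) \<le> norm (f2 x)" by simp
        also have "norm (?c x *\<^sub>R f0 x) \<le> c * ?c x" using mult_left_mono[OF b(1)[OF elim] p] p by (simp add: mult.commute)
        finally show ?case by simp
      qed
    qed
    also have "\<dots> = c * (\<integral>x. \<bar>\<beta> x\<bar> \<partial>\<nu>) + (\<integral>x. norm (f2 x) \<partial>\<nu>) + c * (\<eta> * (\<integral>x. \<bar>\<beta> x\<bar> + 1 \<partial>\<nu>))"
      using beta_nu f(3) by simp
    finally show ?thesis .
  qed
  have n: "0 \<le> (\<integral>x. norm (f2 x) \<partial>\<nu>)" by (rule Bochner_nonneg) auto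
  have "norm (L f0 f1 f2) \<le> norm (\<integral>x. f0 x \<partial>\<pi>2) + norm (\<integral>x. f0 x \<partial>\<pi>1)
     + norm (\<integral>x. ?h x \<partial>\<nu>)"
    unfolding L_def by (intro order_trans[OF norm_triangle_ineq4] add_right_mono norm_triangle_ineq4)
  also have "\<dots> \<le> c * measure \<pi>2 (space \<pi>2) + c * measure \<pi>1 (space \<pi>1) +
     (c * (\<integral>x. \<bar>\<beta> x\<bar> \<partial>\<nu>) + (\<integral>x. norm (f2 x) \<partial>\<nu>) + c * (\<eta> * (\<integral>x. \<bar>\<beta> x\<bar> + 1 \<partial>\<nu>)))"
    by (intro add_mono 1 3) (use fin i supp in auto)
  also have "\<dots> = (LC - 1) * c + 1 * (\<integral>x. norm (f2 x) \<partial>\<nu>)" by (simp add: LC_def algebra_simps)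
  also have "\<dots> \<le> LC * c + LC * (\<integral>x. norm (f2 x) \<partial>\<nu>)"
  proof (intro add_mono mult_right_mono)
    show "1 \<le> LC" by (rule LC_ge_1)
  qed (use c n in auto)
  finally show ?thesis by (simp add: distrib_left)
qed

end

context weak_diffusion_identity begin

interpretation nu: finite_measure \<nu> by (rule fin)

text \<open>The shift by \<open>A\<close> multiplies the triple by a constant; it makes the Taylor
  coefficients in \<open>v\<close> powers of \<open>x - A\<close>, whose iterated primitives from
  \<open>A\<close> are again monomials.\<close>

lemma L_iexp:
  "L (\<lambda>x. iexp (v * (x - A))) (\<lambda>x. \<i> * of_real v * iexp (v * (x - A))) (\<lambda>x. - of_real (v\<^sup>2) * iexp (v * (x - A))) = 0"
proof -
  have "L (\<lambda>x. iexp (v * x)) (\<lambda>x. \<i> * of_real v * iexp (v * x)) (\<lambda>x. - of_real (v\<^sup>2) * iexp (v * x)) = 0"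
    unfolding L_def exp_identity right_minus_eq by (rule Bochner_cong) (auto simp: scaleR_conv_of_real algebra_simps)
  then have "L (\<lambda>x. iexp (- v * A) * iexp (v * x)) (\<lambda>x. iexp (- v * A) * (\<i> * v * iexp (v * x)))
      (\<lambda>x. iexp (- v * A) * (- of_real (v\<^sup>2) * iexp (v * x))) = 0" unfolding L_mult by simp
  moreover have "iexp (v * (x - A)) = iexp (- v * A) * iexp (v * x)" for x by (simp add: exp_add[symmetric] algebra_simps)
  ultimately show ?thesis by (simp add: mult_ac)
qed

text \<open>The Taylor coefficients in \<open>v\<close> of \<open>iexp (v * (x - A))\<close>;
  \<open>E1\<close> and \<open>E2\<close> are their first and second derivatives in
  \<open>x\<close>.\<close>

definition E :: "nat \<Rightarrow> real \<Rightarrow> complex" where "E j x = (\<i> * of_real (x - A)) ^ j / fact j"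
definition E1 :: "nat \<Rightarrow> real \<Rightarrow> complex" where "E1 j x = (case j of 0 \<Rightarrow> 0 | Suc i \<Rightarrow> \<i> * E i x)"
definition E2 :: "nat \<Rightarrow> real \<Rightarrow> complex" where "E2 j x = (case j of 0 \<Rightarrow> 0 | Suc i \<Rightarrow> \<i> * E1 i x)"

lemma E_measurable [measurable]: "E j \<in> borel_measurable borel" "E1 j \<in> borel_measurable borel" "E2 j \<in> borel_measurable borel"
proof -
  show [measurable]: "E j \<in> borel_measurable borel" for j unfolding E_def[abs_def] by measurable
  show [measurable]: "E1 j \<in> borel_measurable borel" for j unfolding E1_def[abs_def] by (cases j) measurable
  show "E2 j \<in> borel_measurable borel" unfolding E2_def[abs_def] by (cases j) measurable
qed

lemma bounded_fun_E:
  "\<exists>c. bounded_fun c (E j) \<and> bounded_fun c (E1 j) \<and> bounded_fun c (E2 j)"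
proof -
  have c: "continuous_on {A..B} (E j)" for j unfolding E_def[abs_def] by (intro continuous_intros) auto
  have c1: "continuous_on {A..B} (E1 j)" for j unfolding E1_def[abs_def] by (cases j) (auto intro!: continuous_intros c)
  have c2: "continuous_on {A..B} (E2 j)" for j unfolding E2_def[abs_def] by (cases j) (auto intro!: continuous_intros c1)
  have "\<exists>b. \<forall>x\<in>{A..B}. norm (f x) \<le> b" if "continuous_on {A..B} f" for f :: "real \<Rightarrow> complex"
    using compact_continuous_image[OF that compact_Icc] compact_imp_bounded bounded_iff by (metis (no_types, lifting) imageI)
  from this[OF c] this[OF c1] this[OF c2] obtain a b d where
    "\<forall>x\<in>{A..B}. norm (E j x) \<le> a" "\<forall>x\<in>{A..B}. norm (E1 j x) \<le> b" "\<forall>x\<in>{A..B}. norm (E2 j x) \<le> d" by blast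
  then show ?thesis by (intro exI[of _ "max a (max b d)"]) (force simp: bounded_fun_def)
qed

lemma sum_E:
  fixes v :: real
  shows
  "(\<Sum>j<Suc n. of_real v ^ j * E1 j x) = \<i> * of_real v * (\<Sum>j<n. of_real v ^ j * E j x)"
  "(\<Sum>j<Suc n. of_real v ^ j * E2 j x) = - of_real (v\<^sup>2) * (\<Sum>j<n - 1. of_real v ^ j * E j x)"
proof -
  show 1: "(\<Sum>j<Suc n. of_real v ^ j * E1 j x) = \<i> * of_real v * (\<Sum>j<n. of_real v ^ j * E j x)" for n
    unfolding sum.lessThan_Suc_shift by (simp add: E1_def sum_distrib_left mult_ac)
  show "(\<Sum>j<Suc n. of_real v ^ j * E2 j x) = - of_real (v\<^sup>2) * (\<Sum>j<n - 1. of_real v ^ j * E j x)"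
  proof (cases n)
    case (Suc m)
    have "(\<Sum>j<Suc n. of_real v ^ j * E2 j x) = \<i> * of_real v * (\<Sum>j<n. of_real v ^ j * E1 j x)"
      unfolding sum.lessThan_Suc_shift by (simp add: E2_def sum_distrib_left mult_ac)
    then show ?thesis unfolding Suc 1 by (simp add: power2_eq_square mult_ac) 
  qed (simp add: E2_def)
qed

lemma iexp_remainder:
  assumes "x \<in> {A..B}"
  shows "cmod (iexp (v * (x - A)) - (\<Sum>j<n. of_real v ^ j * E j x)) \<le> (\<bar>v\<bar> * (B - A)) ^ n"
proof -
  have e: "(\<Sum>j<n. of_real v ^ j * E j x) = (\<Sum>j<n. (\<i> * of_real (v * (x - A))) ^ j / fact j)"
    by (simp add: E_def power_mult_distrib mult_ac)
  show ?thesis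
  proof (cases n)
    case 0 then show ?thesis by simp
  next
    case (Suc m)
    have "cmod (iexp (v * (x - A)) - (\<Sum>j<n. of_real v ^ j * E j x)) \<le> \<bar>v * (x - A)\<bar> ^ n / fact n"
      unfolding e using iexp_approx1[of "v * (x - A)" m] by (simp only: Suc lessThan_Suc_atMost)
    also have "\<dots> \<le> \<bar>v * (x - A)\<bar> ^ n" using mult_right_mono[OF fact_ge_1, of "\<bar>v * (x - A)\<bar> ^ n" n] by (simp add: field_simps)
    also have "\<dots> \<le> (\<bar>v\<bar> * (B - A)) ^ n" using assms by (intro power_mono) (auto simp: abs_mult intro!: mult_left_mono)
    finally show ?thesis .
  qed
qed

text \<open>Comparison of coefficients at \<open>v = 0\<close>. \<open>L\<close> annihilates
  \<open>iexp\<close> for every \<open>v\<close> and, by induction, the coefficients below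
  \<open>k\<close>, so \<open>v ^ k * L (E k) (E1 k) (E2 k)\<close> is minus \<open>L\<close> of the
  Taylor remainder, and that is of order \<open>v ^ Suc k\<close>.\<close>

lemma L_E: "L (E k) (E1 k) (E2 k) = 0"
proof (induction k rule: less_induct)
  case (less k)
  define D where "D = (B - A + 1) ^ Suc k"
  have D: "(B - A) ^ j \<le> D" if "j \<le> Suc k" for j
  proof -
    have "(B - A) ^ j \<le> (B - A + 1) ^ j" using AB by (intro power_mono) auto
    also have "\<dots> \<le> D" unfolding D_def using AB that by (intro power_increasing) auto
    finally show ?thesis .
  qed
  have D0: "0 \<le> D" using AB by (simp add: D_def)
  define K where "K = LC * (D + D * measure \<nu> (space \<nu>))"
  have bd: "cmod (L (E k) (E1 k) (E2 k)) \<le> K * v" if v: "0 < v" "v < 1" for v :: real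
  proof -
    define r where "r n x = iexp (v * (x - A)) - (\<Sum>j<n. of_real v ^ j * E j x)" for n x
    \<comment> \<open>The derivatives of the remainder of order \<open>Suc k\<close> are again
      remainders, of orders \<open>k\<close> and \<open>k - 1\<close>, multiplied by
      \<open>v\<close> and \<open>v\<^sup>2\<close>. For \<open>k = 0\<close> the difference
      \<open>k - 1\<close> is truncated to \<open>0\<close> and one factor \<open>v < 1\<close> is
      given away.\<close>
    define f0 where "f0 = r (Suc k)"
    define f1 where "f1 = (\<lambda>x. \<i> * of_real v * r k x)"
    define f2 where "f2 = (\<lambda>x. - of_real (v\<^sup>2) * r (k - 1) x)"
    have [measurable]: "r n \<in> borel_measurable borel" for n unfolding r_def[abs_def] by measurable
    define c where "c = D * v ^ Suc k"
    have c0: "0 \<le> c" using D0 v by (simp add: c_def)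
    have rb: "cmod (r n x) \<le> v ^ n * (B - A) ^ n" if "x \<in> {A..B}" for n x
      using iexp_remainder[OF that, of v n] v by (simp add: r_def power_mult_distrib)
    have "bounded_fun c f0" unfolding bounded_fun_def f0_def
    proof (intro conjI ballI)
      fix x assume "x \<in> {A..B}"
      have "cmod (r (Suc k) x) \<le> v ^ Suc k * (B - A) ^ Suc k" by (rule rb) fact
      also have "\<dots> \<le> v ^ Suc k * D" using D[of "Suc k"] v by (intro mult_left_mono) auto
      finally show "cmod (r (Suc k) x) \<le> c" by (simp add: c_def mult_ac)
    qed measurable
    moreover have "bounded_fun c f1" unfolding bounded_fun_def f1_def
    proof (intro conjI ballI)
      fix x assume "x \<in> {A..B}"
      have "cmod (r k x) \<le> v ^ k * (B - A) ^ k" by (rule rb) fact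
      also have "\<dots> \<le> v ^ k * D" using D[of k] v by (intro mult_left_mono) auto
      finally have "v * cmod (r k x) \<le> v * (v ^ k * D)" using v by (intro mult_left_mono) auto
      then show "cmod (\<i> * of_real v * r k x) \<le> c" using v by (simp add: c_def norm_mult mult_ac)
    qed measurable
    moreover have f2: "bounded_fun c f2" unfolding bounded_fun_def f2_def
    proof (intro conjI ballI)
      fix x assume "x \<in> {A..B}"
      have "cmod (r (k - 1) x) \<le> v ^ (k - 1) * (B - A) ^ (k - 1)" by (rule rb) fact
      also have "\<dots> \<le> v ^ (k - 1) * D" using D[of "k - 1"] v by (intro mult_left_mono) auto
      finally have "v\<^sup>2 * cmod (r (k - 1) x) \<le> v\<^sup>2 * (v ^ (k - 1) * D)" using v by (intro mult_left_mono) auto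
      also have "\<dots> = v ^ (2 + (k - 1)) * D" by (simp add: power_add power2_eq_square)
      also have "\<dots> \<le> v ^ Suc k * D" using v D0 by (intro mult_right_mono power_decreasing) auto
      finally show "cmod (- of_real (v\<^sup>2) * r (k - 1) x) \<le> c" using v by (simp add: c_def norm_mult norm_power mult_ac)
    qed measurable
    ultimately have b: "bounded_fun c f0" "bounded_fun c f1" "integrable \<nu> f2" using bounded_fun_integrable by auto
    obtain C where C: "\<And>j. bounded_fun (C j) (E j) \<and> bounded_fun (C j) (E1 j) \<and> bounded_fun (C j) (E2 j)"
      using bounded_fun_E by metis
    have S: "L (\<lambda>x. \<Sum>j<Suc k. of_real v ^ j * E j x) (\<lambda>x. \<Sum>j<Suc k. of_real v ^ j * E1 j x) (\<lambda>x. \<Sum>j<Suc k. of_real v ^ j * E2 j x)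
        = (\<Sum>j<Suc k. of_real v ^ j * L (E j) (E1 j) (E2 j)) \<and>
      bounded_fun (\<Sum>j<Suc k. norm (complex_of_real v ^ j) * C j) (\<lambda>x. \<Sum>j<Suc k. of_real v ^ j * E j x) \<and>
      bounded_fun (\<Sum>j<Suc k. norm (complex_of_real v ^ j) * C j) (\<lambda>x. \<Sum>j<Suc k. of_real v ^ j * E1 j x) \<and>
      bounded_fun (\<Sum>j<Suc k. norm (complex_of_real v ^ j) * C j) (\<lambda>x. \<Sum>j<Suc k. of_real v ^ j * E2 j x)"
      by (rule L_sum) (use C in auto)
    have "0 = L (\<lambda>x. f0 x + (\<Sum>j<Suc k. of_real v ^ j * E j x)) (\<lambda>x. f1 x + (\<Sum>j<Suc k. of_real v ^ j * E1 j x))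
        (\<lambda>x. f2 x + (\<Sum>j<Suc k. of_real v ^ j * E2 j x))"
      using L_iexp[of v] by (simp only: sum_E f0_def f1_def f2_def r_def right_diff_distrib diff_Suc_1 diff_add_cancel)
    also have "\<dots> = L f0 f1 f2 + (\<Sum>j<Suc k. of_real v ^ j * L (E j) (E1 j) (E2 j))"
      using S b by (subst L_add) (auto intro: bounded_fun_integrable)
    also have "(\<Sum>j<Suc k. of_real v ^ j * L (E j) (E1 j) (E2 j)) = of_real v ^ k * L (E k) (E1 k) (E2 k)" using less.IH by simp
    finally have "of_real v ^ k * L (E k) (E1 k) (E2 k) = - L f0 f1 f2" by (simp add: add_eq_0_iff2)
    then have "v ^ k * cmod (L (E k) (E1 k) (E2 k)) = cmod (L f0 f1 f2)"
      using v by (metis norm_minus_cancel norm_mult norm_power norm_of_real abs_of_pos)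
    also have "\<dots> \<le> LC * (c + (\<integral>x. norm (f2 x) \<partial>\<nu>))" by (rule L_bound[OF b c0])
    also have "\<dots> \<le> LC * (c + c * measure \<nu> (space \<nu>))"
    proof (intro mult_left_mono add_left_mono)
      have "(\<integral>x. norm (f2 x) \<partial>\<nu>) \<le> (\<integral>x. c \<partial>\<nu>)"
        using supp(1) f2 b(3) by (intro integral_mono_AE) (auto simp: bounded_fun_def)
      then show "(\<integral>x. norm (f2 x) \<partial>\<nu>) \<le> c * measure \<nu> (space \<nu>)" by (simp add: mult.commute)
    qed (use LC_ge_1 in auto)
    also have "\<dots> = v ^ k * (K * v)" by (simp add: c_def K_def algebra_simps)
    finally show ?thesis using v by simp
  qed
  \<comment> \<open>The estimate is applied at \<open>v = 1 / (n + 2)\<close>, which is below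
    \<open>1\<close> for every \<open>n\<close>.\<close>
  have "(\<lambda>n. K * (1 / real (Suc (Suc n)))) \<longlonglongrightarrow> K * 0"
    by (intro tendsto_mult_left) (use LIMSEQ_Suc[OF LIMSEQ_inverse_real_of_nat] in \<open>simp add: inverse_eq_divide\<close>)
  then have "cmod (L (E k) (E1 k) (E2 k)) \<le> K * 0" by (rule LIMSEQ_le_const) (intro exI[of _ 0] allI impI bd, auto)
  then show ?case by simp
qed

end

section \<open>From polynomials to test functions with an integrable second derivative\<close>

context weak_diffusion_identity begin

interpretation nu: finite_measure \<nu> by (rule fin)

text \<open>The factor \<open>fact k / \<i> ^ Suc (Suc k)\<close> turns the Taylor coefficient of
  order \<open>k + 2\<close> into the second primitive of \<open>(x - A) ^ k\<close>.\<close>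

lemma L_monomial:
  "L (\<lambda>x. (x - A) ^ Suc (Suc k) / (real (Suc k) * real (Suc (Suc k)))) (\<lambda>x. (x - A) ^ Suc k / real (Suc k)) (\<lambda>x. (x - A) ^ k) = 0"
proof -
  define a where "a = fact k / \<i> ^ Suc (Suc k)"
  have n0: "complex_of_nat (Suc j) \<noteq> 0" for j using of_nat_neq_0 .
  have z0: "z ^ Suc (Suc k) / (of_nat (Suc k) * of_nat (Suc (Suc k))) = a * ((\<i> * z) ^ Suc (Suc k) / fact (Suc (Suc k)))" for z :: complex
    using n0[of k] n0[of "Suc k"] unfolding a_def power_mult_distrib fact_Suc by (simp add: field_simps del: of_nat_Suc power_Suc)
  have z1: "z ^ Suc k / of_nat (Suc k) = a * (\<i> * ((\<i> * z) ^ Suc k / fact (Suc k)))" for z :: complex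
    using n0[of k] unfolding a_def power_mult_distrib fact_Suc by (simp add: field_simps del: of_nat_Suc)
  have z2: "z ^ k = a * (\<i> * (\<i> * ((\<i> * z) ^ k / fact k)))" for z :: complex
    unfolding a_def power_mult_distrib by (simp add: field_simps)
  have E0: "complex_of_real ((x - A) ^ Suc (Suc k) / (real (Suc k) * real (Suc (Suc k)))) = a * E (Suc (Suc k)) x" for x
    using z0[of "of_real (x - A)"] by (simp add: E_def del: of_nat_Suc power_Suc fact_Suc)
  have E1: "complex_of_real ((x - A) ^ Suc k / real (Suc k)) = a * E1 (Suc (Suc k)) x" for x
    using z1[of "of_real (x - A)"] by (simp add: E1_def E_def del: of_nat_Suc power_Suc fact_Suc)
  have E2: "complex_of_real ((x - A) ^ k) = a * E2 (Suc (Suc k)) x" for x using z2[of "of_real (x - A)"] by (simp add: E2_def E1_def E_def)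
  have "complex_of_real (L (\<lambda>x. (x - A) ^ Suc (Suc k) / (real (Suc k) * real (Suc (Suc k)))) (\<lambda>x. (x - A) ^ Suc k / real (Suc k)) (\<lambda>x. (x - A) ^ k))
     = a * L (E (Suc (Suc k))) (E1 (Suc (Suc k))) (E2 (Suc (Suc k)))" unfolding L_of_real[symmetric] L_mult[symmetric] E0 E1 E2 ..
  then show ?thesis unfolding L_E by simp
qed

lemma set_integrable_const_Icc: "set_integrable lborel {a..b::real} (\<lambda>_. c :: real)"
  by (rule borel_integrable_atLeastAtMost') (rule continuous_on_const)

text \<open>The clamp makes \<open>I f\<close> a measurable function on the whole line.\<close>

definition I :: "(real \<Rightarrow> real) \<Rightarrow> real \<Rightarrow> real" where
  "I f x = (LINT w:{A..max A (min x B)}|lborel. f w)"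

lemma I_eq: "x \<in> {A..B} \<Longrightarrow> I f x = (LINT w:{A..x}|lborel. f w)"
  by (simp add: I_def)

lemma set_integrable_subinterval:
  "set_integrable lborel {A..B} f \<Longrightarrow> {a..b} \<subseteq> {A..B} \<Longrightarrow> set_integrable lborel {a..b} (f :: real \<Rightarrow> real)"
  by (erule set_integrable_subset) auto

lemma I_continuous:
  assumes f: "set_integrable lborel {A..B} f"
  shows "continuous_on UNIV (I f)"
proof -
  have c: "continuous_on {A..B} (\<lambda>u. integral {A..u} f)"
    by (rule indefinite_integral_continuous_1) (rule set_borel_integral_eq_integral(1)[OF f])
  have "continuous_on UNIV (\<lambda>x. integral {A..max A (min x B)} f)"
    by (rule continuous_on_compose2[OF c]) (use AB in \<open>auto intro!: continuous_intros\<close>)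
  moreover have "I f x = integral {A..max A (min x B)} f" for x
    unfolding I_def using AB by (intro set_borel_integral_eq_integral(2) set_integrable_subinterval[OF f]) auto
  ultimately show ?thesis by (simp add: fun_eq_iff[symmetric] cong: continuous_on_cong)
qed

lemma I_measurable: "set_integrable lborel {A..B} f \<Longrightarrow> I f \<in> borel_measurable borel"
  by (rule borel_measurable_continuous_onI[OF I_continuous])

lemma I_set_integrable: "set_integrable lborel {A..B} f \<Longrightarrow> set_integrable lborel {A..B} (I f)"
  by (rule borel_integrable_atLeastAtMost') (rule continuous_on_subset[OF I_continuous], auto)

lemma I_bound:
  assumes f: "set_integrable lborel {A..B} f"
  shows "\<bar>I f x\<bar> \<le> (LINT w:{A..B}|lborel. \<bar>f w\<bar>)"
proof -
  have "norm (I f x) \<le> (LINT w:{A..max A (min x B)}|lborel. norm (f w))"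
    unfolding I_def using AB by (intro set_integral_norm_bound set_integrable_subinterval[OF f]) auto
  also have "\<dots> \<le> (LINT w:{A..B}|lborel. norm (f w))" using AB by (intro set_integral_mono_set_nonneg set_integrable_norm f) auto
  finally show ?thesis by simp
qed

lemma I_I_bound:
  assumes f: "set_integrable lborel {A..B} f"
  shows "\<bar>I (I f) x\<bar> \<le> (B - A) * (LINT w:{A..B}|lborel. \<bar>f w\<bar>)"
proof -
  have "\<bar>I (I f) x\<bar> \<le> (LINT w:{A..B}|lborel. \<bar>I f w\<bar>)" by (rule I_bound[OF I_set_integrable[OF f]])
  also have "\<dots> \<le> (LINT w:{A..B}|lborel. (LINT w:{A..B}|lborel. \<bar>f w\<bar>))"
    using I_bound[OF f] I_set_integrable[OF f] by (intro set_integral_mono set_integrable_abs set_integrable_const_Icc) auto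
  also have "\<dots> = (B - A) * (LINT w:{A..B}|lborel. \<bar>f w\<bar>)"
    using AB by (simp add: set_lebesgue_integral_def[of _ _ "\<lambda>_. _"] mult.commute)
  finally show ?thesis .
qed

lemma I_diff:
  assumes "set_integrable lborel {A..B} f" "set_integrable lborel {A..B} g"
  shows "I (\<lambda>x. f x - g x) = (\<lambda>x. I f x - I g x)"
  unfolding I_def using AB
  by (intro ext set_integral_diff(2) set_integrable_subinterval[OF assms(1)] set_integrable_subinterval[OF assms(2)]) auto

text \<open>The defect as a functional of the second derivative alone: the test function is the one
  that vanishes at \<open>A\<close> together with its first derivative.\<close>

definition T :: "(real \<Rightarrow> real) \<Rightarrow> real" where "T \<psi> = L (I (I \<psi>)) (I \<psi>) \<psi>"

lemma T_bounded_fun: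
  assumes "set_integrable lborel {A..B} f"
  defines "c \<equiv> (B - A + 1) * (LINT w:{A..B}|lborel. \<bar>f w\<bar>)"
  shows "bounded_fun c (I (I f))" "bounded_fun c (I f)" "0 \<le> c"
proof -
  have n: "0 \<le> (LINT w:{A..B}|lborel. \<bar>f w\<bar>)" by (simp add: set_lebesgue_integral_def)
  then show "0 \<le> c" using AB by (simp add: c_def)
  show "bounded_fun c (I f)" unfolding bounded_fun_def
  proof (intro conjI ballI I_measurable assms)
    fix x
    have "\<bar>I f x\<bar> \<le> 1 * (LINT w:{A..B}|lborel. \<bar>f w\<bar>)" using I_bound[OF assms(1), of x] by simp
    also have "\<dots> \<le> c" unfolding c_def using AB n by (intro mult_right_mono) auto
    finally show "norm (I f x) \<le> c" by simp
  qed
  show "bounded_fun c (I (I f))" unfolding bounded_fun_def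
  proof (intro conjI ballI I_measurable I_set_integrable assms)
    fix x
    have "\<bar>I (I f) x\<bar> \<le> (B - A) * (LINT w:{A..B}|lborel. \<bar>f w\<bar>)" using I_I_bound[OF assms(1), of x] by simp
    also have "\<dots> \<le> c" unfolding c_def using AB n by (intro mult_right_mono) auto
    finally show "norm (I (I f) x) \<le> c" by simp
  qed
qed

lemma L_diff:
  fixes f0 :: "real \<Rightarrow> real"
  assumes f: "bounded_fun c f0" "bounded_fun c f1" "integrable \<nu> f2"
    and g: "bounded_fun d g0" "bounded_fun d g1" "integrable \<nu> g2"
  shows "L (\<lambda>x. f0 x - g0 x) (\<lambda>x. f1 x - g1 x) (\<lambda>x. f2 x - g2 x) = L f0 f1 f2 - L g0 g1 g2"
  using L_add[OF f bounded_fun_mult[OF g(1), of "-1"] bounded_fun_mult[OF g(2), of "-1"] integrable_mult_right[OF g(3), of "-1"]]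
    L_mult[of "-1" g0 g1 g2] by simp

lemma T_diff:
  assumes f: "set_integrable lborel {A..B} f" "integrable \<nu> f" and g: "set_integrable lborel {A..B} g" "integrable \<nu> g"
  shows "T (\<lambda>x. f x - g x) = T f - T g"
proof -
  have "T (\<lambda>x. f x - g x) = L (\<lambda>x. I (I f) x - I (I g) x) (\<lambda>x. I f x - I g x) (\<lambda>x. f x - g x)"
    unfolding T_def I_diff[OF f(1) g(1)] I_diff[OF I_set_integrable[OF f(1)] I_set_integrable[OF g(1)]] ..
  also have "\<dots> = T f - T g" unfolding T_def by (rule L_diff[OF T_bounded_fun(1,2)[OF f(1)] f(2) T_bounded_fun(1,2)[OF g(1)] g(2)])
  finally show ?thesis .
qed

lemma T_bound:
  assumes f: "set_integrable lborel {A..B} f" "integrable \<nu> f"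
  shows "\<bar>T f\<bar> \<le> LC * ((B - A + 1) * (LINT w:{A..B}|lborel. \<bar>f w\<bar>) + (\<integral>x. \<bar>f x\<bar> \<partial>\<nu>))"
  using L_bound[OF T_bounded_fun(1,2)[OF f(1)] f(2) T_bounded_fun(3)[OF f(1)]] by (simp add: T_def)

lemma L_cong:
  assumes "\<And>x. x \<in> {A..B} \<Longrightarrow> f0 x = g0 x" "\<And>x. x \<in> {A..B} \<Longrightarrow> f1 x = g1 x" "\<And>x. x \<in> {A..B} \<Longrightarrow> f2 x = g2 x"
    and [measurable]: "f0 \<in> borel_measurable borel" "f1 \<in> borel_measurable borel" "f2 \<in> borel_measurable borel"
     "g0 \<in> borel_measurable borel" "g1 \<in> borel_measurable borel" "g2 \<in> borel_measurable borel"
  shows "L f0 f1 f2 = L g0 g1 g2"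
proof -
  have "AE x in \<pi>2. f0 x = g0 x" using supp(3) by eventually_elim (rule assms)
  then have "(\<integral>x. f0 x \<partial>\<pi>2) = (\<integral>x. g0 x \<partial>\<pi>2)" by (intro integral_cong_AE) auto
  moreover have "AE x in \<pi>1. f0 x = g0 x" using supp(2) by eventually_elim (rule assms)
  then have "(\<integral>x. f0 x \<partial>\<pi>1) = (\<integral>x. g0 x \<partial>\<pi>1)" by (intro integral_cong_AE) auto
  moreover have "AE x in \<nu>. \<beta> x *\<^sub>R f1 x + (1/2) *\<^sub>R f2 x - (\<eta> * (\<bar>\<beta> x\<bar> + 1)) *\<^sub>R f0 x
      = \<beta> x *\<^sub>R g1 x + (1/2) *\<^sub>R g2 x - (\<eta> * (\<bar>\<beta> x\<bar> + 1)) *\<^sub>R g0 x" using supp(1)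
  proof eventually_elim
    case (elim x) show ?case unfolding assms(1)[OF elim] assms(2)[OF elim] assms(3)[OF elim] ..
  qed
  then have "(\<integral>x. \<beta> x *\<^sub>R f1 x + (1/2) *\<^sub>R f2 x - (\<eta> * (\<bar>\<beta> x\<bar> + 1)) *\<^sub>R f0 x \<partial>\<nu>) =
     (\<integral>x. \<beta> x *\<^sub>R g1 x + (1/2) *\<^sub>R g2 x - (\<eta> * (\<bar>\<beta> x\<bar> + 1)) *\<^sub>R g0 x \<partial>\<nu>)"
    by (intro integral_cong_AE) auto
  ultimately show ?thesis unfolding L_def by simp
qed

lemma I_sum_powers:
  assumes "x \<in> {A..B}"
  shows "I (\<lambda>x. \<Sum>i\<le>n. a i * (x - A) ^ (i + m)) x = (\<Sum>i\<le>n. a i * ((x - A) ^ Suc (i + m) / real (Suc (i + m))))"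
proof -
  let ?P = "\<lambda>i x. a i * ((x - A) ^ Suc (i + m) / real (Suc (i + m)))" and ?p = "\<lambda>x. \<Sum>i\<le>n. a i * (x - A) ^ (i + m)"
  have "I ?p x = (\<integral>w. indicator {A..x} w *\<^sub>R ?p w \<partial>lborel)" using assms by (simp add: I_eq set_lebesgue_integral_def)
  also have "\<dots> = (\<Sum>i\<le>n. ?P i x) - (\<Sum>i\<le>n. ?P i A)"
  proof (rule integral_FTC_Icc)
    fix y
    have "((\<lambda>x. ?P i x) has_real_derivative a i * (y - A) ^ (i + m)) (at y within {A..x})" for i
    proof -
      have "((\<lambda>x. (x - A) ^ Suc (i + m)) has_real_derivative real (Suc (i + m)) * (y - A) ^ (i + m)) (at y within {A..x})"
      proof -
        have "((\<lambda>x. x - A) has_real_derivative 1) (at y within {A..x})" by (auto intro!: derivative_eq_intros)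
        from DERIV_power[OF this, of "Suc (i + m)"] show ?thesis by (simp del: of_nat_Suc power_Suc)
      qed
      from DERIV_cmult[OF this, of "a i / real (Suc (i + m))"] show ?thesis by (simp del: of_nat_Suc power_Suc)
    qed
    then have "((\<lambda>x. \<Sum>i\<le>n. ?P i x) has_real_derivative ?p y) (at y within {A..x})" by (rule DERIV_sum)
    then show "((\<lambda>x. \<Sum>i\<le>n. ?P i x) has_vector_derivative ?p y) (at y within {A..x})"
      by (simp add: has_real_derivative_iff_has_vector_derivative)
  qed (use assms in \<open>auto intro!: continuous_intros\<close>)
  finally show ?thesis by simp
qed

lemma polynomial_integrable:
  assumes "continuous_on UNIV (p :: real \<Rightarrow> real)"
  shows "set_integrable lborel {A..B} p" "integrable \<nu> p"
proof -
  have c: "continuous_on {A..B} p" using assms continuous_on_subset by blast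
  then show "set_integrable lborel {A..B} p" by (rule borel_integrable_atLeastAtMost')
  have [measurable]: "p \<in> borel_measurable borel" by (rule borel_measurable_continuous_onI[OF assms])
  have "bounded (p ` {A..B})" using c compact_continuous_image compact_imp_bounded by blast
  then obtain b where "\<forall>x\<in>{A..B}. norm (p x) \<le> b" unfolding bounded_iff by auto
  then show "integrable \<nu> p" by (intro nu.integrable_const_bound[of _ b]) (use supp(1) in auto)
qed

lemma bounded_fun_continuous:
  assumes "continuous_on UNIV (f :: real \<Rightarrow> real)"
  obtains c where "bounded_fun c f"
proof -
  have "bounded (f ` {A..B})" using continuous_on_subset[OF assms] compact_continuous_image compact_imp_bounded by blast
  then obtain b where "\<forall>x\<in>{A..B}. norm (f x) \<le> b" unfolding bounded_iff by auto
  then show ?thesis using borel_measurable_continuous_onI[OF assms] by (intro that[of b]) (auto simp: bounded_fun_def)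
qed

lemma T_polynomial: "T (\<lambda>x. \<Sum>i\<le>n. a i * (x - A) ^ i) = 0"
proof -
  define q1 where "q1 i x = (x - A) ^ Suc i / real (Suc i)" for i x
  define q0 where "q0 i x = (x - A) ^ Suc (Suc i) / (real (Suc i) * real (Suc (Suc i)))" for i x
  have qc: "continuous_on UNIV (q0 i)" "continuous_on UNIV (q1 i)" "continuous_on UNIV (\<lambda>x. (x - A) ^ i)" for i
    unfolding q0_def[abs_def] q1_def[abs_def] by (intro continuous_intros; simp del: of_nat_Suc)+
  define p where "p = (\<lambda>x. \<Sum>i\<le>n. a i * (x - A) ^ i)"
  define p1 where "p1 = (\<lambda>x. \<Sum>i\<le>n. a i * q1 i x)"
  define p0 where "p0 = (\<lambda>x. \<Sum>i\<le>n. a i * q0 i x)"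
  have pc: "continuous_on UNIV p" unfolding p_def by (intro continuous_intros)
  have p1c: "continuous_on UNIV p1" unfolding p1_def by (intro continuous_intros qc)
  have p0c: "continuous_on UNIV p0" unfolding p0_def by (intro continuous_intros qc)
  have [measurable]: "p \<in> borel_measurable borel" "p1 \<in> borel_measurable borel" "p0 \<in> borel_measurable borel"
    using pc p1c p0c by (auto intro: borel_measurable_continuous_onI)
  have i1: "I p x = p1 x" if "x \<in> {A..B}" for x
    using I_sum_powers[OF that, where m = 0 and a = a and n = n] by (simp add: p_def p1_def q1_def)
  have p1': "p1 = (\<lambda>x. \<Sum>i\<le>n. (a i / real (Suc i)) * (x - A) ^ (i + 1))"
    unfolding p1_def q1_def by (intro ext sum.cong) (simp_all del: of_nat_Suc)
  have i0: "I (I p) x = p0 x" if "x \<in> {A..B}" for x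
  proof -
    have "I (I p) x = (LINT w:{A..x}|lborel. I p w)" by (rule I_eq[OF that])
    also have "\<dots> = (LINT w:{A..x}|lborel. p1 w)" by (rule set_lebesgue_integral_cong) (use that i1 in auto)
    also have "\<dots> = I p1 x" by (rule I_eq[OF that, symmetric])
    also have "\<dots> = p0 x" unfolding p1' I_sum_powers[OF that] p0_def q0_def
      by (intro sum.cong) (simp_all add: divide_divide_eq_left del: of_nat_Suc power_Suc)
    finally show ?thesis .
  qed
  have "T p = L p0 p1 p" unfolding T_def using i0 i1 polynomial_integrable(1)[OF pc]
    by (intro L_cong) (auto intro!: I_measurable I_set_integrable)
  also have "\<dots> = (\<Sum>i\<le>n. a i * L (q0 i) (q1 i) (\<lambda>x. (x - A) ^ i))"
  proof -
    have "\<exists>c. bounded_fun c (q0 i) \<and> bounded_fun c (q1 i) \<and> bounded_fun c (\<lambda>x. (x - A) ^ i)" for i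
    proof -
      obtain c where c: "bounded_fun c (q0 i)" by (rule bounded_fun_continuous[OF qc(1)])
      obtain d where d: "bounded_fun d (q1 i)" by (rule bounded_fun_continuous[OF qc(2)])
      obtain e where "bounded_fun e (\<lambda>x. (x - A) ^ i)" by (rule bounded_fun_continuous[OF qc(3)])
      with c d show ?thesis by (intro exI[of _ "max c (max d e)"] conjI) (erule bounded_fun_mono, simp)+
    qed
    then have "\<forall>i. \<exists>c. bounded_fun c (q0 i) \<and> bounded_fun c (q1 i) \<and> bounded_fun c (\<lambda>x. (x - A) ^ i)" ..
    from choice[OF this] obtain c where c: "\<And>i. bounded_fun (c i) (q0 i) \<and> bounded_fun (c i) (q1 i) \<and> bounded_fun (c i) (\<lambda>x. (x - A) ^ i)"
      by auto
    show ?thesis unfolding p0_def p1_def p_def by (rule conjunct1[OF L_sum[where c = c]]) (use c in auto)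
  qed
  also have "\<dots> = 0" unfolding q0_def q1_def L_monomial by simp
  finally show ?thesis by (simp add: p_def)
qed

text \<open>\<open>T\<close> is continuous in the sum of the \<open>L^1\<close> norms for Lebesgue
  measure on \<open>[A, B]\<close> and for \<open>\<nu>\<close>, and it vanishes on polynomials. The
  simultaneous approximation provides a continuous function close to \<open>f\<close> in both norms,
  and Stone-Weierstrass a polynomial uniformly close to that function.\<close>

lemma T_zero:
  assumes f: "set_integrable lborel {A..B} f" "integrable \<nu> f"
  shows "T f = 0"
proof -
  define m where "m = density lborel (\<lambda>x. ennreal (indicator {A..B} x))"
  have sm: "sets m = sets borel" by (simp add: m_def)
  have fm: "finite_measure m"
    by (rule finite_measureI) (simp add: m_def emeasure_density nn_integral_indicator ennreal_indicator emeasure_lborel_Icc_eq)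
  have fm' [measurable]: "f \<in> borel_measurable borel" using borel_measurable_integrable[OF f(2)] by simp
  have mi: "integrable m f" using f(1) by (simp add: m_def set_integrable_def integrable_density)
  have mI: "(\<integral>x. g x \<partial>m) = (LINT u:{A..B}|lborel. g u)" if "g \<in> borel_measurable borel" for g :: "real \<Rightarrow> real"
    using that by (simp add: m_def set_lebesgue_integral_def integral_density)
  define m' where "m' = (\<lambda>i. if i then m else \<nu>)"
  have m': "finite_measure (m' i)" "sets (m' i) = sets borel" "integrable (m' i) f" for i
    unfolding m'_def by (cases i, simp_all only: if_True if_False fm fin(1) sm sets_borel(1) mi f(2))+
  \<comment> \<open>With \<open>c = B - A + 1\<close> and \<open>n\<close> the mass of
    \<open>\<nu>\<close>, the constant only has to exceed \<open>LC * (c + 1)\<close> and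
    \<open>LC * (c * (c - 1) + n)\<close>, one for each of the two approximations.\<close>
  define K where "K = LC * ((B - A + 1) * (B - A + 1) + measure \<nu> (space \<nu>) + 1)"
  have bd: "\<bar>T f\<bar> \<le> 2 * K * e" if e: "0 < e" for e
  proof -
    obtain h b where h0: "continuous_on UNIV h" "\<And>x. norm (h x) \<le> (b::real)" "\<And>i. (\<integral>x. norm (f x - h x) \<partial>m' i) < e"
      by (rule L1_approximableE[OF L1_approximable_integrable[of m', OF m'] e]) (rule that)
    note h = h0(1,2) h0(3)[of True, unfolded m'_def if_True real_norm_def] h0(3)[of False, unfolded m'_def if_False real_norm_def]
    have hm [measurable]: "h \<in> borel_measurable borel" by (rule borel_measurable_continuous_onI[OF h(1)])
    note hi = polynomial_integrable[OF h(1)]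
    have h3: "(LINT u:{A..B}|lborel. \<bar>f u - h u\<bar>) < e" using h(3) by (subst (asm) mI) auto
    have hc: "continuous_on {0..B - A} (\<lambda>y. h (A + y))" by (rule continuous_on_compose2[OF h(1)]) (auto intro!: continuous_intros)
    obtain g where g: "real_polynomial_function g" "\<And>y. y \<in> {0..B - A} \<Longrightarrow> \<bar>h (A + y) - g y\<bar> < e"
      by (rule Stone_Weierstrass_real_polynomial_function[OF compact_Icc hc e]) blast
    from g(1) obtain a n where a: "g = (\<lambda>x. \<Sum>i\<le>n. a i * x ^ i)" unfolding real_polynomial_function_iff_sum by blast
    define p where "p = (\<lambda>x. \<Sum>i\<le>n. a i * (x - A) ^ i)"
    have pc: "continuous_on UNIV p" unfolding p_def by (intro continuous_intros)
    have pm [measurable]: "p \<in> borel_measurable borel" by (rule borel_measurable_continuous_onI[OF pc])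
    note pi = polynomial_integrable[OF pc]
    have hp: "\<bar>h x - p x\<bar> \<le> e" if "x \<in> {A..B}" for x using g(2)[of "x - A"] that by (simp add: a p_def)
    have p1: "(LINT u:{A..B}|lborel. \<bar>h u - p u\<bar>) \<le> (B - A) * e"
    proof -
      have "(LINT u:{A..B}|lborel. \<bar>h u - p u\<bar>) \<le> (LINT u:{A..B}|lborel. e)"
        using hp by (intro set_integral_mono set_integrable_abs set_integral_diff hi pi set_integrable_const_Icc) auto
      then show ?thesis using AB by (simp add: set_lebesgue_integral_def[of _ _ "\<lambda>_. e"])
    qed
    have p2: "(\<integral>x. \<bar>h x - p x\<bar> \<partial>\<nu>) \<le> measure \<nu> (space \<nu>) * e"
    proof -
      have "(\<integral>x. \<bar>h x - p x\<bar> \<partial>\<nu>) \<le> (\<integral>x. e \<partial>\<nu>)"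
        using hp supp(1) by (intro integral_mono_AE integrable_abs Bochner_Integration.integrable_diff hi pi) auto
      then show ?thesis by simp
    qed
    define c where "c = B - A + 1"
    define n where "n = measure \<nu> (space \<nu>)"
    have c: "1 \<le> c" and n: "0 \<le> n" using AB by (auto simp: c_def n_def)
    have cc: "c + 1 \<le> c * c + n + 1" "c * (c - 1) + n \<le> c * c + n + 1"
    proof -
      have "c * 1 \<le> c * c" "c * (c - 1) \<le> c * c" using c by (intro mult_left_mono; simp)+
      then show "c + 1 \<le> c * c + n + 1" "c * (c - 1) + n \<le> c * c + n + 1" using n by linarith+
    qed
    have "\<bar>T f - T h\<bar> \<le> K * e"
    proof -
      have "\<bar>T f - T h\<bar> \<le> LC * ((B - A + 1) * (LINT w:{A..B}|lborel. \<bar>f w - h w\<bar>) + (\<integral>x. \<bar>f x - h x\<bar> \<partial>\<nu>))"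
        unfolding T_diff[OF f hi, symmetric] by (rule T_bound) (intro set_integral_diff f hi Bochner_Integration.integrable_diff)+
      also have "\<dots> \<le> LC * (c * e + e)" using c h(4) h3 LC_ge_1 unfolding c_def by (intro mult_left_mono add_mono) auto
      also have "\<dots> = LC * (c + 1) * e" by (simp add: algebra_simps)
      also have "\<dots> \<le> LC * (c * c + n + 1) * e" using cc LC_ge_1 e by (intro mult_right_mono[of _ _ e] mult_left_mono[of _ _ LC]) auto
      also have "\<dots> = K * e" by (simp add: K_def c_def n_def)
      finally show ?thesis .
    qed
    moreover have "\<bar>T h - T p\<bar> \<le> K * e"
    proof -
      have "\<bar>T h - T p\<bar> \<le> LC * ((B - A + 1) * (LINT w:{A..B}|lborel. \<bar>h w - p w\<bar>) + (\<integral>x. \<bar>h x - p x\<bar> \<partial>\<nu>))"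
        unfolding T_diff[OF hi pi, symmetric] by (rule T_bound) (intro set_integral_diff hi pi Bochner_Integration.integrable_diff)+
      also have "\<dots> \<le> LC * (c * ((B - A) * e) + n * e)"
        using c p1 p2 LC_ge_1 unfolding c_def n_def by (intro mult_left_mono add_mono) auto
      also have "\<dots> = LC * (c * (c - 1) + n) * e" by (simp add: c_def algebra_simps)
      also have "\<dots> \<le> LC * (c * c + n + 1) * e" using cc LC_ge_1 e by (intro mult_right_mono[of _ _ e] mult_left_mono[of _ _ LC]) auto
      also have "\<dots> = K * e" by (simp add: K_def c_def n_def)
      finally show ?thesis .
    qed
    moreover have "T p = 0" unfolding p_def by (rule T_polynomial)
    ultimately show ?thesis by linarith
  qed
  have "(\<lambda>n. 2 * K * (1 / real (Suc n))) \<longlonglongrightarrow> 2 * K * 0" by (intro tendsto_mult_left inverse_Suc_tendsto_0)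
  then have "\<bar>T f\<bar> \<le> 2 * K * 0" by (rule LIMSEQ_le_const) (intro exI[of _ 0] allI impI bd, auto)
  then show ?thesis by simp
qed

text \<open>With \<open>s' = \<rho>\<close> and \<open>s'' = -2 \<beta> \<rho>\<close> the first and
  second order terms of the integrand cancel, so only the discount is left. \<open>s\<close> is the
  affine function \<open>q\<close> plus the double primitive of \<open>s''\<close>; the first part
  has no defect by the Taylor coefficients of order \<open>0\<close> and \<open>1\<close>, the
  second by \<open>T_zero\<close>.\<close>

theorem scale_identity:
  fixes s \<rho> :: "real \<Rightarrow> real"
  assumes sm: "s \<in> borel_measurable borel" and rm: "\<rho> \<in> borel_measurable borel"
    and psi: "set_integrable lborel {A..B} (\<lambda>x. - 2 * \<beta> x * \<rho> x)" "integrable \<nu> (\<lambda>x. - 2 * \<beta> x * \<rho> x)"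
    and rho: "\<And>x. x \<in> {A..B} \<Longrightarrow> \<rho> x = \<rho> A + (LINT w:{A..x}|lborel. - 2 * \<beta> w * \<rho> w)"
    and s: "\<And>x. x \<in> {A..B} \<Longrightarrow> s x = s A + (LINT w:{A..x}|lborel. \<rho> w)"
  shows "(\<integral>x. s x \<partial>\<pi>2) - (\<integral>x. s x \<partial>\<pi>1) = - \<eta> * (\<integral>x. s x * (\<bar>\<beta> x\<bar> + 1) \<partial>\<nu>)"
proof -
  define \<psi> where "\<psi> = (\<lambda>x. - 2 * \<beta> x * \<rho> x)"
  note psi' = psi[folded \<psi>_def]
  have [measurable]: "\<psi> \<in> borel_measurable borel" using rm unfolding \<psi>_def by measurable
  have IImeas [measurable]: "I \<psi> \<in> borel_measurable borel" "I (I \<psi>) \<in> borel_measurable borel"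
    using psi' by (auto intro!: I_measurable I_set_integrable)
  define q where "q = (\<lambda>x. s A + \<rho> A * (x - A))"
  have r: "\<rho> x = \<rho> A + I \<psi> x" if "x \<in> {A..B}" for x using rho[OF that] that by (simp add: I_eq \<psi>_def)
  have s2: "s x = q x + I (I \<psi>) x" if x: "x \<in> {A..B}" for x
  proof -
    have "s x = s A + (LINT w:{A..x}|lborel. \<rho> w)" by (rule s[OF x])
    also have "(LINT w:{A..x}|lborel. \<rho> w) = (LINT w:{A..x}|lborel. \<rho> A + I \<psi> w)"
    proof (rule set_lebesgue_integral_cong)
      show "\<forall>w. w \<in> {A..x} \<longrightarrow> \<rho> w = \<rho> A + I \<psi> w" using x by (intro allI impI r) auto
    qed simp
    also have "\<dots> = (LINT w:{A..x}|lborel. \<rho> A) + (LINT w:{A..x}|lborel. I \<psi> w)"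
      using x by (intro set_integral_add(2) set_integrable_subinterval[OF I_set_integrable[OF psi'(1)]] set_integrable_const_Icc) auto
    also have "(LINT w:{A..x}|lborel. \<rho> A) = \<rho> A * (x - A)" using x by (simp add: set_lebesgue_integral_def)
    finally show ?thesis using x by (simp add: I_eq q_def)
  qed
  have bq: "\<exists>c. bounded_fun c q \<and> bounded_fun c (\<lambda>x. \<rho> A)"
  proof -
    have "\<bar>q x\<bar> \<le> \<bar>s A\<bar> + \<bar>\<rho> A\<bar> * (B - A) + \<bar>\<rho> A\<bar>" if "x \<in> {A..B}" for x
    proof -
      have "\<bar>q x\<bar> \<le> \<bar>s A\<bar> + \<bar>\<rho> A\<bar> * \<bar>x - A\<bar>" unfolding q_def by (metis abs_mult abs_triangle_ineq)
      also have "\<bar>\<rho> A\<bar> * \<bar>x - A\<bar> \<le> \<bar>\<rho> A\<bar> * (B - A)" using that by (intro mult_left_mono) auto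
      finally show ?thesis by simp
    qed
    moreover have "\<bar>\<rho> A\<bar> \<le> \<bar>s A\<bar> + \<bar>\<rho> A\<bar> * (B - A) + \<bar>\<rho> A\<bar>" using AB by simp
    ultimately show ?thesis unfolding bounded_fun_def q_def by (intro exI[of _ "\<bar>s A\<bar> + \<bar>\<rho> A\<bar> * (B - A) + \<bar>\<rho> A\<bar>"]) auto
  qed
  then obtain c where bq: "bounded_fun c q" "bounded_fun c (\<lambda>x. \<rho> A)" by blast
  have qm [measurable]: "q \<in> borel_measurable borel" unfolding q_def by measurable
  have "L q (\<lambda>x. \<rho> A) (\<lambda>x. 0) = 0"
  proof -
    define d where "d = (c + \<bar>s A\<bar> + \<bar>\<rho> A\<bar>)"
    have L0: "L (\<lambda>x. 1) (\<lambda>x. 0) (\<lambda>x. 0 :: real) = 0"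
    proof -
      have "complex_of_real (L (\<lambda>x. 1) (\<lambda>x. 0) (\<lambda>x. 0)) = L (E 0) (E1 0) (E2 0)"
        unfolding L_of_real[symmetric] by (rule arg_cong3[where f = L]) (auto simp: E_def E1_def E2_def fun_eq_iff)
      then show ?thesis by (simp add: L_E)
    qed
    have L1: "L (\<lambda>x. x - A) (\<lambda>x. 1) (\<lambda>x. 0) = 0"
    proof -
      have "complex_of_real (L (\<lambda>x. x - A) (\<lambda>x. 1) (\<lambda>x. 0)) = L (\<lambda>x. - \<i> * E 1 x) (\<lambda>x. - \<i> * E1 1 x) (\<lambda>x. - \<i> * E2 1 x)"
        unfolding L_of_real[symmetric] by (rule arg_cong3[where f = L]) (auto simp: E_def E1_def E2_def fun_eq_iff)
      then show ?thesis unfolding L_mult by (simp add: L_E)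
    qed
    have b1: "bounded_fun 1 (\<lambda>x. 1 :: real)" "bounded_fun 1 (\<lambda>x. 0 :: real)" by (auto simp: bounded_fun_def)
    have b2: "bounded_fun (max 1 (B - A)) (\<lambda>x. x - A)" "bounded_fun (max 1 (B - A)) (\<lambda>x. 1 :: real)"
      by (auto simp: bounded_fun_def)
    have "L (\<lambda>x. s A * 1 + \<rho> A * (x - A)) (\<lambda>x. s A * 0 + \<rho> A * 1) (\<lambda>x. s A * 0 + \<rho> A * 0)
       = s A * L (\<lambda>x. 1) (\<lambda>x. 0) (\<lambda>x. 0 :: real) + \<rho> A * L (\<lambda>x. x - A) (\<lambda>x. 1) (\<lambda>x. 0)"
      unfolding L_mult[symmetric]
      by (rule L_add[OF bounded_fun_mult[OF b1(1)] bounded_fun_mult[OF b1(2)] _ bounded_fun_mult[OF b2(1)] bounded_fun_mult[OF b2(2)]]) auto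
    then show ?thesis by (simp add: L0 L1 q_def)
  qed
  then have "0 = L q (\<lambda>x. \<rho> A) (\<lambda>x. 0) + T \<psi>" using T_zero[OF psi'] by simp
  also have "\<dots> = L (\<lambda>x. q x + I (I \<psi>) x) (\<lambda>x. \<rho> A + I \<psi> x) (\<lambda>x. 0 + \<psi> x)"
    unfolding T_def by (rule L_add[OF bq _ T_bounded_fun(1,2)[OF psi'(1)] psi'(2), symmetric]) simp
  also have "\<dots> = L s \<rho> \<psi>" by (rule L_cong) (rule s2[symmetric] r[symmetric], assumption | use sm rm in simp)+
  also have "\<dots> = (\<integral>x. s x \<partial>\<pi>2) - (\<integral>x. s x \<partial>\<pi>1) - (\<integral>x. - \<eta> * (s x * (\<bar>\<beta> x\<bar> + 1)) \<partial>\<nu>)"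
    unfolding L_def \<psi>_def by (simp add: algebra_simps)
  also have "\<dots> = (\<integral>x. s x \<partial>\<pi>2) - (\<integral>x. s x \<partial>\<pi>1) - - \<eta> * (\<integral>x. s x * (\<bar>\<beta> x\<bar> + 1) \<partial>\<nu>)"
    by (simp only: integral_mult_right_zero)
  finally show ?thesis by linarith
qed

end

section \<open>Augmented filtrations\<close>

text \<open>Only null sets that belong to \<open>M\<close> are added, so the enlarged filtration
  still consists of sub-sigma-algebras of \<open>M\<close>. It allows processes to be redefined on a
  null set, and thus to have their path properties everywhere, without losing adaptedness.\<close>

definition augment :: "'a measure \<Rightarrow> (real \<Rightarrow> 'a measure) \<Rightarrow> real \<Rightarrow> 'a measure" where
  "augment M F t = sigma (space M) {G \<in> sets M. \<exists>G'\<in>sets (F t). AE om in M. om \<in> G \<longleftrightarrow> om \<in> G'}"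

context filtered_prob_space begin

lemma space_augment: "space (augment M F t) = space M"
  unfolding augment_def using sets.sets_into_space by (subst space_measure_of) auto

lemma sets_augment: "sets (augment M F t) = {G \<in> sets M. \<exists>G'\<in>sets (F t). AE om in M. om \<in> G \<longleftrightarrow> om \<in> G'}"
proof -
  let ?G = "{G \<in> sets M. \<exists>G'\<in>sets (F t). AE om in M. om \<in> G \<longleftrightarrow> om \<in> G'}"
  have "sigma_algebra (space M) ?G" unfolding sigma_algebra_iff2
  proof (intro conjI ballI allI impI)
    show "?G \<subseteq> Pow (space M)" using sets.sets_into_space by auto
    show "{} \<in> ?G" by (auto intro!: bexI[of _ "{}"])
    fix s assume s: "s \<in> ?G"
    then obtain G' where "G' \<in> sets (F t)" "AE om in M. om \<in> s \<longleftrightarrow> om \<in> G'" by auto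
    then have G': "G' \<in> sets (F t)" "AE om in M. om \<in> s \<longleftrightarrow> om \<in> G'" by auto
    have "space M - G' \<in> sets (F t)" using sets.compl_sets[OF G'(1)] by (simp add: space_F)
    moreover have "AE om in M. om \<in> space M - s \<longleftrightarrow> om \<in> space M - G'" using G'(2) by eventually_elim auto
    moreover have "space M - s \<in> events" using s by auto
    ultimately show "space M - s \<in> ?G" by (intro CollectI conjI bexI[of _ "space M - G'"])
  next
    fix A :: "nat \<Rightarrow> _" assume "range A \<subseteq> ?G"
    then have A: "A i \<in> sets M" "\<exists>G'\<in>sets (F t). AE om in M. om \<in> A i \<longleftrightarrow> om \<in> G'" for i by auto
    from A(2) have "\<forall>i. \<exists>G'. G' \<in> sets (F t) \<and> (AE om in M. om \<in> A i \<longleftrightarrow> om \<in> G')" by (simp add: Bex_def)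
    from choice[OF this] obtain G' where G': "\<And>i. G' i \<in> sets (F t)" "\<And>i. AE om in M. om \<in> A i \<longleftrightarrow> om \<in> G' i" by auto
    have "AE om in M. \<forall>i. om \<in> A i \<longleftrightarrow> om \<in> G' i" using G'(2) by (simp add: AE_all_countable)
    then have "AE om in M. om \<in> (\<Union>i. A i) \<longleftrightarrow> om \<in> (\<Union>i. G' i)" by eventually_elim auto
    moreover have "(\<Union>i. G' i) \<in> sets (F t)" using G'(1) by auto
    moreover have "(\<Union>i. A i) \<in> sets M" using A(1) by auto
    ultimately show "(\<Union>i. A i) \<in> ?G" by (intro CollectI conjI bexI[of _ "\<Union>i. G' i"])
  qed
  then show ?thesis unfolding augment_def by (rule sigma_algebra.sets_measure_of_eq)
qed

lemma sets_F_augment: "sets (F t) \<subseteq> sets (augment M F t)"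
  using sets_F_subset[of t] by (auto simp: sets_augment)

lemma augment_null: "N \<in> null_sets M \<Longrightarrow> N \<in> sets (augment M F t)"
  unfolding sets_augment by (auto intro!: bexI[of _ "{}"] AE_not_in elim: eventually_mono)

lemma filtered_prob_space_augment: "filtered_prob_space M (augment M F)"
proof (intro filtered_prob_space.intro filtered_prob_space_axioms.intro)
  show "prob_space M" by (rule prob_space_axioms)
  show "filtration (space M) (augment M F)" by (rule filtration.intro) (use sets_F_mono in \<open>auto simp: space_augment sets_augment\<close>)
  show "sets (augment M F t) \<subseteq> sets M" for t by (auto simp: sets_augment)
qed

lemma augment_measurable:
  assumes X: "X \<in> borel_measurable (F t)" and N: "N \<in> null_sets M"
  shows "(\<lambda>om. if om \<in> N then c else X om) \<in> measurable (augment M F t) borel"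
proof -
  have [measurable]: "N \<in> sets (augment M F t)" by (rule augment_null[OF N])
  have "X \<in> measurable (augment M F t) borel"
  proof (rule measurableI)
    fix A :: "'b set" assume "A \<in> sets borel"
    then have "X -` A \<inter> space (F t) \<in> sets (F t)" using X by (rule_tac measurable_sets)
    then show "X -` A \<inter> space (augment M F t) \<in> sets (augment M F t)" using sets_F_augment[of t] by (auto simp: space_augment space_F)
  qed simp
  then show ?thesis by measurable
qed

lemma measurable_F_M: "X \<in> measurable (F t) B \<Longrightarrow> X \<in> measurable M B"
  by (rule measurable_mono[THEN subsetD]) (auto simp: space_F intro: subsetD[OF sets_F_subset])

lemma measurable_F_mono: "s \<le> t \<Longrightarrow> X \<in> measurable (F s) B \<Longrightarrow> X \<in> measurable (F t) B"
  by (rule measurable_mono[THEN subsetD]) (auto simp: space_F intro: subsetD[OF sets_F_mono])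

text \<open>Changing an event of the past and an increment on null sets alters neither the law of
  the increment nor any probability in the product formula.\<close>

lemma brownian_motion_augment:
  assumes W: "brownian_motion M F W" and N: "N \<in> null_sets M"
  shows "brownian_motion M (augment M F) (\<lambda>t om. if om \<in> N then 0 else W t om)"
proof -
  let ?W = "\<lambda>t om. if om \<in> N then 0 else W t om"
  interpret A: filtered_prob_space M "augment M F" by (rule filtered_prob_space_augment)
  have ae: "AE om in M. om \<notin> N" by (rule AE_not_in[OF N])
  have Wm: "W t \<in> borel_measurable (F t)" if "0 \<le> t" for t using W that by (auto simp: brownian_motion_def adapted_def)
  have ad: "adapted (augment M F) ?W" unfolding adapted_def using augment_measurable[OF Wm N] by auto
  have WM: "W t \<in> borel_measurable M" "?W t \<in> borel_measurable M" if "0 \<le> t" for t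
    using measurable_F_M[OF Wm[OF that]] A.measurable_F_M ad that by (auto simp: adapted_def)
  have inc: "distributed M lborel (\<lambda>om. ?W t om - ?W s om) (\<lambda>x. ennreal (normal_density 0 (sqrt (t - s)) x)) \<and>
     indep_set (sets (augment M F s)) (sets (vimage_algebra (space M) (\<lambda>om. ?W t om - ?W s om) borel))"
    if st: "0 \<le> s" "s < t" for s t
  proof -
    have D: "distributed M lborel (\<lambda>om. W t om - W s om) (\<lambda>x. ennreal (normal_density 0 (sqrt (t - s)) x))"
      and I: "indep_set (sets (F s)) (sets (vimage_algebra (space M) (\<lambda>om. W t om - W s om) borel))"
      using W st by (auto simp: brownian_motion_def)
    have t: "0 \<le> t" using st by simp
    have [measurable]: "(\<lambda>om. W t om - W s om) \<in> borel_measurable M" "(\<lambda>om. ?W t om - ?W s om) \<in> borel_measurable M"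
      using WM(1)[OF t] WM(1)[OF st(1)] borel_measurable_diff[OF WM(2)[OF t] WM(2)[OF st(1)]] by auto
    have aeW: "AE om in M. W t om - W s om = ?W t om - ?W s om" using ae by eventually_elim auto
    have "distr M lborel (\<lambda>om. W t om - W s om) = distr M lborel (\<lambda>om. ?W t om - ?W s om)"
      using aeW by (intro distr_cong_AE) auto
    then have 1: "distributed M lborel (\<lambda>om. ?W t om - ?W s om) (\<lambda>x. ennreal (normal_density 0 (sqrt (t - s)) x))"
      using D by (auto simp: distributed_def)
    have "indep_set (sets (augment M F s)) (sets (vimage_algebra (space M) (\<lambda>om. ?W t om - ?W s om) borel))" unfolding indep_sets2_eq
    proof (intro conjI ballI)
      show "sets (augment M F s) \<subseteq> events" by (rule A.sets_F_subset)
      show "sets (vimage_algebra (space M) (\<lambda>om. ?W t om - ?W s om) borel) \<subseteq> events"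
        by (simp add: sets_vimage_algebra2) (auto intro: measurable_sets)
      fix a b assume a: "a \<in> sets (augment M F s)" and "b \<in> sets (vimage_algebra (space M) (\<lambda>om. ?W t om - ?W s om) borel)"
      then obtain B where B: "B \<in> sets borel" "b = (\<lambda>om. ?W t om - ?W s om) -` B \<inter> space M" by (auto simp: sets_vimage_algebra2)
      define b' where "b' = (\<lambda>om. W t om - W s om) -` B \<inter> space M"
      have b': "b' \<in> sets (vimage_algebra (space M) (\<lambda>om. W t om - W s om) borel)"
        using B by (auto simp: sets_vimage_algebra2 b'_def)
      have bM: "b \<in> events" "b' \<in> events" using B by (auto simp: b'_def intro!: measurable_sets)
      from a obtain a' where a': "a' \<in> sets (F s)" "AE om in M. om \<in> a \<longleftrightarrow> om \<in> a'" "a \<in> events" by (auto simp: sets_augment)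
      have a'M: "a' \<in> events" using a' sets_F_subset by auto
      have bb: "AE om in M. om \<in> b \<longleftrightarrow> om \<in> b'" using aeW by eventually_elim (auto simp: B b'_def)
      have "prob (a \<inter> b) = prob (a' \<inter> b')" using a' a'M bM bb by (intro finite_measure_eq_AE) auto
      also have "\<dots> = prob a' * prob b'" using I a' b' by (auto simp: indep_sets2_eq)
      also have "prob a' = prob a" using a' a'M by (intro finite_measure_eq_AE) auto
      also have "prob b' = prob b" using bb bM by (intro finite_measure_eq_AE) auto
      finally show "prob (a \<inter> b) = prob a * prob b" .
    qed
    with 1 show ?thesis by simp
  qed
  have "AE om in M. ?W 0 om = 0" "AE om in M. continuous_on {0..} (\<lambda>t. ?W t om)"
    using W ae unfolding brownian_motion_def by (auto elim!: eventually_elim2)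
  then show ?thesis unfolding brownian_motion_def using ad inc by blast
qed

end

section \<open>Exponential martingales of simple processes\<close>

lemma normal_char:
  fixes h :: real assumes "0 < \<sigma>"
  shows "(\<integral>x. iexp (h * x) \<partial>density lborel (\<lambda>x. ennreal (normal_density 0 \<sigma> x))) = of_real (exp (- (h\<^sup>2 * \<sigma>\<^sup>2) / 2))"
proof -
  have "(\<integral>x. iexp (h * x) \<partial>density lborel (\<lambda>x. ennreal (normal_density 0 \<sigma> x))) = (\<integral>x. normal_density 0 \<sigma> x *\<^sub>R iexp (h * x) \<partial>lborel)"
    by (rule integral_density) auto
  also have "\<dots> = \<bar>\<sigma>\<bar> *\<^sub>R (\<integral>x. normal_density 0 \<sigma> (0 + \<sigma> * x) *\<^sub>R iexp (h * (0 + \<sigma> * x)) \<partial>lborel)"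
    using assms by (intro lborel_integral_real_affine) auto
  also have "\<dots> = (\<integral>x. \<sigma> *\<^sub>R (normal_density 0 \<sigma> (\<sigma> * x) *\<^sub>R iexp (h * (\<sigma> * x))) \<partial>lborel)"
    using assms by (simp only: integral_scaleR_right abs_of_pos add_0)
  also have "\<dots> = (\<integral>x. std_normal_density x *\<^sub>R iexp ((h * \<sigma>) * x) \<partial>lborel)"
  proof (rule Bochner_cong[OF refl])
    fix x
    have "\<sigma> * normal_density 0 \<sigma> (\<sigma> * x) = std_normal_density x"
      using assms by (simp add: normal_density_def real_sqrt_mult field_simps power_mult_distrib)
    then show "\<sigma> *\<^sub>R (normal_density 0 \<sigma> (\<sigma> * x) *\<^sub>R iexp (h * (\<sigma> * x))) = std_normal_density x *\<^sub>R iexp ((h * \<sigma>) * x)"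
      by (simp only: scaleR_scaleR mult.assoc)
  qed
  also have "\<dots> = char std_normal_distribution (h * \<sigma>)" unfolding char_def by (rule integral_density[symmetric]) auto
  also have "\<dots> = of_real (exp (- (h\<^sup>2 * \<sigma>\<^sup>2) / 2))" by (simp add: char_std_normal_distribution power_mult_distrib)
  finally show ?thesis .
qed

locale continuous_brownian_motion = filtered_prob_space M F for M :: "'a measure" and F +
  fixes W :: "real \<Rightarrow> 'a \<Rightarrow> real"
  assumes bm: "brownian_motion M F W"
    and W_continuous: "\<And>om. om \<in> space M \<Longrightarrow> continuous_on {0..} (\<lambda>t. W t om)"
begin

lemma W_measurable: "0 \<le> t \<Longrightarrow> W t \<in> borel_measurable (F t)"
  using bm by (auto simp: brownian_motion_def adapted_def)

text \<open>Independence makes the joint law of the past and the increment a product, so the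
  increment can be integrated out with \<open>h\<close> and \<open>\<Psi>\<close> frozen.\<close>

lemma gaussian_increment:
  assumes st: "0 \<le> s" "s < t"
    and h: "h \<in> borel_measurable (F s)"
    and \<Psi>: "\<Psi> \<in> borel_measurable (F s)" "integrable M (\<Psi> :: 'a \<Rightarrow> complex)"
  shows "(\<integral>om. \<Psi> om * iexp (h om * (W t om - W s om)) \<partial>M) = (\<integral>om. \<Psi> om * of_real (exp (- ((h om)\<^sup>2 * (t - s)) / 2)) \<partial>M)"
proof -
  define D where "D = (\<lambda>om. W t om - W s om)"
  define N where "N = density lborel (\<lambda>x. ennreal (normal_density 0 (sqrt (t - s)) x))"
  \<comment> \<open>The identity map into \<open>F s\<close> restricts the probability to the past,
    so that the joint law lives on the product of \<open>F s\<close> and the line.\<close>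
  define Ps where "Ps = distr M (F s) (\<lambda>om. om)"
  have idm [measurable]: "(\<lambda>om. om) \<in> measurable M (F s)" using measurable_F_M[of "\<lambda>om. om" s "F s"] by simp
  have Dd: "distributed M lborel D (\<lambda>x. ennreal (normal_density 0 (sqrt (t - s)) x))"
    and I: "indep_set (sets (F s)) (sets (vimage_algebra (space M) D borel))"
    using bm st by (auto simp: brownian_motion_def D_def)
  have Dm [measurable]: "D \<in> borel_measurable M" using distributed_measurable[OF Dd] by simp
  have dN: "distr M borel D = N" using distributed_distr_eq_density[OF Dd] by (simp add: N_def cong: distr_cong)
  interpret Ps: prob_space Ps unfolding Ps_def by (rule prob_space_distr) (rule idm)
  interpret N: prob_space N using prob_space_distr[OF Dm] by (simp add: dN)
  have joint: "Ps \<Otimes>\<^sub>M N = distr M (F s \<Otimes>\<^sub>M borel) (\<lambda>om. (om, D om))"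
  proof (rule pair_measure_eqI)
    show "sigma_finite_measure Ps" "sigma_finite_measure N" by unfold_locales
    show "sets (Ps \<Otimes>\<^sub>M N) = sets (distr M (F s \<Otimes>\<^sub>M borel) (\<lambda>om. (om, D om)))"
      by (simp add: Ps_def N_def cong: sets_pair_measure_cong)
    fix a b assume a: "a \<in> sets Ps" and b: "b \<in> sets N"
    then have a': "a \<in> sets (F s)" and b': "b \<in> sets borel" by (auto simp: Ps_def N_def)
    have aM: "a \<in> events" using a' sets_F_subset by auto
    have "emeasure (distr M (F s \<Otimes>\<^sub>M borel) (\<lambda>om. (om, D om))) (a \<times> b) = emeasure M ((\<lambda>om. (om, D om)) -` (a \<times> b) \<inter> space M)"
      using a' b' by (intro emeasure_distr) auto
    also have "(\<lambda>om. (om, D om)) -` (a \<times> b) \<inter> space M = a \<inter> (D -` b \<inter> space M)" by auto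
    also have "emeasure M \<dots> = ennreal (prob a * prob (D -` b \<inter> space M))"
    proof -
      have "D -` b \<inter> space M \<in> sets (vimage_algebra (space M) D borel)" using b' by (auto simp: sets_vimage_algebra2)
      with I a' have "prob (a \<inter> (D -` b \<inter> space M)) = prob a * prob (D -` b \<inter> space M)" unfolding indep_sets2_eq by blast
      then show ?thesis by (simp add: emeasure_eq_measure)
    qed
    also have "\<dots> = emeasure M a * emeasure M (D -` b \<inter> space M)" by (simp add: emeasure_eq_measure ennreal_mult)
    also have "emeasure M a = emeasure Ps a" using a' aM sets.sets_into_space[OF aM] by (simp add: Ps_def emeasure_distr Int_absorb2)
    also have "emeasure M (D -` b \<inter> space M) = emeasure N b" using b' by (simp add: dN[symmetric] emeasure_distr)
    finally show "emeasure Ps a * emeasure N b = emeasure (distr M (F s \<Otimes>\<^sub>M borel) (\<lambda>om. (om, D om))) (a \<times> b)" by simp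
  qed
  interpret PN: pair_sigma_finite Ps N ..
  have sPs [measurable_cong]: "sets Ps = sets (F s)" by (simp add: Ps_def)
  have sN [measurable_cong]: "sets N = sets borel" by (simp add: N_def)
  note h [measurable] \<Psi>(1) [measurable]
  define f where "f = (\<lambda>(om, x). \<Psi> om * iexp (h om * x))"
  have fm [measurable]: "f \<in> borel_measurable (F s \<Otimes>\<^sub>M borel)" unfolding f_def by measurable
  have "integrable M (\<lambda>om. f (om, D om))"
  proof (rule Bochner_bound[OF \<Psi>(2)])
    have "(\<lambda>om. (om, D om)) \<in> measurable M (F s \<Otimes>\<^sub>M borel)" by measurable
    from measurable_compose[OF this fm] show "(\<lambda>om. f (om, D om)) \<in> borel_measurable M" .
  qed (auto simp: f_def norm_mult)
  then have fi: "integrable (Ps \<Otimes>\<^sub>M N) f" unfolding joint by (subst integrable_distr_eq) auto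
  have "(\<integral>om. \<Psi> om * iexp (h om * (W t om - W s om)) \<partial>M) = (\<integral>om. f (om, D om) \<partial>M)"
    by (simp add: f_def D_def)
  also have "\<dots> = (\<integral>z. f z \<partial>(Ps \<Otimes>\<^sub>M N))" unfolding joint by (rule integral_distr[symmetric]) auto
  also have "\<dots> = (\<integral>om. (\<integral>x. f (om, x) \<partial>N) \<partial>Ps)" by (rule PN.integral_fst'[OF fi, symmetric])
  also have "\<dots> = (\<integral>om. \<Psi> om * of_real (exp (- ((h om)\<^sup>2 * (t - s)) / 2)) \<partial>Ps)"
  proof (rule Bochner_cong[OF refl])
    fix om
    have "(\<integral>x. f (om, x) \<partial>N) = \<Psi> om * (\<integral>x. iexp (h om * x) \<partial>N)" unfolding f_def by simp
    also have "(\<integral>x. iexp (h om * x) \<partial>N) = of_real (exp (- ((h om)\<^sup>2 * (t - s)) / 2))"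
      unfolding N_def using st normal_char[of "sqrt (t - s)" "h om"] by simp
    finally show "(\<integral>x. f (om, x) \<partial>N) = \<Psi> om * of_real (exp (- ((h om)\<^sup>2 * (t - s)) / 2))" .
  qed
  also have "\<dots> = (\<integral>om. \<Psi> om * of_real (exp (- ((h om)\<^sup>2 * (t - s)) / 2)) \<partial>M)"
    unfolding Ps_def by (rule integral_distr) auto
  finally show ?thesis .
qed

end

section \<open>Progressive processes and simple integrands\<close>

context filtered_prob_space begin

text \<open>The time is clamped to \<open>[0, t]\<close> instead of restricting the product space,
  so that the map is defined on the whole line.\<close>

definition progressive :: "(real \<Rightarrow> 'a \<Rightarrow> 'b::topological_space) \<Rightarrow> bool" where
  "progressive h \<longleftrightarrow> (\<forall>t\<ge>0. (\<lambda>(om, r). h (max 0 (min r t)) om) \<in> borel_measurable (F t \<Otimes>\<^sub>M borel))"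

lemma progressiveD:
  "progressive h \<Longrightarrow> 0 \<le> t \<Longrightarrow> (\<lambda>(om, r). h (max 0 (min r t)) om) \<in> borel_measurable (F t \<Otimes>\<^sub>M borel)"
  by (auto simp: progressive_def)

lemma progressive_adapted:
  assumes "progressive h" "0 \<le> t" shows "h t \<in> borel_measurable (F t)"
proof -
  have "(\<lambda>om. (om, t)) \<in> measurable (F t) (F t \<Otimes>\<^sub>M borel)" by simp
  from measurable_compose[OF this progressiveD[OF assms]] show ?thesis using assms by simp
qed

lemma progressive_set_integral_Icc:
  fixes h :: "real \<Rightarrow> 'a \<Rightarrow> 'b::{banach, second_countable_topology}"
  assumes h: "progressive h" and t: "0 \<le> a" "0 \<le> t"
  shows "(\<lambda>om. LINT r:{a..t}|lborel. h r om) \<in> borel_measurable (F t)"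
proof -
  have "(\<lambda>(om, r). indicator {a..t} r *\<^sub>R h (max 0 (min r t)) om) \<in> borel_measurable (F t \<Otimes>\<^sub>M borel)"
    using progressiveD[OF h t(2)] by (simp add: split_beta') measurable
  also have "borel_measurable (F t \<Otimes>\<^sub>M borel) = borel_measurable (F t \<Otimes>\<^sub>M lborel)"
    by (intro measurable_cong_sets sets_pair_measure_cong) auto
  finally have "(\<lambda>om. \<integral>r. indicator {a..t} r *\<^sub>R h (max 0 (min r t)) om \<partial>lborel) \<in> borel_measurable (F t)"
    by (intro lborel.borel_measurable_lebesgue_integral)
  also have "(\<lambda>om. \<integral>r. indicator {a..t} r *\<^sub>R h (max 0 (min r t)) om \<partial>lborel) = (\<lambda>om. LINT r:{a..t}|lborel. h r om)"
    unfolding set_lebesgue_integral_def by (intro ext Bochner_cong refl) (use t in \<open>auto simp: indicator_def max_absorb2\<close>)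
  finally show ?thesis .
qed

lemmas progressive_set_integral = progressive_set_integral_Icc[OF _ order_refl]

lemma progressive_compose:
  assumes "progressive h" "f \<in> borel_measurable borel"
  shows "progressive (\<lambda>r om. f (h r om))"
  unfolding progressive_def
proof (intro allI impI)
  fix t :: real assume "0 \<le> t"
  from measurable_compose[OF progressiveD[OF assms(1) this] assms(2)]
  show "(\<lambda>(om, r). f (h (max 0 (min r t)) om)) \<in> borel_measurable (F t \<Otimes>\<^sub>M borel)" by (simp add: split_beta')
qed

lemma progressive_compose2:
  fixes h1 h2 :: "real \<Rightarrow> 'a \<Rightarrow> 'b::second_countable_topology"
  assumes "progressive h1" "progressive h2" "(\<lambda>(x, y). f x y) \<in> borel_measurable (borel \<Otimes>\<^sub>M borel)"
  shows "progressive (\<lambda>r om. f (h1 r om) (h2 r om))"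
  unfolding progressive_def
proof (intro allI impI)
  fix t :: real assume t: "0 \<le> t"
  have "(\<lambda>x. ((\<lambda>(om, r). h1 (max 0 (min r t)) om) x, (\<lambda>(om, r). h2 (max 0 (min r t)) om) x)) \<in> measurable (F t \<Otimes>\<^sub>M borel) (borel \<Otimes>\<^sub>M borel)"
    by (intro measurable_Pair progressiveD assms t)
  from measurable_compose[OF this assms(3)]
  show "(\<lambda>(om, r). f (h1 (max 0 (min r t)) om) (h2 (max 0 (min r t)) om)) \<in> borel_measurable (F t \<Otimes>\<^sub>M borel)"
    by (simp add: split_beta')
qed

text \<open>Read at times rounded down to multiples of \<open>1 / Suc n\<close> and clamped to
  \<open>[0, t]\<close>, the process is a countable case distinction between
  \<open>F t\<close>-measurable variables; by path continuity these approximations converge.\<close>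

lemma progressive_continuous:
  fixes X :: "real \<Rightarrow> 'a \<Rightarrow> 'b::metric_space"
  assumes X: "\<And>t. 0 \<le> t \<Longrightarrow> X t \<in> borel_measurable (F t)"
    and c: "\<And>om. om \<in> space M \<Longrightarrow> continuous_on {0..} (\<lambda>t. X t om)"
  shows "progressive X"
  unfolding progressive_def
proof (intro allI impI)
  fix t :: real assume t: "0 \<le> t"
  define d where "d k n = max 0 (min (real_of_int k / real (Suc n)) t)" for k n
  have d0: "0 \<le> d k n" "d k n \<le> t" for k n using t by (auto simp: d_def)
  define f where "f n = (\<lambda>x. X (d \<lfloor>snd x * real (Suc n)\<rfloor> n) (fst x))" for n
  have "f n \<in> borel_measurable (F t \<Otimes>\<^sub>M borel)" for n unfolding f_def
  proof (rule measurable_compose_countable[where f = "\<lambda>k x. X (d k n) (fst x)" and g = "\<lambda>x. \<lfloor>snd x * real (Suc n)\<rfloor>"])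
    show "(\<lambda>x. X (d k n) (fst x)) \<in> borel_measurable (F t \<Otimes>\<^sub>M borel)" for k
      using measurable_F_mono[OF d0(2) X[OF d0(1)]] by simp
    show "(\<lambda>x. \<lfloor>snd x * real (Suc n)\<rfloor>) \<in> measurable (F t \<Otimes>\<^sub>M borel) (count_space UNIV)" by measurable
  qed
  moreover have "(\<lambda>n. f n x) \<longlonglongrightarrow> X (max 0 (min (snd x) t)) (fst x)" if x: "x \<in> space (F t \<Otimes>\<^sub>M borel)" for x
  proof -
    obtain om r where xr: "x = (om, r)" by (cases x)
    then have om: "om \<in> space M" using x by (auto simp: space_pair_measure space_F)
    have "(\<lambda>n. real_of_int \<lfloor>r * real (Suc n)\<rfloor> / real (Suc n)) \<longlonglongrightarrow> r"
    proof (rule tendsto_sandwich[where f = "\<lambda>n. r - 1 / real (Suc n)" and h = "\<lambda>n. r"])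
      show "\<forall>\<^sub>F n in sequentially. r - 1 / real (Suc n) \<le> real_of_int \<lfloor>r * real (Suc n)\<rfloor> / real (Suc n)"
      proof (intro always_eventually allI)
        fix n
        have "r * real (Suc n) - 1 \<le> real_of_int \<lfloor>r * real (Suc n)\<rfloor>" by linarith
        then have "(r * real (Suc n) - 1) / real (Suc n) \<le> real_of_int \<lfloor>r * real (Suc n)\<rfloor> / real (Suc n)"
          by (intro divide_right_mono) auto
        then show "r - 1 / real (Suc n) \<le> real_of_int \<lfloor>r * real (Suc n)\<rfloor> / real (Suc n)" by (simp add: diff_divide_distrib del: of_nat_Suc)
      qed
      show "\<forall>\<^sub>F n in sequentially. real_of_int \<lfloor>r * real (Suc n)\<rfloor> / real (Suc n) \<le> r"
        by (intro always_eventually allI) (simp add: divide_le_eq del: of_nat_Suc)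
      have "(\<lambda>n. r - 1 / real (Suc n)) \<longlonglongrightarrow> r - 0" by (intro tendsto_diff tendsto_const inverse_Suc_tendsto_0)
      then show "(\<lambda>n. r - 1 / real (Suc n)) \<longlonglongrightarrow> r" by simp
    qed simp
    then have "(\<lambda>n. d \<lfloor>r * real (Suc n)\<rfloor> n) \<longlonglongrightarrow> max 0 (min r t)"
      unfolding d_def by (intro tendsto_max tendsto_min tendsto_const)
    then have "(\<lambda>n. X (d \<lfloor>r * real (Suc n)\<rfloor> n) om) \<longlonglongrightarrow> X (max 0 (min r t)) om"
      by (rule continuous_on_tendsto_compose[OF c[OF om]]) (use d0 in auto)
    then show ?thesis by (simp add: xr f_def)
  qed
  ultimately have "(\<lambda>x. X (max 0 (min (snd x) t)) (fst x)) \<in> borel_measurable (F t \<Otimes>\<^sub>M borel)"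
    by (rule borel_measurable_LIMSEQ_metric)
  then show "(\<lambda>(om, r). X (max 0 (min r t)) om) \<in> borel_measurable (F t \<Otimes>\<^sub>M borel)" by (simp add: split_beta')
qed

lemma simple_value_bounded:
  assumes "simple_process M F S"
  shows "\<exists>C\<ge>0. \<forall>om\<in>space M. \<forall>t. \<bar>simple_value S t om\<bar> \<le> C"
  using assms
proof (induction S)
  case Nil then show ?case by (auto simp: simple_value_def)
next
  case (Cons a S)
  obtain u v x where a: "a = (u, v, x)" by (cases a)
  from Cons obtain C where C: "0 \<le> C" "\<And>om t. om \<in> space M \<Longrightarrow> \<bar>simple_value S t om\<bar> \<le> C"
    by (auto simp: simple_process_def)
  have "bounded (x ` space M)" using Cons.prems by (auto simp: simple_process_def a)
  then obtain D where D: "\<And>om. om \<in> space M \<Longrightarrow> \<bar>x om\<bar> \<le> D" by (auto simp: bounded_iff)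
  have "\<bar>simple_value (a # S) t om\<bar> \<le> \<bar>D\<bar> + C" if "om \<in> space M" for t om
  proof -
    have "\<bar>simple_value (a # S) t om\<bar> \<le> \<bar>x om * indicator {u<..v} t\<bar> + \<bar>simple_value S t om\<bar>"
      by (simp add: simple_value_def a)
    also have "\<bar>x om * indicator {u<..v} t\<bar> \<le> \<bar>D\<bar>" using D[OF that] by (auto simp: indicator_def)
    finally show ?thesis using C(2)[OF that, of t] by linarith
  qed
  then show ?case using C(1) by (intro exI[of _ "\<bar>D\<bar> + C"]) auto
qed

lemma simple_value_progressive:
  assumes "simple_process M F S"
  shows "progressive (simple_value S)"
  unfolding progressive_def
proof (intro allI impI)
  fix t :: real assume t: "0 \<le> t"
  show "(\<lambda>(om, r). simple_value S (max 0 (min r t)) om) \<in> borel_measurable (F t \<Otimes>\<^sub>M borel)" using assms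
  proof (induction S)
    case Nil then show ?case by (auto simp: simple_value_def)
  next
    case (Cons a S)
    obtain u v x where a: "a = (u, v, x)" by (cases a)
    have ux: "0 \<le> u" "x \<in> borel_measurable (F u)" using Cons.prems by (auto simp: simple_process_def a)
    have IH: "(\<lambda>p. simple_value S (max 0 (min (snd p) t)) (fst p)) \<in> borel_measurable (F t \<Otimes>\<^sub>M borel)"
    proof -
      have "simple_process M F S" using Cons.prems by (auto simp: simple_process_def)
      from Cons.IH[OF this] show ?thesis by (simp add: split_beta')
    qed
    have "(\<lambda>p. x (fst p) * indicator {u<..v} (max 0 (min (snd p) t))) \<in> borel_measurable (F t \<Otimes>\<^sub>M borel)"
    proof (cases "u < t")
      case True
      then have x [measurable]: "x \<in> borel_measurable (F t)" by (intro measurable_F_mono[OF _ ux(2)]) simp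
      show ?thesis by measurable
    next
      \<comment> \<open>For \<open>t \<le> u\<close> the coefficient need not be
        \<open>F t\<close>-measurable, but then the clamped time never exceeds \<open>u\<close> and
        the indicator vanishes.\<close>
      case False
      then have "indicator {u<..v} (max 0 (min r t)) = (0::real)" for r using ux t by (auto simp: indicator_def)
      then show ?thesis by simp
    qed
    from borel_measurable_add[OF this IH] show ?case by (simp add: simple_value_def a split_beta')
  qed
qed

end

context continuous_brownian_motion begin

lemma simple_integral_measurable:
  assumes "simple_process M F S" "0 \<le> t"
  shows "simple_integral_wrt W S t \<in> borel_measurable (F t)"
  using assms
proof (induction S)
  case Nil then show ?case by (auto simp: simple_integral_wrt_def[abs_def])
next
  case (Cons a S)
  obtain u v x where a: "a = (u, v, x)" by (cases a)
  have ux: "0 \<le> u" "u \<le> v" "x \<in> borel_measurable (F u)" using Cons.prems by (auto simp: simple_process_def a)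
  have IH: "simple_integral_wrt W S t \<in> borel_measurable (F t)" using Cons by (simp add: simple_process_def)
  have "(\<lambda>om. x om * (W (min v t) om - W (min u t) om)) \<in> borel_measurable (F t)"
  proof (cases "u < t")
    case True
    have [measurable]: "x \<in> borel_measurable (F t)" by (intro measurable_F_mono[OF _ ux(3)]) (use True in simp)
    have [measurable]: "W (min v t) \<in> borel_measurable (F t)" "W (min u t) \<in> borel_measurable (F t)"
      using measurable_F_mono[OF _ W_measurable, of "min v t" t] measurable_F_mono[OF _ W_measurable, of "min u t" t] ux Cons.prems by auto
    show ?thesis by measurable
  next
    case False
    then have "min v t = t" "min u t = t" using ux by auto
    then show ?thesis by simp
  qed
  from borel_measurable_add[OF this IH] show ?case by (simp add: simple_integral_wrt_def[abs_def] a)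
qed

lemma simple_integral_continuous:
  assumes "simple_process M F S" "om \<in> space M"
  shows "continuous_on {0..} (\<lambda>t. simple_integral_wrt W S t om)"
  using assms
proof (induction S)
  case Nil then show ?case by (simp add: simple_integral_wrt_def)
next
  case (Cons a S)
  obtain u v x where a: "a = (u, v, x)" by (cases a)
  have ux: "0 \<le> u" "u \<le> v" using Cons.prems by (auto simp: simple_process_def a)
  have IH: "continuous_on {0..} (\<lambda>t. simple_integral_wrt W S t om)" using Cons by (simp add: simple_process_def)
  have c: "continuous_on {0..} (\<lambda>t. W (min w t) om)" if "0 \<le> w" for w
    by (rule continuous_on_compose2[OF W_continuous[OF Cons.prems(2)]]) (use that in \<open>auto intro!: continuous_intros\<close>)
  have "continuous_on {0..} (\<lambda>t. x om * (W (min v t) om - W (min u t) om))" using ux by (intro continuous_intros c) auto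
  from continuous_on_add[OF this IH] show ?case by (simp add: simple_integral_wrt_def a)
qed

definition sq_integral :: "'a simple_process \<Rightarrow> real \<Rightarrow> 'a \<Rightarrow> real" where
  "sq_integral S t om = (LINT r:{0..t}|lborel. (simple_value S r om)\<^sup>2)"

lemma simple_value_borel: "(\<lambda>r. simple_value S r om) \<in> borel_measurable borel"
proof (induction S)
  case Nil then show ?case by (simp add: simple_value_def)
next
  case (Cons a S)
  obtain u v x where a: "a = (u, v, x)" by (cases a)
  have "(\<lambda>t. x om * indicator {u<..v} t) \<in> borel_measurable borel" by measurable
  from borel_measurable_add[OF this Cons] show ?case by (simp add: simple_value_def a)
qed

lemma simple_sq_integrable:
  assumes S: "simple_process M F S" and om: "om \<in> space M"
  shows "set_integrable lborel {a..b} (\<lambda>r. (simple_value S r om)\<^sup>2)"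
proof -
  obtain C where C: "0 \<le> C" "\<forall>om\<in>space M. \<forall>t. \<bar>simple_value S t om\<bar> \<le> C" using simple_value_bounded[OF S] by blast
  show ?thesis unfolding set_integrable_def
  proof (rule Bochner_bound[where f = "\<lambda>r. C\<^sup>2 * indicator {a..b} r"])
    have "(\<lambda>r. (simple_value S r om)\<^sup>2) \<in> borel_measurable borel" using simple_value_borel by (rule borel_measurable_power)
    then show "(\<lambda>r. indicat_real {a..b} r *\<^sub>R (simple_value S r om)\<^sup>2) \<in> borel_measurable lborel" by simp
    have "(simple_value S r om)\<^sup>2 \<le> C\<^sup>2" for r using C om by (metis abs_ge_zero power2_abs power_mono)
    then show "AE r in lborel. norm (indicat_real {a..b} r *\<^sub>R (simple_value S r om)\<^sup>2) \<le> norm (C\<^sup>2 * indicat_real {a..b} r)"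
      by (auto simp: indicator_def)
  qed (simp add: emeasure_lborel_Icc_eq)
qed

lemma sq_integral_bounds:
  assumes S: "simple_process M F S" 
  shows "\<exists>C. \<forall>om\<in>space M. \<forall>t\<in>{0..T}. 0 \<le> sq_integral S t om \<and> sq_integral S t om \<le> C"
proof -
  obtain C where C: "0 \<le> C" "\<forall>om\<in>space M. \<forall>t. \<bar>simple_value S t om\<bar> \<le> C" using simple_value_bounded[OF S] by blast
  have "0 \<le> sq_integral S t om \<and> sq_integral S t om \<le> C\<^sup>2 * T" if om: "om \<in> space M" and t: "t \<in> {0..T}" for om t
  proof
    show "0 \<le> sq_integral S t om" unfolding sq_integral_def set_lebesgue_integral_def by (intro Bochner_nonneg) auto
    have le: "(simple_value S r om)\<^sup>2 \<le> C\<^sup>2" for r using C om by (metis abs_ge_zero power2_abs power_mono)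
    have "sq_integral S t om \<le> (LINT r:{0..t}|lborel. C\<^sup>2)" unfolding sq_integral_def
      by (intro set_integral_mono simple_sq_integrable[OF S om] borel_integrable_atLeastAtMost' continuous_on_const le)
    also have "\<dots> = C\<^sup>2 * t" using t by (simp add: set_lebesgue_integral_def mult.commute)
    also have "\<dots> \<le> C\<^sup>2 * T" using t by (intro mult_left_mono) auto
    finally show "sq_integral S t om \<le> C\<^sup>2 * T" .
  qed
  then show ?thesis by blast
qed

lemma sq_integral_measurable:
  assumes S: "simple_process M F S" "0 \<le> t"
  shows "sq_integral S t \<in> borel_measurable (F t)"
  unfolding sq_integral_def[abs_def] by (intro progressive_set_integral progressive_compose[OF simple_value_progressive] S) auto

text \<open>Between consecutive break points each summand is switched on throughout or off
  throughout, and the coefficients that are on are known at time \<open>s\<close>.\<close>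

lemma simple_step:
  assumes S: "simple_process M F S" and st: "0 \<le> s" "s < t"
    and gap: "\<forall>(u, v, x)\<in>set S. u \<notin> {s<..<t} \<and> v \<notin> {s<..<t}"
  shows "\<exists>h. h \<in> borel_measurable (F s) \<and> (\<forall>om. \<forall>r\<in>{s<..t}. simple_value S r om = h om) \<and>
    (\<forall>om. simple_integral_wrt W S t om - simple_integral_wrt W S s om = h om * (W t om - W s om))" using S gap
proof (induction S)
  case Nil
  then show ?case by (intro exI[of _ "\<lambda>_. 0"]) (auto simp: simple_value_def simple_integral_wrt_def)
next
  case (Cons a S)
  obtain u v x where a: "a = (u, v, x)" by (cases a)
  have ux: "0 \<le> u" "u \<le> v" "x \<in> borel_measurable (F u)" using Cons.prems by (auto simp: simple_process_def a)
  have uv: "u \<notin> {s<..<t}" "v \<notin> {s<..<t}" using Cons.prems(2) by (auto simp: a)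
  have "\<exists>h. h \<in> borel_measurable (F s) \<and> (\<forall>om. \<forall>r\<in>{s<..t}. simple_value S r om = h om) \<and>
    (\<forall>om. simple_integral_wrt W S t om - simple_integral_wrt W S s om = h om * (W t om - W s om))"
    by (rule Cons.IH) (use Cons.prems in \<open>auto simp: simple_process_def\<close>)
  then obtain h where h: "h \<in> borel_measurable (F s)" "\<And>om r. r \<in> {s<..t} \<Longrightarrow> simple_value S r om = h om"
    "\<And>om. simple_integral_wrt W S t om - simple_integral_wrt W S s om = h om * (W t om - W s om)" by blast
  define y where "y = (if u \<le> s \<and> t \<le> v then x else (\<lambda>_. 0))"
  have ym: "y \<in> borel_measurable (F s)" unfolding y_def by (auto intro: measurable_F_mono[OF _ ux(3)])
  have y1: "x om * indicator {u<..v} r = y om" if "r \<in> {s<..t}" for om r using that uv st by (auto simp: y_def indicator_def)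
  have y2: "x om * (W (min v t) om - W (min u t) om) - x om * (W (min v s) om - W (min u s) om) = y om * (W t om - W s om)" for om
    using uv st ux by (auto simp: y_def min_def algebra_simps)
  have "simple_value (a # S) r om = y om + h om" if "r \<in> {s<..t}" for r om
    using y1[OF that, of om] h(2)[OF that, of om] by (simp add: simple_value_def a)
  moreover have "simple_integral_wrt W (a # S) t om - simple_integral_wrt W (a # S) s om = (y om + h om) * (W t om - W s om)" for om
    using y2[of om] h(3)[of om] by (simp add: simple_integral_wrt_def a algebra_simps)
  ultimately show ?case using ym h(1) by (intro exI[of _ "\<lambda>om. y om + h om"]) auto
qed

text \<open>The exponential martingale of the imaginary integrand \<open>\<i> v S\<close>, whence
  the positive sign of the compensator. It is bounded on bounded time intervals because simple
  processes are bounded.\<close>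

definition Z :: "real \<Rightarrow> 'a simple_process \<Rightarrow> real \<Rightarrow> 'a \<Rightarrow> complex" where
  "Z v S t om = iexp (v * simple_integral_wrt W S t om) * of_real (exp (v\<^sup>2 / 2 * sq_integral S t om))"

lemma Z_measurable: "simple_process M F S \<Longrightarrow> 0 \<le> t \<Longrightarrow> Z v S t \<in> borel_measurable (F t)"
proof -
  assume "simple_process M F S" "0 \<le> t"
  note [measurable] = simple_integral_measurable[OF this] sq_integral_measurable[OF this]
  show ?thesis unfolding Z_def[abs_def] by measurable
qed

lemma Z_bounded:
  assumes S: "simple_process M F S"
  shows "\<exists>C\<ge>0. \<forall>om\<in>space M. \<forall>t\<in>{0..T}. cmod (Z v S t om) \<le> C"
proof -
  obtain C where C: "\<forall>om\<in>space M. \<forall>t\<in>{0..T}. 0 \<le> sq_integral S t om \<and> sq_integral S t om \<le> C"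
    using sq_integral_bounds[OF S] by blast
  have "cmod (Z v S t om) \<le> exp (v\<^sup>2 / 2 * C)" if "om \<in> space M" "t \<in> {0..T}" for om t
    using C that by (auto simp: Z_def norm_mult intro!: mult_left_mono)
  then show ?thesis by (intro exI[of _ "exp (v\<^sup>2 / 2 * C)"]) auto
qed

lemma integrable_Z_mult:
  assumes S: "simple_process M F S" and t: "0 \<le> t" and \<Psi>: "integrable M \<Psi>"
  shows "integrable M (\<lambda>om. \<Psi> om * Z v S t om)"
proof -
  obtain C where C: "0 \<le> C" "\<forall>om\<in>space M. \<forall>r\<in>{0..t}. cmod (Z v S r om) \<le> C" using Z_bounded[OF S] by blast
  have [measurable]: "Z v S t \<in> borel_measurable M" by (rule measurable_F_M[OF Z_measurable[OF S t]])
  show ?thesis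
  proof (rule Bochner_bound)
    show "integrable M (\<lambda>om. C *\<^sub>R \<Psi> om)" using \<Psi> by simp
    show "AE om in M. norm (\<Psi> om * Z v S t om) \<le> norm (C *\<^sub>R \<Psi> om)"
    proof (rule AE_I2)
      fix om assume "om \<in> space M"
      then have "cmod (Z v S t om) \<le> C" using C t by auto
      from mult_left_mono[OF this, of "norm (\<Psi> om)"] show "norm (\<Psi> om * Z v S t om) \<le> norm (C *\<^sub>R \<Psi> om)"
        using C(1) by (simp add: norm_mult mult.commute)
    qed
  qed (use \<Psi> in measurable)
qed

lemma Z_step:
  assumes S: "simple_process M F S" and st: "0 \<le> s" "s < t"
    and gap: "\<forall>(u, v, x)\<in>set S. u \<notin> {s<..<t} \<and> v \<notin> {s<..<t}"
    and \<Psi>: "\<Psi> \<in> borel_measurable (F s)" "integrable M \<Psi>"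
  shows "(\<integral>om. \<Psi> om * Z v S t om \<partial>M) = (\<integral>om. \<Psi> om * Z v S s om \<partial>M)"
proof -
  obtain h where h: "h \<in> borel_measurable (F s)" "\<And>om r. r \<in> {s<..t} \<Longrightarrow> simple_value S r om = h om"
    "\<And>om. simple_integral_wrt W S t om - simple_integral_wrt W S s om = h om * (W t om - W s om)" using simple_step[OF S st gap] by blast
  obtain C where C: "0 \<le> C" "\<forall>om\<in>space M. \<forall>t. \<bar>simple_value S t om\<bar> \<le> C" using simple_value_bounded[OF S] by blast
  have sq: "sq_integral S t om = sq_integral S s om + (h om)\<^sup>2 * (t - s)" if om: "om \<in> space M" for om
  proof -
    have "{0..t} = {0..s} \<union> {s<..t}" using st by auto
    then have "sq_integral S t om = sq_integral S s om + (LINT r:{s<..t}|lborel. (simple_value S r om)\<^sup>2)" unfolding sq_integral_def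
      by (simp, intro set_integral_Un simple_sq_integrable[OF S om] set_integrable_subset[OF simple_sq_integrable[OF S om, of s t]]) auto
    also have "(LINT r:{s<..t}|lborel. (simple_value S r om)\<^sup>2) = (LINT r:{s<..t}|lborel. (h om)\<^sup>2)"
      by (rule set_lebesgue_integral_cong) (use h(2) in auto)
    also have "\<dots> = (h om)\<^sup>2 * (t - s)" using st by (simp add: set_lebesgue_integral_def mult.commute)
    finally show ?thesis .
  qed
  \<comment> \<open>The compensator gained on the step is known at time \<open>s\<close>; it joins
    the test variable and cancels the Gaussian characteristic function of the increment.\<close>
  define \<Psi>' where "\<Psi>' = (\<lambda>om. \<Psi> om * Z v S s om * of_real (exp (v\<^sup>2 / 2 * ((h om)\<^sup>2 * (t - s)))))"
  note [measurable] = h(1) \<Psi>(1) Z_measurable[OF S st(1), of v]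
  have m: "\<Psi>' \<in> borel_measurable (F s)" unfolding \<Psi>'_def by measurable
  have hb: "(h om)\<^sup>2 \<le> C\<^sup>2" if "om \<in> space M" for om
  proof -
    have "h om = simple_value S t om" using h(2)[of t om] st by simp
    then have "\<bar>h om\<bar> \<le> C" using C(2) that by simp
    from power_mono[OF this, of 2] show ?thesis by simp
  qed
  have i: "integrable M \<Psi>'"
  proof (rule Bochner_bound)
    show "integrable M (\<lambda>om. exp (v\<^sup>2 / 2 * (C\<^sup>2 * (t - s))) *\<^sub>R (\<Psi> om * Z v S s om))"
      using integrable_Z_mult[OF S st(1) \<Psi>(2)] by simp
    show "AE om in M. norm (\<Psi>' om) \<le> norm (exp (v\<^sup>2 / 2 * (C\<^sup>2 * (t - s))) *\<^sub>R (\<Psi> om * Z v S s om))"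
    proof (rule AE_I2)
      fix om assume "om \<in> space M"
      then have "exp (v\<^sup>2 / 2 * ((h om)\<^sup>2 * (t - s))) \<le> exp (v\<^sup>2 / 2 * (C\<^sup>2 * (t - s)))"
        using hb st by (intro exp_le_cancel_iff[THEN iffD2] mult_left_mono mult_right_mono) auto
      from mult_left_mono[OF this, of "norm (\<Psi> om * Z v S s om)"]
      show "norm (\<Psi>' om) \<le> norm (exp (v\<^sup>2 / 2 * (C\<^sup>2 * (t - s))) *\<^sub>R (\<Psi> om * Z v S s om))"
        unfolding \<Psi>'_def norm_mult norm_scaleR by (simp add: mult_ac norm_mult)
    qed
  qed (rule measurable_F_M[OF m])
  have "(\<integral>om. \<Psi> om * Z v S t om \<partial>M) = (\<integral>om. \<Psi>' om * iexp (v * h om * (W t om - W s om)) \<partial>M)"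
  proof (rule Bochner_cong[OF refl])
    fix om assume om: "om \<in> space M"
    have "simple_integral_wrt W S t om = simple_integral_wrt W S s om + h om * (W t om - W s om)" using h(3)[of om] by simp
    then show "\<Psi> om * Z v S t om = \<Psi>' om * iexp (v * h om * (W t om - W s om))"
      unfolding \<Psi>'_def Z_def sq[OF om] by (simp add: distrib_left exp_add mult_ac)
  qed
  also have "\<dots> = (\<integral>om. \<Psi>' om * of_real (exp (- ((v * h om)\<^sup>2 * (t - s)) / 2)) \<partial>M)"
    by (rule gaussian_increment[OF st _ m i]) simp
  also have "\<dots> = (\<integral>om. \<Psi> om * Z v S s om \<partial>M)"
  proof (rule Bochner_cong[OF refl])
    fix om
    have "exp (v\<^sup>2 / 2 * ((h om)\<^sup>2 * (t - s))) * exp (- ((v * h om)\<^sup>2 * (t - s)) / 2) = 1"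
      unfolding exp_add[symmetric] by (simp add: power_mult_distrib)
    then have "complex_of_real (exp (v\<^sup>2 / 2 * ((h om)\<^sup>2 * (t - s)))) * of_real (exp (- ((v * h om)\<^sup>2 * (t - s)) / 2)) = 1"
      unfolding of_real_mult[symmetric] by simp
    then show "\<Psi>' om * of_real (exp (- ((v * h om)\<^sup>2 * (t - s)) / 2)) = \<Psi> om * Z v S s om"
      unfolding \<Psi>'_def mult.assoc by simp
  qed
  finally show ?thesis .
qed

text \<open>Induction on the number of break points strictly inside the interval, which is split at
  one of them until \<open>Z_step\<close> applies.\<close>

lemma Z_martingale:
  assumes S: "simple_process M F S" and st: "0 \<le> s" "s \<le> t"
    and \<Psi>: "\<Psi> \<in> borel_measurable (F s)" "integrable M \<Psi>"
  shows "(\<integral>om. \<Psi> om * Z v S t om \<partial>M) = (\<integral>om. \<Psi> om * Z v S s om \<partial>M)"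
proof -
  define P where "P = fst ` set S \<union> (fst \<circ> snd) ` set S"
  have P: "finite P" by (simp add: P_def)
  show ?thesis using st \<Psi>(1)
  proof (induction "card (P \<inter> {s<..<t})" arbitrary: s t rule: less_induct)
    case less
    show ?case
    proof (cases "s = t")
      case False
      then have "s < t" using less by simp
      show ?thesis
      proof (cases "P \<inter> {s<..<t} = {}")
        case True
        show ?thesis
        proof (rule Z_step[OF S \<open>0 \<le> s\<close> \<open>s < t\<close> _ less.prems(3) \<Psi>(2)])
          show "\<forall>(u, v, x)\<in>set S. u \<notin> {s<..<t} \<and> v \<notin> {s<..<t}" using True unfolding P_def by force
        qed
      next
        case False
        then obtain p where p: "p \<in> P" "s < p" "p < t" by auto
        have "card (P \<inter> {s<..<p}) < card (P \<inter> {s<..<t})" "card (P \<inter> {p<..<t}) < card (P \<inter> {s<..<t})"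
          using P p by (auto intro!: psubset_card_mono)
        note IH = less.hyps[OF this(1)] less.hyps[OF this(2)]
        have "(\<integral>om. \<Psi> om * Z v S t om \<partial>M) = (\<integral>om. \<Psi> om * Z v S p om \<partial>M)"
          using p less.prems by (intro IH(2)) (auto intro: measurable_F_mono[of s p])
        also have "\<dots> = (\<integral>om. \<Psi> om * Z v S s om \<partial>M)" using p less.prems by (intro IH(1)) auto
        finally show ?thesis .
      qed
    qed simp
  qed
qed

end

section \<open>Exponential identities for the diffusion\<close>

lemma set_integrable_of_real:
  assumes "set_integrable M A f" shows "set_integrable M A (\<lambda>x. complex_of_real (f x))"
proof -
  have "integrable M (\<lambda>x. complex_of_real (indicator A x *\<^sub>R f x))"
    using assms unfolding set_integrable_def by (rule integrable_of_real)
  then show ?thesis by (simp add: set_integrable_def scaleR_conv_of_real)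
qed

lemma exp_set_integral_real:
  fixes k :: "real \<Rightarrow> real"
  assumes k: "set_integrable lborel {a..b} k" and st: "a \<le> s" "s \<le> t" "t \<le> b"
  shows "set_integrable lborel {s..t} (\<lambda>u. k u * exp (LINT v:{a..u}|lborel. k v))"
    and "(LINT u:{s..t}|lborel. k u * exp (LINT v:{a..u}|lborel. k v))
     = exp (LINT v:{a..t}|lborel. k v) - exp (LINT v:{a..s}|lborel. k v)"
proof -
  have k': "set_integrable lborel {a..b} (\<lambda>u. complex_of_real (k u))" using k by (rule set_integrable_of_real)
  note E = exp_set_integral[OF k' st]
  have eq: "complex_of_real (k u) * exp (LINT v:{a..u}|lborel. complex_of_real (k v)) = of_real (k u * exp (LINT v:{a..u}|lborel. k v))" for u
    by (simp add: set_integral_complex_of_real exp_of_real)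
  show "set_integrable lborel {s..t} (\<lambda>u. k u * exp (LINT v:{a..u}|lborel. k v))"
  proof -
    have "integrable lborel (\<lambda>u. complex_of_real (indicator {s..t} u * (k u * exp (LINT v:{a..u}|lborel. k v))))"
      using E(1) unfolding eq set_integrable_def by (simp add: scaleR_conv_of_real)
    then show ?thesis unfolding complex_of_real_integrable_eq set_integrable_def by simp
  qed
  have "complex_of_real (LINT u:{s..t}|lborel. k u * exp (LINT v:{a..u}|lborel. k v)) = of_real (exp (LINT v:{a..t}|lborel. k v) - exp (LINT v:{a..s}|lborel. k v))"
    using E(2) unfolding eq unfolding set_integral_complex_of_real exp_of_real of_real_diff .
  then show "(LINT u:{s..t}|lborel. k u * exp (LINT v:{a..u}|lborel. k v))
     = exp (LINT v:{a..t}|lborel. k v) - exp (LINT v:{a..s}|lborel. k v)" by (simp only: of_real_eq_iff)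
qed

text \<open>The integrand is the derivative of \<open>- exp (- \<eta> K) / \<eta>\<close>, with
  \<open>K\<close> the integral of \<open>k\<close>, so its integral is at most
  \<open>1 / \<eta>\<close> however large \<open>K\<close> is. The discount is introduced for the
  sake of this uniform bound.\<close>

lemma exp_decay:
  fixes k :: "real \<Rightarrow> real"
  assumes k: "set_integrable lborel {0..t} k" "\<And>r. 0 \<le> k r" and st: "0 \<le> s" "s \<le> t" and eta: "0 < \<eta>"
  shows "set_integrable lborel {s..t} (\<lambda>r. k r * exp (- \<eta> * (LINT u:{0..r}|lborel. k u)))"
    and "(LINT r:{s..t}|lborel. k r * exp (- \<eta> * (LINT u:{0..r}|lborel. k u))) \<le> 1 / \<eta>"
proof -
  let ?K = "\<lambda>r. LINT u:{0..r}|lborel. k u"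
  have k': "set_integrable lborel {0..t} (\<lambda>r. - \<eta> * k r)" using k(1) by (intro set_integrable_mult_right)
  note E = exp_set_integral_real[OF k' st order_refl]
  have c: "(LINT u:{0..r}|lborel. - \<eta> * k u) = - \<eta> * ?K r" for r by (rule set_integral_mult_right)
  have eq: "(\<lambda>r. k r * exp (- \<eta> * ?K r)) = (\<lambda>r. (- 1 / \<eta>) * (- \<eta> * k r * exp (LINT u:{0..r}|lborel. - \<eta> * k u)))"
    unfolding c using eta by (simp add: fun_eq_iff)
  show "set_integrable lborel {s..t} (\<lambda>r. k r * exp (- \<eta> * ?K r))" unfolding eq by (rule set_integrable_mult_right) (rule E(1))
  have n: "0 \<le> ?K r" for r unfolding set_lebesgue_integral_def using k(2) by (intro Bochner_nonneg) auto
  have "(LINT r:{s..t}|lborel. k r * exp (- \<eta> * ?K r))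
    = (- 1 / \<eta>) * (exp (LINT v:{0..t}|lborel. - \<eta> * k v) - exp (LINT v:{0..s}|lborel. - \<eta> * k v))"
    unfolding eq by (subst set_integral_mult_right) (simp only: E(2))
  also have "\<dots> = (exp (- \<eta> * (LINT v:{0..s}|lborel. k v)) - exp (- \<eta> * (LINT v:{0..t}|lborel. k v))) / \<eta>"
    unfolding c using eta by (simp add: field_simps)
  also have "\<dots> \<le> (1 - 0) / \<eta>" using eta n by (intro divide_right_mono diff_mono) auto
  finally show "(LINT r:{s..t}|lborel. k r * exp (- \<eta> * ?K r)) \<le> 1 / \<eta>" by simp
qed

lemma continuous_on_atLeast:
  fixes f :: "real \<Rightarrow> 'b::topological_space"
  assumes "\<And>T. continuous_on {a..T} f" shows "continuous_on {a..} f"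
  unfolding continuous_on_eq_continuous_within
proof
  fix x assume x: "x \<in> {a..}"
  then have "continuous (at x within {a..x+1}) f" using assms[of "x+1"] unfolding continuous_on_eq_continuous_within by auto
  moreover have "at x within {a..x+1} = at x within {a..}" by (rule at_within_nhd[of _ "{..<x+1}"]) (use x in auto)
  ultimately show "continuous (at x within {a..}) f" by simp
qed

lemma set_integral_continuous_atLeast:
  fixes k :: "real \<Rightarrow> complex"
  assumes "\<And>T. set_integrable lborel {a..T} k"
  shows "continuous_on {a..} (\<lambda>u. LINT v:{a..u}|lborel. k v)"
  by (intro continuous_on_atLeast set_integral_atLeastAtMost_continuous assms)

context continuous_brownian_motion begin

lemma progressive_M:
  assumes "progressive h" "0 \<le> T"
  shows "(\<lambda>x. h (max 0 (min (snd x) T)) (fst x)) \<in> borel_measurable (M \<Otimes>\<^sub>M lborel)"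
proof -
  have "(\<lambda>x. (fst x, snd x)) \<in> measurable (M \<Otimes>\<^sub>M lborel) (F T \<Otimes>\<^sub>M borel)"
  proof (rule measurable_Pair)
    have "(\<lambda>om. om) \<in> measurable M (F T)" using measurable_F_M[of "\<lambda>om. om" T "F T"] by simp
    then show "fst \<in> measurable (M \<Otimes>\<^sub>M lborel) (F T)" by (rule measurable_compose[OF measurable_fst])
  qed measurable
  from measurable_compose[OF this progressiveD[OF assms]] show ?thesis by simp
qed

lemma Z_progressive:
  assumes S: "simple_process M F S"
  shows "progressive (Z v S)"
proof (rule progressive_continuous)
  show "Z v S t \<in> borel_measurable (F t)" if "0 \<le> t" for t by (rule Z_measurable[OF S that])
  fix om assume om: "om \<in> space M"
  have "set_integrable lborel {0..T} (\<lambda>r. complex_of_real ((simple_value S r om)\<^sup>2))" for T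
    by (rule set_integrable_of_real) (rule simple_sq_integrable[OF S om])
  from set_integral_continuous_atLeast[OF this]
  have "continuous_on {0..} (\<lambda>t. complex_of_real (sq_integral S t om))" unfolding sq_integral_def set_integral_complex_of_real .
  from continuous_on_Re[OF this] have "continuous_on {0..} (\<lambda>t. sq_integral S t om)" by simp
  moreover have "Z v S t om = iexp (v * simple_integral_wrt W S t om) * exp (of_real (v\<^sup>2 / 2) * complex_of_real (sq_integral S t om))" for t
    unfolding Z_def by (simp add: exp_of_real[symmetric])
  ultimately show "continuous_on {0..} (\<lambda>t. Z v S t om)"
    by (simp only:) (intro continuous_on_mult continuous_on_exp continuous_on_const continuous_on_of_real
        simple_integral_continuous[OF S om])
qed

text \<open>Write \<open>E = Z * \<Theta>\<close> with \<open>\<Theta>\<close> the exponential of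
  the integral of \<open>\<kappa>\<close>, which is absolutely continuous in time. The martingale
  property replaces \<open>Z s\<close> by \<open>Z t\<close>, so the left side is the expectation of
  \<open>\<Phi> * Z t * (\<Theta> t - \<Theta> s)\<close>. Writing
  \<open>\<Theta> t - \<Theta> s\<close> as an integral over \<open>r\<close> and replacing
  \<open>Z t\<close> by \<open>Z r\<close> under that integral gives the right side. This is
  integration by parts for a martingale and a process of finite variation.\<close>

lemma simple_exp_identity:
  fixes v \<eta> s t :: real and b :: "real \<Rightarrow> 'a \<Rightarrow> real" and \<Phi> :: "'a \<Rightarrow> complex"
  assumes S: "simple_process M F S" and b: "progressive b"
    and bi: "\<And>om T. om \<in> space M \<Longrightarrow> set_integrable lborel {0..T} (\<lambda>r. b r om)"
    and eta: "0 < \<eta>" and st: "0 \<le> s" "s \<le> t"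
    and \<Phi>: "\<Phi> \<in> borel_measurable (F s)" "\<And>om. om \<in> space M \<Longrightarrow> cmod (\<Phi> om) \<le> 1"
  defines "\<alpha> \<equiv> \<lambda>r om. \<bar>b r om\<bar> + (simple_value S r om)\<^sup>2"
  defines "\<kappa> \<equiv> \<lambda>r om. \<i> * of_real (v * b r om) - of_real (v\<^sup>2 / 2 * (simple_value S r om)\<^sup>2) - of_real (\<eta> * \<alpha> r om)"
  defines "E \<equiv> \<lambda>r om. exp (of_real (- \<eta> * (LINT u:{0..r}|lborel. \<alpha> u om)) + \<i> * of_real (v * ((LINT u:{0..r}|lborel. b u om) + simple_integral_wrt W S r om)))"
  shows "(\<integral>om. \<Phi> om * E t om \<partial>M) - (\<integral>om. \<Phi> om * E s om \<partial>M) = (\<integral>om. \<Phi> om * (LINT r:{s..t}|lborel. \<kappa> r om * E r om) \<partial>M)"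
proof -
  let ?A = "\<lambda>r om. LINT u:{0..r}|lborel. \<alpha> u om"
  let ?e = "\<lambda>r om. exp (- \<eta> * ?A r om)"
  define \<Theta> where "\<Theta> = (\<lambda>r om. exp (LINT u:{0..r}|lborel. \<kappa> u om))"
  let ?Tk = "\<lambda>r om. \<Theta> (max 0 (min r t)) om * \<kappa> (max 0 (min r t)) om"
  have t: "0 \<le> t" using st by simp
  have bi': "set_integrable lborel {x..y} (\<lambda>r. b r om)" if "om \<in> space M" "0 \<le> x" for x y om
    by (rule set_integrable_subset[OF bi[OF that(1), of y]]) (use that in auto)
  have ai: "set_integrable lborel {x..y} (\<lambda>r. \<alpha> r om)" if "om \<in> space M" "0 \<le> x" for x y om
    unfolding \<alpha>_def by (intro set_integral_add set_integrable_abs bi' simple_sq_integrable S that)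
  have a0: "0 \<le> \<alpha> r om" for r om by (auto simp: \<alpha>_def)
  have ki: "set_integrable lborel {x..y} (\<lambda>r. \<kappa> r om)" if "om \<in> space M" "0 \<le> x" for x y om
    unfolding \<kappa>_def by (intro set_integral_diff set_integrable_mult_right set_integrable_of_real bi' ai simple_sq_integrable S that)
  have kint: "(LINT u:{0..r}|lborel. \<kappa> u om) = \<i> * of_real (v * (LINT u:{0..r}|lborel. b u om))
      - of_real (v\<^sup>2 / 2 * sq_integral S r om) - of_real (\<eta> * ?A r om)" if om: "om \<in> space M" for r om
  proof -
    note i = bi[OF om, of r] ai[OF om order_refl, of r] simple_sq_integrable[OF S om, of 0 r]
    have "(LINT u:{0..r}|lborel. \<kappa> u om) = (LINT u:{0..r}|lborel. \<i> * of_real (v * b u om))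
      - (LINT u:{0..r}|lborel. complex_of_real (v\<^sup>2 / 2 * (simple_value S u om)\<^sup>2)) - (LINT u:{0..r}|lborel. complex_of_real (\<eta> * \<alpha> u om))"
    proof -
      have A: "set_integrable lborel {0..r} (\<lambda>u. \<i> * of_real (v * b u om))"
        "set_integrable lborel {0..r} (\<lambda>u. complex_of_real (v\<^sup>2 / 2 * (simple_value S u om)\<^sup>2))"
        "set_integrable lborel {0..r} (\<lambda>u. complex_of_real (\<eta> * \<alpha> u om))"
        by (intro set_integrable_mult_right set_integrable_of_real i)+
      show ?thesis unfolding \<kappa>_def
        by (simp only: set_integral_diff(2)[OF set_integral_diff(1)[OF A(1,2)] A(3)] set_integral_diff(2)[OF A(1,2)])
    qed
    then show ?thesis by (simp only: set_integral_mult_right set_integral_complex_of_real sq_integral_def)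
  qed
  have EZ: "E r om = Z v S r om * \<Theta> r om" if om: "om \<in> space M" for r om
    unfolding E_def Z_def \<Theta>_def kint[OF om] exp_of_real[symmetric] exp_add[symmetric] by (simp add: algebra_simps)
  have \<alpha>p: "progressive \<alpha>" unfolding \<alpha>_def by (rule progressive_compose2[OF b simple_value_progressive[OF S]]) measurable
  have \<kappa>p: "progressive \<kappa>"
    unfolding \<kappa>_def \<alpha>_def by (rule progressive_compose2[OF b simple_value_progressive[OF S]]) measurable
  have \<Theta>p: "progressive \<Theta>"
  proof (rule progressive_continuous)
    fix r :: real assume "0 \<le> r"
    from progressive_set_integral[OF \<kappa>p this] show "\<Theta> r \<in> borel_measurable (F r)" unfolding \<Theta>_def by measurable
  next
    fix om assume "om \<in> space M"
    then show "continuous_on {0..} (\<lambda>t. \<Theta> t om)"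
      unfolding \<Theta>_def by (intro continuous_intros set_integral_continuous_atLeast ki) auto
  qed
  define c0 where "c0 = \<bar>v\<bar> + v\<^sup>2 / 2 + \<eta>"
  have c0: "0 \<le> c0" using eta by (simp add: c0_def)
  have kb: "cmod (\<kappa> r om) \<le> c0 * \<alpha> r om" for r om
    unfolding \<kappa>_def c0_def by (rule norm_exponent_le) (use eta in \<open>auto simp: \<alpha>_def\<close>)
  have Tb: "cmod (\<Theta> r om) \<le> ?e r om" if "om \<in> space M" for r om
  proof -
    have "0 \<le> sq_integral S r om" unfolding sq_integral_def set_lebesgue_integral_def by (intro Bochner_nonneg) auto
    then have "0 \<le> v\<^sup>2 / 2 * sq_integral S r om" by simp
    then show ?thesis unfolding \<Theta>_def kint[OF that] by (simp add: norm_exp_eq_Re)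
  qed
  have kTb: "cmod (\<Theta> r om * \<kappa> r om) \<le> c0 * (\<alpha> r om * ?e r om)" if "om \<in> space M" for r om
  proof -
    have "cmod (\<Theta> r om) * cmod (\<kappa> r om) \<le> ?e r om * (c0 * \<alpha> r om)" using Tb[OF that] kb c0 by (intro mult_mono) auto
    then show ?thesis by (simp add: norm_mult mult_ac)
  qed
  have decay: "set_integrable lborel {s..t} (\<lambda>r. \<alpha> r om * ?e r om)"
    "(LINT r:{s..t}|lborel. \<alpha> r om * ?e r om) \<le> 1 / \<eta>" if "om \<in> space M" for om
    using exp_decay[OF ai[OF that order_refl, of t] a0 st eta] by auto
  obtain C where C: "0 \<le> C" "\<And>om r. om \<in> space M \<Longrightarrow> r \<in> {0..t} \<Longrightarrow> cmod (Z v S r om) \<le> C" using Z_bounded[OF S, of t v] by blast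
  have E: "(LINT r:{s..t}|lborel. \<kappa> r om * \<Theta> r om) = \<Theta> t om - \<Theta> s om" if "om \<in> space M" for om
    unfolding \<Theta>_def by (rule exp_set_integral(2)[OF ki[OF that order_refl, of t] st order_refl])
  note \<Phi>M [measurable] = measurable_F_M[OF \<Phi>(1)]
  note ZtM [measurable] = measurable_F_M[OF Z_measurable[OF S t, of v]]
  note [measurable] = progressive_M[OF Z_progressive[OF S, of v] t] progressive_M[OF \<kappa>p t] progressive_M[OF \<Theta>p t]
  interpret PL: pair_sigma_finite M lborel ..
  \<comment> \<open>Joint integrability over paths and times, common to \<open>f0\<close>,
    \<open>f1\<close> and \<open>f2\<close> below: the factor \<open>Y\<close> is bounded, and the
    rest is controlled by \<open>exp_decay\<close> uniformly in the path.\<close>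
  have PLint: "integrable (M \<Otimes>\<^sub>M lborel) (\<lambda>(om, r). indicator {s..t} r *\<^sub>R (Y (om, r) * ?Tk r om))"
    if Y [measurable]: "Y \<in> borel_measurable (M \<Otimes>\<^sub>M lborel)" and Yb: "\<And>om r. om \<in> space M \<Longrightarrow> r \<in> {s..t} \<Longrightarrow> cmod (Y (om, r)) \<le> D"
    for Y :: "'a \<times> real \<Rightarrow> complex" and D
  proof (rule PL.Fubini_integrable)
    define g where "g = (\<lambda>x. indicator {s..t} (snd x) *\<^sub>R (Y (fst x, snd x) * (\<Theta> (max 0 (min (snd x) t)) (fst x) * \<kappa> (max 0 (min (snd x) t)) (fst x))))"
    have g: "(\<lambda>(om, r). indicator {s..t} r *\<^sub>R (Y (om, r) * ?Tk r om)) = g" by (auto simp: g_def fun_eq_iff)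
    have gm [measurable]: "g \<in> borel_measurable (M \<Otimes>\<^sub>M lborel)" unfolding g_def by measurable
    have gm2: "(\<lambda>r. g (om, r)) \<in> borel_measurable lborel" if "om \<in> space M" for om by (rule measurable_Pair2[OF gm that])
    have gb: "cmod (g (om, r)) \<le> \<bar>D\<bar> * c0 * (indicator {s..t} r *\<^sub>R (\<alpha> r om * ?e r om))"
      if "om \<in> space M" for r om
    proof (cases "r \<in> {s..t}")
      case True
      have "cmod (Y (om, r)) * cmod (\<Theta> r om * \<kappa> r om) \<le> \<bar>D\<bar> * (c0 * (\<alpha> r om * ?e r om))"
        using Yb[OF that True] kTb[OF that, of r] by (intro mult_mono) auto
      then show ?thesis using True st(1) by (simp add: g_def norm_mult mult.assoc max_absorb2)
    qed (simp add: g_def)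
    have di: "integrable lborel (\<lambda>r. \<bar>D\<bar> * c0 * (indicator {s..t} r *\<^sub>R (\<alpha> r om * ?e r om)))"
      if "om \<in> space M" for om using decay(1)[OF that] unfolding set_integrable_def by (rule integrable_mult_right)
    have gi: "integrable lborel (\<lambda>r. g (om, r))" if "om \<in> space M" for om by (rule Bochner_bound[OF di[OF that] gm2[OF that]])
        (intro AE_I2 order_trans[OF gb[OF that]], unfold real_norm_def, rule abs_ge_self)
    show "(\<lambda>(om, r). indicator {s..t} r *\<^sub>R (Y (om, r) * ?Tk r om)) \<in> borel_measurable (M \<Otimes>\<^sub>M lborel)"
      unfolding g by (rule gm)
    show "AE om in M. integrable lborel (\<lambda>r. case (om, r) of (om, r) \<Rightarrow> indicator {s..t} r *\<^sub>R (Y (om, r) * ?Tk r om))"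
      using gi by (intro AE_I2) (simp add: g_def)
    have "integrable M (\<lambda>om. \<integral>r. cmod (g (om, r)) \<partial>lborel)"
    proof (rule integrable_const_bound)
      show "(\<lambda>om. \<integral>r. cmod (g (om, r)) \<partial>lborel) \<in> borel_measurable M" by measurable
      show "AE om in M. norm (\<integral>r. cmod (g (om, r)) \<partial>lborel) \<le> \<bar>D\<bar> * c0 * (1 / \<eta>)"
      proof (rule AE_I2)
        fix om assume om: "om \<in> space M"
        have "(\<integral>r. cmod (g (om, r)) \<partial>lborel) \<le> (\<integral>r. \<bar>D\<bar> * c0 * (indicator {s..t} r *\<^sub>R (\<alpha> r om * ?e r om)) \<partial>lborel)"
          by (intro integral_mono integrable_norm gi di om gb)
        also have "\<dots> = \<bar>D\<bar> * c0 * (LINT r:{s..t}|lborel. \<alpha> r om * ?e r om)"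
          unfolding set_lebesgue_integral_def by (rule integral_mult_right_zero)
        also have "\<dots> \<le> \<bar>D\<bar> * c0 * (1 / \<eta>)" using decay(2)[OF om] c0 by (intro mult_left_mono) auto
        finally show "norm (\<integral>r. cmod (g (om, r)) \<partial>lborel) \<le> \<bar>D\<bar> * c0 * (1 / \<eta>)" by simp
      qed
    qed
    then show "integrable M (\<lambda>om. \<integral>r. cmod (case (om, r) of (om, r) \<Rightarrow> indicator {s..t} r *\<^sub>R (Y (om, r) * ?Tk r om)) \<partial>lborel)"
      by (simp add: g_def)
  qed
  define f0 f1 f2 where "f0 = (\<lambda>om r. indicator {s..t} r *\<^sub>R (\<Phi> om * ?Tk r om))"
    and "f1 = (\<lambda>om r. indicator {s..t} r *\<^sub>R (\<Phi> om * Z v S t om * ?Tk r om))"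
    and "f2 = (\<lambda>om r. indicator {s..t} r *\<^sub>R (\<Phi> om * Z v S (max 0 (min r t)) om * ?Tk r om))"
  have \<Phi>Zb: "cmod (\<Phi> om * Z v S r om) \<le> 1 * C" if "om \<in> space M" "r \<in> {0..t}" for om r
    unfolding norm_mult using \<Phi>(2)[OF that(1)] C(2)[OF that] by (intro mult_mono) auto
  have i0: "integrable (M \<Otimes>\<^sub>M lborel) (\<lambda>(om, r). f0 om r)"
    using PLint[of "\<lambda>x. \<Phi> (fst x)" 1] \<Phi>(2) unfolding f0_def by simp
  have i1: "integrable (M \<Otimes>\<^sub>M lborel) (\<lambda>(om, r). f1 om r)"
    using PLint[of "\<lambda>x. \<Phi> (fst x) * Z v S t (fst x)" C] \<Phi>Zb t unfolding f1_def by simp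
  have i2: "integrable (M \<Otimes>\<^sub>M lborel) (\<lambda>(om, r). f2 om r)"
    using PLint[of "\<lambda>x. \<Phi> (fst x) * Z v S (max 0 (min (snd x) t)) (fst x)" C] \<Phi>Zb t unfolding f2_def by simp
  \<comment> \<open>For almost every \<open>r\<close>, Fubini's theorem provides the integrability
    that \<open>Z_martingale\<close> asks of the variable multiplying \<open>Z\<close>.\<close>
  have "AE r in lborel. integrable M (\<lambda>om. f0 om r)" using PL.AE_integrable_snd[OF i0] by simp
  then have "AE r in lborel. (\<integral>om. f1 om r \<partial>M) = (\<integral>om. f2 om r \<partial>M)"
  proof eventually_elim
    case (elim r)
    show ?case
    proof (cases "r \<in> {s..t}")
      case True
      then have r: "0 \<le> r" "r \<le> t" "s \<le> r" using st by auto
      define \<Psi> where "\<Psi> = (\<lambda>om. \<Phi> om * (\<Theta> r om * \<kappa> r om))"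
      have "integrable M \<Psi>" using elim True r by (simp add: f0_def \<Psi>_def max_absorb2)
      moreover have "\<Psi> \<in> borel_measurable (F r)"
        unfolding \<Psi>_def using measurable_F_mono[OF r(3) \<Phi>(1)] progressive_adapted[OF \<Theta>p r(1)] progressive_adapted[OF \<kappa>p r(1)] by measurable
      ultimately have "(\<integral>om. \<Psi> om * Z v S t om \<partial>M) = (\<integral>om. \<Psi> om * Z v S r om \<partial>M)"
        using r by (intro Z_martingale[OF S]) auto
      then show ?thesis using True r by (simp add: f1_def f2_def \<Psi>_def mult_ac max_absorb2)
    qed (simp add: f1_def f2_def)
  qed
  then have "(\<integral>r. (\<integral>om. f1 om r \<partial>M) \<partial>lborel) = (\<integral>r. (\<integral>om. f2 om r \<partial>M) \<partial>lborel)"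
    using PL.integrable_snd[OF i1] PL.integrable_snd[OF i2] by (intro integral_cong_AE) auto
  then have eq: "(\<integral>om. (\<integral>r. f1 om r \<partial>lborel) \<partial>M) = (\<integral>om. (\<integral>r. f2 om r \<partial>lborel) \<partial>M)"
    using PL.Fubini_integral[OF i1] PL.Fubini_integral[OF i2] by simp
  have F1: "(\<integral>r. f1 om r \<partial>lborel) = \<Phi> om * Z v S t om * (\<Theta> t om - \<Theta> s om)" if "om \<in> space M" for om
  proof -
    have "(\<integral>r. f1 om r \<partial>lborel) = (\<integral>r. \<Phi> om * Z v S t om * (indicator {s..t} r *\<^sub>R (\<kappa> r om * \<Theta> r om)) \<partial>lborel)"
      unfolding f1_def by (rule Bochner_cong[OF refl]) (use st(1) in \<open>auto simp: indicator_def mult_ac max_absorb2\<close>)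
    also have "\<dots> = \<Phi> om * Z v S t om * (\<Theta> t om - \<Theta> s om)"
      unfolding integral_mult_right_zero E[OF that, unfolded set_lebesgue_integral_def] ..
    finally show ?thesis .
  qed
  have F2: "(\<integral>r. f2 om r \<partial>lborel) = \<Phi> om * (LINT r:{s..t}|lborel. \<kappa> r om * E r om)" if "om \<in> space M" for om
  proof -
    have "(\<integral>r. f2 om r \<partial>lborel) = (\<integral>r. \<Phi> om * (indicator {s..t} r *\<^sub>R (\<kappa> r om * E r om)) \<partial>lborel)"
      unfolding f2_def by (rule Bochner_cong[OF refl]) (use st(1) in \<open>auto simp: indicator_def mult_ac max_absorb2 EZ[OF that]\<close>)
    then show ?thesis unfolding integral_mult_right_zero set_lebesgue_integral_def .
  qed
  have Tb1: "cmod (\<Theta> r om) \<le> 1" if "om \<in> space M" for r om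
  proof -
    have "0 \<le> ?A r om" unfolding set_lebesgue_integral_def using a0 by (intro Bochner_nonneg) auto
    then have "?e r om \<le> 1" using eta by simp
    with Tb[OF that, of r] show ?thesis by linarith
  qed
  have \<Theta>M: "\<Theta> r \<in> borel_measurable M" if "0 \<le> r" for r by (rule measurable_F_M[OF progressive_adapted[OF \<Theta>p that]])
  have \<Phi>\<Theta>: "integrable M (\<lambda>om. \<Phi> om * \<Theta> r om)" if "0 \<le> r" for r
  proof (rule integrable_const_bound)
    show "AE om in M. norm (\<Phi> om * \<Theta> r om) \<le> 1 * 1" unfolding norm_mult using \<Phi>(2) Tb1 by (intro AE_I2 mult_mono) auto
    show "(\<lambda>om. \<Phi> om * \<Theta> r om) \<in> borel_measurable M" using \<Theta>M[OF that] by measurable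
  qed
  have "(\<integral>om. \<Phi> om * E t om \<partial>M) - (\<integral>om. \<Phi> om * E s om \<partial>M) = (\<integral>om. \<Phi> om * \<Theta> t om * Z v S t om \<partial>M) - (\<integral>om. \<Phi> om * \<Theta> s om * Z v S s om \<partial>M)"
    by (intro arg_cong2[where f = minus] Bochner_cong refl) (auto simp: EZ mult_ac)
  also have "(\<integral>om. \<Phi> om * \<Theta> s om * Z v S s om \<partial>M) = (\<integral>om. \<Phi> om * \<Theta> s om * Z v S t om \<partial>M)"
    by (intro Z_martingale[OF S st, symmetric] \<Phi>\<Theta> st borel_measurable_times \<Phi>(1) progressive_adapted[OF \<Theta>p st(1)])
  also have "(\<integral>om. \<Phi> om * \<Theta> t om * Z v S t om \<partial>M) - (\<integral>om. \<Phi> om * \<Theta> s om * Z v S t om \<partial>M)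
     = (\<integral>om. \<Phi> om * \<Theta> t om * Z v S t om - \<Phi> om * \<Theta> s om * Z v S t om \<partial>M)"
    by (intro Bochner_Integration.integral_diff[symmetric] integrable_Z_mult[OF S t] \<Phi>\<Theta> st t)
  also have "\<dots> = (\<integral>om. (\<integral>r. f1 om r \<partial>lborel) \<partial>M)"
    by (rule Bochner_cong[OF refl]) (simp add: F1 algebra_simps)
  also have "\<dots> = (\<integral>om. (\<integral>r. f2 om r \<partial>lborel) \<partial>M)" by (rule eq)
  also have "\<dots> = (\<integral>om. \<Phi> om * (LINT r:{s..t}|lborel. \<kappa> r om * E r om) \<partial>M)"
    by (rule Bochner_cong[OF refl]) (rule F2)
  finally show ?thesis .
qed

end

text \<open>By Young's inequality
  \<open>\<bar>x^2 - y^2\<bar> \<le> (1 + 1/e) (x - y)^2 + e y^2\<close>. The parameter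
  \<open>e\<close> is fixed first and makes the last term small, since \<open>h\<close> is square
  integrable.\<close>

lemma L2_limit_squares:
  fixes f :: "nat \<Rightarrow> real \<Rightarrow> real"
  assumes f: "\<And>n. set_integrable lborel A (\<lambda>r. (f n r - h r)\<^sup>2)" and h: "set_integrable lborel A (\<lambda>r. (h r)\<^sup>2)"
    and fh: "\<And>n. set_integrable lborel A (\<lambda>r. \<bar>(f n r)\<^sup>2 - (h r)\<^sup>2\<bar>)"
    and lim: "(\<lambda>n. LINT r:A|lborel. (f n r - h r)\<^sup>2) \<longlonglongrightarrow> 0"
  shows "(\<lambda>n. LINT r:A|lborel. \<bar>(f n r)\<^sup>2 - (h r)\<^sup>2\<bar>) \<longlonglongrightarrow> 0"
proof -
  let ?d = "\<lambda>n. LINT r:A|lborel. (f n r - h r)\<^sup>2"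
  let ?sq = "\<lambda>n r. \<bar>(f n r)\<^sup>2 - (h r)\<^sup>2\<bar>"
  define c where "c = (LINT r:A|lborel. (h r)\<^sup>2)"
  have c0: "0 \<le> c" unfolding c_def set_lebesgue_integral_def by (intro Bochner_nonneg) auto
  have bd: "(LINT r:A|lborel. ?sq n r) \<le> (1 + 1 / e) * ?d n + e * c" if e: "0 < e" for n e
  proof -
    have pt: "\<bar>x\<^sup>2 - y\<^sup>2\<bar> \<le> (1 + 1 / e) * (x - y)\<^sup>2 + e * y\<^sup>2" for x y :: real
    proof -
      have "2 * (\<bar>y\<bar> * \<bar>x - y\<bar>) \<le> e * \<bar>y\<bar>\<^sup>2 + \<bar>x - y\<bar>\<^sup>2 / e"
      proof -
        have "0 \<le> (e * \<bar>y\<bar> - \<bar>x - y\<bar>)\<^sup>2 / e" using e by simp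
        also have "\<dots> = e * \<bar>y\<bar>\<^sup>2 + \<bar>x - y\<bar>\<^sup>2 / e - 2 * (\<bar>y\<bar> * \<bar>x - y\<bar>)"
          using e by (simp add: power2_eq_square field_simps)
        finally show ?thesis by simp
      qed
      moreover have "\<bar>x\<^sup>2 - y\<^sup>2\<bar> \<le> \<bar>x - y\<bar>\<^sup>2 + 2 * (\<bar>y\<bar> * \<bar>x - y\<bar>)"
      proof -
        have "x\<^sup>2 - y\<^sup>2 = (x - y)\<^sup>2 + 2 * (y * (x - y))" by (simp add: power2_eq_square algebra_simps)
        also have "\<bar>\<dots>\<bar> \<le> \<bar>(x - y)\<^sup>2\<bar> + \<bar>2 * (y * (x - y))\<bar>" by (rule abs_triangle_ineq)
        finally show ?thesis by (simp add: abs_mult)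
      qed
      ultimately show ?thesis by (simp add: algebra_simps)
    qed
    have "(LINT r:A|lborel. ?sq n r) \<le> (LINT r:A|lborel. (1 + 1 / e) * (f n r - h r)\<^sup>2 + e * (h r)\<^sup>2)"
      by (intro set_integral_mono fh set_integral_add set_integrable_mult_right f h pt)
    also have "\<dots> = (1 + 1 / e) * ?d n + e * c"
      unfolding c_def using f h by (subst set_integral_add(2)) (auto intro!: set_integrable_mult_right)
    finally show ?thesis .
  qed
  show ?thesis
  proof (rule LIMSEQ_I)
    fix d :: real assume d: "0 < d"
    define e where "e = d / (2 * (c + 1))"
    have e: "0 < e" using d c0 by (simp add: e_def)
    have ec: "e * c \<le> d / 2"
    proof -
      have "e * c \<le> e * (c + 1)" using e by (intro mult_left_mono) auto
      also have "\<dots> = d / 2" using c0 by (simp add: e_def field_simps)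
      finally show ?thesis .
    qed
    have "(\<lambda>n. (1 + 1 / e) * ?d n) \<longlonglongrightarrow> (1 + 1 / e) * 0" by (intro tendsto_mult_left lim)
    then have "\<forall>\<^sub>F n in sequentially. (1 + 1 / e) * ?d n < d / 2" using d by (intro order_tendstoD(2)) auto
    then obtain N where N: "\<And>n. n \<ge> N \<Longrightarrow> (1 + 1 / e) * ?d n < d / 2" by (auto simp: eventually_sequentially)
    have "norm ((LINT r:A|lborel. ?sq n r) - 0) < d" if "n \<ge> N" for n
    proof -
      have "0 \<le> (LINT r:A|lborel. ?sq n r)" unfolding set_lebesgue_integral_def by (intro Bochner_nonneg) auto
      then show ?thesis using bd[OF e, of n] N[OF that] ec unfolding real_norm_def diff_zero by linarith
    qed
    then show "\<exists>N. \<forall>n\<ge>N. norm ((LINT r:A|lborel. ?sq n r) - 0) < d" by blast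
  qed
qed

text \<open>The discount and the coefficient \<open>\<kappa>\<close> depend on the integrand through
  its square only, which converges in \<open>L^1\<close>. The bounds in the last two claims do not
  depend on the path; they later justify the limit under the expectation.\<close>

lemma path_limit:
  fixes s t v \<eta> :: real and b h :: "real \<Rightarrow> real" and f u :: "nat \<Rightarrow> real \<Rightarrow> real" and u0 :: "real \<Rightarrow> real"
  assumes st: "0 \<le> s" "s \<le> t" and eta: "0 < \<eta>"
    and b: "set_integrable lborel {0..t} b"
    and h: "set_integrable lborel {0..t} (\<lambda>r. (h r)\<^sup>2)"
    and f: "\<And>n. set_integrable lborel {0..t} (\<lambda>r. (f n r)\<^sup>2)"
    and fh: "\<And>n. set_integrable lborel {0..t} (\<lambda>r. (f n r - h r)\<^sup>2)"
    and lim: "(\<lambda>n. LINT r:{0..t}|lborel. (f n r - h r)\<^sup>2) \<longlonglongrightarrow> 0"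
    and u: "\<And>n. continuous_on {0..t} (u n)" "continuous_on {0..t} u0" "\<And>r. r \<in> {0..t} \<Longrightarrow> (\<lambda>n. u n r) \<longlonglongrightarrow> u0 r"
  defines "\<alpha> \<equiv> \<lambda>g r. \<bar>b r\<bar> + (g r)\<^sup>2"
  defines "\<kappa> \<equiv> \<lambda>g r. \<i> * of_real (v * b r) - of_real (v\<^sup>2 / 2 * (g r)\<^sup>2) - of_real (\<eta> * \<alpha> g r)"
  defines "E \<equiv> \<lambda>g w r. exp (of_real (- \<eta> * (LINT x:{0..r}|lborel. \<alpha> g x)) + \<i> * of_real (v * w r))"
  shows "\<And>r. r \<in> {0..t} \<Longrightarrow> (\<lambda>n. E (f n) (u n) r) \<longlonglongrightarrow> E h u0 r"
    and "(\<lambda>n. LINT r:{s..t}|lborel. \<kappa> (f n) r * E (f n) (u n) r) \<longlonglongrightarrow> (LINT r:{s..t}|lborel. \<kappa> h r * E h u0 r)"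
    and "\<And>n. cmod (LINT r:{s..t}|lborel. \<kappa> (f n) r * E (f n) (u n) r) \<le> (\<bar>v\<bar> + v\<^sup>2 / 2 + \<eta>) / \<eta>"
    and "\<And>n r. cmod (E (f n) (u n) r) \<le> 1"
proof -
  let ?DE = "\<lambda>n r. (\<kappa> (f n) r - \<kappa> h r) * E (f n) (u n) r"
  let ?sq = "\<lambda>n r. \<bar>(f n r)\<^sup>2 - (h r)\<^sup>2\<bar>"
  let ?KE = "\<lambda>n r. \<kappa> (f n) r * E (f n) (u n) r"
  have sub: "set_integrable lborel S g" if "set_integrable lborel {0..t} g" "S \<subseteq> {0..t}" "S \<in> sets borel" for g :: "real \<Rightarrow> real" and S
    using that by (auto intro: set_integrable_subset)
  have abs: "set_integrable lborel {0..t} (\<lambda>r. ?sq n r)" for n by (intro set_integrable_abs set_integral_diff f h)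
  have q: "(\<lambda>n. LINT r:{0..t}|lborel. ?sq n r) \<longlonglongrightarrow> 0" by (rule L2_limit_squares[OF fh h abs lim])
  have ai: "set_integrable lborel {0..t} (\<alpha> g)" if "set_integrable lborel {0..t} (\<lambda>r. (g r)\<^sup>2)" for g
    unfolding \<alpha>_def by (intro set_integral_add set_integrable_abs b that)
  have a0: "0 \<le> \<alpha> g r" for g r by (auto simp: \<alpha>_def)
  have A0: "0 \<le> (LINT x:{0..r}|lborel. \<alpha> g x)" for g r unfolding set_lebesgue_integral_def using a0 by (intro Bochner_nonneg) auto
  have Eb: "cmod (E g w r) \<le> 1" "cmod (E g w r) = exp (- \<eta> * (LINT x:{0..r}|lborel. \<alpha> g x))" for g w r
    using A0[of r g] eta by (auto simp: E_def norm_exp_eq_Re)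
  show "\<And>n r. cmod (E (f n) (u n) r) \<le> 1" by (rule Eb)
  have Alim: "(\<lambda>n. LINT x:{0..r}|lborel. \<alpha> (f n) x) \<longlonglongrightarrow> (LINT x:{0..r}|lborel. \<alpha> h x)" if r: "r \<in> {0..t}" for r
  proof (rule LIM_zero_cancel, rule Lim_null_comparison[OF _ q], rule always_eventually, rule allI)
    fix n
    have S: "{0..r} \<subseteq> {0..t}" using r by auto
    have "(LINT x:{0..r}|lborel. \<alpha> (f n) x) - (LINT x:{0..r}|lborel. \<alpha> h x) = (LINT x:{0..r}|lborel. \<alpha> (f n) x - \<alpha> h x)"
      by (rule set_integral_diff(2)[symmetric]) (intro sub[OF ai S] f h, simp)+
    also have "norm \<dots> \<le> (LINT x:{0..r}|lborel. norm (\<alpha> (f n) x - \<alpha> h x))"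
      by (rule set_integral_norm_bound) (intro set_integral_diff sub[OF ai S] f h, simp_all)
    also have "\<dots> = (LINT x:{0..r}|lborel. ?sq n x)" by (simp add: \<alpha>_def)
    also have "\<dots> \<le> (LINT x:{0..t}|lborel. ?sq n x)" by (rule set_integral_mono_set_nonneg[OF abs S]) auto
    finally show "norm ((LINT x:{0..r}|lborel. \<alpha> (f n) x) - (LINT x:{0..r}|lborel. \<alpha> h x)) \<le> (LINT x:{0..t}|lborel. ?sq n x)" .
  qed
  show El: "(\<lambda>n. E (f n) (u n) r) \<longlonglongrightarrow> E h u0 r" if r: "r \<in> {0..t}" for r
    unfolding E_def by (intro tendsto_exp tendsto_add tendsto_of_real tendsto_mult_left Alim u(3) r)
  have Ec: "continuous_on {0..t} (E g w)" if "set_integrable lborel {0..t} (\<lambda>r. (g r)\<^sup>2)" "continuous_on {0..t} w" for g w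
  proof -
    have "continuous_on {0..t} (\<lambda>r. integral {0..r} (\<alpha> g))"
      by (rule indefinite_integral_continuous_1) (rule set_borel_integral_eq_integral(1)[OF ai[OF that(1)]])
    moreover have "integral {0..r} (\<alpha> g) = (LINT x:{0..r}|lborel. \<alpha> g x)" if "r \<in> {0..t}" for r
      using that \<open>set_integrable lborel {0..t} (\<lambda>r. (g r)\<^sup>2)\<close>
      by (intro set_borel_integral_eq_integral(2)[symmetric] sub[OF ai]) auto
    ultimately have "continuous_on {0..t} (\<lambda>r. LINT x:{0..r}|lborel. \<alpha> g x)" by (rule continuous_on_eq)
    then show ?thesis unfolding E_def using that(2)
      by (intro continuous_on_exp continuous_on_add continuous_on_of_real continuous_on_mult continuous_on_const)
  qed
  have ss: "{s..t} \<subseteq> {0..t}" using st by auto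
  have Em: "set_borel_measurable lborel {s..t} (E g w)" if "set_integrable lborel {0..t} (\<lambda>r. (g r)\<^sup>2)" "continuous_on {0..t} w" for g w
    using continuous_on_subset[OF Ec[OF that] ss] by (auto intro!: borel_measurable_continuous_on_indicator simp: set_borel_measurable_def)
  have ki: "set_integrable lborel {s..t} (\<kappa> g)" if "set_integrable lborel {0..t} (\<lambda>r. (g r)\<^sup>2)" for g
    unfolding \<kappa>_def by (intro set_integral_diff set_integrable_mult_right set_integrable_of_real sub[OF _ ss] b ai that) auto
  have kEi: "set_integrable lborel {s..t} (\<lambda>r. \<kappa> g r * E g' w r)"
    if "set_integrable lborel {0..t} (\<lambda>r. (g r)\<^sup>2)" "set_integrable lborel {0..t} (\<lambda>r. (g' r)\<^sup>2)" "continuous_on {0..t} w" for g g' w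
    by (intro set_integrable_bounded_mult[where B = 1] ki Em that Eb)
  define c0 where "c0 = \<bar>v\<bar> + v\<^sup>2 / 2 + \<eta>"
  have c0: "0 \<le> c0" using eta by (simp add: c0_def)
  have kb: "cmod (\<kappa> g r) \<le> c0 * \<alpha> g r" for r g
    unfolding \<kappa>_def c0_def by (rule norm_exponent_le) (use eta in \<open>auto simp: \<alpha>_def\<close>)
  show "cmod (LINT r:{s..t}|lborel. ?KE n r) \<le> (\<bar>v\<bar> + v\<^sup>2 / 2 + \<eta>) / \<eta>" for n
  proof -
    note d = exp_decay[OF ai[OF f[of n]] a0 st eta]
    have "cmod (LINT r:{s..t}|lborel. ?KE n r) \<le> (LINT r:{s..t}|lborel. cmod (?KE n r))"
      by (rule set_integral_norm_bound[OF kEi[OF f f u(1)]])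
    also have "\<dots> \<le> (LINT r:{s..t}|lborel. c0 * (\<alpha> (f n) r * exp (- \<eta> * (LINT x:{0..r}|lborel. \<alpha> (f n) x))))"
    proof (intro set_integral_mono set_integrable_norm kEi f u set_integrable_mult_right d)
      fix r
      show "cmod (?KE n r) \<le> c0 * (\<alpha> (f n) r * exp (- \<eta> * (LINT x:{0..r}|lborel. \<alpha> (f n) x)))"
        unfolding norm_mult Eb(2) mult.assoc[symmetric] using kb by (intro mult_right_mono) auto
    qed
    also have "\<dots> \<le> c0 * (1 / \<eta>)" unfolding set_integral_mult_right using d(2) c0 by (intro mult_left_mono) auto
    finally show ?thesis by (simp add: c0_def)
  qed
  \<comment> \<open>Only the squared integrand varies in \<open>\<kappa>\<close>, so the difference
    is a multiple of the difference of the squares, while the exponential stays in the unit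
    disc.\<close>
  have P1: "(\<lambda>n. LINT r:{s..t}|lborel. ?DE n r) \<longlonglongrightarrow> 0"
  proof (rule Lim_null_comparison)
    show "\<forall>\<^sub>F n in sequentially. norm (LINT r:{s..t}|lborel. ?DE n r) \<le> c0 * (LINT r:{0..t}|lborel. ?sq n r)"
    proof (intro always_eventually allI)
      fix n
      have i: "set_integrable lborel {s..t} (\<lambda>r. ?DE n r)"
        by (intro set_integrable_bounded_mult[where B = 1] set_integral_diff ki Em f h u Eb)
      have "norm (LINT r:{s..t}|lborel. ?DE n r) \<le> (LINT r:{s..t}|lborel. norm (?DE n r))" by (rule set_integral_norm_bound[OF i])
      also have "\<dots> \<le> (LINT r:{s..t}|lborel. c0 * ?sq n r)"
      proof (intro set_integral_mono set_integrable_norm i set_integrable_mult_right sub[OF abs ss])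
        fix r
        have "\<kappa> (f n) r - \<kappa> h r = of_real (- (v\<^sup>2 / 2 + \<eta>) * ((f n r)\<^sup>2 - (h r)\<^sup>2))"
          by (simp add: \<kappa>_def \<alpha>_def algebra_simps)
        then have "cmod (\<kappa> (f n) r - \<kappa> h r) = (v\<^sup>2 / 2 + \<eta>) * ?sq n r"
          using eta by (simp only: norm_of_real abs_mult abs_minus) simp
        also have "\<dots> \<le> c0 * ?sq n r" by (intro mult_right_mono) (auto simp: c0_def)
        finally have "cmod (\<kappa> (f n) r - \<kappa> h r) * cmod (E (f n) (u n) r) \<le> c0 * ?sq n r * 1"
          using Eb(1) c0 by (intro mult_mono) auto
        then show "norm (?DE n r) \<le> c0 * ?sq n r" by (simp add: norm_mult)
      qed simp
      also have "\<dots> \<le> c0 * (LINT r:{0..t}|lborel. ?sq n r)"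
        unfolding set_integral_mult_right using c0 by (intro mult_left_mono set_integral_mono_set_nonneg[OF abs ss]) auto
      finally show "norm (LINT r:{s..t}|lborel. ?DE n r) \<le> c0 * (LINT r:{0..t}|lborel. ?sq n r)" .
    qed
    show "(\<lambda>n. c0 * (LINT r:{0..t}|lborel. ?sq n r)) \<longlonglongrightarrow> 0" by (rule tendsto_mult_right_zero[OF q])
  qed
  have P2: "(\<lambda>n. LINT r:{s..t}|lborel. \<kappa> h r * E (f n) (u n) r) \<longlonglongrightarrow> (LINT r:{s..t}|lborel. \<kappa> h r * E h u0 r)"
    unfolding set_lebesgue_integral_def
  proof (rule integral_dominated_convergence)
    show "integrable lborel (\<lambda>r. cmod (indicator {s..t} r *\<^sub>R \<kappa> h r))"
      using ki[OF h] unfolding set_integrable_def by (rule integrable_norm)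
    show "(\<lambda>r. indicator {s..t} r *\<^sub>R (\<kappa> h r * E (f n) (u n) r)) \<in> borel_measurable lborel" for n
      using kEi[OF h f u(1)] by (simp add: set_integrable_def borel_measurable_integrable)
    show "(\<lambda>r. indicator {s..t} r *\<^sub>R (\<kappa> h r * E h u0 r)) \<in> borel_measurable lborel"
      using kEi[OF h h u(2)] by (simp add: set_integrable_def borel_measurable_integrable)
    show "AE r in lborel. (\<lambda>n. indicator {s..t} r *\<^sub>R (\<kappa> h r * E (f n) (u n) r)) \<longlonglongrightarrow> indicator {s..t} r *\<^sub>R (\<kappa> h r * E h u0 r)"
    proof (rule AE_I2)
      fix r
      show "(\<lambda>n. indicator {s..t} r *\<^sub>R (\<kappa> h r * E (f n) (u n) r)) \<longlonglongrightarrow> indicator {s..t} r *\<^sub>R (\<kappa> h r * E h u0 r)"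
      proof (cases "r \<in> {s..t}")
        case True
        then show ?thesis using El[of r] ss by (auto intro!: tendsto_mult_left)
      qed simp
    qed
    show "AE r in lborel. norm (indicator {s..t} r *\<^sub>R (\<kappa> h r * E (f n) (u n) r)) \<le> cmod (indicator {s..t} r *\<^sub>R \<kappa> h r)" for n
    proof (rule AE_I2)
      fix r
      have "cmod (\<kappa> h r) * cmod (E (f n) (u n) r) \<le> cmod (\<kappa> h r) * 1" using Eb(1) by (intro mult_left_mono) auto
      then show "norm (indicator {s..t} r *\<^sub>R (\<kappa> h r * E (f n) (u n) r)) \<le> cmod (indicator {s..t} r *\<^sub>R \<kappa> h r)"
        by (auto simp: norm_mult indicator_def)
    qed
  qed
  have "(LINT r:{s..t}|lborel. ?KE n r) = (LINT r:{s..t}|lborel. ?DE n r) + (LINT r:{s..t}|lborel. \<kappa> h r * E (f n) (u n) r)" for n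
  proof (subst set_integral_add(2)[symmetric])
    show "set_integrable lborel {s..t} (\<lambda>r. ?DE n r)"
      by (intro set_integrable_bounded_mult[where B = 1] set_integral_diff ki Em f h u Eb)
    show "set_integrable lborel {s..t} (\<lambda>r. \<kappa> h r * E (f n) (u n) r)" by (rule kEi[OF h f u(1)])
  qed (simp add: algebra_simps)
  then show "(\<lambda>n. LINT r:{s..t}|lborel. ?KE n r) \<longlonglongrightarrow> (LINT r:{s..t}|lborel. \<kappa> h r * E h u0 r)"
    using tendsto_add[OF P1 P2] by simp
qed

text \<open>\<open>\<beta>\<close> is drift over squared volatility, so the drift itself is
  \<open>\<beta> * sg^2\<close>. The path properties hold at every point of the space. The Ito
  integral enters only through simple processes that converge almost surely; they may depend on the
  time horizon \<open>T\<close>.\<close>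

locale stopped_diffusion = continuous_brownian_motion M F W for M :: "'a measure" and F W +
  fixes X :: "real \<Rightarrow> 'a \<Rightarrow> real" and A B x0 :: real and \<beta> sg :: "real \<Rightarrow> real"
  assumes AB: "A < B"
    and X_continuous: "\<And>om. om \<in> space M \<Longrightarrow> continuous_on {0..} (\<lambda>t. X t om)"
    and X_adapted: "\<And>t. 0 \<le> t \<Longrightarrow> X t \<in> borel_measurable (F t)"
    and X_range: "\<And>om t. om \<in> space M \<Longrightarrow> 0 \<le> t \<Longrightarrow> X t om \<in> {A..B}"
    and beta [measurable]: "\<beta> \<in> borel_measurable borel" and sg [measurable]: "sg \<in> borel_measurable borel"
    and sg_integrable: "\<And>om T. om \<in> space M \<Longrightarrow> set_integrable lborel {0..T} (\<lambda>r. (sg (X r om))\<^sup>2)"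
    and drift_integrable: "\<And>om T. om \<in> space M \<Longrightarrow> set_integrable lborel {0..T} (\<lambda>r. \<beta> (X r om) * (sg (X r om))\<^sup>2)"
    and beta_integrable: "set_integrable lborel {A..B} \<beta>"
    and ito: "\<And>T. 0 \<le> T \<Longrightarrow> \<exists>S. (\<forall>n. simple_process M F (S n)) \<and> (AE om in M.
        ((\<lambda>n. \<integral>\<^sup>+u\<in>{0..T}. ennreal ((simple_value (S n) u om - sg (X u om))\<^sup>2) \<partial>lborel) \<longlonglongrightarrow> 0) \<and>
        ((\<lambda>n. SUP r\<in>{0..T}. ennreal \<bar>simple_integral_wrt W (S n) r om -
            (X r om - x0 - (LINT u:{0..r}|lborel. \<beta> (X u om) * (sg (X u om))\<^sup>2))\<bar>) \<longlonglongrightarrow> 0))"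
begin

definition b where "b r om = \<beta> (X r om) * (sg (X r om))\<^sup>2"
definition a where "a r om = \<bar>b r om\<bar> + (sg (X r om))\<^sup>2"
definition e where "e \<eta> r om = exp (- \<eta> * (LINT u:{0..r}|lborel. a u om))"

lemma X_progressive: "progressive X"
  by (rule progressive_continuous) (auto intro: X_adapted X_continuous)

lemma b_progressive: "progressive b"
  unfolding b_def[abs_def] by (rule progressive_compose[OF X_progressive]) measurable

lemma a_progressive: "progressive a"
  unfolding a_def[abs_def] b_def by (rule progressive_compose[OF X_progressive]) measurable

lemma b_integrable: "om \<in> space M \<Longrightarrow> set_integrable lborel {0..T} (\<lambda>r. b r om)"
  unfolding b_def by (rule drift_integrable)

lemma a_nonneg: "0 \<le> a r om" by (simp add: a_def)

lemma a_integrable: "om \<in> space M \<Longrightarrow> set_integrable lborel {0..T} (\<lambda>r. a r om)"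
  unfolding a_def by (intro set_integral_add set_integrable_abs b_integrable sg_integrable)

lemma exp_progressive:
  assumes g: "progressive g" "\<And>om T. om \<in> space M \<Longrightarrow> set_integrable lborel {0..T} (\<lambda>r. g r om)"
    and w: "progressive w"
  shows "progressive (\<lambda>r om. exp (of_real (- \<eta> * (LINT x:{0..r}|lborel. g x om)) + \<i> * of_real (v * w r om)))"
proof (rule progressive_compose2[where f = "\<lambda>x y. exp (of_real (- \<eta> * x) + \<i> * of_real (v * y))"])
  show "progressive (\<lambda>r om. LINT x:{0..r}|lborel. g x om)"
  proof (rule progressive_continuous)
    show "(\<lambda>om. LINT x:{0..t}|lborel. g x om) \<in> borel_measurable (F t)" if "0 \<le> t" for t
      by (rule progressive_set_integral[OF g(1) that])
    fix om assume om: "om \<in> space M"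
    have "continuous_on {0..} (\<lambda>r. LINT x:{0..r}|lborel. complex_of_real (g x om))"
      by (intro set_integral_continuous_atLeast set_integrable_of_real g(2) om)
    from continuous_on_Re[OF this] show "continuous_on {0..} (\<lambda>t. LINT x:{0..t}|lborel. g x om)"
      unfolding set_integral_complex_of_real by simp
  qed
qed (rule w, measurable)

lemma a0: "0 \<le> (LINT x:{0..r}|lborel. a x om)"
  unfolding set_lebesgue_integral_def using a_nonneg by (intro Bochner_nonneg) auto

text \<open>\<open>simple_exp_identity\<close> holds for the approximating simple processes; the
  limit is taken along paths by \<open>path_limit\<close> and under the expectation by dominated
  convergence. The limiting exponent contains \<open>X - x0\<close>, and the constant factor
  \<open>iexp (v * x0)\<close> restores \<open>X\<close>.\<close>

lemma exp_identity_X: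
  fixes \<Phi> :: "'a \<Rightarrow> complex" and v s t \<eta> :: real
  assumes eta: "0 < \<eta>" and st: "0 \<le> s" "s \<le> t"
    and \<Phi>: "\<Phi> \<in> borel_measurable (F s)" "\<And>om. om \<in> space M \<Longrightarrow> cmod (\<Phi> om) \<le> 1"
  shows "(\<integral>om. \<Phi> om * (of_real (e \<eta> t om) * iexp (v * X t om)) \<partial>M) - (\<integral>om. \<Phi> om * (of_real (e \<eta> s om) * iexp (v * X s om)) \<partial>M)
    = (\<integral>om. \<Phi> om * (LINT r:{s..t}|lborel. (\<i> * of_real (v * b r om) - of_real (v\<^sup>2 / 2 * (sg (X r om))\<^sup>2) - of_real (\<eta> * a r om)) *
         (of_real (e \<eta> r om) * iexp (v * X r om))) \<partial>M)"
proof -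
  have t: "0 \<le> t" using st by simp
  obtain S where S: "\<And>n. simple_process M F (S n)" and lim: "AE om in M.
        ((\<lambda>n. \<integral>\<^sup>+u\<in>{0..t}. ennreal ((simple_value (S n) u om - sg (X u om))\<^sup>2) \<partial>lborel) \<longlonglongrightarrow> 0) \<and>
        ((\<lambda>n. SUP r\<in>{0..t}. ennreal \<bar>simple_integral_wrt W (S n) r om -
            (X r om - x0 - (LINT u:{0..r}|lborel. \<beta> (X u om) * (sg (X u om))\<^sup>2))\<bar>) \<longlonglongrightarrow> 0)"
    using ito[OF t] by blast
  define \<alpha> where "\<alpha> = (\<lambda>g r om. \<bar>b r om\<bar> + (g r om)\<^sup>2)"
  define \<kappa> where "\<kappa> = (\<lambda>g r om. \<i> * of_real (v * b r om) - of_real (v\<^sup>2 / 2 * (g r om)\<^sup>2) - of_real (\<eta> * \<alpha> g r om))"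
  define E where "E = (\<lambda>g w r om. exp (of_real (- \<eta> * (LINT x:{0..r}|lborel. \<alpha> g x om)) + \<i> * of_real (v * w r om)))"
  define u where "u = (\<lambda>n r om. (LINT u:{0..r}|lborel. b u om) + simple_integral_wrt W (S n) r om)"
  define u0 where "u0 = (\<lambda>r om. X r om - x0)"
  define H where "H = (\<lambda>r om. sg (X r om))"
  let ?f = "\<lambda>n. simple_value (S n)"
  let ?Ef = "\<lambda>n. E (?f n) (u n)"
  let ?dist = "\<lambda>n om. LINT r:{0..t}|lborel. (?f n r om - H r om)\<^sup>2"
  let ?If = "\<lambda>n om. LINT r:{s..t}|lborel. \<kappa> (?f n) r om * ?Ef n r om"
  let ?IH = "\<lambda>om. LINT r:{s..t}|lborel. \<kappa> H r om * E H u0 r om"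
  have id: "(\<integral>om. \<Phi> om * ?Ef n t om \<partial>M) - (\<integral>om. \<Phi> om * ?Ef n s om \<partial>M)
     = (\<integral>om. \<Phi> om * ?If n om \<partial>M)" for n unfolding \<kappa>_def E_def \<alpha>_def u_def
    by (rule simple_exp_identity[OF S b_progressive b_integrable eta st \<Phi>])
  have bc: "continuous_on {0..} (\<lambda>r. LINT x:{0..r}|lborel. b x om)" if "om \<in> space M" for om
  proof -
    have "continuous_on {0..} (\<lambda>r. LINT x:{0..r}|lborel. complex_of_real (b x om))"
      by (intro set_integral_continuous_atLeast set_integrable_of_real b_integrable that)
    from continuous_on_Re[OF this] show ?thesis unfolding set_integral_complex_of_real by simp
  qed
  have uc: "continuous_on {0..} (\<lambda>r. u n r om)" if "om \<in> space M" for om n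
    unfolding u_def by (intro continuous_on_add bc simple_integral_continuous S that)
  have u0c: "continuous_on {0..} (\<lambda>r. u0 r om)" if "om \<in> space M" for om
    unfolding u0_def by (intro continuous_on_diff X_continuous continuous_on_const that)
  have up: "progressive (u n)" for n
  proof (rule progressive_continuous[OF _ uc])
    fix r :: real assume "0 \<le> r"
    then show "u n r \<in> borel_measurable (F r)"
      unfolding u_def by (intro borel_measurable_add progressive_set_integral[OF b_progressive] simple_integral_measurable S)
  qed
  have u0p: "progressive u0" unfolding u0_def by (rule progressive_compose[OF X_progressive]) measurable
  have Hp: "progressive H" unfolding H_def by (rule progressive_compose[OF X_progressive]) measurable
  have \<alpha>p: "progressive (\<alpha> g)" if "progressive g" for g
    unfolding \<alpha>_def by (rule progressive_compose2[OF b_progressive that]) measurable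
  have \<kappa>p: "progressive (\<kappa> g)" if "progressive g" for g
    unfolding \<kappa>_def \<alpha>_def by (rule progressive_compose2[OF b_progressive that]) measurable
  have Ep: "progressive (E g w)" if "progressive g" "progressive w" "\<And>om T. om \<in> space M \<Longrightarrow> set_integrable lborel {0..T} (\<lambda>r. (g r om)\<^sup>2)" for g w
    unfolding E_def
    by (intro exp_progressive \<alpha>p that) (auto simp: \<alpha>_def intro!: set_integral_add set_integrable_abs b_integrable that)
  have KEp: "progressive (\<lambda>r om. \<kappa> g r om * E g w r om)" if "progressive g" "progressive w" "\<And>om T. om \<in> space M \<Longrightarrow> set_integrable lborel {0..T} (\<lambda>r. (g r om)\<^sup>2)" for g w
    by (rule progressive_compose2[OF \<kappa>p[OF that(1)] Ep[OF that]]) measurable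
  have Hi: "set_integrable lborel {0..T} (\<lambda>r. (H r om)\<^sup>2)" if "om \<in> space M" for om T unfolding H_def by (rule sg_integrable[OF that])
  have fh: "set_integrable lborel {0..t} (\<lambda>r. (?f n r om - H r om)\<^sup>2)" if om: "om \<in> space M" for n om
    unfolding set_integrable_def
  proof (rule Bochner_bound)
    have "set_integrable lborel {0..t} (\<lambda>r. 2 * (?f n r om)\<^sup>2 + 2 * (H r om)\<^sup>2)"
      by (intro set_integral_add set_integrable_mult_right simple_sq_integrable[OF S om] Hi om)
    then show "integrable lborel (\<lambda>r. indicator {0..t} r  *\<^sub>R (2 * (?f n r om)\<^sup>2 + 2 * (H r om)\<^sup>2))"
      unfolding set_integrable_def .
    have "continuous_on {0..t} (\<lambda>r. X r om)" using X_continuous[OF om] by (rule continuous_on_subset) auto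
    then have "(\<lambda>r. X r om) \<in> borel_measurable (restrict_space borel {0..t})" by (rule borel_measurable_continuous_on_restrict)
    from measurable_compose[OF this sg] have "(\<lambda>r. H r om) \<in> borel_measurable (restrict_space borel {0..t})" by (simp add: H_def)
    then have "(\<lambda>r. (?f n r om - H r om)\<^sup>2) \<in> borel_measurable (restrict_space borel {0..t})"
      using measurable_restrict_space1[OF simple_value_borel[of "S n" om]] by measurable
    then show "(\<lambda>r. indicator {0..t} r *\<^sub>R (?f n r om - H r om)\<^sup>2) \<in> borel_measurable lborel"
      by (subst (asm) borel_measurable_restrict_space_iff) auto
    have "(x - y)\<^sup>2 \<le> 2 * x\<^sup>2 + 2 * y\<^sup>2" for x y :: real
      using zero_le_power2[of "x + y"] by (simp add: power2_eq_square algebra_simps)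
    then show "AE r in lborel. norm (indicator {0..t} r *\<^sub>R (?f n r om - H r om)\<^sup>2) \<le> norm (indicator {0..t} r  *\<^sub>R (2 * (?f n r om)\<^sup>2 + 2 * (H r om)\<^sup>2))"
      by (intro AE_I2) (auto simp: indicator_def)
  qed
  have good: "AE om in M. (\<lambda>n. ?dist n om) \<longlonglongrightarrow> 0 \<and> (\<forall>r\<in>{0..t}. (\<lambda>n. u n r om) \<longlonglongrightarrow> u0 r om)"
    using lim AE_space
  proof eventually_elim
    case (elim om)
    note om = elim(2)
      have "(\<integral>\<^sup>+u\<in>{0..t}. ennreal ((?f n u om - sg (X u om))\<^sup>2) \<partial>lborel) = ennreal (?dist n om)" for n
      proof -
        have "(\<integral>\<^sup>+u\<in>{0..t}. ennreal ((?f n u om - sg (X u om))\<^sup>2) \<partial>lborel) = (\<integral>\<^sup>+u. ennreal (indicator {0..t} u *\<^sub>R (?f n u om - H u om)\<^sup>2) \<partial>lborel)"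
          by (intro nn_integral_cong) (auto simp: H_def indicator_def)
        also have "\<dots> = ennreal (?dist n om)" unfolding set_lebesgue_integral_def using fh[OF om, of n] unfolding set_integrable_def
          by (intro nn_integral_eq_integral) auto
        finally show ?thesis .
      qed
      with elim(1) have "(\<lambda>n. ennreal (?dist n om)) \<longlonglongrightarrow> ennreal 0" by simp
      then have 1: "(\<lambda>n. ?dist n om) \<longlonglongrightarrow> 0"
        by (subst (asm) tendsto_ennreal_iff) (auto simp: set_lebesgue_integral_def intro!: always_eventually Bochner_nonneg)
      have "(\<lambda>n. u n r om) \<longlonglongrightarrow> u0 r om" if r: "r \<in> {0..t}" for r
      proof -
        have "(\<lambda>n. ennreal \<bar>u n r om - u0 r om\<bar>) \<longlonglongrightarrow> 0"
        proof (rule tendsto_sandwich[OF _ _ tendsto_const conjunct2[OF elim(1)]])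
          show "\<forall>\<^sub>F n in sequentially. ennreal \<bar>u n r om - u0 r om\<bar> \<le> (SUP r\<in>{0..t}. ennreal \<bar>simple_integral_wrt W (S n) r om -
            (X r om - x0 - (LINT u:{0..r}|lborel. \<beta> (X u om) * (sg (X u om))\<^sup>2))\<bar>)"
          proof (intro always_eventually allI SUP_upper2[OF r])
            fix n
            show "ennreal \<bar>u n r om - u0 r om\<bar> \<le> ennreal \<bar>simple_integral_wrt W (S n) r om - (X r om - x0 - (LINT u:{0..r}|lborel. \<beta> (X u om) * (sg (X u om))\<^sup>2))\<bar>"
              by (simp add: u_def u0_def b_def algebra_simps)
          qed
        qed simp
        then have "(\<lambda>n. ennreal \<bar>u n r om - u0 r om\<bar>) \<longlonglongrightarrow> ennreal 0" by simp
        then have "(\<lambda>n. \<bar>u n r om - u0 r om\<bar>) \<longlonglongrightarrow> 0" by (subst (asm) tendsto_ennreal_iff) auto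
        then show ?thesis by (rule LIM_zero_cancel[OF tendsto_rabs_zero_cancel])
      qed
      with 1 show ?case by blast
  qed
  have conv: "(\<lambda>n. ?Ef n r om) \<longlonglongrightarrow> E H u0 r om" 
    if om: "om \<in> space M" and g: "(\<lambda>n. ?dist n om) \<longlonglongrightarrow> 0" "\<forall>r\<in>{0..t}. (\<lambda>n. u n r om) \<longlonglongrightarrow> u0 r om" and r: "r \<in> {0..t}" for om r
  proof -
    have c: "continuous_on {0..t} (\<lambda>r. u n r om)" "continuous_on {0..t} (\<lambda>r. u0 r om)" for n
      by (rule continuous_on_subset[OF uc[OF om]], simp) (rule continuous_on_subset[OF u0c[OF om]], simp)
    show ?thesis
      using path_limit(1)[OF st eta b_integrable[OF om] Hi[OF om] simple_sq_integrable[OF S om] fh[OF om] g(1) c g(2)[rule_format] r, of v]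
      by (simp only: E_def \<alpha>_def)
  qed
  have PL: "cmod (?Ef n r om) \<le> 1"
    "(\<lambda>n. ?If n om) \<longlonglongrightarrow> ?IH om"
    "cmod (?If n om) \<le> (\<bar>v\<bar> + v\<^sup>2 / 2 + \<eta>) / \<eta>"
    if om: "om \<in> space M" and g: "(\<lambda>n. ?dist n om) \<longlonglongrightarrow> 0" "\<forall>r\<in>{0..t}. (\<lambda>n. u n r om) \<longlonglongrightarrow> u0 r om" for om r n
  proof -
    have c: "continuous_on {0..t} (\<lambda>r. u n r om)" "continuous_on {0..t} (\<lambda>r. u0 r om)" for n
      by (rule continuous_on_subset[OF uc[OF om]], simp) (rule continuous_on_subset[OF u0c[OF om]], simp)
    show "cmod (?Ef n r om) \<le> 1"
      using path_limit(4)[OF st eta b_integrable[OF om] Hi[OF om] simple_sq_integrable[OF S om] fh[OF om] g(1) c g(2)[rule_format], where v = v and n = n and r = r]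
      by (simp only: E_def \<alpha>_def)
    show "(\<lambda>n. ?If n om) \<longlonglongrightarrow> ?IH om"
      using path_limit(2)[OF st eta b_integrable[OF om] Hi[OF om] simple_sq_integrable[OF S om] fh[OF om] g(1) c g(2)[rule_format], where v = v]
      by (simp only: E_def \<kappa>_def \<alpha>_def)
    show "cmod (?If n om) \<le> (\<bar>v\<bar> + v\<^sup>2 / 2 + \<eta>) / \<eta>"
      using path_limit(3)[OF st eta b_integrable[OF om] Hi[OF om] simple_sq_integrable[OF S om] fh[OF om] g(1) c g(2)[rule_format], where v = v and n = n]
      by (simp only: E_def \<kappa>_def \<alpha>_def)
  qed
  have EM: "?Ef n r \<in> borel_measurable M" "E H u0 r \<in> borel_measurable M" if "0 \<le> r" for r n
    using measurable_F_M[OF progressive_adapted[OF Ep[OF simple_value_progressive[OF S] up simple_sq_integrable[OF S]] that]]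
      measurable_F_M[OF progressive_adapted[OF Ep[OF Hp u0p Hi] that]] by auto
  have KM: "(\<lambda>om. ?If n om) \<in> borel_measurable M"
    "(\<lambda>om. ?IH om) \<in> borel_measurable M" for n
    using measurable_F_M[OF progressive_set_integral_Icc[OF KEp[OF simple_value_progressive[OF S] up simple_sq_integrable[OF S]] st(1) t]]
      measurable_F_M[OF progressive_set_integral_Icc[OF KEp[OF Hp u0p Hi] st(1) t]] by auto
  have \<Phi>M: "\<Phi> \<in> borel_measurable M" by (rule measurable_F_M[OF \<Phi>(1)])
  have L: "(\<lambda>n. \<integral>om. \<Phi> om * ?Ef n r om \<partial>M) \<longlonglongrightarrow> (\<integral>om. \<Phi> om * E H u0 r om \<partial>M)" if r: "r \<in> {0..t}" for r
  proof (rule integral_dominated_convergence[where w = "\<lambda>_. 1"])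
    show "(\<lambda>om. \<Phi> om * ?Ef n r om) \<in> borel_measurable M" "(\<lambda>om. \<Phi> om * E H u0 r om) \<in> borel_measurable M" for n
      using EM[of r] \<Phi>M r by (auto intro: borel_measurable_times)
    show "AE om in M. (\<lambda>n. \<Phi> om * ?Ef n r om) \<longlonglongrightarrow> \<Phi> om * E H u0 r om"
      using good AE_space by eventually_elim (rule tendsto_mult_left, rule conv, simp_all add: r[simplified])
    show "AE om in M. norm (\<Phi> om * ?Ef n r om) \<le> 1" for n using good AE_space
    proof eventually_elim
      case (elim om)
      then have "cmod (\<Phi> om) * cmod (?Ef n r om) \<le> 1 * 1" by (intro mult_mono \<Phi> PL(1)) auto
      then show ?case by (simp add: norm_mult)
    qed
  qed simp
  have R: "(\<lambda>n. \<integral>om. \<Phi> om * ?If n om \<partial>M)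
      \<longlonglongrightarrow> (\<integral>om. \<Phi> om * ?IH om \<partial>M)"
  proof (rule integral_dominated_convergence[where w = "\<lambda>_. (\<bar>v\<bar> + v\<^sup>2 / 2 + \<eta>) / \<eta>"])
    show "(\<lambda>om. \<Phi> om * ?If n om) \<in> borel_measurable M"
      "(\<lambda>om. \<Phi> om * ?IH om) \<in> borel_measurable M" for n using KM \<Phi>M by (auto intro: borel_measurable_times)
    show "AE om in M. (\<lambda>n. \<Phi> om * ?If n om) \<longlonglongrightarrow> \<Phi> om * ?IH om"
      using good AE_space by eventually_elim (rule tendsto_mult_left, rule PL(2), simp_all)
    show "AE om in M. norm (\<Phi> om * ?If n om) \<le> (\<bar>v\<bar> + v\<^sup>2 / 2 + \<eta>) / \<eta>" for n using good AE_space
    proof eventually_elim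
      case (elim om)
      then have "cmod (\<Phi> om) * cmod (?If n om) \<le> 1 * ((\<bar>v\<bar> + v\<^sup>2 / 2 + \<eta>) / \<eta>)"
        by (intro mult_mono \<Phi> PL(3)) auto
      then show ?case by (simp add: norm_mult)
    qed
  qed simp
  have lim_eq: "(\<integral>om. \<Phi> om * E H u0 t om \<partial>M) - (\<integral>om. \<Phi> om * E H u0 s om \<partial>M) = (\<integral>om. \<Phi> om * ?IH om \<partial>M)"
  proof (rule LIMSEQ_unique[OF _ R])
    show "(\<lambda>n. \<integral>om. \<Phi> om * ?If n om \<partial>M)
       \<longlonglongrightarrow> (\<integral>om. \<Phi> om * E H u0 t om \<partial>M) - (\<integral>om. \<Phi> om * E H u0 s om \<partial>M)"
      unfolding id[symmetric] by (intro tendsto_diff L) (use st in auto)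
  qed
  have EH: "of_real (e \<eta> r om) * iexp (v * X r om) = iexp (v * x0) * E H u0 r om" for r om
  proof -
    have "\<alpha> H r om = a r om" for r by (simp add: \<alpha>_def a_def H_def)
    then show ?thesis by (simp add: E_def e_def u0_def exp_of_real[symmetric] exp_add[symmetric] algebra_simps)
  qed
  have KH: "\<i> * of_real (v * b r om) - of_real (v\<^sup>2 / 2 * (sg (X r om))\<^sup>2) - of_real (\<eta> * a r om) = \<kappa> H r om" for r om
    by (simp add: \<kappa>_def \<alpha>_def a_def H_def)
  have 1: "(\<integral>om. \<Phi> om * (of_real (e \<eta> r om) * iexp (v * X r om)) \<partial>M) = iexp (v * x0) * (\<integral>om. \<Phi> om * E H u0 r om \<partial>M)" for r
    unfolding EH integral_mult_right_zero[symmetric] by (simp only: mult_ac)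
  have 2: "(\<integral>om. \<Phi> om * (LINT r:{s..t}|lborel. (\<i> * of_real (v * b r om) - of_real (v\<^sup>2 / 2 * (sg (X r om))\<^sup>2) - of_real (\<eta> * a r om)) *
         (of_real (e \<eta> r om) * iexp (v * X r om))) \<partial>M) = iexp (v * x0) * (\<integral>om. \<Phi> om * ?IH om \<partial>M)"
  proof -
    have "(LINT r:{s..t}|lborel. \<kappa> H r om * (iexp (v * x0) * E H u0 r om)) = iexp (v * x0) * ?IH om" for om
      unfolding set_integral_mult_right[symmetric] by (simp only: mult_ac)
    then show ?thesis unfolding EH KH integral_mult_right_zero[symmetric] by (simp only: mult_ac)
  qed
  show ?thesis unfolding 1 2 lim_eq[symmetric] by (simp only: right_diff_distrib)
qed

end

section \<open>The scale function yields a martingale\<close>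

context stopped_diffusion begin

lemma e_progressive: "progressive (e \<eta>)"
proof -
  have "progressive (\<lambda>r om. exp (of_real (- \<eta> * (LINT x:{0..r}|lborel. a x om)) + \<i> * of_real (0 * X r om)))"
    by (rule exp_progressive[OF a_progressive a_integrable X_progressive])
  from progressive_compose[OF this, of Re]
  have "progressive (\<lambda>r om. Re (exp (of_real (- \<eta> * (LINT x:{0..r}|lborel. a x om)) + \<i> * of_real (0 * X r om))))" by measurable
  moreover have "Re (exp (of_real (- \<eta> * (LINT x:{0..r}|lborel. a x om)) + \<i> * of_real (0 * X r om))) = e \<eta> r om" for r om
    by (simp only: e_def mult_zero_left of_real_0 mult_zero_right add_0_right exp_of_real Re_complex_of_real)
  ultimately show ?thesis by simp
qed

lemma e_bounds: "0 < \<eta> \<Longrightarrow> 0 < e \<eta> r om \<and> e \<eta> r om \<le> 1"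
  using a0[of r om] by (simp add: e_def)

lemma e_nonneg: "0 \<le> e \<eta> r om"
  by (simp add: e_def)

lemma e_decay:
  assumes "0 < \<eta>" "0 \<le> s" "s \<le> t" "om \<in> space M"
  shows "set_integrable lborel {s..t} (\<lambda>r. a r om * e \<eta> r om)" "(LINT r:{s..t}|lborel. a r om * e \<eta> r om) \<le> 1 / \<eta>"
  using exp_decay[OF a_integrable[OF assms(4)] a_nonneg assms(2,3,1)] by (auto simp: e_def)

context
  fixes sc rho :: "real \<Rightarrow> real" and s t K R :: real and G :: "'a set"
  assumes st: "0 \<le> s" "s \<le> t" and G: "G \<in> sets (F s)"
    and scm: "sc \<in> borel_measurable borel" and rhom: "rho \<in> borel_measurable borel"
    and scb: "\<And>x. x \<in> {A..B} \<Longrightarrow> \<bar>sc x\<bar> \<le> K" and rhob: "\<And>x. x \<in> {A..B} \<Longrightarrow> \<bar>rho x\<bar> \<le> R"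
    and rho: "\<And>x. x \<in> {A..B} \<Longrightarrow> rho x = rho A + (LINT w:{A..x}|lborel. - 2 * \<beta> w * rho w)"
    and sc: "\<And>x. x \<in> {A..B} \<Longrightarrow> sc x = sc A + (LINT w:{A..x}|lborel. rho w)"
begin

text \<open>At \<open>v = 0\<close> the exponential identity says that the mass lost to the discount
  between \<open>s\<close> and \<open>t\<close> is \<open>\<eta>\<close> times the integral of
  \<open>\<bar>\<beta>\<bar> + 1\<close> against \<open>\<nu>\<close>. The right side of
  \<open>scale_identity\<close> has this form with an additional factor \<open>sc\<close>, hence is
  at most \<open>K\<close> times the lost mass.\<close>

lemma scale_estimate:
  assumes eta: "0 < \<eta>"
  shows "\<bar>(\<integral>om. indicator G om * e \<eta> t om * sc (X t om) \<partial>M) - (\<integral>om. indicator G om * e \<eta> s om * sc (X s om) \<partial>M)\<bar>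
     \<le> K * ((\<integral>om. indicator G om * e \<eta> s om \<partial>M) - (\<integral>om. indicator G om * e \<eta> t om \<partial>M))"
proof -
  let ?I = "\<lambda>r. \<integral>om. indicator G om * e \<eta> r om \<partial>M"
  let ?Ge = "\<lambda>r om. indicator G om * e \<eta> r om"
  let ?MB = "M \<Otimes>\<^sub>M lborel"
  let ?\<beta>1 = "\<lambda>x. \<bar>\<beta> x\<bar> + 1"
  have t: "0 \<le> t" using st by simp
  have GM [measurable]: "G \<in> events" using G sets_F_subset by auto
  have eM [measurable]: "e \<eta> r \<in> borel_measurable M" if "0 \<le> r" for r
    by (rule measurable_F_M[OF progressive_adapted[OF e_progressive that]])
  have XM [measurable]: "X r \<in> borel_measurable M" if "0 \<le> r" for r by (rule measurable_F_M[OF X_adapted[OF that]])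
  note [measurable] = progressive_M[OF e_progressive[of \<eta>] t] progressive_M[OF X_progressive t] scm rhom
  interpret PL: pair_sigma_finite M lborel ..
  \<comment> \<open>Clamping makes \<open>Y\<close> and \<open>w\<close> jointly measurable and
    keeps \<open>Y\<close> in \<open>[A, B]\<close> at every real time; the indicator in
    \<open>w\<close> discards the times outside \<open>[s, t]\<close>.\<close>
  define cl where "cl r = max 0 (min r t)" for r
  have cl: "cl r = r" if "r \<in> {s..t}" for r using that st by (auto simp: cl_def)
  have cl0: "0 \<le> cl r" for r by (simp add: cl_def)
  define Y where "Y x = X (cl (snd x)) (fst x)" for x
  let ?\<beta>Y = "\<lambda>x. \<bar>\<beta> (Y x)\<bar> + 1"
  let ?\<beta>2 = "\<lambda>om r. \<bar>\<beta> (Y (om, r))\<bar> + 1"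
  define w where "w x = indicator G (fst x) * indicator {s..t} (snd x) * e \<eta> (cl (snd x)) (fst x) * (sg (Y x))\<^sup>2" for x
  have Ym [measurable]: "Y \<in> borel_measurable ?MB" unfolding Y_def[abs_def] cl_def by measurable
  have wm [measurable]: "w \<in> borel_measurable ?MB" unfolding w_def[abs_def] cl_def by measurable
  have w0: "0 \<le> w x" for x using e_nonneg by (auto simp: w_def intro!: mult_nonneg_nonneg)
  \<comment> \<open>\<open>\<bar>\<beta>\<bar> + 1\<close> times the squared volatility is the rate
    \<open>a\<close>, so \<open>e_decay\<close> bounds the integral along every path by
    \<open>1 / \<eta>\<close>.\<close>
  have key: "integrable ?MB (\<lambda>x. w x * ?\<beta>Y x)"
  proof (rule PL.Fubini_integrable)
    have in_eq: "w (om, r) * ?\<beta>2 om r = indicator G om * (indicator {s..t} r * (a r om * e \<eta> r om))" for om r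
      by (cases "r \<in> {s..t}") (auto simp: w_def Y_def cl a_def b_def abs_mult algebra_simps)
    show "(\<lambda>x. w x * ?\<beta>Y x) \<in> borel_measurable ?MB" by measurable
    show "AE om in M. integrable lborel (\<lambda>r. w (om, r) * ?\<beta>2 om r)"
      unfolding in_eq using e_decay(1)[OF eta st] by (intro AE_I2 integrable_mult_right) (simp add: set_integrable_def)
    show "integrable M (\<lambda>om. \<integral>r. norm (w (om, r) * ?\<beta>2 om r) \<partial>lborel)"
    proof (rule integrable_const_bound)
      show "(\<lambda>om. \<integral>r. norm (w (om, r) * ?\<beta>2 om r) \<partial>lborel) \<in> borel_measurable M" by measurable
      show "AE om in M. norm (\<integral>r. norm (w (om, r) * ?\<beta>2 om r) \<partial>lborel) \<le> 1 / \<eta>"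
      proof (rule AE_I2)
        fix om assume om: "om \<in> space M"
        have "(\<integral>r. norm (w (om, r) * ?\<beta>2 om r) \<partial>lborel) = (\<integral>r. indicator G om * (indicator {s..t} r * (a r om * e \<eta> r om)) \<partial>lborel)"
        proof (rule Bochner_cong[OF refl])
          fix r
          have "0 \<le> w (om, r) * ?\<beta>2 om r" using w0 by simp
          then show "norm (w (om, r) * ?\<beta>2 om r) = indicator G om * (indicator {s..t} r * (a r om * e \<eta> r om))"
            unfolding in_eq real_norm_def by (rule abs_of_nonneg)
        qed
        also have "\<dots> = indicator G om * (LINT r:{s..t}|lborel. a r om * e \<eta> r om)"
          unfolding set_lebesgue_integral_def integral_mult_right_zero real_scaleR_def ..
        finally have 1: "(\<integral>r. norm (w (om, r) * ?\<beta>2 om r) \<partial>lborel) = indicator G om * (LINT r:{s..t}|lborel. a r om * e \<eta> r om)" .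
        have "0 \<le> (LINT r:{s..t}|lborel. a r om * e \<eta> r om)" unfolding set_lebesgue_integral_def using a_nonneg e_nonneg
          by (intro Bochner_nonneg) (auto intro!: mult_nonneg_nonneg)
        then show "norm (\<integral>r. norm (w (om, r) * ?\<beta>2 om r) \<partial>lborel) \<le> 1 / \<eta>"
          unfolding 1 using e_decay(2)[OF eta st om] eta by (auto simp: indicator_def)
      qed
    qed
  qed
  define \<nu> where "\<nu> = distr (density ?MB (\<lambda>x. ennreal (w x))) borel Y"
  let ?N = "\<integral>x. \<bar>\<beta> x\<bar> + 1 \<partial>\<nu>"
  define \<pi> where "\<pi> r = distr (density M (\<lambda>om. ennreal (?Ge r om))) borel (X r)" for r
  have s\<nu>: "sets \<nu> = sets borel" by (simp add: \<nu>_def)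
  have s\<pi>: "sets (\<pi> r) = sets borel" for r by (simp add: \<pi>_def)
  have Yd [measurable]: "Y \<in> measurable (density ?MB (\<lambda>x. ennreal (w x))) borel" by simp
  have nuI: "(\<integral>x. f x \<partial>\<nu>) = (\<integral>x. w x *\<^sub>R f (Y x) \<partial>?MB)" if [measurable]: "f \<in> borel_measurable borel"
    for f :: "real \<Rightarrow> 'c::{banach, second_countable_topology}"
  proof -
    have "(\<integral>x. f x \<partial>\<nu>) = (\<integral>x. f (Y x) \<partial>density ?MB (\<lambda>x. ennreal (w x)))"
      unfolding \<nu>_def by (rule integral_distr[OF Yd that])
    also have "\<dots> = (\<integral>x. w x *\<^sub>R f (Y x) \<partial>?MB)" by (rule integral_density) (use w0 in auto)
    finally show ?thesis .
  qed
  have nui: "integrable \<nu> f \<longleftrightarrow> integrable ?MB (\<lambda>x. w x *\<^sub>R f (Y x))" if [measurable]: "f \<in> borel_measurable borel"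
    for f :: "real \<Rightarrow> 'c::{banach, second_countable_topology}"
  proof -
    have "integrable \<nu> f \<longleftrightarrow> integrable (density ?MB (\<lambda>x. ennreal (w x))) (\<lambda>x. f (Y x))"
      unfolding \<nu>_def by (rule integrable_distr_eq[OF Yd that])
    also have "\<dots> \<longleftrightarrow> integrable ?MB (\<lambda>x. w x *\<^sub>R f (Y x))" by (rule integrable_density) (use w0 in auto)
    finally show ?thesis .
  qed
  have nu_bound: "integrable ?MB (\<lambda>x. w x *\<^sub>R f (Y x))"
    if [measurable]: "f \<in> borel_measurable borel" and f: "\<And>x. norm (f x) \<le> C * ?\<beta>1 x"
    for f :: "real \<Rightarrow> 'c::{banach, second_countable_topology}" and C
  proof (rule Bochner_bound)
    show "integrable ?MB (\<lambda>x. C * (w x * ?\<beta>Y x))" using key by (rule integrable_mult_right)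
    show "AE x in M \<Otimes>\<^sub>M lborel. norm (w x *\<^sub>R f (Y x)) \<le> norm (C * (w x * ?\<beta>Y x))"
    proof (rule AE_I2)
      fix x
      have "w x * norm (f (Y x)) \<le> w x * (C * ?\<beta>Y x)" using f w0 by (intro mult_left_mono) auto
      also have "\<dots> \<le> \<bar>C * (w x * ?\<beta>Y x)\<bar>" by (simp add: mult_ac)
      finally show "norm (w x *\<^sub>R f (Y x)) \<le> norm (C * (w x * ?\<beta>Y x))" using w0[of x] by simp
    qed
  qed simp
  have piI: "(\<integral>x. f x \<partial>\<pi> r) = (\<integral>om. ?Ge r om *\<^sub>R f (X r om) \<partial>M)" if [measurable]: "f \<in> borel_measurable borel" and r: "0 \<le> r"
    for f :: "real \<Rightarrow> 'c::{banach, second_countable_topology}" and r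
  proof -
    have [measurable]: "X r \<in> borel_measurable M" "e \<eta> r \<in> borel_measurable M" using r XM eM by auto
    have "(\<integral>x. f x \<partial>\<pi> r) = (\<integral>om. f (X r om) \<partial>density M (\<lambda>om. ennreal (?Ge r om)))"
      unfolding \<pi>_def by (rule integral_distr) auto
    also have "\<dots> = (\<integral>om. ?Ge r om *\<^sub>R f (X r om) \<partial>M)"
      by (rule integral_density) (use e_nonneg in \<open>auto intro!: mult_nonneg_nonneg\<close>)
    finally show ?thesis .
  qed
  have f\<nu>: "finite_measure \<nu>"
  proof (rule finite_measureI)
    have "emeasure \<nu> (space \<nu>) = emeasure (density ?MB (\<lambda>x. ennreal (w x))) (space ?MB)"
      unfolding \<nu>_def by (simp add: emeasure_distr[OF Yd])
    also have "\<dots> = (\<integral>\<^sup>+x. ennreal (w x) * indicator (space ?MB) x \<partial>?MB)" by (rule emeasure_density) measurable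
    also have "\<dots> = (\<integral>\<^sup>+x. ennreal (w x) \<partial>?MB)" by (rule nn_integral_cong) simp
    also have "\<dots> < \<infinity>" using nu_bound[of "\<lambda>_. 1 :: real" 1] w0 by (simp add: integrable_iff_bounded)
    finally show "emeasure \<nu> (space \<nu>) \<noteq> \<infinity>" by simp
  qed
  have f\<pi>: "finite_measure (\<pi> r)" if "0 \<le> r" for r
  proof (rule finite_measureI)
    have [measurable]: "X r \<in> borel_measurable M" "e \<eta> r \<in> borel_measurable M" using that XM eM by auto
    have "emeasure (\<pi> r) (space (\<pi> r)) = emeasure (density M (\<lambda>om. ennreal (?Ge r om))) (space M)"
      unfolding \<pi>_def by (subst emeasure_distr) auto
    also have "\<dots> = (\<integral>\<^sup>+om. ennreal (?Ge r om) * indicator (space M) om \<partial>M)" by (rule emeasure_density) measurable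
    also have "\<dots> = (\<integral>\<^sup>+om. ennreal (?Ge r om) \<partial>M)" by (rule nn_integral_cong) simp
    also have "\<dots> \<le> (\<integral>\<^sup>+om. 1 \<partial>M)"
      using e_bounds[OF eta] by (intro nn_integral_mono) (auto simp: indicator_def)
    also have "\<dots> < \<infinity>" by (simp add: emeasure_space_1)
    finally show "emeasure (\<pi> r) (space (\<pi> r)) \<noteq> \<infinity>" by simp
  qed
  have G1: "(indicator G :: 'a \<Rightarrow> complex) \<in> borel_measurable (F s)" "\<And>om. om \<in> space M \<Longrightarrow> cmod (indicator G om) \<le> 1"
    using G by (auto simp: indicator_def)
  have id: "(\<integral>x. iexp (v * x) \<partial>\<pi> t) - (\<integral>x. iexp (v * x) \<partial>\<pi> s) =
       (\<integral>x. (\<i> * of_real (v * \<beta> x) - of_real (v\<^sup>2 / 2) - of_real (\<eta> * ?\<beta>1 x)) * iexp (v * x) \<partial>\<nu>)" for v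
  proof -
    define f where "f = (\<lambda>x. (\<i> * of_real (v * \<beta> x) - of_real (v\<^sup>2 / 2) - of_real (\<eta> * ?\<beta>1 x)) * iexp (v * x))"
    have fm [measurable]: "f \<in> borel_measurable borel" unfolding f_def by measurable
    have fb: "cmod (f x) \<le> (\<bar>v\<bar> + v\<^sup>2 / 2 + \<eta>) * ?\<beta>1 x" for x
      using norm_exponent_le[of \<eta> "\<beta> x" "?\<beta>1 x" 1 v] eta by (simp add: f_def norm_mult)
    have fi: "integrable ?MB (\<lambda>x. w x *\<^sub>R f (Y x))" by (rule nu_bound[OF fm fb])
    have "(\<integral>x. f x \<partial>\<nu>) = (\<integral>x. w x *\<^sub>R f (Y x) \<partial>?MB)" by (rule nuI[OF fm])
    also have "\<dots> = (\<integral>om. (\<integral>r. w (om, r) *\<^sub>R f (Y (om, r)) \<partial>lborel) \<partial>M)"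
      using PL.integral_fst'[OF fi] by simp
    also have "\<dots> = (\<integral>om. indicator G om * (LINT r:{s..t}|lborel. (\<i> * of_real (v * b r om) - of_real (v\<^sup>2 / 2 * (sg (X r om))\<^sup>2) - of_real (\<eta> * a r om)) *
         (of_real (e \<eta> r om) * iexp (v * X r om))) \<partial>M)"
    proof (rule Bochner_cong[OF refl])
      fix om
      have "w (om, r) *\<^sub>R f (Y (om, r)) = indicator G om * (indicator {s..t} r *\<^sub>R ((\<i> * of_real (v * b r om) - of_real (v\<^sup>2 / 2 * (sg (X r om))\<^sup>2) - of_real (\<eta> * a r om)) *
         (of_real (e \<eta> r om) * iexp (v * X r om))))" for r
      proof (cases "r \<in> {s..t}")
        case True
        have "\<bar>\<beta> (X r om) * (sg (X r om))\<^sup>2\<bar> = \<bar>\<beta> (X r om)\<bar> * (sg (X r om))\<^sup>2" by (simp add: abs_mult)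
        then show ?thesis using True unfolding w_def Y_def f_def a_def b_def fst_conv snd_conv cl[OF True]
          by (simp add: scaleR_conv_of_real algebra_simps indicator_def)
      qed (simp add: w_def)
      then show "(\<integral>r. w (om, r) *\<^sub>R f (Y (om, r)) \<partial>lborel) = indicator G om * (LINT r:{s..t}|lborel. (\<i> * of_real (v * b r om) - of_real (v\<^sup>2 / 2 * (sg (X r om))\<^sup>2) - of_real (\<eta> * a r om)) *
         (of_real (e \<eta> r om) * iexp (v * X r om)))" unfolding set_lebesgue_integral_def by (simp only: integral_mult_right_zero)
    qed
    also have "\<dots> = (\<integral>om. indicator G om * (of_real (e \<eta> t om) * iexp (v * X t om)) \<partial>M) - (\<integral>om. indicator G om * (of_real (e \<eta> s om) * iexp (v * X s om)) \<partial>M)"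
      by (rule exp_identity_X[OF eta st G1, symmetric])
    also have "\<dots> = (\<integral>x. iexp (v * x) \<partial>\<pi> t) - (\<integral>x. iexp (v * x) \<partial>\<pi> s)"
      using st t by (subst (1 2) piI) (auto simp: scaleR_conv_of_real mult.assoc indicator_def intro!: arg_cong2[where f = minus] Bochner_cong)
    finally show ?thesis unfolding f_def by simp
  qed
  have bnui: "integrable \<nu> \<beta>" unfolding nui[OF beta] by (rule nu_bound[of \<beta> 1]) simp_all
  have supp\<nu>: "AE x in \<nu>. x \<in> {A..B}" unfolding \<nu>_def
    by (subst AE_distr_iff[OF Yd]) (auto intro!: AE_I2 simp: Y_def space_pair_measure simp del: atLeastAtMost_iff intro: X_range cl0)
  have supp\<pi>: "AE x in \<pi> r. x \<in> {A..B}" if "0 \<le> r" for r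
  proof -
    have [measurable]: "X r \<in> borel_measurable M" using that XM by auto
    show ?thesis unfolding \<pi>_def by (subst AE_distr_iff) (auto intro!: AE_I2 simp del: atLeastAtMost_iff intro: X_range that)
  qed
  interpret W: weak_diffusion_identity A B \<eta> \<beta> \<nu> "\<pi> s" "\<pi> t"
    by (rule weak_diffusion_identity.intro[OF AB eta f\<nu> f\<pi>[OF st(1)] f\<pi>[OF t] s\<nu> s\<pi> s\<pi>
          supp\<nu> supp\<pi>[OF st(1)] supp\<pi>[OF t] beta bnui beta_integrable id])
  have R0: "0 \<le> R" using rhob[of A] AB by auto
  have psi1: "set_integrable lborel {A..B} (\<lambda>x. - 2 * \<beta> x * rho x)" unfolding set_integrable_def
  proof (rule Bochner_bound)
    show "integrable lborel (\<lambda>x. (2 * R) * (indicator {A..B} x *\<^sub>R \<beta> x))"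
      using beta_integrable unfolding set_integrable_def by (rule integrable_mult_right)
    have "\<bar>\<beta> x\<bar> * \<bar>rho x\<bar> \<le> R * \<bar>\<beta> x\<bar>" if "x \<in> {A..B}" for x
      using mult_left_mono[OF rhob[OF that], of "\<bar>\<beta> x\<bar>"] by (simp add: mult.commute)
    then show "AE x in lborel. norm (indicator {A..B} x *\<^sub>R (- 2 * \<beta> x * rho x)) \<le> norm ((2 * R) * (indicator {A..B} x *\<^sub>R \<beta> x))"
      using R0 by (intro AE_I2) (auto simp: indicator_def abs_mult)
  qed measurable
  have psi2: "integrable \<nu> (\<lambda>x. - 2 * \<beta> x * rho x)"
  proof (rule Bochner_bound)
    show "integrable \<nu> (\<lambda>x. (2 * R) * \<beta> x)" using bnui by (rule integrable_mult_right)
    show "(\<lambda>x. - 2 * \<beta> x * rho x) \<in> borel_measurable \<nu>" unfolding measurable_cong_sets[OF s\<nu> refl] by measurable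
    show "AE x in \<nu>. norm (- 2 * \<beta> x * rho x) \<le> norm ((2 * R) * \<beta> x)" using supp\<nu>
    proof eventually_elim
      case (elim x)
      then show ?case using mult_left_mono[OF rhob[OF elim], of "\<bar>\<beta> x\<bar>"] R0 by (simp add: mult.commute abs_mult)
    qed
  qed
  have SI: "(\<integral>x. sc x \<partial>\<pi> t) - (\<integral>x. sc x \<partial>\<pi> s) = - \<eta> * (\<integral>x. sc x * ?\<beta>1 x \<partial>\<nu>)"
    by (rule W.scale_identity[OF scm rhom psi1 psi2 rho sc])
  have b1: "integrable \<nu> (\<lambda>x. \<bar>\<beta> x\<bar> + 1)" by (subst nui, simp, rule nu_bound[of _ 1]) auto
  have scn: "\<bar>\<integral>x. sc x * ?\<beta>1 x \<partial>\<nu>\<bar> \<le> K * ?N"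
  proof -
    have le: "AE x in \<nu>. norm (sc x * ?\<beta>1 x) \<le> K * ?\<beta>1 x"
      using supp\<nu> by eventually_elim (auto simp: abs_mult intro!: mult_right_mono scb)
    have i: "integrable \<nu> (\<lambda>x. sc x * ?\<beta>1 x)"
    proof (rule Bochner_bound[OF integrable_mult_right[OF b1, of K]])
      show "(\<lambda>x. sc x * ?\<beta>1 x) \<in> borel_measurable \<nu>" unfolding measurable_cong_sets[OF s\<nu> refl] by measurable
      show "AE x in \<nu>. norm (sc x * ?\<beta>1 x) \<le> norm (K * ?\<beta>1 x)"
        using le by eventually_elim (erule order_trans, unfold real_norm_def, rule abs_ge_self)
    qed
    have "\<bar>\<integral>x. sc x * ?\<beta>1 x \<partial>\<nu>\<bar> \<le> (\<integral>x. norm (sc x * ?\<beta>1 x) \<partial>\<nu>)"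
      using integral_norm_bound[of \<nu> "\<lambda>x. sc x * ?\<beta>1 x"] by simp
    also have "\<dots> \<le> (\<integral>x. K * ?\<beta>1 x \<partial>\<nu>)"
      by (rule integral_mono_AE[OF integrable_norm[OF i] integrable_mult_right[OF b1] le])
    finally show ?thesis by (simp only: integral_mult_right_zero)
  qed
  have "complex_of_real (?I t - ?I s) = of_real (- \<eta> * ?N)"
  proof -
    have "(\<integral>x. (1::complex) \<partial>\<pi> t) - (\<integral>x. 1 \<partial>\<pi> s) = (\<integral>x. - of_real (\<eta> * ?\<beta>1 x) \<partial>\<nu>)"
      using id[of 0] by simp
    also have "(\<integral>x. - of_real (\<eta> * ?\<beta>1 x) \<partial>\<nu>) = complex_of_real (- (\<integral>x. \<eta> * ?\<beta>1 x \<partial>\<nu>))"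
      by (simp only: integral_minus integral_complex_of_real of_real_minus)
    finally have "(\<integral>x. (1::complex) \<partial>\<pi> t) - (\<integral>x. 1 \<partial>\<pi> s) = of_real (- \<eta> * ?N)"
      unfolding integral_mult_right_zero by simp
    moreover have "(\<integral>x. (1::complex) \<partial>\<pi> r) = of_real (?I r)" if "0 \<le> r" for r
    proof -
      have "(\<integral>x. (1::complex) \<partial>\<pi> r) = (\<integral>om. ?Ge r om *\<^sub>R 1 \<partial>M)" using that by (intro piI) auto
      also have "\<dots> = (\<integral>om. complex_of_real (?Ge r om) \<partial>M)" by (simp only: scaleR_conv_of_real mult_1_right)
      finally show ?thesis by (simp only: integral_complex_of_real)
    qed
    ultimately show ?thesis using st t by simp
  qed
  then have D: "?I t - ?I s = - \<eta> * ?N" by (simp only: of_real_eq_iff)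
  have "(\<integral>om. indicator G om * e \<eta> t om * sc (X t om) \<partial>M) - (\<integral>om. indicator G om * e \<eta> s om * sc (X s om) \<partial>M) = (\<integral>x. sc x \<partial>\<pi> t) - (\<integral>x. sc x \<partial>\<pi> s)"
    using st t by (simp add: piI)
  also have "\<bar>\<dots>\<bar> = \<eta> * \<bar>\<integral>x. sc x * ?\<beta>1 x \<partial>\<nu>\<bar>" unfolding SI using eta by (simp add: abs_mult)
  also have "\<dots> \<le> \<eta> * (K * ?N)" using scn eta by (intro mult_left_mono) auto
  also have "\<dots> = K * (\<eta> * ?N)" by simp
  also have "\<eta> * ?N = ?I s - ?I t" using D by simp
  finally show ?thesis .
qed

text \<open>As \<open>\<eta>\<close> tends to \<open>0\<close> the discounts tend to
  \<open>1\<close>, so no mass is lost in the limit and the bound of \<open>scale_estimate\<close>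
  vanishes.\<close>

theorem scale_martingale:
  "(\<integral>om. indicator G om * sc (X t om) \<partial>M) = (\<integral>om. indicator G om * sc (X s om) \<partial>M)"
proof -
  have t: "0 \<le> t" using st by simp
  have GM [measurable]: "G \<in> events" using G sets_F_subset by auto
  define \<eta> where "\<eta> n = 1 / real (Suc n)" for n
  have eta: "0 < \<eta> n" for n by (simp add: \<eta>_def)
  have eta0: "\<eta> \<longlonglongrightarrow> 0" unfolding \<eta>_def[abs_def] by (rule inverse_Suc_tendsto_0)
  let ?G1 = "\<integral>om. indicator G om * 1 \<partial>M"
  let ?e = "\<lambda>f n r om. indicator G om * e (\<eta> n) r om * f (X r om)"
  have lim: "(\<lambda>n. \<integral>om. ?e f n r om \<partial>M) \<longlonglongrightarrow> (\<integral>om. indicator G om * f (X r om) \<partial>M)"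
    if r: "0 \<le> r" and f [measurable]: "f \<in> borel_measurable borel" and fb: "\<And>x. x \<in> {A..B} \<Longrightarrow> \<bar>f x\<bar> \<le> C" for r f C
  proof (rule integral_dominated_convergence[where w = "\<lambda>_. C"])
    have [measurable]: "X r \<in> borel_measurable M" "e (\<eta> n) r \<in> borel_measurable M" for n
      using measurable_F_M[OF X_adapted[OF r]] measurable_F_M[OF progressive_adapted[OF e_progressive r]] by auto
    show "(\<lambda>om. ?e f n r om) \<in> borel_measurable M" "(\<lambda>om. indicator G om * f (X r om)) \<in> borel_measurable M" for n
      by measurable
    have "(\<lambda>n. e (\<eta> n) r om) \<longlonglongrightarrow> exp (- 0 * (LINT u:{0..r}|lborel. a u om))" for om
      unfolding e_def by (intro tendsto_exp tendsto_mult_right tendsto_minus eta0)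
    then have "(\<lambda>n. ?e f n r om) \<longlonglongrightarrow> indicator G om * 1 * f (X r om)" for om
      by (intro tendsto_mult_right tendsto_mult_left) simp
    then show "AE om in M. (\<lambda>n. ?e f n r om) \<longlonglongrightarrow> indicator G om * f (X r om)" by simp
    show "AE om in M. norm (?e f n r om) \<le> C" for n
    proof (rule AE_I2)
      fix om assume om: "om \<in> space M"
      have C: "\<bar>f (X r om)\<bar> \<le> C" by (rule fb[OF X_range[OF om r]])
      have "\<bar>indicator G om * e (\<eta> n) r om\<bar> * \<bar>f (X r om)\<bar> \<le> 1 * C"
        using e_bounds[OF eta[of n], of r om] C by (intro mult_mono) (auto simp: indicator_def)
      then show "norm (?e f n r om) \<le> C" by (simp add: abs_mult)
    qed
  qed simp
  have "(\<lambda>n. \<bar>(\<integral>om. ?e sc n t om \<partial>M) - (\<integral>om. ?e sc n s om \<partial>M)\<bar>)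
     \<longlonglongrightarrow> \<bar>(\<integral>om. indicator G om * sc (X t om) \<partial>M) - (\<integral>om. indicator G om * sc (X s om) \<partial>M)\<bar>"
    by (intro tendsto_rabs tendsto_diff lim[OF _ scm scb] t st)
  moreover have "(\<lambda>n. K * ((\<integral>om. indicator G om * e (\<eta> n) s om \<partial>M) - (\<integral>om. indicator G om * e (\<eta> n) t om \<partial>M)))
     \<longlonglongrightarrow> K * (?G1 - ?G1)"
    using lim[of s "\<lambda>_. 1" 1] lim[of t "\<lambda>_. 1" 1] st t by (intro tendsto_mult_left tendsto_diff) simp_all
  ultimately have "\<bar>(\<integral>om. indicator G om * sc (X t om) \<partial>M) - (\<integral>om. indicator G om * sc (X s om) \<partial>M)\<bar>
     \<le> K * (?G1 - ?G1)" by (rule LIMSEQ_le) (intro exI[of _ 0] allI impI scale_estimate eta)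
  then show ?thesis by simp
qed

end

end

text \<open>Borel-Cantelli for measurable covers of the exceptional sets, whose outer measures are
  small along the subsequence. One subsequence serves both sequences, because an integrand and its
  Ito integral must be approximated through the same simple processes.\<close>

lemma tendsto_0_in_prob_AE_subsequence:
  assumes X: "tendsto_0_in_prob M X" and Y: "tendsto_0_in_prob M Y"
  shows "\<exists>r :: nat \<Rightarrow> nat. AE om in M. (\<lambda>k. X (r k) om) \<longlonglongrightarrow> 0 \<and> (\<lambda>k. Y (r k) om) \<longlonglongrightarrow> 0"
proof -
  define \<epsilon> where "\<epsilon> k = ennreal ((1/2) ^ k)" for k :: nat
  have e0: "0 < \<epsilon> k" for k by (simp add: \<epsilon>_def)
  let ?o = "\<lambda>Z k. outer_measure_of M {om\<in>space M. \<epsilon> k < Z om} < \<epsilon> k"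
  have "\<forall>k. \<exists>n. ?o (X n) k \<and> ?o (Y n) k"
  proof
    fix k
    have "\<forall>\<^sub>F n in sequentially. ?o (X n) k"
      "\<forall>\<^sub>F n in sequentially. ?o (Y n) k" using X Y e0[of k] unfolding tendsto_0_in_prob_def by (auto intro: order_tendstoD(2))
    then have "\<forall>\<^sub>F n in sequentially. ?o (X n) k \<and> ?o (Y n) k" by (rule eventually_conj)
    then show "\<exists>n. ?o (X n) k \<and> ?o (Y n) k" by (auto dest: eventually_happens)
  qed
  from choice[OF this] obtain r where r:
    "\<And>k. ?o (X (r k)) k"
    "\<And>k. ?o (Y (r k)) k" by auto
  have conv: "AE om in M. (\<lambda>k. Z k om) \<longlonglongrightarrow> 0" if Z: "\<And>k. ?o (Z k) k" for Z :: "nat \<Rightarrow> 'a \<Rightarrow> ennreal"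
  proof -
    have "\<forall>k. \<exists>C. C \<in> sets M \<and> {om\<in>space M. \<epsilon> k < Z k om} \<subseteq> C \<and> emeasure M C < \<epsilon> k"
      using Z unfolding outer_measure_of_def by (auto simp: INF_less_iff)
    from choice[OF this] obtain C where C: "\<And>k. C k \<in> sets M" "\<And>k. {om\<in>space M. \<epsilon> k < Z k om} \<subseteq> C k" "\<And>k. emeasure M (C k) < \<epsilon> k"
      by auto
    have fin: "emeasure M (C k) < \<infinity>" for k using C(3)[of k] by (rule order_less_trans) (simp add: \<epsilon>_def)
    have "AE om in M. \<forall>\<^sub>F k in sequentially. om \<in> space M - C k"
    proof (rule borel_cantelli_AE1[OF C(1) fin])
      show "summable (\<lambda>k. measure M (C k))"
      proof (rule summable_comparison_test')
        show "summable (\<lambda>k. (1/2 :: real) ^ k)" by (rule summable_geometric) simp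
        fix k :: nat
        have "emeasure M (C k) = ennreal (measure M (C k))" using fin[of k] by (intro emeasure_eq_ennreal_measure) simp
        then show "norm (measure M (C k)) \<le> (1/2) ^ k" using C(3)[of k] by (simp add: \<epsilon>_def ennreal_less_iff)
      qed
    qed
    then show ?thesis
    proof eventually_elim
      case (elim om)
      have e: "\<epsilon> \<longlonglongrightarrow> 0"
        unfolding \<epsilon>_def[abs_def] ennreal_0[symmetric] by (intro tendsto_ennrealI LIMSEQ_power_zero) simp
      show ?case
      proof (rule tendsto_sandwich[OF _ _ tendsto_const e])
        show "\<forall>\<^sub>F k in sequentially. Z k om \<le> \<epsilon> k" using elim
        proof eventually_elim
          case (elim k)
          then show ?case using C(2)[of k] by (auto simp: not_less[symmetric])
        qed
      qed simp
    qed
  qed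
  from conv[OF r(1)] conv[OF r(2)]
  have "AE om in M. (\<lambda>k. X (r k) om) \<longlonglongrightarrow> 0 \<and> (\<lambda>k. Y (r k) om) \<longlonglongrightarrow> 0" by eventually_elim simp
  then show ?thesis by blast
qed

section \<open>Stopping a continuous process at its exit from an interval\<close>

locale exit_stopping = filtered_prob_space M F for M :: "'a measure" and F +
  fixes V :: "real \<Rightarrow> 'a \<Rightarrow> real" and a b :: real
  assumes V_continuous: "\<And>om. om \<in> space M \<Longrightarrow> continuous_on {0..} (\<lambda>t. V t om)"
    and V_adapted: "\<And>t. 0 \<le> t \<Longrightarrow> V t \<in> borel_measurable (F t)"
begin

definition \<tau> :: "'a \<Rightarrow> ereal" where "\<tau> om = exit_time (\<lambda>t om. ereal (V t om)) (ereal a) (ereal b) om"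

definition St :: "real \<Rightarrow> 'a \<Rightarrow> real" where "St t om = real_of_ereal (min (ereal t) (\<tau> om))"

lemma tau_nonneg: "0 \<le> \<tau> om"
  unfolding \<tau>_def exit_time_def by (rule Inf_greatest) auto

lemma before_tau: "0 \<le> v \<Longrightarrow> ereal v < \<tau> om \<Longrightarrow> V v om \<in> {a<..<b}"
proof (rule ccontr)
  assume v: "0 \<le> v" "ereal v < \<tau> om" "V v om \<notin> {a<..<b}"
  then have "\<tau> om \<le> ereal v" unfolding \<tau>_def exit_time_def by (intro Inf_lower imageI) auto
  with v(2) show False by simp
qed

text \<open>The times at which a continuous path is outside the open interval form a closed set, so
  the infimum is attained.\<close>

lemma at_tau:
  assumes om: "om \<in> space M" and fin: "\<tau> om < \<infinity>"
  obtains z where "0 \<le> z" "\<tau> om = ereal z" "V z om \<notin> {a<..<b}"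
proof -
  obtain z where z: "\<tau> om = ereal z" using fin tau_nonneg[of om] by (cases "\<tau> om") auto
  have z0: "0 \<le> z" using tau_nonneg[of om] z by simp
  define D where "D = {t. 0 \<le> t \<and> V t om \<notin> {a<..<b}}"
  have D: "D = {0..} \<inter> (\<lambda>t. V t om) -` ({..a} \<union> {b..})" unfolding D_def by auto
  have "closed D" unfolding D by (intro continuous_closed_preimage V_continuous om closed_Un closed_atMost closed_atLeast)
  have eqD: "\<tau> om = Inf (ereal ` D)" unfolding \<tau>_def exit_time_def D_def by (rule arg_cong[where f = "\<lambda>S. Inf (ereal ` S)"]) auto
  have ne: "D \<noteq> {}" using fin eqD by (auto simp: top_ereal_def)
  have bb: "bdd_below D" by (rule bdd_belowI[of _ 0]) (auto simp: D_def)
  have I: "Inf D \<in> D" using closed_contains_Inf[OF ne bb \<open>closed D\<close>] .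
  have "ereal (Inf D) = \<tau> om" unfolding eqD
  proof (rule antisym)
    show "ereal (Inf D) \<le> Inf (ereal ` D)" using cInf_lower[OF _ bb] by (auto intro!: Inf_greatest)
    show "Inf (ereal ` D) \<le> ereal (Inf D)" using I by (intro Inf_lower imageI)
  qed
  then have "z = Inf D" using z by simp
  with I z z0 that show ?thesis by (auto simp: D_def)
qed

lemma tau_gt_iff:
  assumes om: "om \<in> space M" and v: "0 \<le> v"
  shows "ereal v < \<tau> om \<longleftrightarrow> (\<forall>u\<in>{0..v}. V u om \<in> {a<..<b})"
proof
  assume "ereal v < \<tau> om"
  then show "\<forall>u\<in>{0..v}. V u om \<in> {a<..<b}" by (auto intro!: before_tau simp del: greaterThanLessThan_iff elim: order.strict_trans1[rotated])
next
  assume A: "\<forall>u\<in>{0..v}. V u om \<in> {a<..<b}"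
  show "ereal v < \<tau> om"
  proof (rule ccontr)
    assume "\<not> ereal v < \<tau> om"
    then have le: "\<tau> om \<le> ereal v" by simp
    then have "\<tau> om < \<infinity>" by (rule order.strict_trans1) simp
    from at_tau[OF om this] obtain z where z: "0 \<le> z" "\<tau> om = ereal z" "V z om \<notin> {a<..<b}" .
    then have "z \<in> {0..v}" using le by simp
    with A z(3) show False by blast
  qed
qed

text \<open>By compactness the path stays in the open interval on \<open>[0, v]\<close> iff it stays
  inside with some margin \<open>1 / Suc n\<close>. This closed condition can be tested at the
  countable dense set of times \<open>q k\<close>, all of which are at most
  \<open>v\<close>.\<close>

lemma tau_gt_measurable:
  assumes v: "0 \<le> v"
  shows "{om\<in>space M. ereal v < \<tau> om} \<in> sets (F v)"
proof -
  define q where "q k = v * max 0 (min 1 (real_of_rat k))" for k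
  have q: "0 \<le> q k" "q k \<le> v" for k using v by (auto simp: q_def intro!: mult_left_le mult_nonneg_nonneg)
  have iff: "(\<forall>u\<in>{0..v}. V u om \<in> {a<..<b}) \<longleftrightarrow> (\<exists>n. \<forall>k. a + 1 / real (Suc n) \<le> V (q k) om \<and> V (q k) om \<le> b - 1 / real (Suc n))"
    if om: "om \<in> space M" for om
  proof
    have c: "continuous_on {0..v} (\<lambda>t. V t om)" using V_continuous[OF om] by (rule continuous_on_subset) auto
    assume A: "\<forall>u\<in>{0..v}. V u om \<in> {a<..<b}"
    obtain x where x: "x \<in> {0..v}" "\<And>u. u \<in> {0..v} \<Longrightarrow> V x om \<le> V u om"
      using continuous_attains_inf[OF compact_Icc _ c] v by auto
    obtain y where y: "y \<in> {0..v}" "\<And>u. u \<in> {0..v} \<Longrightarrow> V u om \<le> V y om"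
      using continuous_attains_sup[OF compact_Icc _ c] v by auto
    have "0 < min (V x om - a) (b - V y om)" using A x(1) y(1) by auto
    from reals_Archimedean[OF this] obtain n where n: "1 / real (Suc n) < min (V x om - a) (b - V y om)" unfolding inverse_eq_divide by auto
    have "a + 1 / real (Suc n) \<le> V (q k) om \<and> V (q k) om \<le> b - 1 / real (Suc n)" for k
      using n x(2)[of "q k"] y(2)[of "q k"] q[of k] by auto
    then show "\<exists>n. \<forall>k. a + 1 / real (Suc n) \<le> V (q k) om \<and> V (q k) om \<le> b - 1 / real (Suc n)" by blast
  next
    assume "\<exists>n. \<forall>k. a + 1 / real (Suc n) \<le> V (q k) om \<and> V (q k) om \<le> b - 1 / real (Suc n)"
    then obtain n where n: "\<And>k. a + 1 / real (Suc n) \<le> V (q k) om" "\<And>k. V (q k) om \<le> b - 1 / real (Suc n)" by blast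
    show "\<forall>u\<in>{0..v}. V u om \<in> {a<..<b}"
    proof
      fix u assume u: "u \<in> {0..v}"
      define y where "y = (if v = 0 then 0 else u / v)"
      have "\<forall>i. \<exists>k. \<bar>real_of_rat k - y\<bar> < 1 / real (Suc i)"
      proof
        fix i
        obtain x where "x \<in> \<rat>" "\<bar>x - y\<bar> < 1 / real (Suc i)" by (rule rational_approximation[of "1 / real (Suc i)" y]) simp
        then show "\<exists>k. \<bar>real_of_rat k - y\<bar> < 1 / real (Suc i)" by (auto elim: Rats_cases)
      qed
      from choice[OF this] obtain k where k: "\<And>i. \<bar>real_of_rat (k i) - y\<bar> < 1 / real (Suc i)" by auto
      have p: "(\<lambda>i. real_of_rat (k i)) \<longlonglongrightarrow> y"
      proof (rule LIM_zero_cancel, rule Lim_null_comparison)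
        show "\<forall>\<^sub>F i in sequentially. norm (real_of_rat (k i) - y) \<le> 1 / real (Suc i)"
          using k by (intro always_eventually allI) (simp add: less_imp_le del: of_nat_Suc)
        show "(\<lambda>i. 1 / real (Suc i)) \<longlonglongrightarrow> 0" by (rule inverse_Suc_tendsto_0)
      qed
      have "(\<lambda>i. q (k i)) \<longlonglongrightarrow> v * max 0 (min 1 y)"
        unfolding q_def by (intro tendsto_mult_left tendsto_max tendsto_min tendsto_const p)
      moreover have "v * max 0 (min 1 y) = u" using u v by (auto simp: y_def max_def min_def field_simps)
      ultimately have "(\<lambda>i. q (k i)) \<longlonglongrightarrow> u" by simp
      then have "(\<lambda>i. V (q (k i)) om) \<longlonglongrightarrow> V u om"
        by (rule continuous_on_tendsto_compose[OF V_continuous[OF om]]) (use q u in auto)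
      then have "a + 1 / real (Suc n) \<le> V u om" "V u om \<le> b - 1 / real (Suc n)" using n by (auto intro: LIMSEQ_le_const LIMSEQ_le_const2)
      moreover have "0 < 1 / real (Suc n)" by simp
      ultimately show "V u om \<in> {a<..<b}" unfolding greaterThanLessThan_iff by linarith
    qed
  qed
  have "{om\<in>space M. ereal v < \<tau> om} = {om\<in>space (F v). \<exists>n. \<forall>k. a + 1 / real (Suc n) \<le> V (q k) om \<and> V (q k) om \<le> b - 1 / real (Suc n)}"
    using tau_gt_iff[OF _ v] iff by (auto simp: space_F)
  also have "\<dots> \<in> sets (F v)"
  proof -
    have [measurable]: "V (q k) \<in> borel_measurable (F v)" for k by (rule measurable_F_mono[OF q(2) V_adapted[OF q(1)]])
    show ?thesis by measurable
  qed
  finally show ?thesis .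
qed

lemma St_eq: "0 \<le> t \<Longrightarrow> ereal (St t om) = min (ereal t) (\<tau> om)"
  unfolding St_def using tau_nonneg[of om] by (cases "\<tau> om") (auto simp: min_def)

lemma St_bounds: "0 \<le> t \<Longrightarrow> 0 \<le> St t om \<and> St t om \<le> t"
proof -
  assume t: "0 \<le> t"
  have "0 \<le> ereal (St t om)" "ereal (St t om) \<le> ereal t" unfolding St_eq[OF t] using t tau_nonneg[of om] by auto
  then show ?thesis by simp
qed

lemma St_measurable:
  assumes t: "0 \<le> t" shows "St t \<in> borel_measurable (F t)"
proof (rule borel_measurableI_greater)
  fix y
  show "{om \<in> space (F t). y < St t om} \<in> sets (F t)"
  proof (cases "0 \<le> y \<and> y < t")
    case True
    have "y < St t om \<longleftrightarrow> ereal y < \<tau> om" for om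
    proof -
      have "y < St t om \<longleftrightarrow> ereal y < ereal (St t om)" by simp
      also have "\<dots> \<longleftrightarrow> ereal y < \<tau> om" unfolding St_eq[OF t] using True by simp
      finally show ?thesis .
    qed
    then have "{om \<in> space (F t). y < St t om} = {om\<in>space M. ereal y < \<tau> om}" by (simp add: space_F)
    also have "\<dots> \<in> sets (F t)" using tau_gt_measurable[of y] sets_F_mono[of y t] True by auto
    finally show ?thesis .
  next
    case False
    have "y < St t om \<longleftrightarrow> y < 0" for om using False St_bounds[OF t, of om] by linarith
    then have "{om \<in> space (F t). y < St t om} = (if y < 0 then space (F t) else {})" by simp
    then show ?thesis by simp
  qed
qed

lemma St_continuous: "continuous_on {0..} (\<lambda>t. St t om)"
proof (cases "\<tau> om")
  case (real z)
  then have "St t om = min t z" for t unfolding St_def by (auto simp: min_def)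
  then show ?thesis by (simp add: continuous_on_min continuous_on_id continuous_on_const)
next
  case PInf
  then have "St t om = t" for t unfolding St_def by (auto simp: min_def)
  then show ?thesis by (simp add: continuous_on_id)
qed (use tau_nonneg[of om] in auto)

definition X :: "real \<Rightarrow> 'a \<Rightarrow> real" where "X t om = V (St t om) om"

lemma X_continuous: "om \<in> space M \<Longrightarrow> continuous_on {0..} (\<lambda>t. X t om)"
  unfolding X_def by (rule continuous_on_compose2[OF V_continuous St_continuous]) (use St_bounds in auto)

lemma X_adapted:
  assumes t: "0 \<le> t" shows "X t \<in> borel_measurable (F t)"
proof -
  have "progressive V" by (rule progressive_continuous[OF V_adapted V_continuous])
  from progressiveD[OF this t] have "(\<lambda>(om, r). V (max 0 (min r t)) om) \<in> borel_measurable (F t \<Otimes>\<^sub>M borel)" .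
  moreover have "(\<lambda>om. (om, St t om)) \<in> measurable (F t) (F t \<Otimes>\<^sub>M borel)" using St_measurable[OF t] by measurable
  then have "(\<lambda>om. (\<lambda>(om, r). V (max 0 (min r t)) om) (om, St t om)) \<in> borel_measurable (F t)"
    by (rule measurable_compose) (rule calculation)
  then have "(\<lambda>om. V (max 0 (min (St t om) t)) om) \<in> borel_measurable (F t)" by simp
  moreover have "max 0 (min (St t om) t) = St t om" for om using St_bounds[OF t, of om] by simp
  ultimately show ?thesis by (simp add: X_def[abs_def])
qed

text \<open>Whether the exit has happened can be read off the stopped value, so coefficients that
  depend on the state alone can switch themselves off at the exit.\<close>

lemma X_in_iff:
  assumes om: "om \<in> space M" and t: "0 \<le> t"
  shows "X t om \<in> {a<..<b} \<longleftrightarrow> ereal t < \<tau> om"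
proof
  assume "ereal t < \<tau> om"
  then have "St t om = t" by (simp add: St_def)
  then show "X t om \<in> {a<..<b}" using before_tau[OF t \<open>ereal t < \<tau> om\<close>] by (simp add: X_def)
next
  assume X: "X t om \<in> {a<..<b}"
  show "ereal t < \<tau> om"
  proof (rule ccontr)
    assume "\<not> ereal t < \<tau> om"
    then have le: "\<tau> om \<le> ereal t" by simp
    then have "\<tau> om < \<infinity>" by (rule order.strict_trans1) simp
    from at_tau[OF om this] obtain z where z: "0 \<le> z" "\<tau> om = ereal z" "V z om \<notin> {a<..<b}" .
    then have "St t om = z" using le by (simp add: St_def min_def)
    then show False using X z(3) by (simp add: X_def)
  qed
qed

end

section \<open>The diffusion up to its exit from an interior interval\<close>

locale exiting_sde = filtered_prob_space M F for M :: "'a measure" and F +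
  fixes W :: "real \<Rightarrow> 'a \<Rightarrow> real" and Y :: "real \<Rightarrow> 'a \<Rightarrow> ereal" and l r :: ereal
    and \<mu> \<sigma> :: "real \<Rightarrow> real" and x0 :: real
  assumes bm: "brownian_motion M F W"
    and sde: "sde_solution_with_exit M F W \<mu> \<sigma> l r x0 Y"
    and mu_measurable: "\<mu> \<in> borel_measurable (restrict_space borel (einterval l r))"
    and sigma_measurable: "\<sigma> \<in> borel_measurable (restrict_space borel (einterval l r))"
    and sigma_nonzero: "\<And>x. x \<in> einterval l r \<Longrightarrow> \<sigma> x \<noteq> 0"
    and drift_ratio: "locally_integrable_on (\<lambda>x. \<mu> x / (\<sigma> x)\<^sup>2) (einterval l r)"
    and x0: "x0 \<in> einterval l r"
begin

text \<open>The purely pathwise requirements on a solution, collected so that one null set can be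
  removed for all of them.\<close>

definition good :: "'a \<Rightarrow> bool" where
  "good om \<longleftrightarrow> Y 0 om = ereal x0 \<and> continuous_on {t. 0 \<le> t \<and> ereal t < exit_time Y l r om} (\<lambda>t. Y t om) \<and>
     (exit_time Y l r om < \<infinity> \<longrightarrow>
        (\<exists>e\<in>{l, r}. exits_through Y l r e om \<and> (\<forall>t. exit_time Y l r om \<le> ereal t \<longrightarrow> Y t om = e)))"

lemma AE_good: "AE om in M. good om"
proof -
  have "AE om in M. Y 0 om = ereal x0"
    "AE om in M. continuous_on {t. 0 \<le> t \<and> ereal t < exit_time Y l r om} (\<lambda>t. Y t om)"
    "AE om in M. exit_time Y l r om < \<infinity> \<longrightarrow>
        (\<exists>e\<in>{l, r}. exits_through Y l r e om \<and> (\<forall>t. exit_time Y l r om \<le> ereal t \<longrightarrow> Y t om = e))"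
    using sde unfolding sde_solution_with_exit_def by auto
  then show ?thesis unfolding good_def by eventually_elim blast
qed

lemma exit_time_nonneg: "0 \<le> exit_time Y a b om"
  unfolding exit_time_def by (rule Inf_greatest) auto

lemma good_exit_pos:
  assumes g: "good om" and fin: "exit_time Y l r om < \<infinity>"
  obtains z where "0 < z" "exit_time Y l r om = ereal z"
proof -
  obtain z where z: "exit_time Y l r om = ereal z" using fin exit_time_nonneg[of l r om] by (cases "exit_time Y l r om") auto
  have "z \<noteq> 0"
  proof
    assume "z = 0"
    then have "Y 0 om \<in> {l, r}" using g fin z unfolding good_def by (auto simp: zero_ereal_def)
    moreover have "Y 0 om = ereal x0" using g by (simp add: good_def)
    ultimately show False using x0 by (auto simp: einterval_def)
  qed
  moreover have "0 \<le> z" using exit_time_nonneg[of l r om] z by simp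
  ultimately show ?thesis using that z by simp
qed

text \<open>Absorption at the limit point makes the extended real path continuous through the exit
  time as well.\<close>

lemma good_continuous:
  assumes g: "good om" shows "continuous_on {0..} (\<lambda>t. Y t om)"
proof (cases "exit_time Y l r om < \<infinity>")
  case False
  then have "{t. 0 \<le> t \<and> ereal t < exit_time Y l r om} = {0..}" by auto
  then show ?thesis using g unfolding good_def by simp
next
  case True
  then obtain z where z: "0 < z" "exit_time Y l r om = ereal z" using good_exit_pos[OF g] by blast
  obtain e where e: "((\<lambda>t. Y t om) \<longlongrightarrow> e) (at_left z)" "\<And>t. z \<le> t \<Longrightarrow> Y t om = e"
    using g True z unfolding good_def exits_through_def by auto
  have c: "continuous_on {0..<z} (\<lambda>t. Y t om)"
  proof -
    have "{t. 0 \<le> t \<and> ereal t < exit_time Y l r om} = {0..<z}" using z by auto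
    then show ?thesis using g unfolding good_def by simp
  qed
  show ?thesis unfolding continuous_on_def
  proof
    fix t :: real assume t: "t \<in> {0..}"
    consider "t < z" | "t = z" | "z < t" by linarith
    then show "((\<lambda>t. Y t om) \<longlongrightarrow> Y t om) (at t within {0..})"
    proof cases
      case 1
      then have "((\<lambda>t. Y t om) \<longlongrightarrow> Y t om) (at t within {0..<z})" using c t unfolding continuous_on_def by auto
      moreover have "at t within {0..<z} = at t within {0..}" by (rule at_within_nhd[of _ "{..<z}"]) (use 1 in auto)
      ultimately show ?thesis by simp
    next
      case 2
      have "((\<lambda>t. Y t om) \<longlongrightarrow> e) (at_right z)"
        by (rule tendsto_eventually) (auto simp: eventually_at_right_field e(2) intro!: exI[of _ "z + 1"])
      with e(1) have "((\<lambda>t. Y t om) \<longlongrightarrow> e) (at z)" by (rule filterlim_split_at)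
      then show ?thesis using 2 e(2)[of z] by (auto intro: tendsto_within_subset)
    next
      case 3
      have "\<forall>\<^sub>F u in at t within {0..}. Y u om = Y t om"
        unfolding eventually_at_topological using 3 e(2) by (intro exI[of _ "{z<..}"]) auto
      then show ?thesis by (rule tendsto_eventually)
    qed
  qed
qed

lemma subinterval: "l < ereal a \<Longrightarrow> ereal b < r \<Longrightarrow> {a..b} \<subseteq> einterval l r"
  by (auto simp: einterval_def intro: less_le_trans[of l "ereal a"] le_less_trans[of _ "ereal b" r])

text \<open>The drift is divided by the squared volatility, in accordance with the parameter
  \<open>\<beta>\<close> of \<open>stopped_diffusion\<close>. Here and in \<open>vol\<close> the
  cut-off outside the open interval turns stopping into a property of the coefficients.\<close>

definition drift :: "real \<Rightarrow> real \<Rightarrow> real \<Rightarrow> real" where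
  "drift a b x = indicator {a<..<b} x * (\<mu> x / (\<sigma> x)\<^sup>2)"

definition vol :: "real \<Rightarrow> real \<Rightarrow> real \<Rightarrow> real" where
  "vol a b x = indicator {a<..<b} x * \<sigma> x"

lemma restrict_indicator_measurable:
  fixes f :: "real \<Rightarrow> real" and a b :: real
  assumes f: "f \<in> borel_measurable (restrict_space borel (einterval l r))" and ab: "l < ereal a" "ereal b < r"
  shows "(\<lambda>x. indicator {a<..<b} x * f x) \<in> borel_measurable (borel :: real measure)"
proof -
  have "(\<lambda>x. indicator (einterval l r) x *\<^sub>R f x) \<in> borel_measurable borel"
    using f by (subst (asm) borel_measurable_restrict_space_iff) auto
  then have "(\<lambda>x. indicator {a<..<b} x * (indicator (einterval l r) x *\<^sub>R f x)) \<in> borel_measurable borel" by measurable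
  moreover have "indicator {a<..<b} x * (indicator (einterval l r) x *\<^sub>R f x) = indicator {a<..<b} x * f x" for x
    using subinterval[OF ab] by (cases "x \<in> {a<..<b}") (auto simp: subset_eq)
  ultimately show ?thesis by (simp only: )
qed

lemma vol_measurable: "l < ereal a \<Longrightarrow> ereal b < r \<Longrightarrow> vol a b \<in> borel_measurable borel"
  unfolding vol_def[abs_def] by (rule restrict_indicator_measurable[OF sigma_measurable])

lemma drift_measurable: "l < ereal a \<Longrightarrow> ereal b < r \<Longrightarrow> drift a b \<in> borel_measurable borel"
  unfolding drift_def[abs_def]
  using mu_measurable sigma_measurable by (intro restrict_indicator_measurable borel_measurable_divide borel_measurable_power)

lemma drift_set_integrable:
  assumes "l < ereal a" "ereal b < r" shows "set_integrable lborel {a..b} (drift a b)"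
proof -
  have "set_integrable lborel {a..b} (\<lambda>x. \<mu> x / (\<sigma> x)\<^sup>2)"
    using drift_ratio subinterval[OF assms] unfolding locally_integrable_on_def by blast
  then have "set_integrable lborel {a<..<b} (\<lambda>x. \<mu> x / (\<sigma> x)\<^sup>2)" by (rule set_integrable_subset) auto
  moreover have "indicator {a..b} x *\<^sub>R drift a b x = indicator {a<..<b} x *\<^sub>R (\<mu> x / (\<sigma> x)\<^sup>2)" for x
    by (auto simp: drift_def indicator_def)
  ultimately show ?thesis unfolding set_integrable_def by simp
qed

lemma drift_vol: "l < ereal a \<Longrightarrow> ereal b < r \<Longrightarrow> drift a b x * (vol a b x)\<^sup>2 = indicator {a<..<b} x * \<mu> x"
  using sigma_nonzero[of x] subinterval[of a b] by (cases "x \<in> {a<..<b}") (auto simp: drift_def vol_def subset_eq)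

text \<open>All almost sure properties fail at most on one null set \<open>N\<close>. There the
  process is replaced by the constant \<open>a\<close>, where both coefficients vanish; off
  \<open>N\<close> the path is clamped to \<open>[a, b]\<close> and then stopped. The path
  properties demanded by \<open>stopped_diffusion\<close> then hold at every point, with respect to
  the augmented filtration.\<close>

lemma stopped_diffusion_exists:
  assumes ab: "l < ereal a" "a < x0" "x0 < b" "ereal b < r"
  obtains N W' X where "N \<in> null_sets M" "\<And>om. om \<in> space M - N \<Longrightarrow> good om"
    "stopped_diffusion M (augment M F) W' X a b x0 (drift a b) (vol a b)"
    "\<And>om t. om \<in> space M - N \<Longrightarrow> 0 \<le> t \<Longrightarrow> ereal (X t om) = Y (real_of_ereal (min (ereal t) (exit_time Y a b om))) om"
proof -
  define \<tau>Y where "\<tau>Y = exit_time Y (ereal a) (ereal b)"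
  define y where "y = (\<lambda>t om. real_of_ereal (Y t om))"
  let ?q = "\<lambda>u om. \<bar>\<mu> (y u om)\<bar> + (\<sigma> (y u om))\<^sup>2" and ?m = "\<lambda>t om. min (ereal t) (\<tau>Y om)"
  let ?fin = "\<lambda>t om. (\<integral>\<^sup>+u\<in>einterval 0 (?m t om). ennreal (?q u om) \<partial>lborel) < \<infinity>"
    and ?ito = "has_ito_integral M F W (\<lambda>u om. if ereal u < \<tau>Y om then \<sigma> (y u om) else 0)"
    and ?sol = "\<lambda>I t om. Y (real_of_ereal (?m t om)) om = ereal (x0 + (LBINT u=0..?m t om. \<mu> (y u om)) + I t om)"
  have aeI: "AE om in M. \<forall>t\<ge>0. ?fin t om" and Iex: "\<exists>I. ?ito I \<and> (AE om in M. \<forall>t\<ge>0. ?sol I t om)"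
    using sde ab unfolding sde_solution_with_exit_def Let_def \<tau>Y_def y_def by auto
  obtain I where I: "?ito I" "AE om in M. \<forall>t\<ge>0. ?sol I t om" using Iex by blast
  let ?ok = "\<lambda>om. good om \<and> continuous_on {0..} (\<lambda>t. W t om) \<and> (\<forall>t\<ge>0. ?fin t om) \<and> (\<forall>t\<ge>0. ?sol I t om)"
  have aeW: "AE om in M. continuous_on {0..} (\<lambda>t. W t om)" using bm by (auto simp: brownian_motion_def)
  have "AE om in M. ?ok om" using AE_good aeW aeI I(2) by eventually_elim simp
  then obtain N where N0: "{om\<in>space M. \<not> ?ok om} \<subseteq> N" "emeasure M N = 0" "N \<in> sets M" by (rule AE_E)
  then have N: "N \<in> null_sets M" by auto
  have ok: "good om" "continuous_on {0..} (\<lambda>t. W t om)"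
     "\<And>t. 0 \<le> t \<Longrightarrow> ?fin t om" "\<And>t. 0 \<le> t \<Longrightarrow> ?sol I t om"
    if "om \<in> space M - N" for om using N0(1) that by auto
  \<comment> \<open>Clamping changes nothing up to the exit from \<open>(a, b)\<close>, but it
    yields a real-valued path with the same exit time.\<close>
  define clamp where "clamp = (\<lambda>v :: ereal. real_of_ereal (max (ereal a) (min (ereal b) v)))"
  have a_b: "a < b" using ab by simp
  have clamp_range: "clamp v \<in> {a..b}" for v using a_b by (cases v) (auto simp: clamp_def max_def min_def)
  have clamp_in: "clamp v \<in> {a<..<b} \<longleftrightarrow> v \<in> {ereal a<..<ereal b}" for v using a_b by (cases v) (auto simp: clamp_def max_def min_def)
  have clamp_id: "ereal (clamp v) = v" if "v \<in> {ereal a..ereal b}" for v using that by (cases v) (auto simp: clamp_def max_def min_def)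
  define V where "V = (\<lambda>t om. if om \<in> N then a else clamp (Y t om))"
  have VN: "V t om = a" if "om \<in> N" for t om using that by (simp add: V_def)
  have VY: "V t om = clamp (Y t om)" if "om \<notin> N" for t om using that by (simp add: V_def)
  define W' where "W' = (\<lambda>t om. if om \<in> N then 0 else W t om)"
  interpret A: filtered_prob_space M "augment M F" by (rule filtered_prob_space_augment)
  interpret S: exit_stopping M "augment M F" V a b
  proof
    show "V t \<in> borel_measurable (augment M F t)" if "0 \<le> t" for t
    proof -
      have "Y t \<in> borel_measurable (F t)" using sde that by (auto simp: sde_solution_with_exit_def adapted_def)
      then have "(\<lambda>om. clamp (Y t om)) \<in> borel_measurable (F t)" unfolding clamp_def by measurable
      from augment_measurable[OF this N] show ?thesis by (simp add: V_def)
    qed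
    fix om assume om: "om \<in> space M"
    show "continuous_on {0..} (\<lambda>t. V t om)"
    proof (cases "om \<in> N")
      case True then show ?thesis by (simp add: V_def)
    next
      case False
      then have "continuous_on {0..} (\<lambda>t. Y t om)" using good_continuous ok(1) om by blast
      then have "continuous_on {0..} (\<lambda>t. max (ereal a) (min (ereal b) (Y t om)))" by (intro continuous_intros)
      then have "continuous_on {0..} (\<lambda>t. clamp (Y t om))"
        unfolding clamp_def by (rule continuous_on_compose2[OF continuous_on_real]) (auto simp: max_def min_def)
      then show ?thesis using False by (simp add: V_def)
    qed
  qed
  have V_range: "V t om \<in> {a..b}" for t om using clamp_range a_b by (auto simp: V_def)
  have X_range: "S.X t om \<in> {a..b}" for t om unfolding S.X_def by (rule V_range)
  have tau: "S.\<tau> om = \<tau>Y om" if "om \<in> space M - N" for om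
  proof -
    have "ereal (V t om) \<in> {ereal a<..<ereal b} \<longleftrightarrow> Y t om \<in> {ereal a<..<ereal b}" for t
      using that clamp_in[of "Y t om"] by (simp add: VY)
    then show ?thesis unfolding S.\<tau>_def \<tau>Y_def exit_time_def by simp
  qed
  have XN: "S.X t om = a" if "om \<in> N" for t om using that by (simp add: S.X_def VN)
  have X_before: "S.X u om = y u om \<and> y u om \<in> {a<..<b}" if om: "om \<in> space M - N" and u: "0 \<le> u" "ereal u < \<tau>Y om" for u om
  proof -
    have "V u om \<in> {a<..<b}" using S.before_tau[OF u(1)] tau[OF om] u by simp
    then have "Y u om \<in> {ereal a<..<ereal b}" using om clamp_in by (simp add: VY)
    then have "ereal (V u om) = Y u om" using om clamp_id[of "Y u om"] by (simp add: VY less_imp_le)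
    then have "V u om = y u om" unfolding y_def by (metis real_of_ereal.simps(1))
    moreover have "S.St u om = u" using u tau[OF om] by (simp add: S.St_def)
    ultimately show ?thesis using \<open>V u om \<in> {a<..<b}\<close> by (simp add: S.X_def)
  qed
  have X_after: "S.X u om \<notin> {a<..<b}" if om: "om \<in> space M - N" and u: "0 \<le> u" "\<not> ereal u < \<tau>Y om" for u om
    using S.X_in_iff[of om u] tau[OF om] om u by simp
  have XY: "ereal (S.X t om) = Y (real_of_ereal (?m t om)) om" if om: "om \<in> space M - N" and t: "0 \<le> t" for t om
  proof -
    have omM: "om \<in> space M" "om \<notin> N" using om by auto
    have St: "S.St t om = real_of_ereal (?m t om)" by (simp add: S.St_def tau[OF om])
    have "Y (S.St t om) om \<in> {ereal a..ereal b}"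
    proof (cases "ereal (S.St t om) < \<tau>Y om")
      case True
      have "V (S.St t om) om \<in> {a<..<b}" using S.before_tau[of "S.St t om" om] S.St_bounds[OF t] True tau[OF om] by simp
      then show ?thesis using clamp_in[of "Y (S.St t om) om"] omM by (auto simp: VY less_imp_le)
    next
      case False
      then have z: "\<tau>Y om = ereal (S.St t om)" using S.St_eq[OF t, of om] tau[OF om] by (auto simp: min_def split: if_splits)
      \<comment> \<open>At the exit time the value of \<open>Y\<close> lies in \<open>[a, b]\<close>
        as the limit of the values at the earlier times \<open>v n\<close>; such times exist because
        the path starts inside, so that \<open>0 < z\<close>.\<close>
      define z where "z = S.St t om"
      have "V 0 om = x0" using ok(1)[OF om] omM ab clamp_id[of "ereal x0"] by (simp add: VY good_def)
      then have "ereal 0 < S.\<tau> om" using S.tau_gt_iff[OF omM(1), of 0] ab by simp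
      then have z0: "0 < z" using z tau[OF om] by (simp add: z_def)
      define v where "v n = z * (1 - 1 / real (Suc n))" for n
      have v: "0 \<le> v n" "v n < z" for n using z0 by (auto simp: v_def field_simps)
      have "v \<longlonglongrightarrow> z * (1 - 0)"
        unfolding v_def[abs_def] by (intro tendsto_mult_left tendsto_diff tendsto_const inverse_Suc_tendsto_0)
      then have "v \<longlonglongrightarrow> z" by simp
      then have lim: "(\<lambda>n. Y (v n) om) \<longlonglongrightarrow> Y z om"
        by (rule continuous_on_tendsto_compose[OF good_continuous[OF ok(1)[OF om]]]) (use v z0 in auto)
      have "Y (v n) om \<in> {ereal a<..<ereal b}" for n
      proof -
        have "V (v n) om \<in> {a<..<b}" using S.before_tau[OF v(1)[of n], of om] v(2)[of n] z tau[OF om] by (simp add: z_def)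
        then show ?thesis using clamp_in[of "Y (v n) om"] omM by (simp add: VY)
      qed
      then have "ereal a \<le> Y (v n) om" "Y (v n) om \<le> ereal b" for n by (auto simp: less_imp_le)
      then show ?thesis using lim unfolding z_def[symmetric] by (auto intro: LIMSEQ_le_const LIMSEQ_le_const2)
    qed
    then have "ereal (V (S.St t om) om) = Y (S.St t om) om" using clamp_id omM by (simp add: VY)
    then show ?thesis by (simp add: S.X_def St)
  qed
  have path_meas: "(\<lambda>u. indicator {0..T} u * f (S.X u om)) \<in> borel_measurable lborel"
    if om: "om \<in> space M" and f: "f \<in> borel_measurable borel" for f :: "real \<Rightarrow> real" and T om
  proof -
    have "continuous_on {0..T} (\<lambda>u. S.X u om)" using S.X_continuous[OF om] by (rule continuous_on_subset) auto
    then have "(\<lambda>u. S.X u om) \<in> borel_measurable (restrict_space borel {0..T})" by (rule borel_measurable_continuous_on_restrict)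
    from measurable_compose[OF this f] show ?thesis by (subst (asm) borel_measurable_restrict_space_iff) auto
  qed
  \<comment> \<open>The integrability in the equation concerns the open interval from
    \<open>0\<close> to the smaller of \<open>T\<close> and the exit time. Up to two points it
    contains every time in \<open>[0, T]\<close> at which \<open>f\<close> of the stopped process is
    nonzero.\<close>
  have path_integrable: "set_integrable lborel {0..T} (\<lambda>u. f (S.X u om))"
    if om: "om \<in> space M" and f: "f \<in> borel_measurable borel"
      and f1: "\<And>x. x \<in> {a<..<b} \<Longrightarrow> \<bar>f x\<bar> \<le> \<bar>\<mu> x\<bar> + (\<sigma> x)\<^sup>2" and f0: "\<And>x. x \<notin> {a<..<b} \<Longrightarrow> f x = 0" for f :: "real \<Rightarrow> real" and T om
  proof (cases "om \<in> N \<or> T < 0")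
    case True
    then have "indicator {0..T} u *\<^sub>R f (S.X u om) = 0" for u using XN f0[of a] by auto
    then show ?thesis unfolding set_integrable_def by (simp only: integrable_zero)
  next
    case False
    then have omN: "om \<in> space M - N" and T: "0 \<le> T" using om by auto
    have "(\<integral>\<^sup>+u. ennreal (norm (indicator {0..T} u *\<^sub>R f (S.X u om))) \<partial>lborel)
       \<le> (\<integral>\<^sup>+u. ennreal (?q u om) * indicator (einterval 0 (?m T om)) u \<partial>lborel)"
    proof (rule nn_integral_mono_AE)
      show "AE u in lborel. ennreal (norm (indicator {0..T} u *\<^sub>R f (S.X u om))) \<le> ennreal (?q u om) * indicator (einterval 0 (?m T om)) u"
        using AE_lborel_singleton[of 0] AE_lborel_singleton[of T]
      proof eventually_elim
        case (elim u)
        show ?case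
        proof (cases "u \<in> {0..T} \<and> ereal u < \<tau>Y om")
          case True
          then have "u \<in> einterval 0 (?m T om)" using elim by (auto simp: einterval_def)
          then show ?thesis using True X_before[OF omN, of u] f1[of "y u om"] by (simp add: ennreal_leI del: ennreal_plus)
        next
          case False
          then have "norm (indicator {0..T} u *\<^sub>R f (S.X u om)) = 0" using X_after[OF omN, of u] f0 by (auto simp: indicator_def)
          then show ?thesis by (simp only: ennreal_0 zero_le)
        qed
      qed
    qed
    also have "\<dots> < \<infinity>" by (rule ok(3)[OF omN T])
    finally show ?thesis unfolding set_integrable_def using path_meas[OF om f, of T] by (intro integrableI_bounded) auto
  qed
  note vm = vol_measurable[OF ab(1,4)] drift_measurable[OF ab(1,4)]
  have v2: "(\<lambda>x. (vol a b x)\<^sup>2) \<in> borel_measurable borel" "(\<lambda>x. drift a b x * (vol a b x)\<^sup>2) \<in> borel_measurable borel"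
    using vm by simp_all
  have sg_int: "set_integrable lborel {0..T} (\<lambda>u. (vol a b (S.X u om))\<^sup>2)" if "om \<in> space M" for T om
    by (rule path_integrable[OF that v2(1)]) (auto simp: vol_def)
  have b_int: "set_integrable lborel {0..T} (\<lambda>u. drift a b (S.X u om) * (vol a b (S.X u om))\<^sup>2)" if "om \<in> space M" for T om
    by (rule path_integrable[OF that v2(2)]) (auto simp: drift_vol[OF ab(1,4)])
  \<comment> \<open>Before the exit the product of the truncated coefficients is
    \<open>\<mu>\<close>; afterwards it vanishes and the stopped process stands still. The equation
    can therefore be solved for \<open>I\<close> at every time.\<close>
  have Ieq: "I t om = S.X t om - x0 - (LINT u:{0..t}|lborel. drift a b (S.X u om) * (vol a b (S.X u om))\<^sup>2)"
    if om: "om \<in> space M - N" and t: "0 \<le> t" for t om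
  proof -
    have omM: "om \<in> space M" using om by simp
    define f where "f = (\<lambda>x. drift a b x * (vol a b x)\<^sup>2)"
    have fm: "f \<in> borel_measurable borel" unfolding f_def using vm by measurable
    have m0: "0 \<le> min (ereal t) (\<tau>Y om)" using t tau[OF om] S.tau_nonneg[of om] by simp
    let ?E = "einterval 0 (?m t om)"
    have Es: "?E \<subseteq> {0..t}" by (auto simp: einterval_def)
    have "(LBINT u=0..min (ereal t) (\<tau>Y om). \<mu> (y u om)) = (LINT u:?E|lborel. \<mu> (y u om))"
      using m0 by (simp add: interval_lebesgue_integral_def)
    also have "\<dots> = (\<integral>u. indicator ?E u * f (S.X u om) \<partial>lborel)" unfolding set_lebesgue_integral_def
    proof (rule Bochner_cong[OF refl])
      fix u
      show "indicator ?E u *\<^sub>R \<mu> (y u om) = indicator ?E u * f (S.X u om)"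
      proof (cases "u \<in> ?E")
        case True
        then have "0 \<le> u" "ereal u < \<tau>Y om" by (auto simp: einterval_def)
        from X_before[OF om this] show ?thesis by (simp add: f_def drift_vol[OF ab(1,4)])
      qed simp
    qed
    also have "\<dots> = (\<integral>u. indicator {0..t} u * f (S.X u om) \<partial>lborel)"
    proof (rule integral_cong_AE)
      have "(\<lambda>u. indicator ?E u * (indicator {0..t} u * f (S.X u om))) \<in> borel_measurable lborel"
        by (rule borel_measurable_times[OF _ path_meas[OF omM fm, of t]]) simp
      also have "(\<lambda>u. indicator ?E u * (indicator {0..t} u * f (S.X u om))) = (\<lambda>u. indicator ?E u * f (S.X u om))"
        using Es by (auto simp: indicator_def fun_eq_iff)
      finally show "(\<lambda>u. indicator ?E u * f (S.X u om)) \<in> borel_measurable lborel" .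
      show "(\<lambda>u. indicator {0..t} u * f (S.X u om)) \<in> borel_measurable lborel" by (rule path_meas[OF omM fm])
      show "AE u in lborel. indicator ?E u * f (S.X u om) = indicator {0..t} u * f (S.X u om)"
        using AE_lborel_singleton[of 0] AE_lborel_singleton[of t]
      proof eventually_elim
        case (elim u)
        show ?case
        proof (cases "u \<in> {0..t} \<and> u \<notin> ?E")
          case True
          then have "\<not> ereal u < \<tau>Y om" using elim by (auto simp: einterval_def)
          then have "S.X u om \<notin> {a<..<b}" using X_after[OF om, of u] True by auto
          then show ?thesis by (simp add: f_def drift_def)
        qed (use Es in \<open>auto simp: indicator_def\<close>)
      qed
    qed
    also have "\<dots> = (LINT u:{0..t}|lborel. f (S.X u om))" by (simp add: set_lebesgue_integral_def)
    finally have "ereal (S.X t om) = ereal (x0 + (LINT u:{0..t}|lborel. f (S.X u om)) + I t om)" using ok(4)[OF om t] XY[OF om t] by simp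
    then show ?thesis by (simp add: f_def)
  qed
  have aeN: "AE om in M. om \<in> space M - N" using AE_not_in[OF N] AE_space by eventually_elim simp
  let ?Z = "\<lambda>r om. S.X r om - x0 - (LINT u:{0..r}|lborel. drift a b (S.X u om) * (vol a b (S.X u om))\<^sup>2)"
    and ?D = "\<lambda>T S f om. \<integral>\<^sup>+u\<in>{0..T}. ennreal ((simple_value S u om - f u om)\<^sup>2) \<partial>lborel"
    and ?s = "\<lambda>u om. if ereal u < \<tau>Y om then \<sigma> (y u om) else 0" and ?v = "\<lambda>u om. vol a b (S.X u om)"
  have ito: "\<exists>S'. (\<forall>n. simple_process M (augment M F) (S' n)) \<and> (AE om in M.
        ((\<lambda>n. ?D T (S' n) ?v om) \<longlonglongrightarrow> 0) \<and>
        ((\<lambda>n. SUP r\<in>{0..T}. ennreal \<bar>simple_integral_wrt W' (S' n) r om - ?Z r om\<bar>) \<longlonglongrightarrow> 0))"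
    if T: "0 \<le> T" for T
  proof -
    obtain S0 where S0: "\<And>n. simple_process M F (S0 n)"
      "tendsto_0_in_prob M (\<lambda>n om. ?D T (S0 n) ?s om)"
      "tendsto_0_in_prob M (\<lambda>n om. SUP t\<in>{0..T}. ennreal \<bar>simple_integral_wrt W (S0 n) t om - I t om\<bar>)"
      using I(1) T unfolding has_ito_integral_def by blast
    from tendsto_0_in_prob_AE_subsequence[OF S0(2,3)] obtain k :: "nat \<Rightarrow> nat" where k:
      "AE om in M. (\<lambda>n. ?D T (S0 (k n)) ?s om) \<longlonglongrightarrow> 0 \<and>
         (\<lambda>n. SUP t\<in>{0..T}. ennreal \<bar>simple_integral_wrt W (S0 (k n)) t om - I t om\<bar>) \<longlonglongrightarrow> 0" by blast
    have sp: "simple_process M (augment M F) (S0 (k n))" for n unfolding simple_process_def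
    proof (clarify, intro conjI)
      fix u v \<xi> assume "(u, v, \<xi>) \<in> set (S0 (k n))"
      with S0(1)[of "k n", unfolded simple_process_def, rule_format, of "(u, v, \<xi>)"] have h: "0 \<le> u \<and> u \<le> v \<and> \<xi> \<in> borel_measurable (F u) \<and> bounded (\<xi> ` space M)"
        by simp
      have "(\<lambda>om. if om \<in> {} then 0 else \<xi> om) \<in> borel_measurable (augment M F u)" using h by (intro augment_measurable) auto
      then show "\<xi> \<in> borel_measurable (augment M F u)" by simp
      show "0 \<le> u" "u \<le> v" "bounded (\<xi> ` space M)" using h by auto
    qed
    show ?thesis
    proof (intro exI[of _ "\<lambda>n. S0 (k n)"] conjI allI sp)
      show "AE om in M.
        ((\<lambda>n. ?D T (S0 (k n)) ?v om) \<longlonglongrightarrow> 0) \<and>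
        ((\<lambda>n. SUP r\<in>{0..T}. ennreal \<bar>simple_integral_wrt W' (S0 (k n)) r om - ?Z r om\<bar>) \<longlonglongrightarrow> 0)"
        using k aeN
      proof eventually_elim
        case (elim om)
        note om = elim(2)
        \<comment> \<open>The integrand of the equation is switched off by time, the truncated
          volatility by the state; they agree because the stopped value is outside
          \<open>(a, b)\<close> exactly from the exit time on.\<close>
        have h: "?s u om = ?v u om" if "0 \<le> u" for u using X_before[OF om that] X_after[OF om that] by (auto simp: vol_def indicator_def)
        have 1: "(?D T (S0 (k n)) ?v om) = (?D T (S0 (k n)) ?s om)" for n by (intro nn_integral_cong) (simp add: h[symmetric] indicator_def)
        have w: "simple_integral_wrt W' S' u om = simple_integral_wrt W S' u om" for S' u using om by (simp add: simple_integral_wrt_def W'_def)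
        have 2: "(SUP r\<in>{0..T}. ennreal \<bar>simple_integral_wrt W' (S0 (k n)) r om - ?Z r om\<bar>)
           = (SUP t\<in>{0..T}. ennreal \<bar>simple_integral_wrt W (S0 (k n)) t om - I t om\<bar>)" for n
          by (rule SUP_cong[OF refl]) (use Ieq[OF om] in \<open>auto simp: w\<close>)
        show ?case unfolding 1 2 using elim(1) by simp
      qed
    qed
  qed
  have "stopped_diffusion M (augment M F) W' S.X a b x0 (drift a b) (vol a b)"
  proof (intro stopped_diffusion.intro continuous_brownian_motion.intro A.filtered_prob_space_axioms
        continuous_brownian_motion_axioms.intro stopped_diffusion_axioms.intro)
    show "brownian_motion M (augment M F) W'" unfolding W'_def by (rule brownian_motion_augment[OF bm N])
    show "continuous_on {0..} (\<lambda>t. W' t om)" if "om \<in> space M" for om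
      using ok(2)[of om] that by (cases "om \<in> N") (auto simp: W'_def)
  qed (use a_b S.X_continuous S.X_adapted X_range vm sg_int b_int drift_set_integrable[OF ab(1,4)] ito in \<open>assumption | blast\<close>)+
  then show ?thesis using that[of N W' S.X] N ok(1) XY unfolding \<tau>Y_def by blast
qed

end

lemma outer_measure_of_UN_eq_0:
  fixes E :: "nat \<Rightarrow> 'a set"
  assumes E: "\<And>k. E k \<subseteq> space M" and 0: "\<And>k. outer_measure_of M (E k) = 0"
  shows "\<exists>B\<in>null_sets M. (\<Union>k. E k) \<subseteq> B"
proof -
  have "\<exists>B\<in>null_sets M. E k \<subseteq> B" for k using outer_measure_of_attain[OF E[of k]] 0[of k] by (auto simp: null_sets_def)
  then obtain B where B: "\<And>k. B k \<in> null_sets M" "\<And>k. E k \<subseteq> B k" by metis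
  show ?thesis using B by (intro bexI[of _ "\<Union>k. B k"]) auto
qed

text \<open>On the compact time interval up to the exit the continuous path attains its maximum,
  which is below \<open>r\<close>: the path ends at \<open>l\<close> and has not left the interval
  earlier.\<close>

lemma (in exiting_sde) exit_at_left_path:
  assumes g: "good om" and e: "exits_through Y l r l om"
  obtains z v where "exit_time Y l r om = ereal z" "0 < z" "Y z om = l" "v < r" "\<And>t. 0 \<le> t \<Longrightarrow> t \<le> z \<Longrightarrow> Y t om \<le> v"
proof -
  have lr: "l < r" using x0 by (auto simp: einterval_def elim: less_trans)
  have fin: "exit_time Y l r om < \<infinity>" using e by (simp add: exits_through_def)
  obtain z where z: "0 < z" "exit_time Y l r om = ereal z" using good_exit_pos[OF g fin] by blast
  have c: "continuous_on {0..} (\<lambda>t. Y t om)" by (rule good_continuous[OF g])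
  have "((\<lambda>t. Y t om) \<longlongrightarrow> Y z om) (at z within {0..})" using c z unfolding continuous_on_def by auto
  then have "((\<lambda>t. Y t om) \<longlongrightarrow> Y z om) (at z within {0..<z})" by (rule tendsto_within_subset) auto
  moreover have "at z within {0..<z} = at_left z" by (rule at_within_nhd[of _ "{0<..}"]) (use z in auto)
  ultimately have Yz: "Y z om = l" using e z(2) tendsto_unique[OF _ _ , of "at_left z" "\<lambda>t. Y t om"] unfolding exits_through_def by auto
  have "continuous_on {0..z} (\<lambda>t. Y t om)" using c by (rule continuous_on_subset) auto
  then obtain m where m: "m \<in> {0..z}" "\<And>t. t \<in> {0..z} \<Longrightarrow> Y t om \<le> Y m om"
    using continuous_attains_sup[of "{0..z}" "\<lambda>t. Y t om"] z by auto
  have "Y m om < r"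
  proof (cases "m = z")
    case True then show ?thesis using Yz lr by simp
  next
    case False
    show ?thesis
    proof (rule ccontr)
      assume "\<not> Y m om < r"
      then have "exit_time Y l r om \<le> ereal m" unfolding exit_time_def using m(1) by (intro Inf_lower) auto
      then show False using z False m(1) by simp
    qed
  qed
  with that[of z "Y m om"] z Yz m show ?thesis by auto
qed

text \<open>If the path were inside at its exit time, continuity would keep it inside a little
  longer.\<close>

lemma (in exiting_sde) exit_time_attained:
  assumes g: "good om" and t: "exit_time Y a b om = ereal t" shows "Y t om \<notin> {a<..<b}"
proof
  assume Y: "Y t om \<in> {a<..<b}"
  have t0: "0 \<le> t" using exit_time_nonneg[of a b om] t by simp
  have "((\<lambda>t. Y t om) \<longlongrightarrow> Y t om) (at t within {0..})"
    using good_continuous[OF g] t0 unfolding continuous_on_def by auto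
  then have "\<forall>\<^sub>F u in at t within {0..}. Y u om \<in> {a<..<b}" by (rule topological_tendstoD) (use Y in auto)
  then obtain d where d: "d > 0" "\<And>u. 0 \<le> u \<Longrightarrow> u \<noteq> t \<Longrightarrow> dist u t < d \<Longrightarrow> Y u om \<in> {a<..<b}"
    unfolding eventually_at by blast
  have "ereal (t + d) \<le> exit_time Y a b om" unfolding exit_time_def
  proof (rule Inf_greatest, clarify)
    fix u assume u: "0 \<le> u" "Y u om \<notin> {a<..<b}"
    then have "exit_time Y a b om \<le> ereal u" unfolding exit_time_def by (intro Inf_lower) auto
    then have "t \<le> u" using t by simp
    moreover have "u \<noteq> t" using u(2) Y by auto
    ultimately show "ereal (t + d) \<le> ereal u" using d(2)[OF u(1)] u(2) by (force simp: dist_real_def)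
  qed
  then show False using t d(1) by simp
qed

text \<open>\<open>T\<close>, \<open>b\<close> and \<open>p\<close> are chosen before
  \<open>a\<close>. Almost every path that exits at \<open>l\<close> does so by some time
  \<open>Suc k\<close> while staying below \<open>c k\<close>, so countably many sets cover the exit
  event and one of them is not negligible. A path in that set is at or below any level
  \<open>a > l\<close> before it can reach \<open>b\<close>, hence is stopped at
  \<open>a\<close>.\<close>

lemma (in exiting_sde) left_hitting_probability:
  assumes ex: "exits_at M Y l r l"
  obtains T b p where "0 < T" "x0 < b" "ereal b < r" "0 < p"
    "\<And>a N X. l < ereal a \<Longrightarrow> N \<in> null_sets M \<Longrightarrow>
      (\<And>om. om \<in> space M - N \<Longrightarrow> ereal (X T om) = Y (real_of_ereal (min (ereal T) (exit_time Y a b om))) om) \<Longrightarrow>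
      (\<And>om. om \<in> space M \<Longrightarrow> X T om \<in> {a..b}) \<Longrightarrow> X T \<in> borel_measurable M \<Longrightarrow>
      p \<le> measure M {om\<in>space M. X T om = a}"
proof -
  have x0r: "ereal x0 < r" using x0 by (simp add: einterval_def)
  obtain c where c: "incseq c" "\<And>k::nat. ereal x0 < ereal (c k)" "\<And>k. ereal (c k) < r" "(\<lambda>k. ereal (c k)) \<longlonglongrightarrow> r"
    using ereal_incseq_approx[OF x0r] by blast
  \<comment> \<open>These sets need not be measurable, hence the outer measures throughout.\<close>
  define E where "E k = {om\<in>space M. good om \<and> exits_through Y l r l om \<and> (\<exists>z. z \<le> real (Suc k) \<and> 0 < z \<and> Y z om = l \<and>
    (\<forall>t. 0 \<le> t \<and> t \<le> z \<longrightarrow> Y t om < ereal (c k)))}" for k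
  have cover: "{om\<in>space M. exits_through Y l r l om} \<subseteq> {om\<in>space M. \<not> good om} \<union> (\<Union>k. E k)"
  proof
    fix om assume om: "om \<in> {om\<in>space M. exits_through Y l r l om}"
    show "om \<in> {om\<in>space M. \<not> good om} \<union> (\<Union>k. E k)"
    proof (cases "good om")
      case True
      obtain z v where zv: "0 < z" "Y z om = l" "v < r" "\<And>t. 0 \<le> t \<Longrightarrow> t \<le> z \<Longrightarrow> Y t om \<le> v"
        using exit_at_left_path[OF True, of thesis] om by auto
      have "\<forall>\<^sub>F k in sequentially. v < ereal (c k)" using c(4) zv(3) by (rule order_tendstoD)
      moreover have "\<forall>\<^sub>F k in sequentially. z \<le> real (Suc k)"
        using eventually_ge_at_top[of "nat \<lceil>z\<rceil>"] by eventually_elim linarith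
      ultimately have "\<forall>\<^sub>F k in sequentially. v < ereal (c k) \<and> z \<le> real (Suc k)" by eventually_elim simp
      then obtain k where "v < ereal (c k)" "z \<le> real (Suc k)" unfolding eventually_sequentially by blast
      then have "om \<in> E k" using om True zv unfolding E_def by (auto intro!: exI[of _ z] intro: le_less_trans)
      then show ?thesis by blast
    qed (use om in auto)
  qed
  have "\<exists>k. outer_measure_of M (E k) \<noteq> 0"
  proof (rule ccontr)
    assume "\<not> ?thesis"
    then obtain B where B: "B \<in> null_sets M" "(\<Union>k. E k) \<subseteq> B" using outer_measure_of_UN_eq_0[of E M] by (auto simp: E_def)
    obtain B' where B': "{om\<in>space M. \<not> good om} \<subseteq> B'" "B' \<in> null_sets M" using AE_good by (auto simp: eventually_ae_filter)
    have "outer_measure_of M {om\<in>space M. exits_through Y l r l om} \<le> outer_measure_of M (B' \<union> B)"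
      by (rule outer_measure_of_mono) (use cover B B' in blast)
    also have "\<dots> = emeasure M (B' \<union> B)" by (rule outer_measure_of_eq) (use B B' in auto)
    also have "\<dots> = 0" using B B' null_sets.Un by blast
    finally show False using ex by (simp add: exits_at_def)
  qed
  then obtain k where k: "outer_measure_of M (E k) \<noteq> 0" by blast
  have "outer_measure_of M (E k) \<le> emeasure M (space M)" using outer_measure_of_mono[of "E k" "space M" M] by (simp add: E_def subset_eq)
  then have fin': "outer_measure_of M (E k) < \<infinity>" using emeasure_space_1 by (simp add: order.strict_trans1[OF _ ennreal_one_less_top])
  show thesis
  proof (rule that[of "real (Suc k)" "c k" "enn2real (outer_measure_of M (E k))"])
    show "0 < enn2real (outer_measure_of M (E k))" using k fin' by (simp add: enn2real_positive_iff zero_less_iff_neq_zero)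
    fix a :: real and N and X :: "real \<Rightarrow> 'a \<Rightarrow> real"
    let ?T = "real (Suc k)"
    assume a: "l < ereal a" and N: "N \<in> null_sets M"
      and XY: "\<And>om. om \<in> space M - N \<Longrightarrow> ereal (X ?T om) = Y (real_of_ereal (min (ereal ?T) (exit_time Y a (c k) om))) om"
      and X: "\<And>om. om \<in> space M \<Longrightarrow> X ?T om \<in> {a..c k}" and [measurable]: "X ?T \<in> borel_measurable M"
    let ?H = "{om\<in>space M. X ?T om = a}"
    have ev: "?H \<in> sets M" by measurable
    have "E k \<subseteq> ?H \<union> N"
    proof
      fix om assume om: "om \<in> E k"
      then obtain z where z: "z \<le> ?T" "0 < z" "Y z om = l" "\<And>t. 0 \<le> t \<Longrightarrow> t \<le> z \<Longrightarrow> Y t om < ereal (c k)"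
        by (auto simp: E_def)
      have om': "om \<in> space M" "good om" using om by (auto simp: E_def)
      have "exit_time Y a (c k) om \<le> ereal z" unfolding exit_time_def by (intro Inf_lower) (use a z in auto)
      then obtain t where t: "exit_time Y a (c k) om = ereal t" "0 \<le> t" "t \<le> z"
        using exit_time_nonneg[of a "c k" om] by (cases "exit_time Y a (c k) om") auto
      show "om \<in> ?H \<union> N"
      proof (cases "om \<in> N")
        case False
        have "min (ereal ?T) (exit_time Y a (c k) om) = ereal t" using t z(1) by (simp add: min_def)
        then have "ereal (X ?T om) = Y t om" using XY[of om] om'(1) False by simp
        \<comment> \<open>The path has not reached \<open>c k\<close> by this time, so it has left
          the interval at the left end.\<close>
        moreover have "Y t om \<le> ereal a" using exit_time_attained[OF om'(2) t(1)] z(4)[OF t(2,3)] by auto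
        ultimately show ?thesis using X[OF om'(1)] om' by (metis (mono_tags, lifting) Un_iff antisym atLeastAtMost_iff ereal_less_eq(3) mem_Collect_eq)
      qed simp
    qed
    then have "outer_measure_of M (E k) \<le> outer_measure_of M (?H \<union> N)" by (rule outer_measure_of_mono)
    also have "\<dots> = emeasure M (?H \<union> N)" by (rule outer_measure_of_eq) (rule sets.Un[OF ev null_setsD2[OF N]])
    also have "\<dots> = emeasure M ?H" by (rule emeasure_Un_null_set[OF ev N])
    finally show "enn2real (outer_measure_of M (E k)) \<le> measure M ?H"
      unfolding measure_def by (rule enn2real_mono) (simp add: less_top[symmetric])
  qed (use c in auto)
qed

section \<open>Squared increments of semimartingales\<close>

definition clip :: "real \<Rightarrow> real \<Rightarrow> real" where
  "clip L x = max (- L) (min L x)"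

text \<open>Convex, equal to the square on \<open>[-L, L]\<close> and of linear growth outside. It
  stands in for the square where the martingale is integrable but perhaps not square
  integrable.\<close>

definition huber :: "real \<Rightarrow> real \<Rightarrow> real" where
  "huber L x = (if \<bar>x\<bar> \<le> L then x\<^sup>2 else 2 * L * \<bar>x\<bar> - L\<^sup>2)"

lemma clip_bound: "0 \<le> L \<Longrightarrow> \<bar>clip L x\<bar> \<le> L"
  by (auto simp: clip_def)

lemma huber_le:
  assumes "0 \<le> L" shows "huber L x \<le> 2 * L * \<bar>x\<bar>"
proof (cases "\<bar>x\<bar> \<le> L")
  case True
  have "x\<^sup>2 = \<bar>x\<bar> * \<bar>x\<bar>" by (simp add: power2_eq_square)
  also have "\<dots> \<le> L * \<bar>x\<bar>" using True by (rule mult_right_mono) simp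
  also have "\<dots> \<le> 2 * (L * \<bar>x\<bar>)" using assms by simp
  finally show ?thesis using True by (simp add: huber_def)
qed (simp add: huber_def)

lemma huber_nonneg: "0 \<le> L \<Longrightarrow> 0 \<le> huber L x"
proof (cases "\<bar>x\<bar> \<le> L")
  case False
  assume "0 \<le> L"
  then have "L * L \<le> L * \<bar>x\<bar>" using False by (intro mult_left_mono) auto
  moreover have "0 \<le> L * \<bar>x\<bar>" using \<open>0 \<le> L\<close> by simp
  ultimately show ?thesis using False by (simp add: huber_def power2_eq_square)
qed (simp add: huber_def)

text \<open>The derivative of \<open>huber L\<close> is \<open>2 * clip L\<close>.\<close>

lemma huber_gap:
  assumes L: "0 \<le> L"
  shows "(if \<bar>x\<bar> \<le> L \<and> \<bar>y\<bar> \<le> L then (y - x)\<^sup>2 else 0) \<le> huber L y - huber L x - 2 * clip L x * (y - x)"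
proof -
  consider "\<bar>x\<bar> \<le> L" "\<bar>y\<bar> \<le> L" | "\<bar>x\<bar> \<le> L" "L < y" | "\<bar>x\<bar> \<le> L" "y < - L" | "L < x" "\<bar>y\<bar> \<le> L" | "L < x" "L < y" | "L < x" "y < - L"
    | "x < - L" "\<bar>y\<bar> \<le> L" | "x < - L" "L < y" | "x < - L" "y < - L" by linarith
  then show ?thesis
  proof cases
    case 1 then have "clip L x = x" by (auto simp: clip_def)
    with 1 show ?thesis by (simp add: huber_def power2_eq_square algebra_simps)
  next
    case 2
    then have "clip L x = x" by (auto simp: clip_def)
    moreover have "0 \<le> (L - x) * (2 * y - L - x)" using 2 by (intro mult_nonneg_nonneg) auto
    ultimately show ?thesis using 2 L by (simp add: huber_def power2_eq_square algebra_simps)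
  next
    case 3
    then have "clip L x = x" by (auto simp: clip_def)
    moreover have "0 \<le> (L + x) * (- 2 * y - L + x)" using 3 by (intro mult_nonneg_nonneg) auto
    ultimately show ?thesis using 3 L by (simp add: huber_def power2_eq_square algebra_simps)
  next
    case 4
    then have "clip L x = L" using L by (auto simp: clip_def)
    moreover have "0 \<le> (y - L)\<^sup>2" by simp
    ultimately show ?thesis using 4 L by (simp add: huber_def power2_eq_square algebra_simps)
  next
    case 5
    then have "clip L x = L" using L by (auto simp: clip_def)
    with 5 L show ?thesis by (simp add: huber_def power2_eq_square algebra_simps)
  next
    case 6
    then have "clip L x = L" using L by (auto simp: clip_def)
    moreover have "L * y \<le> 0" using 6 L by (intro mult_nonneg_nonpos) auto
    ultimately show ?thesis using 6 L by (simp add: huber_def power2_eq_square algebra_simps)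
  next
    case 7
    then have "clip L x = - L" using L by (auto simp: clip_def)
    moreover have "0 \<le> (y + L)\<^sup>2" by simp
    ultimately show ?thesis using 7 L by (simp add: huber_def power2_eq_square algebra_simps)
  next
    case 8
    then have "clip L x = - L" using L by (auto simp: clip_def)
    moreover have "0 \<le> L * y" using 8 L by (intro mult_nonneg_nonneg) auto
    ultimately show ?thesis using 8 L by (simp add: huber_def power2_eq_square algebra_simps)
  next
    case 9
    then have "clip L x = - L" using L by (auto simp: clip_def)
    with 9 L show ?thesis by (simp add: huber_def power2_eq_square algebra_simps)
  qed
qed

text \<open>The one-sided limits bound the path near each time, and by compactness finitely many
  such neighbourhoods suffice.\<close>

lemma cadlag_bounded:
  assumes f: "cadlag f" shows "\<exists>B. \<forall>t\<in>{0..T}. \<bar>f t\<bar> \<le> B"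
proof -
  have loc: "\<exists>d B. 0 < d \<and> (\<forall>u\<in>{0..T}. \<bar>u - t\<bar> < d \<longrightarrow> \<bar>f u\<bar> \<le> B)" if t: "t \<in> {0..T}" for t
  proof -
    have "(f \<longlongrightarrow> f t) (at_right t)" using f t by (auto simp: cadlag_def)
    then have "\<forall>\<^sub>F u in at_right t. \<bar>f u - f t\<bar> < 1" using tendstoD[of f "f t" "at_right t" 1] by (simp add: dist_real_def)
    then obtain d1 where d1: "t < d1" "\<And>u. t < u \<Longrightarrow> u < d1 \<Longrightarrow> \<bar>f u - f t\<bar> < 1" by (auto simp: eventually_at_right_field)
    show ?thesis
    proof (cases "t = 0")
      case True
      show ?thesis
      proof (rule exI[of _ d1], rule exI[of _ "\<bar>f t\<bar> + 1"], intro conjI ballI impI)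
        fix u assume u: "u \<in> {0..T}" "\<bar>u - t\<bar> < d1"
        then show "\<bar>f u\<bar> \<le> \<bar>f t\<bar> + 1" using d1(2)[of u] True by (cases "u = t") auto
      qed (use d1 True in auto)
    next
      case False
      then have "0 < t" using t by auto
      then obtain L where "(f \<longlongrightarrow> L) (at_left t)" using f unfolding cadlag_def by blast
      then have "\<forall>\<^sub>F u in at_left t. \<bar>f u - L\<bar> < 1" using tendstoD[of f L "at_left t" 1] by (simp add: dist_real_def)
      then obtain d2 where d2: "d2 < t" "\<And>u. d2 < u \<Longrightarrow> u < t \<Longrightarrow> \<bar>f u - L\<bar> < 1" by (auto simp: eventually_at_left_field)
      show ?thesis
      proof (rule exI[of _ "min (d1 - t) (t - d2)"], rule exI[of _ "\<bar>f t\<bar> + \<bar>L\<bar> + 1"], intro conjI ballI impI)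
        fix u assume u: "u \<in> {0..T}" "\<bar>u - t\<bar> < min (d1 - t) (t - d2)"
        consider "u < t" | "u = t" | "t < u" by linarith
        then show "\<bar>f u\<bar> \<le> \<bar>f t\<bar> + \<bar>L\<bar> + 1"
        proof cases
          case 1 then show ?thesis using d2(2)[of u] u by auto
        next
          case 3 then show ?thesis using d1(2)[of u] u by auto
        qed simp
      qed (use d1 d2 in auto)
    qed
  qed
  then obtain d B where dB: "\<And>t. t \<in> {0..T} \<Longrightarrow> 0 < d t" "\<And>t u. t \<in> {0..T} \<Longrightarrow> u \<in> {0..T} \<Longrightarrow> \<bar>u - t\<bar> < d t \<Longrightarrow> \<bar>f u\<bar> \<le> B t" by metis
  obtain D where D: "D \<subseteq> {0..T}" "finite D" "{0..T} \<subseteq> (\<Union>t\<in>D. ball t (d t))"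
    by (rule compactE_image[OF compact_Icc, of "{0..T}" "\<lambda>t. ball t (d t)" 0 T]) (use dB(1) in \<open>auto intro!: centre_in_ball[THEN iffD2]\<close>)
  show ?thesis
  proof (intro exI[of _ "\<Sum>t\<in>D. \<bar>B t\<bar>"] ballI)
    fix u assume u: "u \<in> {0..T}"
    then obtain t where t: "t \<in> D" "u \<in> ball t (d t)" using D(3) by auto
    then have "\<bar>f u\<bar> \<le> B t" using dB(2)[of t u] u D(1) by (auto simp: dist_real_def abs_minus_commute)
    also have "\<dots> \<le> (\<Sum>t\<in>D. \<bar>B t\<bar>)" using member_le_sum[of t D "\<lambda>t. \<bar>B t\<bar>"] t(1) D(2) by auto
    finally show "\<bar>f u\<bar> \<le> (\<Sum>t\<in>D. \<bar>B t\<bar>)" .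
  qed
qed

lemma (in prob_space) eventually_small_measure:
  assumes A: "\<And>k::nat. A k \<in> events" and ev: "AE om in M. \<forall>\<^sub>F k in sequentially. om \<notin> A k" and e: "0 < (e::real)"
  shows "\<exists>k. prob (A k) < e"
proof -
  have "(\<lambda>k. \<integral>om. indicator (A k) om \<partial>M) \<longlonglongrightarrow> (\<integral>om. (0::real) \<partial>M)"
  proof (rule integral_dominated_convergence[where w = "\<lambda>_. 1"])
    show "AE om in M. (\<lambda>k. indicator (A k) om) \<longlonglongrightarrow> (0::real)" using ev
    proof eventually_elim
      case (elim om)
      then show ?case by (intro tendsto_eventually) (auto elim: eventually_mono)
    qed
  qed (use A in auto)
  then have "(\<lambda>k. prob (A k)) \<longlonglongrightarrow> 0" using A by simp
  then have "\<forall>\<^sub>F k in sequentially. prob (A k) < e" using e by (rule order_tendstoD)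
  then show ?thesis unfolding eventually_sequentially by blast
qed

context filtered_prob_space begin

text \<open>Summing \<open>huber_gap\<close> along the grid telescopes, and the terms with
  \<open>clip\<close> have mean zero because \<open>clip L (P (t i))\<close> is bounded and known at
  time \<open>t i\<close>. On the event that all grid values lie in \<open>[-L, L]\<close> the gaps
  dominate the squares. Thanks to the linear growth of \<open>huber\<close> only a first moment of
  \<open>P\<close> appears.\<close>

lemma martingale_squares:
  assumes P: "martingale M F P" and L: "0 \<le> L" and t: "\<And>i. 0 \<le> t i" "incseq t"
  shows "integrable M (\<lambda>om. indicator {om. \<forall>i\<le>n. \<bar>P (t i) om\<bar> \<le> L} om * (\<Sum>i<n. (P (t (Suc i)) om - P (t i) om)\<^sup>2))"
    and "(\<integral>om. indicator {om. \<forall>i\<le>n. \<bar>P (t i) om\<bar> \<le> L} om * (\<Sum>i<n. (P (t (Suc i)) om - P (t i) om)\<^sup>2) \<partial>M)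
     \<le> 2 * L * (\<integral>om. \<bar>P (t n) om\<bar> \<partial>M)"
proof -
  let ?d = "\<lambda>i om. P (t (Suc i)) om - P (t i) om"
  let ?S = "\<lambda>om. indicator {om. \<forall>i\<le>n. \<bar>P (t i) om\<bar> \<le> L} om * (\<Sum>i<n. (?d i om)\<^sup>2)"
  have mF: "P (t i) \<in> borel_measurable (F (t i))" for i using P t by (auto simp: martingale_def adapted_def)
  have mM [measurable]: "P (t i) \<in> borel_measurable M" for i by (rule measurable_F_M[OF mF])
  have int: "integrable M (P (t i))" for i using P t by (auto simp: martingale_def)
  have clipm [measurable]: "clip L \<in> borel_measurable borel" unfolding clip_def[abs_def] by measurable
  have hubm [measurable]: "huber L \<in> borel_measurable borel" unfolding huber_def[abs_def] by measurable
  have ch: "integrable M (\<lambda>om. clip L (P (t i) om) * P (t j) om)" for i j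
    by (rule Bochner_bound[OF integrable_mult_right[OF int[of j], of L]])
      (use clip_bound[OF L] L in \<open>auto simp: abs_mult intro!: mult_right_mono\<close>)
  have orth: "(\<integral>om. clip L (P (t i) om) * ?d i om \<partial>M) = 0" for i
  proof -
    interpret C: finite_measure_subalgebra M "F (t i)" by standard (auto simp: subalgebra_def space_F intro: subsetD[OF sets_F_subset])
    have "AE om in M. real_cond_exp M (F (t i)) (P (t (Suc i))) om = P (t i) om" using P t incseq_SucD[OF t(2)] by (auto simp: martingale_def)
    then have "(\<integral>om. clip L (P (t i) om) * real_cond_exp M (F (t i)) (P (t (Suc i))) om \<partial>M) = (\<integral>om. clip L (P (t i) om) * P (t i) om \<partial>M)"
      by (intro integral_cong_AE) auto
    moreover have "(\<integral>om. clip L (P (t i) om) * real_cond_exp M (F (t i)) (P (t (Suc i))) om \<partial>M) = (\<integral>om. clip L (P (t i) om) * P (t (Suc i)) om \<partial>M)"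
      by (rule C.real_cond_exp_intg(2)[OF ch measurable_compose[OF mF clipm] mM])
    ultimately show ?thesis using ch by (simp add: right_diff_distrib)
  qed
  have hi: "integrable M (\<lambda>om. huber L (P (t i) om))" for i by (rule Bochner_bound[OF integrable_mult_right[OF int[of i], of "2 * L"]])
      (use huber_le[OF L] huber_nonneg[OF L] L in \<open>auto simp: abs_mult\<close>)
  define R where "R i om = huber L (P (t (Suc i)) om) - huber L (P (t i) om) - 2 * (clip L (P (t i) om) * ?d i om)" for i om
  have ci: "integrable M (\<lambda>om. clip L (P (t i) om) * ?d i om)" for i using ch by (simp add: right_diff_distrib)
  have Ri: "integrable M (R i)" for i unfolding R_def[abs_def] using hi ci by auto
  have le: "?S om \<le> (\<Sum>i<n. R i om)" for om
  proof -
    have "indicator {om. \<forall>i\<le>n. \<bar>P (t i) om\<bar> \<le> L} om * (?d i om)\<^sup>2 \<le> R i om" if "i < n" for i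
    proof -
      have "indicator {om. \<forall>i\<le>n. \<bar>P (t i) om\<bar> \<le> L} om * (?d i om)\<^sup>2
         \<le> (if \<bar>P (t i) om\<bar> \<le> L \<and> \<bar>P (t (Suc i)) om\<bar> \<le> L then (?d i om)\<^sup>2 else 0)"
        using that by (auto simp: indicator_def)
      also note huber_gap[OF L]
      finally show ?thesis by (simp add: R_def mult.assoc)
    qed
    then show ?thesis unfolding sum_distrib_left by (intro sum_mono) auto
  qed
  show I: "integrable M (\<lambda>om. ?S om)"
  proof (rule Bochner_bound)
    show "integrable M (\<lambda>om. \<Sum>i<n. R i om)" using Ri by auto
    show "AE om in M. norm (?S om) \<le> norm (\<Sum>i<n. R i om)"
    proof (rule AE_I2)
      fix om
      have "0 \<le> ?S om" by (intro mult_nonneg_nonneg sum_nonneg) auto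
      then show "norm (?S om) \<le> norm (\<Sum>i<n. R i om)" using le[of om] by simp
    qed
    have "(\<lambda>om. if (\<forall>i\<le>n. \<bar>P (t i) om\<bar> \<le> L) then (\<Sum>i<n. (?d i om)\<^sup>2) else 0) \<in> borel_measurable M"
      by measurable
    then show "(\<lambda>om. ?S om) \<in> borel_measurable M" by (rule measurable_cong[THEN iffD1, rotated]) (simp add: indicator_def)
  qed
  have "(\<integral>om. ?S om \<partial>M) \<le> (\<integral>om. (\<Sum>i<n. R i om) \<partial>M)" using Ri by (intro integral_mono I le) auto
  also have "\<dots> = (\<Sum>i<n. (\<integral>om. R i om \<partial>M))" using Ri by (intro Bochner_Integration.integral_sum) auto
  also have "\<dots> = (\<Sum>i<n. (\<integral>om. huber L (P (t (Suc i)) om) \<partial>M) - (\<integral>om. huber L (P (t i) om) \<partial>M))"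
  proof (rule sum.cong[OF refl])
    fix i
    have "(\<integral>om. R i om \<partial>M) = (\<integral>om. huber L (P (t (Suc i)) om) \<partial>M) - (\<integral>om. huber L (P (t i) om) \<partial>M)
       - 2 * (\<integral>om. clip L (P (t i) om) * ?d i om \<partial>M)" unfolding R_def[abs_def] using hi ci by simp
    then show "(\<integral>om. R i om \<partial>M) = (\<integral>om. huber L (P (t (Suc i)) om) \<partial>M) - (\<integral>om. huber L (P (t i) om) \<partial>M)"
      by (simp only: orth)
  qed
  also have "\<dots> = (\<integral>om. huber L (P (t n) om) \<partial>M) - (\<integral>om. huber L (P (t 0) om) \<partial>M)"
    by (rule sum_lessThan_telescope)
  also have "\<dots> \<le> (\<integral>om. huber L (P (t n) om) \<partial>M)" using huber_nonneg[OF L] by (simp add: Bochner_nonneg)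
  also have "\<dots> \<le> (\<integral>om. 2 * L * \<bar>P (t n) om\<bar> \<partial>M)" using hi int huber_le[OF L] by (intro integral_mono) auto
  finally show "(\<integral>om. ?S om \<partial>M)
     \<le> 2 * L * (\<integral>om. \<bar>P (t n) om\<bar> \<partial>M)" by simp
qed

end

text \<open>For positive \<open>n\<close> the grid stays at \<open>T\<close> beyond the index
  \<open>n\<close>, so it is an increasing sequence on all of \<open>nat\<close>.\<close>

definition grid :: "real \<Rightarrow> nat \<Rightarrow> nat \<Rightarrow> real" where
  "grid T n i = T * real (min i n) / real n"

lemma grid_range: "0 \<le> T \<Longrightarrow> 0 \<le> grid T n i \<and> grid T n i \<le> T"
proof -
  assume T: "0 \<le> T"
  have "T * real (min i n) \<le> T * real n" using T by (intro mult_left_mono) auto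
  then show ?thesis using T by (cases "n = 0") (auto simp: grid_def divide_le_eq)
qed

lemma grid_mono: "0 \<le> T \<Longrightarrow> incseq (grid T n)"
  unfolding incseq_def grid_def by (auto intro!: divide_right_mono mult_left_mono)

lemma grid_end: "0 < n \<Longrightarrow> grid T n n = T"
  by (simp add: grid_def)

lemma sum_squares_le_square_sum:
  fixes f :: "nat \<Rightarrow> real" shows "(\<Sum>i<n. (f i)\<^sup>2) \<le> (\<Sum>i<n. \<bar>f i\<bar>)\<^sup>2"
proof (induction n)
  case (Suc n)
  have "(\<Sum>i<Suc n. (f i)\<^sup>2) \<le> (\<Sum>i<n. \<bar>f i\<bar>)\<^sup>2 + (f n)\<^sup>2" using Suc by simp
  also have "\<dots> \<le> ((\<Sum>i<n. \<bar>f i\<bar>) + \<bar>f n\<bar>)\<^sup>2"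
    using mult_nonneg_nonneg[OF sum_nonneg[of "{..<n}" "\<lambda>i. \<bar>f i\<bar>"] abs_ge_zero[of "f n"]] by (simp add: power2_sum)
  finally show ?case by simp
qed simp

text \<open>Up to a null set there are four bad events of probability at most \<open>e / 5\<close>:
  the localizing time is early, \<open>N\<close> is large, the variation of \<open>A\<close> is
  large, or the localized sum is large. Outside them the sum is at most twice the martingale part
  plus twice the square of the variation. No threshold depends on the grid.\<close>

lemma (in filtered_prob_space) semimartingale_squares_tight:
  assumes Z: "semimartingale M F Z" and T: "0 < T" and e: "0 < e"
  obtains K where "\<And>n. 0 < n \<Longrightarrow> prob {om\<in>space M. K < (\<Sum>i<n. (Z (grid T n (Suc i)) om - Z (grid T n i) om)\<^sup>2)} \<le> e"
proof -
  let ?d = "\<lambda>P n i om. P (grid T n (Suc i)) om - P (grid T n i) om"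
  obtain N A where N: "local_martingale M F N" and A: "adapted F A" and Z_ad: "adapted F Z"
    and aeA: "AE om in M. cadlag (\<lambda>t. A t om) \<and> locally_finite_variation (\<lambda>t. A t om)"
    and aeZ: "AE om in M. N 0 om = 0 \<and> A 0 om = 0 \<and> (\<forall>t\<ge>0. Z t om = Z 0 om + N t om + A t om)"
    using Z unfolding semimartingale_def by blast
  obtain \<tau> where st: "\<And>k. stopping_time F (\<tau> k)" and tau_lim: "AE om in M. filterlim (\<lambda>k. \<tau> k om) at_top sequentially"
    and mart: "\<And>k::nat. martingale M F (\<lambda>t om. N (min t (\<tau> k om)) om - N 0 om)"
    using N unfolding local_martingale_def by auto
  have N_ad: "adapted F N" and aeN: "AE om in M. cadlag (\<lambda>t. N t om)" using N by (auto simp: local_martingale_def)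
  have g0: "0 \<le> grid T n i" for n i using grid_range[of T n i] T by simp
  have ms [measurable]: "N (grid T n i) \<in> borel_measurable M" "A (grid T n i) \<in> borel_measurable M" "Z (grid T n i) \<in> borel_measurable M"
      "N 0 \<in> borel_measurable M" for n i using N_ad A Z_ad g0[of n i] by (auto simp: adapted_def intro: measurable_F_M)
  have tm [measurable]: "\<tau> k \<in> borel_measurable M" for k by (rule measurable_stopping_time[OF st]) (use sets_F_subset space_F in auto)
  have e5: "0 < e / 5" using e by simp
  have "\<exists>k. prob {om\<in>space M. \<tau> k om \<le> T} < e / 5"
  proof (rule eventually_small_measure[OF _ _ e5])
    show "AE om in M. \<forall>\<^sub>F k in sequentially. om \<notin> {om\<in>space M. \<tau> k om \<le> T}" using tau_lim
    proof eventually_elim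
      case (elim om)
      then have "\<forall>\<^sub>F k in sequentially. T < \<tau> k om" by (simp add: filterlim_at_top_dense)
      then show ?case by eventually_elim simp
    qed
  qed measurable
  then obtain k where k: "prob {om\<in>space M. \<tau> k om \<le> T} < e / 5" by blast
  \<comment> \<open>Taking all grids at once keeps the level \<open>m\<close> independent of
    \<open>n\<close>; the event is measurable since only countably many times occur.\<close>
  have "\<exists>m. prob {om\<in>space M. \<exists>n i. real m < \<bar>N (grid T n i) om - N 0 om\<bar>} < e / 5"
  proof (rule eventually_small_measure[OF _ _ e5])
    show "AE om in M. \<forall>\<^sub>F m in sequentially. om \<notin> {om\<in>space M. \<exists>n i. real m < \<bar>N (grid T n i) om - N 0 om\<bar>}"
      using aeN
    proof eventually_elim
      case (elim om)
      obtain B where B: "\<And>t. t \<in> {0..T} \<Longrightarrow> \<bar>N t om\<bar> \<le> B" using cadlag_bounded[OF elim] by blast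
      have "\<bar>N (grid T n i) om - N 0 om\<bar> \<le> 2 * B" for n i using B[of "grid T n i"] B[of 0] grid_range[of T n i] T by auto
      note bd = this
      show ?case
      proof (rule eventually_mono[OF eventually_ge_at_top[of "nat \<lceil>2 * B\<rceil>"]])
        fix m assume "nat \<lceil>2 * B\<rceil> \<le> m"
        then have "2 * B \<le> real m" by linarith
        from order_trans[OF bd this] show "om \<notin> {om\<in>space M. \<exists>n i. real m < \<bar>N (grid T n i) om - N 0 om\<bar>}"
          by (simp add: not_less)
      qed
    qed
  qed measurable
  then obtain m where m: "prob {om\<in>space M. \<exists>n i. real m < \<bar>N (grid T n i) om - N 0 om\<bar>} < e / 5" by blast
  let ?v = "\<lambda>n om. \<Sum>i<n. \<bar>?d A n i om\<bar>"
  have "\<exists>v. prob {om\<in>space M. \<exists>n. real v < ?v n om} < e / 5"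
  proof (rule eventually_small_measure[OF _ _ e5])
    show "AE om in M. \<forall>\<^sub>F v in sequentially. om \<notin> {om\<in>space M. \<exists>n. real v < ?v n om}" using aeA
    proof eventually_elim
      case (elim om)
      obtain B where B: "\<And>n p. mono_on {..n::nat} p \<Longrightarrow> p ` {..n} \<subseteq> {0..T} \<Longrightarrow> (\<Sum>i<n. \<bar>A (p (Suc i)) om - A (p i) om\<bar>) \<le> B"
        using elim T unfolding locally_finite_variation_def by (meson less_imp_le)
      have "?v n om \<le> B" for n by (rule B) (use grid_mono[of T n] grid_range[of T n] T in \<open>auto simp: mono_on_def incseq_def\<close>)
      note bd = this
      show ?case
      proof (rule eventually_mono[OF eventually_ge_at_top[of "nat \<lceil>B\<rceil>"]])
        fix v assume "nat \<lceil>B\<rceil> \<le> v"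
        then have "B \<le> real v" by linarith
        from order_trans[OF bd this] show "om \<notin> {om\<in>space M. \<exists>n. real v < ?v n om}" by (simp add: not_less)
      qed
    qed
  qed measurable
  then obtain v where v: "prob {om\<in>space M. \<exists>n. real v < ?v n om} < e / 5" by blast
  define P where "P = (\<lambda>t om. N (min t (\<tau> k om)) om - N 0 om)"
  have P: "martingale M F P" unfolding P_def by (rule mart)
  define S where "S n om = indicator {om. \<forall>i\<le>n. \<bar>P (grid T n i) om\<bar> \<le> real m} om * (\<Sum>i<n. (P (grid T n (Suc i)) om - P (grid T n i) om)\<^sup>2)" for n om
  define c where "c = 2 * real m * (\<integral>om. \<bar>P T om\<bar> \<partial>M)"
  \<comment> \<open>Markov's inequality needs \<open>c / K1 \<le> e / 5\<close>; the
    \<open>+ 1\<close> keeps \<open>K1\<close> positive when \<open>c = 0\<close>.\<close>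
  define K1 where "K1 = 5 * c / e + 1"
  have c0: "0 \<le> c" unfolding c_def by (intro mult_nonneg_nonneg Bochner_nonneg) auto
  have K1: "0 < K1" using c0 e by (simp add: K1_def add_nonneg_pos)
  have S_int: "integrable M (S n)" for n unfolding S_def[abs_def] using T by (intro martingale_squares(1)[OF P] g0 grid_mono) auto
  have S_prob: "prob {om\<in>space M. K1 \<le> S n om} \<le> e / 5" if n: "0 < n" for n
  proof -
    have "prob {om\<in>space M. K1 \<le> S n om} \<le> (\<integral>om. S n om \<partial>M) / K1"
      by (rule integral_Markov_inequality_measure[OF S_int sets.empty_sets _ K1])
        (auto simp: S_def intro!: mult_nonneg_nonneg sum_nonneg)
    also have "\<dots> \<le> c / K1"
    proof (rule divide_right_mono)
      have "(\<integral>om. S n om \<partial>M) \<le> 2 * real m * (\<integral>om. \<bar>P (grid T n n) om\<bar> \<partial>M)"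
        unfolding S_def[abs_def] using T by (intro martingale_squares(2)[OF P] g0 grid_mono) auto
      then show "(\<integral>om. S n om \<partial>M) \<le> c" by (simp add: c_def grid_end[OF n])
    qed (use K1 in simp)
    also have "\<dots> \<le> e / 5"
    proof -
      have "e / 5 * K1 = c + e / 5" using e by (simp add: K1_def field_simps)
      then show ?thesis using K1 e by (simp add: pos_divide_le_eq)
    qed
    finally show ?thesis .
  qed
  show thesis
  proof (rule that[of "2 * K1 + 2 * (real v)\<^sup>2"])
    fix n :: nat assume n: "0 < n"
    obtain Bad where Bad: "Bad \<in> null_sets M" "\<And>om. om \<in> space M - Bad \<Longrightarrow> \<forall>t\<ge>0. Z t om = Z 0 om + N t om + A t om"
    proof -
      from aeZ obtain Bad where "{om\<in>space M. \<not> (N 0 om = 0 \<and> A 0 om = 0 \<and> (\<forall>t\<ge>0. Z t om = Z 0 om + N t om + A t om))} \<subseteq> Bad"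
          "emeasure M Bad = 0" "Bad \<in> sets M" by (rule AE_E)
      then show thesis by (intro that[of Bad]) auto
    qed
    let ?E = "{om\<in>space M. 2 * K1 + 2 * (real v)\<^sup>2 < (\<Sum>i<n. (?d Z n i om)\<^sup>2)}"
    let ?E1 = "{om\<in>space M. \<tau> k om \<le> T}" and ?E2 = "{om\<in>space M. \<exists>n i. real m < \<bar>N (grid T n i) om - N 0 om\<bar>}"
      and ?E3 = "{om\<in>space M. \<exists>n. real v < ?v n om}"
      and ?E4 = "{om\<in>space M. K1 \<le> S n om}"
    have sub: "?E \<subseteq> ?E1 \<union> (?E2 \<union> (?E3 \<union> (?E4 \<union> Bad)))"
    proof
      fix om assume om: "om \<in> ?E"
      show "om \<in> ?E1 \<union> (?E2 \<union> (?E3 \<union> (?E4 \<union> Bad)))"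
      proof (rule ccontr)
        assume nin: "om \<notin> ?E1 \<union> (?E2 \<union> (?E3 \<union> (?E4 \<union> Bad)))"
        have omM: "om \<in> space M" using om by simp
        have nn: "om \<notin> ?E1 \<and> om \<notin> ?E2 \<and> om \<notin> ?E3 \<and> om \<notin> ?E4 \<and> om \<notin> Bad"
          using nin by (simp only: Un_iff de_Morgan_disj not_False_eq_True simp_thms)
        have tau: "T < \<tau> k om" using conjunct1[OF nn] omM by (simp add: not_le)
        have Nb: "\<bar>N (grid T n i) om - N 0 om\<bar> \<le> real m" for n i
          using nn[THEN conjunct2, THEN conjunct1] omM by (simp add: not_less)
        have Ab: "?v n om \<le> real v" for n using nn[THEN conjunct2, THEN conjunct2, THEN conjunct1] omM by (simp add: not_less)
        have Sb: "S n om < K1" 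
          using nn[THEN conjunct2, THEN conjunct2, THEN conjunct2, THEN conjunct1] omM by (simp add: not_le)
        have Zeq: "Z t om = Z 0 om + N t om + A t om" if "0 \<le> t" for t by (rule Bad(2)[rule_format]) (use nn omM that in auto)
        have Pg: "P (grid T n i) om = N (grid T n i) om - N 0 om" for i using tau grid_range[of T n i] T by (simp add: P_def min_def)
        have Seq: "S n om = (\<Sum>i<n. (?d N n i om)\<^sup>2)" using Nb by (simp add: S_def Pg)
        have "(\<Sum>i<n. (?d Z n i om)\<^sup>2)
           \<le> (\<Sum>i<n. 2 * (?d N n i om)\<^sup>2 + 2 * (?d A n i om)\<^sup>2)"
        proof (rule sum_mono)
          fix i
          have "(x + y)\<^sup>2 \<le> 2 * x\<^sup>2 + 2 * y\<^sup>2" for x y :: real using sum_squares_bound[of x y] by (simp add: power2_sum)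
          from this[of "?d N n i om" "?d A n i om"]
          show "(?d Z n i om)\<^sup>2 \<le> 2 * (?d N n i om)\<^sup>2 + 2 * (?d A n i om)\<^sup>2"
            using Zeq[OF g0[of n "Suc i"]] Zeq[OF g0[of n i]] by (simp add: algebra_simps)
        qed
        also have "\<dots> = 2 * S n om + 2 * (\<Sum>i<n. (?d A n i om)\<^sup>2)" by (simp add: sum.distrib sum_distrib_left Seq)
        also have "(\<Sum>i<n. (?d A n i om)\<^sup>2) \<le> (real v)\<^sup>2"
          by (rule order_trans[OF sum_squares_le_square_sum power_mono[OF Ab]]) (auto intro: sum_nonneg)
        finally show False using om Sb by simp
      qed
    qed
    have Sm [measurable]: "S n \<in> borel_measurable M" using S_int by blast
    have s1: "?E1 \<in> events" by measurable
    have s2: "?E2 \<in> events" by measurable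
    have s3: "?E3 \<in> events" by measurable
    have s4: "?E4 \<in> events" by measurable
    note sets = s1 s2 s3 s4 null_setsD2[OF Bad(1)]
    have "prob ?E \<le> prob (?E1 \<union> (?E2 \<union> (?E3 \<union> (?E4 \<union> Bad))))"
      by (rule finite_measure_mono[OF sub]) (intro sets.Un sets)
    also have "\<dots> \<le> prob ?E1 + (prob ?E2 + (prob ?E3 + (prob ?E4 + prob Bad)))"
      by (intro order_trans[OF measure_Un_le] add_left_mono sets.Un sets order_refl)
    also have "prob Bad = 0" by (rule measure_eq_0_null_sets[OF Bad(1)])
    finally show "prob ?E \<le> e" using k m v S_prob[OF n] e by simp
  qed
qed

section \<open>A concave potential\<close>

text \<open>The infimum runs over all nearby pairs, not only those that involve \<open>x\<close>.
  Hence its strict sublevel sets are open, which makes it measurable for arbitrary \<open>g\<close>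
  and \<open>s\<close>, and at every \<open>z\<close> between two points less than \<open>d\<close>
  apart it is at most their squared quotient. The cap \<open>m\<close> keeps it bounded.\<close>

definition local_slope :: "real \<Rightarrow> real \<Rightarrow> real \<Rightarrow> real \<Rightarrow> (real \<Rightarrow> real) \<Rightarrow> (real \<Rightarrow> real) \<Rightarrow> real \<Rightarrow> real" where
  "local_slope a b d m s g x =
     Inf (insert m {((g v - g u) / (s v - s u))\<^sup>2 | u v. u \<in> {a..b} \<and> v \<in> {a..b} \<and> u \<noteq> v \<and> \<bar>u - x\<bar> < d \<and> \<bar>v - x\<bar> < d})"

lemma local_slope_bdd:
  fixes g s :: "real \<Rightarrow> real" and m :: real
  assumes "0 \<le> m"
  shows "bdd_below (insert m {((g v - g u) / (s v - s u))\<^sup>2 | u v. u \<in> {a..b} \<and> v \<in> {a..b} \<and> u \<noteq> v \<and> \<bar>u - x\<bar> < d \<and> \<bar>v - x\<bar> < (d::real)})"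
  by (rule bdd_belowI[of _ 0]) (use assms in auto)

lemma local_slope_nonneg: "0 \<le> m \<Longrightarrow> 0 \<le> local_slope a b d m s g x"
  unfolding local_slope_def by (rule cInf_greatest) auto

lemma local_slope_le_cap: "0 \<le> m \<Longrightarrow> local_slope a b d m s g x \<le> m"
  unfolding local_slope_def by (rule cInf_lower[OF _ local_slope_bdd]) auto

lemma local_slope_le:
  assumes "0 \<le> m" "u \<in> {a..b}" "v \<in> {a..b}" "u \<noteq> v" "\<bar>u - x\<bar> < d" "\<bar>v - x\<bar> < d"
  shows "local_slope a b d m s g x \<le> ((g v - g u) / (s v - s u))\<^sup>2"
  unfolding local_slope_def by (rule cInf_lower[OF _ local_slope_bdd]) (use assms in auto)

lemma local_slope_greatest:
  assumes "c \<le> m" "\<And>u v. u \<in> {a..b} \<Longrightarrow> v \<in> {a..b} \<Longrightarrow> u \<noteq> v \<Longrightarrow> \<bar>u - x\<bar> < d \<Longrightarrow> \<bar>v - x\<bar> < d \<Longrightarrow> c \<le> ((g v - g u) / (s v - s u))\<^sup>2"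
  shows "c \<le> local_slope a b d m s g x"
  unfolding local_slope_def by (rule cInf_greatest) (use assms in auto)

lemma local_slope_measurable:
  assumes m: "0 \<le> m" shows "local_slope a b d m s g \<in> borel_measurable borel"
proof (rule borel_measurableI_less)
  fix c
  have "open {x. local_slope a b d m s g x < c}"
  proof (cases "m < c")
    case True
    then have "{x. local_slope a b d m s g x < c} = UNIV" using order.strict_trans1[OF local_slope_le_cap[OF m]] by auto
    then show ?thesis by simp
  next
    case False
    have "{x. local_slope a b d m s g x < c} =
      (\<Union>(u, v)\<in>{(u, v). u \<in> {a..b} \<and> v \<in> {a..b} \<and> u \<noteq> v \<and> ((g v - g u) / (s v - s u))\<^sup>2 < c}. ball u d \<inter> ball v d)"
      (is "?L = ?R")
    proof (rule set_eqI)
      fix x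
      have "local_slope a b d m s g x < c \<longleftrightarrow> (\<exists>z\<in>insert m {((g v - g u) / (s v - s u))\<^sup>2 | u v. u \<in> {a..b} \<and> v \<in> {a..b} \<and> u \<noteq> v \<and> \<bar>u - x\<bar> < d \<and> \<bar>v - x\<bar> < d}. z < c)"
        unfolding local_slope_def by (rule cInf_less_iff[OF _ local_slope_bdd[OF m]]) auto
      also have "\<dots> \<longleftrightarrow> (\<exists>u v. u \<in> {a..b} \<and> v \<in> {a..b} \<and> u \<noteq> v \<and> \<bar>u - x\<bar> < d \<and> \<bar>v - x\<bar> < d \<and> ((g v - g u) / (s v - s u))\<^sup>2 < c)"
        using False by blast
      also have "\<dots> \<longleftrightarrow> x \<in> ?R" by (auto simp: dist_real_def)
      finally show "x \<in> ?L \<longleftrightarrow> x \<in> ?R" by simp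
    qed
    then show ?thesis by (auto intro!: open_UN open_Int)
  qed
  then show "{x \<in> space borel. local_slope a b d m s g x < c} \<in> sets borel" by simp
qed

locale concave_potential =
  fixes a b x0 d m :: real and rho g :: "real \<Rightarrow> real"
  assumes ab: "a < x0" "x0 < b" and d: "0 < d" and m: "0 \<le> m"
    and rho_cont: "continuous_on {a..b} rho" and rho_pos: "\<And>x. x \<in> {a..b} \<Longrightarrow> 0 < rho x"
begin

text \<open>Based at \<open>a\<close> and not at the reference point of the scale function: an
  additive constant does not affect the martingale property, and \<open>sc a = 0\<close> turns
  \<open>- V a\<close> into the energy integral, see \<open>V_left\<close>.\<close>

definition sc :: "real \<Rightarrow> real" where "sc x = integral {a..x} rho"

definition f :: "real \<Rightarrow> real" where "f = local_slope a b d m sc g"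

text \<open>\<open>G\<close> integrates \<open>2 f\<close> against \<open>d sc\<close>, and
  \<open>P\<close> integrates \<open>f\<close> against \<open>d (sc^2)\<close>; integration by parts
  then expresses the potential through both.\<close>

definition G :: "real \<Rightarrow> real" where "G x = integral {a..x} (\<lambda>u. f u * (2 * rho u))"

definition P :: "real \<Rightarrow> real" where "P x = integral {a..x} (\<lambda>u. f u * (2 * sc u * rho u))"

definition D :: "real \<Rightarrow> real" where "D x = G x0 - G x"

text \<open>As a function of \<open>sc\<close>, \<open>V\<close> has derivative \<open>D\<close> and second derivative \<open>- 2 * f\<close>.\<close>

definition V :: "real \<Rightarrow> real" where "V x = P x - P x0 + sc x * D x"

lemma f_nonneg: "0 \<le> f x" and f_le: "f x \<le> m" and f_measurable [measurable]: "f \<in> borel_measurable borel"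
  unfolding f_def using m by (auto intro: local_slope_nonneg local_slope_le_cap local_slope_measurable)

lemma rho_integrable: "rho integrable_on {a..b}"
  using rho_cont by (rule integrable_continuous_real)

lemma sc_deriv: "x \<in> {a..b} \<Longrightarrow> (sc has_real_derivative rho x) (at x within {a..b})"
  unfolding sc_def[abs_def] by (rule integral_has_real_derivative[OF rho_cont])

lemma sc_cont: "continuous_on {a..b} sc"
  unfolding sc_def[abs_def] by (rule indefinite_integral_continuous_1[OF rho_integrable])

lemma sc_diff:
  assumes "x \<in> {a..b}" "y \<in> {a..b}" "x \<le> y" shows "sc y - sc x = integral {x..y} rho"
proof -
  have "rho integrable_on {a..y}" using assms by (intro integrable_on_subinterval[OF rho_integrable]) auto
  from Henstock_Kurzweil_Integration.integral_combine[OF _ assms(3) this] assms show ?thesis by (simp add: sc_def)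
qed

lemma sc_strict:
  assumes "x \<in> {a..b}" "y \<in> {a..b}" "x < y" shows "sc x < sc y"
proof -
  have sub: "{x..y} \<subseteq> {a..b}" using assms by auto
  obtain z where z: "z \<in> {x..y}" "\<And>u. u \<in> {x..y} \<Longrightarrow> rho z \<le> rho u"
    using continuous_attains_inf[of "{x..y}" rho] continuous_on_subset[OF rho_cont sub] assms by auto
  have "0 < (y - x) * rho z" using rho_pos[of z] z(1) sub assms by auto
  also have "\<dots> = integral {x..y} (\<lambda>_. rho z)" using assms by simp
  also have "\<dots> \<le> integral {x..y} rho" using z(2) integrable_on_subinterval[OF rho_integrable sub] by (intro integral_le) auto
  finally show ?thesis using sc_diff[OF assms(1,2)] assms(3) by simp
qed

lemma sc_mono: "x \<in> {a..b} \<Longrightarrow> y \<in> {a..b} \<Longrightarrow> x \<le> y \<Longrightarrow> sc x \<le> sc y"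
  using sc_strict[of x y] by (cases "x = y") auto

lemma f_times_set_integrable:
  assumes k: "continuous_on {a..b} k" shows "set_integrable lborel {a..b} (\<lambda>u. f u * k u)"
proof -
  have "set_integrable lborel {a..b} (\<lambda>u. m * k u)" using k by (intro set_integrable_mult_right borel_integrable_atLeastAtMost')
  moreover have "set_borel_measurable lborel {a..b} (\<lambda>u. f u * k u)"
  proof -
    have "(\<lambda>u. indicator {a..b} u *\<^sub>R k u) \<in> borel_measurable borel"
      using borel_measurable_continuous_on_restrict[OF k] by (subst (asm) borel_measurable_restrict_space_iff) auto
    then have "(\<lambda>u. f u * (indicator {a..b} u *\<^sub>R k u)) \<in> borel_measurable borel"
      by (rule borel_measurable_times[OF f_measurable])
    then show ?thesis unfolding set_borel_measurable_def by (simp add: mult.left_commute)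
  qed
  ultimately show ?thesis
    by (rule set_integrable_bound) (use f_nonneg f_le m in \<open>auto simp: abs_mult intro!: mult_right_mono AE_I2\<close>)
qed

lemma f_times: "continuous_on {a..b} k \<Longrightarrow> (\<lambda>u. f u * k u) integrable_on {a..b}"
  by (rule set_borel_integral_eq_integral(1)[OF f_times_set_integrable])

lemma f_times_diff:
  assumes k: "continuous_on {a..b} k" and "x \<in> {a..b}" "y \<in> {a..b}" "x \<le> y"
  shows "integral {a..y} (\<lambda>u. f u * k u) - integral {a..x} (\<lambda>u. f u * k u) = integral {x..y} (\<lambda>u. f u * k u)"
proof -
  have "(\<lambda>u. f u * k u) integrable_on {a..y}" using assms by (intro integrable_on_subinterval[OF f_times[OF k]]) auto
  from Henstock_Kurzweil_Integration.integral_combine[OF _ assms(4) this] assms show ?thesis by simp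
qed

lemma kG: "continuous_on {a..b} (\<lambda>u. 2 * rho u)" and kP: "continuous_on {a..b} (\<lambda>u. 2 * sc u * rho u)"
  by (intro continuous_intros rho_cont sc_cont)+

text \<open>Taylor's formula with integral remainder in the variable \<open>sc\<close> at the base
  point \<open>z\<close>, for either order of \<open>z\<close> and \<open>w\<close>.\<close>

lemma potential_diff:
  assumes x: "x \<in> {a..b}" and y: "y \<in> {a..b}" and le: "x \<le> y" and zw: "z = x \<and> w = y \<or> z = y \<and> w = x"
  shows "V z + D z * (sc w - sc z) - V w = integral {x..y} (\<lambda>u. f u * (2 * \<bar>sc u - sc w\<bar> * rho u))"
proof -
  have sub: "{x..y} \<subseteq> {a..b}" using x y by auto
  have I: "(\<lambda>u. f u * k u) integrable_on {x..y}" if "continuous_on {a..b} k" for k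
    by (rule integrable_on_subinterval[OF f_times[OF that] sub])
  note I = I[OF kG] I[OF kP]
  have "integral {x..y} (\<lambda>u. f u * (2 * (sc u - sc w) * rho u))
    = integral {x..y} (\<lambda>u. f u * (2 * sc u * rho u) - sc w * (f u * (2 * rho u)))" by (intro integral_cong) (simp add: algebra_simps)
  also have "\<dots> = integral {x..y} (\<lambda>u. f u * (2 * sc u * rho u)) - sc w * integral {x..y} (\<lambda>u. f u * (2 * rho u))"
    by (subst Henstock_Kurzweil_Integration.integral_diff)
      (use I in \<open>auto intro: integrable_on_cmult_left[where 'b = real, simplified]\<close>)
  also have "\<dots> = (P y - P x) - sc w * (G y - G x)"
    unfolding P_def G_def by (simp only: f_times_diff[OF kG x y le] f_times_diff[OF kP x y le])
  finally have eq: "integral {x..y} (\<lambda>u. f u * (2 * (sc u - sc w) * rho u)) = (P y - P x) - sc w * (G y - G x)" .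
  show ?thesis
  proof (cases "w = y")
    case True
    have "integral {x..y} (\<lambda>u. f u * (2 * \<bar>sc u - sc w\<bar> * rho u)) = integral {x..y} (\<lambda>u. - (f u * (2 * (sc u - sc w) * rho u)))"
      by (intro integral_cong) (use True sc_mono[OF _ y] sub in \<open>auto simp: algebra_simps subset_eq\<close>)
    also have "\<dots> = - ((P y - P x) - sc w * (G y - G x))" by (simp only: integral_neg eq)
    finally show ?thesis using True zw by (auto simp: V_def D_def algebra_simps)
  next
    case False
    then have w: "w = x" "z = y" using zw by auto
    have "integral {x..y} (\<lambda>u. f u * (2 * \<bar>sc u - sc w\<bar> * rho u)) = integral {x..y} (\<lambda>u. f u * (2 * (sc u - sc w) * rho u))"
      by (intro integral_cong) (use w sc_mono[OF x] sub in \<open>auto simp: algebra_simps subset_eq\<close>)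
    then show ?thesis using eq w by (simp add: V_def D_def algebra_simps)
  qed
qed

lemma abs_sc_cont: "continuous_on {a..b} (\<lambda>u. 2 * \<bar>sc u - c\<bar> * rho u)"
  by (intro continuous_intros rho_cont sc_cont)

lemma integral_abs_sc:
  assumes x: "x \<in> {a..b}" and y: "y \<in> {a..b}" and le: "x \<le> y" and w: "w = x \<or> w = y"
  shows "((\<lambda>u. 2 * \<bar>sc u - sc w\<bar> * rho u) has_integral (sc y - sc x)\<^sup>2) {x..y}"
proof -
  have sub: "{x..y} \<subseteq> {a..b}" using x y by auto
  \<comment> \<open>The sign of \<open>sc u - sc w\<close> on the interval.\<close>
  define e where "e = (if w = x then 1 else -1 :: real)"
  have "((\<lambda>u. e * (2 * (sc u - sc w) * rho u)) has_integral (e * (sc y - sc w)\<^sup>2 - e * (sc x - sc w)\<^sup>2)) {x..y}"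
  proof (rule fundamental_theorem_of_calculus[OF le])
    fix u assume u: "u \<in> {x..y}"
    have "(sc has_real_derivative rho u) (at u within {x..y})" by (rule DERIV_subset[OF sc_deriv sub]) (use u sub in auto)
    then have "((\<lambda>u. e * (sc u - sc w)\<^sup>2) has_real_derivative e * (2 * (sc u - sc w) * rho u)) (at u within {x..y})"
      by (auto intro!: derivative_eq_intros)
    then show "((\<lambda>u. e * (sc u - sc w)\<^sup>2) has_vector_derivative e * (2 * (sc u - sc w) * rho u)) (at u within {x..y})"
      by (simp add: has_real_derivative_iff_has_vector_derivative)
  qed
  moreover have "e * (sc y - sc w)\<^sup>2 - e * (sc x - sc w)\<^sup>2 = (sc y - sc x)\<^sup>2" using w by (auto simp: e_def power2_commute)
  moreover have "e * (2 * (sc u - sc w) * rho u) = 2 * \<bar>sc u - sc w\<bar> * rho u" if "u \<in> {x..y}" for u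
    using sc_mono[OF x, of u] sc_mono[OF _ y, of u] that sub w by (auto simp: e_def subset_eq)
  ultimately show ?thesis using has_integral_eq[of "{x..y}"] by (metis (no_types, lifting))
qed

lemma V_x0: "V x0 = 0" by (simp add: V_def D_def)

lemma D_x0: "D x0 = 0" by (simp add: D_def)

lemma V_nonpos:
  assumes y: "y \<in> {a..b}" shows "V y \<le> 0"
proof -
  have x0: "x0 \<in> {a..b}" using ab by auto
  have nn: "0 \<le> integral {u..v} (\<lambda>u. f u * (2 * \<bar>sc u - sc y\<bar> * rho u))" if "{u..v} \<subseteq> {a..b}" for u v
    using f_nonneg rho_pos that
    by (intro integral_nonneg integrable_on_subinterval[OF f_times[OF abs_sc_cont] that]) (auto simp: subset_eq less_imp_le)
  show ?thesis
  proof (cases "x0 \<le> y")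
    case True
    then show ?thesis using potential_diff[OF x0 y True, of x0 y] nn[of x0 y] x0 y by (simp add: V_x0 D_x0)
  next
    case False
    then have le: "y \<le> x0" by simp
    show ?thesis using potential_diff[OF y x0 le, of x0 y] nn[of y x0] x0 y by (simp add: V_x0 D_x0)
  qed
qed

lemma V_left: "- V a = integral {a..x0} (\<lambda>u. f u * (2 * sc u * rho u))"
proof -
  have "V a = - P x0" by (simp add: V_def P_def sc_def)
  then show ?thesis by (simp add: P_def)
qed

lemma energy_eq:
  shows "(\<lambda>u. ennreal (f u * (2 * sc u * rho u)) * indicator {a..x0} u) \<in> borel_measurable lborel"
    and "(\<integral>\<^sup>+u\<in>{a..x0}. ennreal (f u * (2 * sc u * rho u)) \<partial>lborel) = ennreal (- V a)"
proof -
  let ?h = "\<lambda>u. f u * (2 * sc u * rho u)"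
  have h: "set_integrable lborel {a..x0} ?h" by (rule set_integrable_subset[OF f_times_set_integrable[OF kP]]) (use ab in auto)
  have eq: "ennreal (?h u) * indicator {a..x0} u = ennreal (indicator {a..x0} u *\<^sub>R ?h u)" for u by (auto simp: indicator_def)
  have nn: "0 \<le> indicator {a..x0} u *\<^sub>R ?h u" for u
  proof (cases "u \<in> {a..x0}")
    case True
    then have "u \<in> {a..b}" using ab by auto
    then have "0 \<le> sc u" "0 < rho u" using sc_mono[of a u] rho_pos ab by (auto simp: sc_def)
    then show ?thesis using f_nonneg[of u] by simp
  qed simp
  show "(\<lambda>u. ennreal (?h u) * indicator {a..x0} u) \<in> borel_measurable lborel"
    unfolding eq using h unfolding set_integrable_def by (intro measurable_compose[OF borel_measurable_integrable measurable_ennreal])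
  have "(\<integral>\<^sup>+u\<in>{a..x0}. ennreal (?h u) \<partial>lborel) = ennreal (LINT u:{a..x0}|lborel. ?h u)"
    unfolding eq set_lebesgue_integral_def using h nn unfolding set_integrable_def by (intro nn_integral_eq_integral) auto
  also have "(LINT u:{a..x0}|lborel. ?h u) = - V a" unfolding V_left by (rule set_borel_integral_eq_integral(2)[OF h])
  finally show "(\<integral>\<^sup>+u\<in>{a..x0}. ennreal (?h u) \<partial>lborel) = ennreal (- V a)" .
qed

text \<open>Throughout the interval between the two points \<open>f\<close> is at most their squared
  quotient. Pulled out of the remainder in \<open>potential_diff\<close> it leaves the integral of
  \<open>2 \<bar>sc u - sc y\<bar>\<close> against \<open>d sc\<close>, which is the squared
  increment of \<open>sc\<close>; the product is the squared increment of \<open>g\<close>.\<close>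

lemma V_step:
  assumes x: "x \<in> {a..b}" and y: "y \<in> {a..b}" and near: "\<bar>y - x\<bar> < d"
  shows "V x + D x * (sc y - sc x) - (g y - g x)\<^sup>2 \<le> V y"
proof (cases "x = y")
  let ?w = "\<lambda>z. 2 * \<bar>sc z - sc y\<bar> * rho z"
  case False
  define u v where "u = min x y" and "v = max x y"
  have uv: "u \<in> {a..b}" "v \<in> {a..b}" "u < v" "v - u < d" using False x y near by (auto simp: u_def v_def)
  have or: "x = u \<and> y = v \<or> x = v \<and> y = u" by (auto simp: u_def v_def)
  define r where "r = ((g v - g u) / (sc v - sc u))\<^sup>2"
  have "V x + D x * (sc y - sc x) - V y = integral {u..v} (\<lambda>z. f z * ?w z)" by (rule potential_diff[OF uv(1,2) less_imp_le[OF uv(3)] or])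
  also have "\<dots> \<le> integral {u..v} (\<lambda>z. r * ?w z)"
  proof (rule integral_le)
    have sub: "{u..v} \<subseteq> {a..b}" using uv by auto
    show "(\<lambda>z. f z * ?w z) integrable_on {u..v}" by (rule integrable_on_subinterval[OF f_times[OF abs_sc_cont] sub])
    show "(\<lambda>z. r * ?w z) integrable_on {u..v}"
      by (intro integrable_continuous_real continuous_on_mult continuous_on_const continuous_on_subset[OF abs_sc_cont sub])
    fix z assume z: "z \<in> {u..v}"
    have "f z \<le> r" unfolding f_def r_def using z uv by (intro local_slope_le m) auto
    moreover have "0 \<le> 2 * \<bar>sc z - sc y\<bar> * rho z" using rho_pos[of z] z sub by (auto simp: less_imp_le)
    ultimately show "f z * ?w z \<le> r * ?w z" by (rule mult_right_mono)
  qed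
  also have "\<dots> = r * (sc v - sc u)\<^sup>2"
  proof (rule integral_unique, rule has_integral_mult_right, rule integral_abs_sc[OF uv(1,2) less_imp_le[OF uv(3)]])
    show "y = u \<or> y = v" using or by auto
  qed
  also have "\<dots> = (g v - g u)\<^sup>2" using sc_strict[OF uv(1,2,3)] unfolding r_def power_divide by simp
  also have "\<dots> = (g y - g x)\<^sup>2" using or by (auto simp: power2_commute)
  finally show ?thesis by simp
qed simp

lemma V_cont: "continuous_on {a..b} V" and D_cont: "continuous_on {a..b} D"
proof -
  have "continuous_on {a..b} P" "continuous_on {a..b} G" unfolding P_def[abs_def] G_def[abs_def]
    by (rule indefinite_integral_continuous_1 f_times kG kP)+
  then show "continuous_on {a..b} D" unfolding D_def[abs_def] by (intro continuous_intros)
  then show "continuous_on {a..b} V" unfolding V_def[abs_def] using \<open>continuous_on {a..b} P\<close> by (intro continuous_intros sc_cont)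
qed

end

text \<open>
  The weights \<open>c\<close> stop the sum at the first large jump or when the accumulated squares exceed \<open>K\<close>; each
  of the two may be overshot by one step.
\<close>

lemma stopped_sum_bound:
  fixes V w q :: "nat \<Rightarrow> real" and jump :: "nat \<Rightarrow> bool" and K B C :: real
  defines "c \<equiv> \<lambda>i. if (\<Sum>j<i. q j) \<le> K \<and> (\<forall>j<i. \<not> jump j) then 1 else (0::real)"
  assumes V: "\<And>i. V i \<le> 0" "V 0 = 0" and q: "\<And>i. 0 \<le> q i" "\<And>i. q i \<le> B"
    and step: "\<And>i. \<not> jump i \<Longrightarrow> V i + w i - q i \<le> V (Suc i)" and big: "\<And>i. V i + w i - C \<le> V (Suc i)"
    and nonneg: "0 \<le> K" "0 \<le> C"
  shows "(\<Sum>i<n. c i * w i) \<le> K + B + (if \<exists>i<n. jump i then C else 0) + (if (\<Sum>j<n. q j) \<le> K \<and> (\<forall>j<n. \<not> jump j) then V n else 0)"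
proof -
  let ?ok = "\<lambda>n. (\<Sum>j<n. q j) \<le> K \<and> (\<forall>j<n. \<not> jump j)" and ?w = "\<lambda>n. \<Sum>i<n. c i * w i"
  let ?le = "\<lambda>n. ?w n \<le> K + B + (if \<exists>i<n. jump i then C else 0)"
  \<comment> \<open>An invariant with two phases: while the sum runs, the account including
    \<open>V n\<close> is kept; once it has stopped, nothing is added and only the final bound is
    carried along.\<close>
  let ?claim = "\<lambda>n. (c n = 1 \<longrightarrow> ?w n \<le> (\<Sum>j<n. q j) + V n) \<and> (c n = 0 \<longrightarrow> ?le n)"
  have B: "0 \<le> B" using q[of 0] by linarith
  have claim: "?claim n" for n
  proof (induction n)
    case 0
    then show ?case using V nonneg by (auto simp: c_def)
  next
    case (Suc n)
    consider "?ok n" "\<not> jump n" | "?ok n" "jump n"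
      | "\<not> ?ok n" by blast
    then show ?case
    proof cases
      case 1
      then have c1: "c n = 1" by (simp add: c_def)
      have le: "?w (Suc n) \<le> (\<Sum>j<Suc n. q j) + V (Suc n)" using Suc c1 step[OF 1(2)] by simp
      have "(\<Sum>j<Suc n. q j) \<le> K + B" using 1 q(2)[of n] by simp
      then have "?le (Suc n)" using le V(1)[of "Suc n"] nonneg by (auto split: if_splits)
      with le show ?thesis by blast
    next
      case 2
      then have c1: "c n = 1" by (simp add: c_def)
      have "?w (Suc n) \<le> K + C + V (Suc n)" using Suc c1 big[of n] 2 by simp
      then have "?le (Suc n)" using V(1)[of "Suc n"] B 2 by auto
      moreover have "c (Suc n) = 0" using 2 by (auto simp: c_def)
      ultimately show ?thesis by simp
    next
      case 3
      then have c0: "c n = 0" by (auto simp: c_def)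
      have "\<not> ?ok (Suc n)" using 3 q(1)[of n] by (auto simp: less_Suc_eq)
      then have c0': "c (Suc n) = 0" by (auto simp: c_def)
      have "?le n" using Suc c0 by simp
      also have "\<dots> \<le> K + B + (if \<exists>i<Suc n. jump i then C else 0)" using nonneg by (auto simp: less_Suc_eq)
      finally show ?thesis using c0 c0' by simp
    qed
  qed
  show ?thesis
  proof (cases "?ok n")
    case True
    then have "c n = 1" by (simp add: c_def)
    then show ?thesis using claim[of n] True nonneg B by auto
  next
    case False
    then have "c n = 0" by (auto simp: c_def)
    then show ?thesis using claim[of n] False by auto
  qed
qed

context filtered_prob_space begin

text \<open>Equal integrals over all sets of \<open>F t\<close> identify \<open>v\<close> as the
  conditional expectation of \<open>u\<close>, so bounded weights known at time \<open>t\<close> may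
  be inserted.\<close>

lemma weighted_martingale_increment:
  assumes eq: "\<And>A. A \<in> sets (F t) \<Longrightarrow> (\<integral>om. indicator A om * u om \<partial>M) = (\<integral>om. indicator A om * v om \<partial>M)"
    and u: "integrable M u" and v: "integrable M v" "v \<in> borel_measurable (F t)"
    and w: "w \<in> borel_measurable (F t)" "\<And>om. om \<in> space M \<Longrightarrow> \<bar>w om\<bar> \<le> (B :: real)"
  shows "integrable M (\<lambda>om. w om * (u om - v om))" "(\<integral>om. w om * (u om - v om) \<partial>M) = 0"
proof -
  interpret C: finite_measure_subalgebra M "F t" by standard (auto simp: subalgebra_def space_F intro: subsetD[OF sets_F_subset])
  have [measurable]: "u \<in> borel_measurable M" "v \<in> borel_measurable M" using u v by auto
  have wM [measurable]: "w \<in> borel_measurable M" by (rule measurable_F_M[OF w(1)])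
  have "AE om in M. real_cond_exp M (F t) u om = v om"
    by (rule C.real_cond_exp_charact[OF _ u v]) (use eq in \<open>simp add: set_lebesgue_integral_def\<close>)
  then have ce: "(\<integral>om. w om * real_cond_exp M (F t) u om \<partial>M) = (\<integral>om. w om * v om \<partial>M)"
    by (intro integral_cong_AE) auto
  have I: "integrable M (\<lambda>om. w om * h om)" if h: "integrable M h" for h
  proof (rule Bochner_bound[OF integrable_mult_right[OF h, of B]])
    show "(\<lambda>om. w om * h om) \<in> borel_measurable M" using h by measurable
    show "AE om in M. norm (w om * h om) \<le> norm (B * h om)"
      using w(2) by (intro AE_I2) (auto simp: abs_mult intro!: mult_right_mono order_trans[OF w(2) abs_ge_self])
  qed
  have "(\<integral>om. w om * real_cond_exp M (F t) u om \<partial>M) = (\<integral>om. w om * u om \<partial>M)"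
    by (rule C.real_cond_exp_intg(2)[OF I[OF u] w(1)]) simp
  with ce I[OF u] I[OF v(1)] show "integrable M (\<lambda>om. w om * (u om - v om))" "(\<integral>om. w om * (u om - v om) \<partial>M) = 0"
    by (simp_all add: right_diff_distrib)
qed

end

context filtered_prob_space begin

text \<open>\<open>stopped_sum_bound\<close> is applied along paths and integrated. The left side
  has mean zero, since each weight is known before the increment of \<open>sc(X)\<close> that it
  multiplies. What remains is \<open>V\<close> at the final time on the event that the sum was never
  stopped, and there \<open>X T = a\<close> contributes \<open>V a\<close>. That intersection has at
  least the probability of \<open>X T = a\<close> less those of a large sum and of a large
  increment.\<close>

lemma stopped_potential_bound:
  fixes X :: "real \<Rightarrow> 'a \<Rightarrow> real" and V D sc g :: "real \<Rightarrow> real" and a b x0 K B C d T :: real and n :: nat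
  defines "J \<equiv> {om\<in>space M. \<exists>i<n. d \<le> \<bar>X (grid T n (Suc i)) om - X (grid T n i) om\<bar>}"
  assumes X: "\<And>t. 0 \<le> t \<Longrightarrow> X t \<in> borel_measurable (F t)" "\<And>om t. om \<in> space M \<Longrightarrow> 0 \<le> t \<Longrightarrow> X t om \<in> {a..b}"
    "AE om in M. X 0 om = x0"
    and [measurable]: "V \<in> borel_measurable borel" "D \<in> borel_measurable borel" "sc \<in> borel_measurable borel" "g \<in> borel_measurable borel"
    and V0: "V x0 = 0" "\<And>x. x \<in> {a..b} \<Longrightarrow> V x \<le> 0"
    and step: "\<And>x y. x \<in> {a..b} \<Longrightarrow> y \<in> {a..b} \<Longrightarrow> \<bar>y - x\<bar> < d \<Longrightarrow> V x + D x * (sc y - sc x) - (g y - g x)\<^sup>2 \<le> V y"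
    and big: "\<And>x y. x \<in> {a..b} \<Longrightarrow> y \<in> {a..b} \<Longrightarrow> V x + D x * (sc y - sc x) - C \<le> V y"
    and gB: "\<And>x y. x \<in> {a..b} \<Longrightarrow> y \<in> {a..b} \<Longrightarrow> (g y - g x)\<^sup>2 \<le> B"
    and bounds: "\<And>x. x \<in> {a..b} \<Longrightarrow> \<bar>D x\<bar> \<le> Db" "\<And>x. x \<in> {a..b} \<Longrightarrow> \<bar>sc x\<bar> \<le> Sb"
    and nonneg: "0 \<le> K" "0 \<le> C" "0 \<le> T" and n: "0 < n" and a: "a \<in> {a..b}"
    and mart: "\<And>u t A. 0 \<le> u \<Longrightarrow> u \<le> t \<Longrightarrow> A \<in> sets (F u) \<Longrightarrow> (\<integral>om. indicator A om * sc (X t om) \<partial>M) = (\<integral>om. indicator A om * sc (X u om) \<partial>M)"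
  shows "- V a * (prob {om\<in>space M. X T om = a} - prob {om\<in>space M. K < (\<Sum>i<n. (g (X (grid T n (Suc i)) om) - g (X (grid T n i) om))\<^sup>2)} - prob J)
     \<le> K + B + C * prob J"
proof -
  let ?A = "{om\<in>space M. X T om = a}"
  define t where "t = grid T n"
  have t: "0 \<le> t i" "incseq t" "t n = T" "t 0 = 0" for i
    using grid_range[OF nonneg(3)] grid_mono[OF nonneg(3)] grid_end[OF n] by (auto simp: t_def grid_def)
  have XF: "X (t i) \<in> borel_measurable (F (t i))" for i by (rule X(1)[OF t(1)])
  have XM [measurable]: "X (t i) \<in> borel_measurable M" for i by (rule measurable_F_M[OF XF])
  have XR: "X (t i) om \<in> {a..b}" if "om \<in> space M" for i om by (rule X(2)[OF that t(1)])
  have XFj: "X (t j) \<in> borel_measurable (F (t i))" if "j \<le> i" for i j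
    by (rule measurable_F_mono[OF _ XF]) (use incseqD[OF t(2) that] in simp)
  define q where "q i om = (g (X (t (Suc i)) om) - g (X (t i) om))\<^sup>2" for i om
  define jump where "jump i om \<longleftrightarrow> d \<le> \<bar>X (t (Suc i)) om - X (t i) om\<bar>" for i om
  define c where "c i om = (if (\<Sum>j<i. q j om) \<le> K \<and> (\<forall>j<i. \<not> jump j om) then 1 else (0::real))" for i om
  define w where "w i om = D (X (t i) om) * (sc (X (t (Suc i)) om) - sc (X (t i) om))" for i om
  define Gd where "Gd = {om\<in>space M. (\<Sum>j<n. q j om) \<le> K \<and> (\<forall>j<n. \<not> jump j om)}"
  let ?hit = "?A \<inter> Gd"
  have Jd: "J = {om\<in>space M. \<exists>i<n. jump i om}" by (simp add: J_def jump_def t_def)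
  have scint: "integrable M (\<lambda>om. sc (X (t i) om))" for i by (rule integrable_const_bound[where B = Sb]) (use bounds(2) XR in auto)
  have cw: "integrable M (\<lambda>om. c i om * w i om) \<and> (\<integral>om. c i om * w i om \<partial>M) = 0" for i
  proof -
    have qm: "q j \<in> borel_measurable (F (t i))" if "j < i" for j unfolding q_def[abs_def] using measurable_compose[OF XFj] that
      by (intro borel_measurable_power borel_measurable_diff measurable_compose[OF XFj]) auto
    have Qm: "(\<lambda>om. \<Sum>j<i. q j om) \<in> borel_measurable (F (t i))" using qm by (intro borel_measurable_sum) auto
    have jm: "Measurable.pred (F (t i)) (jump j)" if "j < i" for j
    proof -
      have "(\<lambda>om. \<bar>X (t (Suc j)) om - X (t j) om\<bar>) \<in> borel_measurable (F (t i))"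
        using that by (intro borel_measurable_abs borel_measurable_diff XFj) auto
      then show ?thesis unfolding jump_def[abs_def] by measurable
    qed
    have jm': "Measurable.pred (F (t i)) (\<lambda>om. \<forall>j<i. \<not> jump j om)"
    proof -
      have "Measurable.pred (F (t i)) (\<lambda>om. \<forall>j\<in>{..<i}. \<not> jump j om)"
        by (intro pred_intros_finite(3) pred_intros_logic(1)) (use jm in \<open>auto intro: pred_intros_logic\<close>)
      then show ?thesis by (simp only: Ball_def lessThan_iff)
    qed
    have "(\<lambda>om. if S om \<le> K \<and> R om then 1 else (0::real)) \<in> borel_measurable N"
      if [measurable]: "S \<in> borel_measurable N" "Measurable.pred N R" for S R and N :: "'a measure" by measurable
    from this[OF Qm jm'] have cm: "c i \<in> borel_measurable (F (t i))" unfolding c_def[abs_def] .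
    have Dm: "(\<lambda>om. D (X (t i) om)) \<in> borel_measurable (F (t i))" by (rule measurable_compose[OF XF]) simp
    have e: "(\<integral>om. indicator A om * sc (X (t (Suc i)) om) \<partial>M) = (\<integral>om. indicator A om * sc (X (t i) om) \<partial>M)" if "A \<in> sets (F (t i))" for A
      by (rule mart[OF t(1) incseq_SucD[OF t(2)] that])
    have scm: "(\<lambda>om. sc (X (t i) om)) \<in> borel_measurable (F (t i))" by (rule measurable_compose[OF XF]) simp
    have bd: "\<bar>c i om * D (X (t i) om)\<bar> \<le> Db" if "om \<in> space M" for om
      using bounds(1)[OF XR[OF that, of i]] by (auto simp: c_def)
    from weighted_martingale_increment[OF e scint scint scm borel_measurable_times[OF cm Dm] bd]
    show ?thesis by (simp add: w_def mult.assoc)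
  qed
  have Gm [measurable]: "Gd \<in> events" and Jm [measurable]: "J \<in> events" unfolding Gd_def Jd q_def jump_def by measurable
  have XTm: "X T \<in> borel_measurable M" using XM[of n] t(3) by simp
  have pw: "AE om in M. (\<Sum>i<n. c i om * w i om) \<le> K + B + C * indicator J om + V a * indicator ?hit om" using X(3) AE_space
  proof eventually_elim
    case (elim om)
    have "(\<Sum>i<n. c i om * w i om) \<le> K + B + (if \<exists>i<n. jump i om then C else 0) + (if (\<Sum>j<n. q j om) \<le> K \<and> (\<forall>j<n. \<not> jump j om) then V (X (t n) om) else 0)"
      unfolding c_def
    proof (rule stopped_sum_bound)
      show "V (X (t i) om) \<le> 0" for i by (rule V0(2)[OF XR[OF elim(2)]])
      show "V (X (t 0) om) = 0" using elim(1) V0(1) t(4) by simp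
      show "0 \<le> q i om" for i by (simp add: q_def)
      show "q i om \<le> B" for i unfolding q_def by (rule gB[OF XR[OF elim(2)] XR[OF elim(2)]])
      show "V (X (t i) om) + w i om - q i om \<le> V (X (t (Suc i)) om)" if "\<not> jump i om" for i
        unfolding w_def q_def by (rule step[OF XR[OF elim(2)] XR[OF elim(2)]]) (use that in \<open>simp add: jump_def\<close>)
      show "V (X (t i) om) + w i om - C \<le> V (X (t (Suc i)) om)" for i unfolding w_def by (rule big[OF XR[OF elim(2)] XR[OF elim(2)]])
    qed (use nonneg in auto)
    also have "(if \<exists>i<n. jump i om then C else 0) = C * indicator J om" using elim(2) by (auto simp: Jd indicator_def)
    \<comment> \<open>\<open>V\<close> is nonpositive, so its values at final states other than
      \<open>a\<close> are dropped.\<close>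
    also have "(if (\<Sum>j<n. q j om) \<le> K \<and> (\<forall>j<n. \<not> jump j om) then V (X (t n) om) else 0) \<le> V a * indicator ?hit om"
      using elim(2) t(3) V0(2)[OF XR[OF elim(2), of n]] by (auto simp: Gd_def indicator_def)
    finally show ?case by simp
  qed
  have Em: "?A \<in> events" using XTm by measurable
  have EGm: "?A \<inter> Gd \<in> events" using Em Gm by blast
  have "0 = (\<integral>om. (\<Sum>i<n. c i om * w i om) \<partial>M)" using cw by (simp add: Bochner_Integration.integral_sum)
  also have "\<dots> \<le> (\<integral>om. K + B + C * indicator J om + V a * indicator ?hit om \<partial>M)"
  proof (rule integral_mono_AE[OF _ _ pw])
    show "integrable M (\<lambda>om. \<Sum>i<n. c i om * w i om)" using cw by (intro Bochner_Integration.integrable_sum) auto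
    show "integrable M (\<lambda>om. K + B + C * indicator J om + V a * indicator ?hit om)"
      using EGm by (intro Bochner_Integration.integrable_add integrable_mult_right integrable_const) (auto simp: emeasure_eq_measure)
  qed
  also have "\<dots> = K + B + C * prob J + V a * prob ?hit" using EGm by (simp add: emeasure_eq_measure prob_space)
  finally have main: "- V a * prob ?hit \<le> K + B + C * prob J" by simp
  let ?Q = "{om\<in>space M. K < (\<Sum>i<n. (g (X (grid T n (Suc i)) om) - g (X (grid T n i) om))\<^sup>2)}"
  have Qm: "?Q \<in> events" unfolding t_def[symmetric] by measurable
  have "prob ?A \<le> prob (?hit \<union> (?Q \<union> J))"
  proof (rule finite_measure_mono)
    show "?A \<subseteq> ?hit \<union> (?Q \<union> J)" by (auto simp: Gd_def Jd q_def t_def)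
    show "?hit \<union> (?Q \<union> J) \<in> events" using EGm Qm Jm by blast
  qed
  also have "\<dots> \<le> prob ?hit + (prob ?Q + prob J)" by (intro order_trans[OF measure_Un_le] add_left_mono measure_Un_le sets.Un EGm Qm Jm)
  finally have "prob ?A - prob ?Q - prob J \<le> prob ?hit" by simp
  from mult_left_mono[OF this, of "- V a"] main V0(2)[OF a] show ?thesis by simp
qed

text \<open>Each path is uniformly continuous on \<open>[0, T]\<close>, so its increments along a
  fine enough grid are all below \<open>d\<close>.\<close>

lemma large_increment_unlikely:
  assumes X: "\<And>t. 0 \<le> t \<Longrightarrow> X t \<in> borel_measurable M" and c: "\<And>om. om \<in> space M \<Longrightarrow> continuous_on {0..} (\<lambda>t. X t om :: real)"
    and T: "0 \<le> T" and d: "0 < d" and e: "0 < e"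
  shows "\<exists>n>0. prob {om\<in>space M. \<exists>i<n. d \<le> \<bar>X (grid T n (Suc i)) om - X (grid T n i) om\<bar>} < e"
proof -
  have [measurable]: "X (grid T n i) \<in> borel_measurable M" for n i using X grid_range[OF T] by blast
  have "\<exists>n. prob {om\<in>space M. \<exists>i<Suc n. d \<le> \<bar>X (grid T (Suc n) (Suc i)) om - X (grid T (Suc n) i) om\<bar>} < e"
  proof (rule eventually_small_measure[OF _ _ e])
    show "AE om in M. \<forall>\<^sub>F n in sequentially. om \<notin> {om\<in>space M. \<exists>i<Suc n. d \<le> \<bar>X (grid T (Suc n) (Suc i)) om - X (grid T (Suc n) i) om\<bar>}"
    proof (rule AE_I2)
      fix om assume om: "om \<in> space M"
      have "uniformly_continuous_on {0..T} (\<lambda>t. X t om)"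
        by (rule compact_uniformly_continuous[OF continuous_on_subset[OF c[OF om]]]) auto
      then obtain h where h: "0 < h" "\<And>s t. s \<in> {0..T} \<Longrightarrow> t \<in> {0..T} \<Longrightarrow> dist s t < h \<Longrightarrow> dist (X s om) (X t om) < d"
        using d unfolding uniformly_continuous_on_def by metis
      show "\<forall>\<^sub>F n in sequentially. om \<notin> {om\<in>space M. \<exists>i<Suc n. d \<le> \<bar>X (grid T (Suc n) (Suc i)) om - X (grid T (Suc n) i) om\<bar>}"
      proof (rule eventually_mono[OF eventually_ge_at_top[of "nat \<lceil>T / h\<rceil>"]])
        fix n assume "nat \<lceil>T / h\<rceil> \<le> n"
        then have "T / h < real (Suc n)" by linarith
        then have small: "T / real (Suc n) < h" using h(1) by (simp add: field_simps)
        have "\<bar>X (grid T (Suc n) (Suc i)) om - X (grid T (Suc n) i) om\<bar> < d" if "i < Suc n" for i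
        proof -
          have "grid T (Suc n) (Suc i) - grid T (Suc n) i = T / real (Suc n)"
            using that by (simp add: grid_def diff_divide_distrib[symmetric] algebra_simps)
          then have "dist (grid T (Suc n) (Suc i)) (grid T (Suc n) i) < h" using small T by (simp add: dist_real_def)
          from h(2)[OF _ _ this] show ?thesis using grid_range[OF T] by (simp add: dist_real_def)
        qed
        then show "om \<notin> {om\<in>space M. \<exists>i<Suc n. d \<le> \<bar>X (grid T (Suc n) (Suc i)) om - X (grid T (Suc n) i) om\<bar>}"
          by (auto simp: not_le)
      qed
    qed
  qed measurable
  then show ?thesis by blast
qed

end

section \<open>The energy estimate\<close>

text \<open>\<open>x\<close> follows \<open>z\<close> up to time \<open>s\<close> and is constant
  afterwards, so only the grid interval that straddles \<open>s\<close> can contribute a square not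
  bounded by that of \<open>z\<close>.\<close>

lemma frozen_squares_le:
  fixes x z t :: "nat \<Rightarrow> real" and s :: ereal
  assumes t: "incseq t" and eq: "\<And>i. ereal (t i) \<le> s \<Longrightarrow> x i = z i"
    and frozen: "\<And>i j. s \<le> ereal (t i) \<Longrightarrow> s \<le> ereal (t j) \<Longrightarrow> x i = x j" and B: "\<And>i j. (x i - x j)\<^sup>2 \<le> B"
  shows "(\<Sum>i<n. (x (Suc i) - x i)\<^sup>2) \<le> (\<Sum>i<n. (z (Suc i) - z i)\<^sup>2) + B"
proof -
  have B0: "0 \<le> B" using B[of 0 0] by simp
  have "(\<Sum>i<n. (x (Suc i) - x i)\<^sup>2) \<le> (\<Sum>i<n. (z (Suc i) - z i)\<^sup>2) + (if ereal (t n) \<le> s then 0 else B)"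
  proof (induction n)
    case 0 then show ?case using B0 by simp
  next
    case (Suc n)
    consider "ereal (t (Suc n)) \<le> s" | "ereal (t n) \<le> s" "\<not> ereal (t (Suc n)) \<le> s" | "\<not> ereal (t n) \<le> s" by blast
    then show ?case
    proof cases
      case 1
      then have "ereal (t n) \<le> s" using incseq_SucD[OF t, of n] by (metis ereal_less_eq(3) order_trans)
      then show ?thesis using Suc 1 eq by simp
    next
      case 2
      have "(x (Suc n) - x n)\<^sup>2 \<le> (z (Suc n) - z n)\<^sup>2 + B" using B[of "Suc n" n] zero_le_power2[of "z (Suc n) - z n"] by linarith
      then show ?thesis using Suc 2 by simp
    next
      case 3
      then have "\<not> ereal (t (Suc n)) \<le> s" using incseq_SucD[OF t, of n] by (metis ereal_less_eq(3) order_trans)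
      moreover have "x (Suc n) = x n" using 3 calculation by (intro frozen) auto
      moreover have "(\<Sum>i<n. (z (Suc i) - z i)\<^sup>2) \<le> (\<Sum>i<Suc n. (z (Suc i) - z i)\<^sup>2)" by simp
      ultimately show ?thesis using Suc 3 by (simp del: sum.lessThan_Suc add: sum.lessThan_Suc[of "\<lambda>i. (x (Suc i) - x i)\<^sup>2"])
    qed
  qed
  also have "\<dots> \<le> (\<Sum>i<n. (z (Suc i) - z i)\<^sup>2) + B" using B0 by simp
  finally show ?thesis .
qed

lemma compact_bound_real:
  fixes h :: "real \<Rightarrow> real" assumes "continuous_on {a..b} h"
  obtains B where "0 \<le> B" "\<And>x. x \<in> {a..b} \<Longrightarrow> \<bar>h x\<bar> \<le> B"
proof -
  have "bounded (h ` {a..b})" using compact_imp_bounded[OF compact_continuous_image[OF assms compact_Icc]] .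
  then obtain B where B: "\<forall>x\<in>{a..b}. \<bar>h x\<bar> \<le> B" by (auto simp: bounded_iff)
  show ?thesis by (rule that[of "max 0 B"]) (use B in \<open>auto simp: le_max_iff_disj\<close>)
qed

lemma clip_interval_measurable:
  fixes h :: "real \<Rightarrow> real" assumes h: "continuous_on {a..b} h" and "a \<le> b"
  shows "(\<lambda>x. h (max a (min b x))) \<in> borel_measurable borel"
  by (intro borel_measurable_continuous_onI continuous_on_compose2[OF h] continuous_intros) (use assms in auto)

text \<open>Near \<open>l\<close> the limit bounds \<open>g\<close>, on the remaining compact part
  continuity does. The bound reaches down to \<open>l\<close> and so serves all left end points
  \<open>a\<close> at once.\<close>

lemma bounded_left_part:
  fixes g :: "real \<Rightarrow> real" and l r :: ereal
  assumes g: "continuous_on (einterval l r) g" and lim: "((\<lambda>x. g (real_of_ereal x)) \<longlongrightarrow> gl) (at_right l)"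
    and b: "l < ereal b" "ereal b < r"
  obtains B where "0 \<le> B" "\<And>x. l < ereal x \<Longrightarrow> x \<le> b \<Longrightarrow> \<bar>g x\<bar> \<le> B"
proof -
  have "\<forall>\<^sub>F x in at_right l. \<bar>g (real_of_ereal x) - gl\<bar> < 1" using tendstoD[OF lim, of 1] by (simp add: dist_real_def)
  then obtain y where y: "l < y" "\<And>x. l < x \<Longrightarrow> x < y \<Longrightarrow> \<bar>g (real_of_ereal x) - gl\<bar> < 1"
    unfolding eventually_at_right[OF b(1)] by (elim exE conjE) (rule that, auto)
  have "l < min y (ereal b)" using y b by simp
  then obtain z :: real where z: "l < ereal z" "ereal z < min y (ereal b)" using ereal_dense2 by blast
  have sub: "{z..b} \<subseteq> einterval l r"
    using z(1) b(2) by (auto simp: einterval_def intro: less_le_trans[of l "ereal z"] le_less_trans[of _ "ereal b" r])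
  obtain B where B: "0 \<le> B" "\<And>x. x \<in> {z..b} \<Longrightarrow> \<bar>g x\<bar> \<le> B"
    by (rule compact_bound_real[OF continuous_on_subset[OF g sub]]) (rule that)
  show thesis
  proof (rule that[of "max B (\<bar>gl\<bar> + 1)"])
    fix x assume x: "l < ereal x" "x \<le> b"
    show "\<bar>g x\<bar> \<le> max B (\<bar>gl\<bar> + 1)"
    proof (cases "z \<le> x")
      case True then show ?thesis using B(2)[of x] x by auto
    next
      case False
      then have "ereal x < y" using z(2) by (simp add: less_trans[of "ereal x" "ereal z" y])
      then show ?thesis using y(2)[OF x(1)] by auto
    qed
  qed (use B in auto)
qed

section \<open>The scale density on compact intervals\<close>

context exiting_sde begin

lemma scale_density_step:
  assumes c: "c \<in> einterval l r" and ab: "l < ereal a" "ereal b < r" and x: "x \<in> {a..b}"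
  shows "scale_density \<mu> \<sigma> c x = scale_density \<mu> \<sigma> c a * exp (LINT w:{a..x}|lborel. - 2 * drift a b w)"
proof -
  let ?h = "\<lambda>y. 2 * \<mu> y / (\<sigma> y)\<^sup>2"
  have ax: "a \<le> x" using x by simp
  have "interval_lebesgue_integrable lborel (min (ereal c) (min (ereal a) (ereal x))) (max (ereal c) (max (ereal a) (ereal x))) ?h"
  proof -
    define u v where "u = min c (min a x)" and "v = max c (max a x)"
    have uv: "min (ereal c) (min (ereal a) (ereal x)) = ereal u" "max (ereal c) (max (ereal a) (ereal x)) = ereal v"
      by (simp_all add: u_def v_def)
    have "x \<in> einterval l r" "a \<in> einterval l r" using subinterval[OF ab] x by auto
    then have "l < ereal u" "ereal v < r" using c by (auto simp: u_def v_def einterval_def min_def max_def)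
    from subinterval[OF this] have "set_integrable lborel {u..v} (\<lambda>x. \<mu> x / (\<sigma> x)\<^sup>2)"
      using drift_ratio unfolding locally_integrable_on_def by blast
    then have "set_integrable lborel {u..v} (\<lambda>x. 2 * (\<mu> x / (\<sigma> x)\<^sup>2))" by (rule set_integrable_mult_right)
    then have "set_integrable lborel (einterval u v) (\<lambda>x. 2 * (\<mu> x / (\<sigma> x)\<^sup>2))"
      by (rule set_integrable_subset) (auto simp: einterval_def)
    moreover have "u \<le> v" by (auto simp: u_def v_def)
    ultimately show ?thesis unfolding uv interval_lebesgue_integrable_def by simp
  qed
  then have "(LBINT y=ereal c..ereal a. ?h y) + (LBINT y=ereal a..ereal x. ?h y) = (LBINT y=ereal c..ereal x. ?h y)"
    by (rule interval_integral_sum)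
  moreover have "(LBINT y=ereal a..ereal x. ?h y) = (LBINT y=ereal a..ereal x. 2 * drift a b y)"
    by (rule interval_integral_cong) (use x in \<open>auto simp: einterval_def drift_def\<close>)
  moreover have "(LBINT y=ereal a..ereal x. 2 * drift a b y) = (LINT y:{a..x}|lborel. 2 * drift a b y)" by (rule interval_integral_Icc[OF ax])
  moreover have "(LINT y:{a..x}|lborel. - 2 * drift a b y) = - (LINT y:{a..x}|lborel. 2 * drift a b y)"
    by (subst (1 2) set_integral_mult_right) simp
  ultimately show ?thesis unfolding scale_density_def exp_add[symmetric] by simp
qed

lemma scale_density_continuous:
  assumes c: "c \<in> einterval l r" and ab: "l < ereal a" "ereal b < r"
  shows "continuous_on {a..b} (scale_density \<mu> \<sigma> c)"
proof -
  have "set_integrable lborel {a..b} (\<lambda>w. - 2 * drift a b w)" using drift_set_integrable[OF ab] by (rule set_integrable_mult_right)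
  then have "continuous_on {a..b} (\<lambda>x. scale_density \<mu> \<sigma> c a * exp (LINT w:{a..x}|lborel. - 2 * drift a b w))"
    by (intro continuous_intros set_integral_atLeastAtMost_continuous)
  then show ?thesis by (rule continuous_on_eq) (simp only: scale_density_step[OF c ab])
qed

text \<open>The density is the exponential of an integral, so the chain rule for such exponentials
  gives the integrated form of \<open>\<rho>' = -2 (\<mu> / \<sigma>^2) \<rho>\<close> that
  \<open>scale_identity\<close> asks for.\<close>

lemma scale_density_equation:
  assumes c: "c \<in> einterval l r" and ab: "l < ereal a" "ereal b < r" and x: "x \<in> {a..b}"
  shows "scale_density \<mu> \<sigma> c x = scale_density \<mu> \<sigma> c a + (LINT w:{a..x}|lborel. - 2 * drift a b w * scale_density \<mu> \<sigma> c w)"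
proof -
  let ?k = "\<lambda>w. - 2 * drift a b w" and ?r = "scale_density \<mu> \<sigma> c"
  have k: "set_integrable lborel {a..b} ?k" using drift_set_integrable[OF ab] by (rule set_integrable_mult_right)
  have "(LINT w:{a..x}|lborel. ?k w * ?r w) = (LINT w:{a..x}|lborel. ?r a * (?k w * exp (LINT v:{a..w}|lborel. ?k v)))"
  proof (rule set_lebesgue_integral_cong)
    show "\<forall>w. w \<in> {a..x} \<longrightarrow> ?k w * ?r w = ?r a * (?k w * exp (LINT v:{a..w}|lborel. ?k v))"
    proof (intro allI impI)
      fix w assume "w \<in> {a..x}"
      then have "w \<in> {a..b}" using x by auto
      from scale_density_step[OF c ab this] show "?k w * ?r w = ?r a * (?k w * exp (LINT v:{a..w}|lborel. ?k v))" by (simp only: mult_ac)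
    qed
  qed simp
  also have "\<dots> = ?r a * (LINT w:{a..x}|lborel. ?k w * exp (LINT v:{a..w}|lborel. ?k v))" by (rule set_integral_mult_right)
  also have "(LINT w:{a..x}|lborel. ?k w * exp (LINT v:{a..w}|lborel. ?k v)) = exp (LINT v:{a..x}|lborel. ?k v) - exp (LINT v:{a..a}|lborel. ?k v)"
    by (rule exp_set_integral_real(2)[OF k order_refl]) (use x in auto)
  also have "(LINT v:{a..a}|lborel. ?k v) = 0" using scale_density_step[OF c ab, of a] x by (simp add: scale_density_def)
  also have "?r a * (exp (LINT v:{a..x}|lborel. ?k v) - exp 0) = ?r x - ?r a"
    unfolding scale_density_step[OF c ab x] by (simp add: right_diff_distrib)
  finally show ?thesis by simp
qed

end

context exiting_sde begin

text \<open>The bound must not depend on \<open>a\<close>, \<open>d\<close> or \<open>m\<close>. The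
  time \<open>T\<close>, the level \<open>b\<close> and the probability \<open>p\<close> come from
  the exit event, the bound \<open>B\<close> for squared increments from the limit of
  \<open>g\<close> at \<open>l\<close>, and \<open>K\<close> from the tightness of the squares of
  the unstopped \<open>g(Y)\<close> at level \<open>p / 2\<close>; only then is \<open>a\<close>
  fixed. The grid comes last: it may depend on everything, and its error \<open>e\<close> is sent to
  \<open>0\<close>.\<close>

lemma uniform_energy_bound:
  assumes c: "c \<in> einterval l r" and g: "continuous_on (einterval l r) g"
    and lim: "((\<lambda>x. g (real_of_ereal x)) \<longlongrightarrow> gl) (at_right l)"
    and ex: "exits_at M Y l r l" and Z: "semimartingale M F (\<lambda>t om. extend_at_left l r g gl (Y t om))"
  defines "rho \<equiv> scale_density \<mu> \<sigma> c"
  obtains b E where "x0 < b" "ereal b < r" "\<And>a d m. l < ereal a \<Longrightarrow> a < x0 \<Longrightarrow> 0 < d \<Longrightarrow> 0 \<le> m \<Longrightarrow>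
     integral {a..x0} (\<lambda>u. local_slope a b d m (\<lambda>x. integral {a..x} rho) g u * (2 * integral {a..u} rho * rho u)) \<le> E"
proof (rule left_hitting_probability[OF ex], goal_cases)
  case (1 T b p)
  note T = 1(2) and b = 1(3,4) and p = 1(5) and hit = 1(6)
  have lb: "l < ereal b" using x0 b by (auto simp: einterval_def intro: less_trans)
  obtain G where G: "0 \<le> G" "\<And>x. l < ereal x \<Longrightarrow> x \<le> b \<Longrightarrow> \<bar>g x\<bar> \<le> G"
    by (rule bounded_left_part[OF g lim lb b(2)]) (rule that)
  define B where "B = 4 * G\<^sup>2"
  have gB: "(g y - g x)\<^sup>2 \<le> B" if "l < ereal x" "x \<le> b" "l < ereal y" "y \<le> b" for x y
  proof -
    have "\<bar>g y - g x\<bar> \<le> 2 * G" using G(2)[OF that(1,2)] G(2)[OF that(3,4)] by linarith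
    then have "\<bar>g y - g x\<bar>\<^sup>2 \<le> (2 * G)\<^sup>2" by (intro power_mono) auto
    then show ?thesis by (simp add: B_def power_mult_distrib)
  qed
  define Zp where "Zp t om = extend_at_left l r g gl (Y t om)" for t om
  let ?sq = "\<lambda>Z n om. \<Sum>i<n. (Z (grid T n (Suc i)) om - Z (grid T n i) om)\<^sup>2"
  have p2: "0 < p / 2" using p by simp
  obtain K0 where K0: "\<And>n. 0 < n \<Longrightarrow> prob {om\<in>space M. K0 < ?sq Zp n om} \<le> p / 2"
    by (rule semimartingale_squares_tight[OF Z[folded Zp_def] T p2]) (rule that)
  \<comment> \<open>The sums for the stopped process exceed those for \<open>g(Y)\<close> by at most
    one squared increment, which is at most \<open>B\<close>; the maximum makes \<open>K\<close>
    nonnegative.\<close>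
  define K where "K = max 0 K0 + B"
  have B0: "0 \<le> B" by (simp add: B_def)
  show thesis
  proof (rule 1(1)[OF b, of "2 * (K + B) / p"])
    fix a d m :: real assume a: "l < ereal a" "a < x0" and d: "0 < d" and m: "0 \<le> m"
    have rho_cont: "continuous_on {a..b} rho" unfolding rho_def by (rule scale_density_continuous[OF c a(1) b(2)])
    interpret C: concave_potential a b x0 d m rho g by standard (use a b d m rho_cont in \<open>auto simp: rho_def scale_density_def\<close>)
    obtain N W' X where N: "N \<in> null_sets M" "\<And>om. om \<in> space M - N \<Longrightarrow> good om"
      and SD: "stopped_diffusion M (augment M F) W' X a b x0 (drift a b) (vol a b)"
      and XY: "\<And>om t. om \<in> space M - N \<Longrightarrow> 0 \<le> t \<Longrightarrow> ereal (X t om) = Y (real_of_ereal (min (ereal t) (exit_time Y a b om))) om"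
      by (rule stopped_diffusion_exists[OF a b]) (rule that)
    interpret S: stopped_diffusion M "augment M F" W' X a b x0 "drift a b" "vol a b" by (rule SD)
    have le: "a \<le> b" using a b by simp
    \<comment> \<open>The functions involved are known to be continuous on \<open>[a, b]\<close>
      only. Composition with the projection \<open>k\<close> makes them Borel on the whole line
      without changing them along \<open>X\<close>.\<close>
    define k where "k x = max a (min b x)" for x
    have kid: "k x = x" if "x \<in> {a..b}" for x using that by (simp add: k_def)
    have sub: "{a..b} \<subseteq> einterval l r" by (rule subinterval[OF a(1) b(2)])
    have gc: "continuous_on {a..b} g" by (rule continuous_on_subset[OF g sub])
    have km: "(\<lambda>x. h (k x)) \<in> borel_measurable borel" if "continuous_on {a..b} h" for h :: "real \<Rightarrow> real"
      unfolding k_def by (rule clip_interval_measurable[OF that le])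
    obtain Vb where Vb: "0 \<le> Vb" "\<And>x. x \<in> {a..b} \<Longrightarrow> \<bar>C.V x\<bar> \<le> Vb" by (rule compact_bound_real[OF C.V_cont]) (rule that)
    obtain Db where Db: "0 \<le> Db" "\<And>x. x \<in> {a..b} \<Longrightarrow> \<bar>C.D x\<bar> \<le> Db" by (rule compact_bound_real[OF C.D_cont]) (rule that)
    obtain Sb where Sb: "0 \<le> Sb" "\<And>x. x \<in> {a..b} \<Longrightarrow> \<bar>C.sc x\<bar> \<le> Sb" by (rule compact_bound_real[OF C.sc_cont]) (rule that)
    obtain Rb where Rb: "0 \<le> Rb" "\<And>x. x \<in> {a..b} \<Longrightarrow> \<bar>rho x\<bar> \<le> Rb" by (rule compact_bound_real[OF rho_cont]) (rule that)
    have XT: "X T \<in> borel_measurable M" using S.measurable_F_M[OF S.X_adapted] T by simp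
    have pT: "p \<le> prob {om\<in>space M. X T om = a}" by (rule hit[OF a(1) N(1)]) (use XY T S.X_range XT in auto)
    have Q: "prob {om\<in>space M. K < ?sq (\<lambda>t om. g (k (X t om))) n om} \<le> p / 2" if n: "0 < n" for n
    proof -
      let ?Q = "{om\<in>space M. K < ?sq (\<lambda>t om. g (k (X t om))) n om}"
      let ?Z = "{om\<in>space M. K0 < ?sq Zp n om}"
      have T0: "0 \<le> T" using T by simp
      note gr = grid_range[OF T0, of n]
      have Zm [measurable]: "Zp (grid T n i) \<in> borel_measurable M" for i
        using Z gr[of i] unfolding semimartingale_def adapted_def Zp_def[abs_def, symmetric] Zp_def[symmetric]
        by (intro measurable_F_M[of _ "grid T n i"]) blast
      have Zs: "?Z \<in> events" by measurable
      have "?Q \<subseteq> ?Z \<union> N"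
      proof
        fix om assume om: "om \<in> ?Q"
        show "om \<in> ?Z \<union> N"
        proof (cases "om \<in> N")
          case False
          then have omN: "om \<in> space M - N" and omM: "om \<in> space M" using om by auto
          let ?t = "grid T n" and ?s = "exit_time Y a b om"
          have Xk: "k (X (?t i) om) = X (?t i) om" for i by (rule kid[OF S.X_range[OF omM]]) (use gr[of i] in simp)
          have XR: "X (?t i) om \<in> {a..b}" for i by (rule S.X_range[OF omM]) (use gr[of i] in simp)
          have lx: "l < ereal (X (?t i) om)" "X (?t i) om \<le> b" for i using XR[of i] a by (auto intro: less_le_trans[of l "ereal a"])
          have "(\<Sum>i<n. (g (X (?t (Suc i)) om) - g (X (?t i) om))\<^sup>2) \<le> (\<Sum>i<n. (Zp (?t (Suc i)) om - Zp (?t i) om)\<^sup>2) + B"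
          \<comment> \<open>\<open>X\<close> is \<open>Y\<close> stopped at the exit from
            \<open>(a, b)\<close>; its squares are compared with those of the unstopped
            \<open>g(Y)\<close>, for which the tightness level does not depend on
            \<open>a\<close>.\<close>
          proof (rule frozen_squares_le[of ?t ?s])
            show "incseq ?t" by (rule grid_mono[OF T0])
            show "g (X (?t i) om) = Zp (?t i) om" if "ereal (?t i) \<le> ?s" for i
            proof -
              have "ereal (X (?t i) om) = Y (?t i) om" using XY[OF omN, of "?t i"] gr[of i] that by (simp add: min_def)
              moreover have "X (?t i) om \<in> einterval l r" using XR sub by blast
              ultimately show ?thesis unfolding Zp_def extend_at_left_def by (auto simp: einterval_def dest: sym)
            qed
            show "g (X (?t i) om) = g (X (?t j) om)" if "?s \<le> ereal (?t i)" "?s \<le> ereal (?t j)" for i j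
            proof -
              have "ereal (X (?t i) om) = ereal (X (?t j) om)"
                using XY[OF omN, of "?t i"] XY[OF omN, of "?t j"] gr[of i] gr[of j] that by (simp add: min_absorb2)
              then show ?thesis by simp
            qed
            show "(g (X (?t i) om) - g (X (?t j) om))\<^sup>2 \<le> B" for i j by (rule gB[OF lx lx])
          qed
          moreover have "max 0 K0 + B < (\<Sum>i<n. (g (X (?t (Suc i)) om) - g (X (?t i) om))\<^sup>2)" using om by (simp add: Xk K_def)
          ultimately have "K0 < (\<Sum>i<n. (Zp (?t (Suc i)) om - Zp (?t i) om)\<^sup>2)" using max.cobounded2[of K0 0] by linarith
          then show ?thesis using omM by simp
        qed simp
      qed
      then have "prob ?Q \<le> prob (?Z \<union> N)" by (rule finite_measure_mono) (rule sets.Un[OF Zs null_setsD2[OF N(1)]])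
      also have "\<dots> = prob ?Z" by (rule measure_Un_null_set[OF Zs N(1)])
      also have "\<dots> \<le> p / 2" by (rule K0[OF n])
      finally show ?thesis .
    qed
    have X0: "AE om in M. X 0 om = x0"
    proof -
      have "AE om in M. om \<in> space M - N" using AE_not_in[OF N(1)] AE_space by eventually_elim simp
      then show ?thesis
      proof eventually_elim
        case (elim om)
        have "min (ereal 0) (exit_time Y a b om) = ereal 0" using exit_time_nonneg[of a b om] by (simp add: min_def zero_ereal_def[symmetric])
        then have "ereal (X 0 om) = Y 0 om" using XY[OF elim, of 0] by simp
        then show ?case using N(2)[OF elim] by (simp add: good_def)
      qed
    qed
    have mart: "(\<integral>om. indicator A om * C.sc (k (X t om)) \<partial>M) = (\<integral>om. indicator A om * C.sc (k (X u om)) \<partial>M)"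
      if "0 \<le> u" "u \<le> t" "A \<in> sets (augment M F u)" for u t A
    proof (rule S.scale_martingale[OF that, of "\<lambda>x. C.sc (k x)" "\<lambda>x. rho (k x)" Sb Rb])
      show "(\<lambda>x. C.sc (k x)) \<in> borel_measurable borel" by (rule km[OF C.sc_cont])
      show "(\<lambda>x. rho (k x)) \<in> borel_measurable borel" by (rule km[OF rho_cont])
      show "\<bar>C.sc (k x)\<bar> \<le> Sb" "\<bar>rho (k x)\<bar> \<le> Rb" if "x \<in> {a..b}" for x using Sb(2)[OF that] Rb(2)[OF that] kid[OF that] by simp_all
      fix x assume x: "x \<in> {a..b}"
      have ka: "k a = a" "k x = x" using kid x le by auto
      have kw: "k w = w" if "w \<in> {a..x}" for w using kid that x by auto
      have "(LINT w:{a..x}|lborel. - 2 * drift a b w * rho (k w)) = (LINT w:{a..x}|lborel. - 2 * drift a b w * rho w)"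
        by (rule set_lebesgue_integral_cong) (auto simp: kw)
      then show "rho (k x) = rho (k a) + (LINT w:{a..x}|lborel. - 2 * drift a b w * rho (k w))"
        unfolding ka using scale_density_equation[OF c a(1) b(2) x] by (simp only: rho_def)
      have "(LINT w:{a..x}|lborel. rho (k w)) = (LINT w:{a..x}|lborel. rho w)" by (rule set_lebesgue_integral_cong) (auto simp: kw)
      also have "\<dots> = integral {a..x} rho"
        by (rule set_borel_integral_eq_integral(2)[OF borel_integrable_atLeastAtMost'[OF continuous_on_subset[OF rho_cont]]]) (use x in auto)
      finally show "C.sc (k x) = C.sc (k a) + (LINT w:{a..x}|lborel. rho (k w))" unfolding ka by (simp add: C.sc_def)
    qed
    \<comment> \<open>A crude bound for the loss in a step with a large increment. It may depend on
      \<open>a\<close>, \<open>d\<close> and \<open>m\<close>, since such a step has probability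
      below \<open>e\<close>.\<close>
    define Cb where "Cb = 2 * Vb + Db * (2 * Sb)"
    have Cb0: "0 \<le> Cb" using Vb Db Sb by (simp add: Cb_def)
    have main: "- C.V a * (p / 2 - e) \<le> K + B + Cb * e" if e: "0 < e" for e
    proof -
      obtain n where n: "0 < n" and J: "prob {om\<in>space M. \<exists>i<n. d \<le> \<bar>X (grid T n (Suc i)) om - X (grid T n i) om\<bar>} < e"
        using S.large_increment_unlikely[of X T d e] S.measurable_F_M[OF S.X_adapted] S.X_continuous T d e by auto
      let ?J = "prob {om\<in>space M. \<exists>i<n. d \<le> \<bar>X (grid T n (Suc i)) om - X (grid T n i) om\<bar>}"
      let ?Q = "prob {om\<in>space M. K < ?sq (\<lambda>t om. g (k (X t om))) n om}"
      have pot: "- C.V (k a) * (prob {om\<in>space M. X T om = a} - ?Q - ?J) \<le> K + B + Cb * ?J"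
      proof (rule S.stopped_potential_bound[where V = "\<lambda>x. C.V (k x)" and D = "\<lambda>x. C.D (k x)" and sc = "\<lambda>x. C.sc (k x)" and g = "\<lambda>x. g (k x)"
            and ?x0.0 = x0 and Db = Db and Sb = Sb and b = b])
        show "X t \<in> borel_measurable (augment M F t)" if "0 \<le> t" for t by (rule S.X_adapted[OF that])
        show "X t om \<in> {a..b}" if "om \<in> space M" "0 \<le> t" for om t by (rule S.X_range[OF that])
        show "AE om in M. X 0 om = x0" by (rule X0)
        show "(\<lambda>x. C.V (k x)) \<in> borel_measurable borel" "(\<lambda>x. C.D (k x)) \<in> borel_measurable borel"
          "(\<lambda>x. C.sc (k x)) \<in> borel_measurable borel" "(\<lambda>x. g (k x)) \<in> borel_measurable borel"
          by (intro km C.V_cont C.D_cont C.sc_cont gc)+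
        show "C.V (k x0) = 0" using kid[of x0] a b C.V_x0 by simp
        show "C.V (k x) \<le> 0" if "x \<in> {a..b}" for x using C.V_nonpos[OF that] kid[OF that] by simp
        show "C.V (k x) + C.D (k x) * (C.sc (k y) - C.sc (k x)) - (g (k y) - g (k x))\<^sup>2 \<le> C.V (k y)"
          if "x \<in> {a..b}" "y \<in> {a..b}" "\<bar>y - x\<bar> < d" for x y using C.V_step[OF that] kid[OF that(1)] kid[OF that(2)] by simp
        show "C.V (k x) + C.D (k x) * (C.sc (k y) - C.sc (k x)) - Cb \<le> C.V (k y)" if "x \<in> {a..b}" "y \<in> {a..b}" for x y
        proof -
          have "\<bar>C.D x * (C.sc y - C.sc x)\<bar> \<le> Db * (2 * Sb)"
            unfolding abs_mult using Db Sb(2)[OF that(1)] Sb(2)[OF that(2)] that by (intro mult_mono) auto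
          then show ?thesis using Vb(2)[OF that(1)] Vb(2)[OF that(2)] unfolding kid[OF that(1)] kid[OF that(2)] Cb_def by linarith
        qed
        show "(g (k y) - g (k x))\<^sup>2 \<le> B" if "x \<in> {a..b}" "y \<in> {a..b}" for x y unfolding kid[OF that(1)] kid[OF that(2)]
          by (rule gB) (use that a in \<open>auto intro: less_le_trans[of l "ereal a"]\<close>)
        show "\<bar>C.D (k x)\<bar> \<le> Db" "\<bar>C.sc (k x)\<bar> \<le> Sb" if "x \<in> {a..b}" for x using Db(2)[OF that] Sb(2)[OF that] kid[OF that] by simp_all
        show "(\<integral>om. indicator A om * C.sc (k (X t om)) \<partial>M) = (\<integral>om. indicator A om * C.sc (k (X u om)) \<partial>M)"
          if "0 \<le> u" "u \<le> t" "A \<in> sets (augment M F u)" for u t A by (rule mart[OF that])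
      qed (use B0 Cb0 T n le in \<open>auto simp: K_def\<close>)
      have "p / 2 - e \<le> prob {om\<in>space M. X T om = a} - ?Q - ?J" using pT Q[OF n] J by linarith
      moreover have "0 \<le> - C.V a" using C.V_nonpos[of a] le by simp
      ultimately have l: "- C.V a * (p / 2 - e) \<le> - C.V a * (prob {om\<in>space M. X T om = a} - ?Q - ?J)" by (rule mult_left_mono)
      have ka: "k a = a" using le by (intro kid) simp
      have "- C.V a * (p / 2 - e) \<le> K + B + Cb * ?J" by (rule order_trans[OF l pot[unfolded ka]])
      also have "\<dots> \<le> K + B + Cb * e" by (rule add_left_mono[OF mult_left_mono[OF less_imp_le[OF J] Cb0]])
      finally show ?thesis .
    qed
    have l1: "((\<lambda>e. - C.V a * (p / 2 - e)) \<longlongrightarrow> - C.V a * (p / 2 - 0)) (at_right 0)" by (intro tendsto_intros)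
    have l2: "((\<lambda>e. K + B + Cb * e) \<longlongrightarrow> K + B + Cb * 0) (at_right 0)" by (intro tendsto_intros)
    have "\<forall>\<^sub>F e in at_right 0. - C.V a * (p / 2 - e) \<le> K + B + Cb * e"
      using eventually_at_right_less[of 0] by eventually_elim (rule main)
    from tendsto_le[OF trivial_limit_at_right_real l2 l1 this] have "- C.V a * (p / 2) \<le> K + B" by simp
    then have "- C.V a \<le> 2 * (K + B) / p" using p by (simp add: field_simps)
    then show "integral {a..x0} (\<lambda>u. local_slope a b d m (\<lambda>x. integral {a..x} rho) g u * (2 * integral {a..u} rho * rho u)) \<le> 2 * (K + B) / p"
      unfolding C.V_left C.f_def C.sc_def[abs_def] .
  qed
qed

end

section \<open>Strict differentiability and the limit of the local slopes\<close>

definition strict_derivative :: "(real \<Rightarrow> real) \<Rightarrow> real \<Rightarrow> real \<Rightarrow> bool" where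
  "strict_derivative f L x \<longleftrightarrow> (\<forall>e>0. \<exists>d>0. \<forall>u v. \<bar>u - x\<bar> < d \<and> \<bar>v - x\<bar> < d \<and> u \<noteq> v \<longrightarrow> \<bar>(f v - f u) / (v - u) - L\<bar> < e)"

lemma strict_derivativeE:
  assumes f: "strict_derivative f L x" and e: "0 < e"
  obtains d where "0 < d" "\<And>u v. \<bar>u - x\<bar> < d \<Longrightarrow> \<bar>v - x\<bar> < d \<Longrightarrow> u \<noteq> v \<Longrightarrow> \<bar>(f v - f u) / (v - u) - L\<bar> < e"
proof -
  from f[unfolded strict_derivative_def, rule_format, OF e] obtain d where d: "0 < d"
    "\<forall>u v. \<bar>u - x\<bar> < d \<and> \<bar>v - x\<bar> < d \<and> u \<noteq> v \<longrightarrow> \<bar>(f v - f u) / (v - u) - L\<bar> < e" by (elim exE conjE)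
  show thesis by (rule that[OF d(1)]) (rule d(2)[rule_format], intro conjI)
qed

lemma strict_derivativeI_less:
  assumes "\<And>e. 0 < e \<Longrightarrow> \<exists>d>0. \<forall>u v. \<bar>u - x\<bar> < d \<and> \<bar>v - x\<bar> < d \<and> u < v \<longrightarrow> \<bar>(f v - f u) / (v - u) - L\<bar> < e"
  shows "strict_derivative f L x"
  unfolding strict_derivative_def
proof (intro allI impI)
  fix e :: real assume "0 < e"
  from assms[OF this] obtain d where d: "0 < d" "\<And>u v. \<bar>u - x\<bar> < d \<Longrightarrow> \<bar>v - x\<bar> < d \<Longrightarrow> u < v \<Longrightarrow> \<bar>(f v - f u) / (v - u) - L\<bar> < e" by blast
  have "\<bar>(f v - f u) / (v - u) - L\<bar> < e" if "\<bar>u - x\<bar> < d" "\<bar>v - x\<bar> < d" "u \<noteq> v" for u v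
  proof (cases "u < v")
    case False
    have "(f v - f u) / (v - u) = (f u - f v) / (u - v)" by (metis minus_diff_eq minus_divide_divide)
    then show ?thesis using d(2)[of v u] that False by simp
  qed (use that d(2) in auto)
  then show "\<exists>d>0. \<forall>u v. \<bar>u - x\<bar> < d \<and> \<bar>v - x\<bar> < d \<and> u \<noteq> v \<longrightarrow> \<bar>(f v - f u) / (v - u) - L\<bar> < e" using d(1) by blast
qed

lemma strict_derivative_diff:
  assumes f: "strict_derivative f L x" and g: "strict_derivative g K x"
  shows "strict_derivative (\<lambda>u. f u - g u) (L - K) x"
  unfolding strict_derivative_def
proof (intro allI impI)
  fix e :: real assume "0 < e"
  then have e2: "0 < e / 2" by simp
  obtain d1 where d1: "0 < d1" "\<And>u v. \<bar>u - x\<bar> < d1 \<Longrightarrow> \<bar>v - x\<bar> < d1 \<Longrightarrow> u \<noteq> v \<Longrightarrow> \<bar>(f v - f u) / (v - u) - L\<bar> < e / 2"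
    by (rule strict_derivativeE[OF f e2]) (rule that)
  obtain d2 where d2: "0 < d2" "\<And>u v. \<bar>u - x\<bar> < d2 \<Longrightarrow> \<bar>v - x\<bar> < d2 \<Longrightarrow> u \<noteq> v \<Longrightarrow> \<bar>(g v - g u) / (v - u) - K\<bar> < e / 2"
    by (rule strict_derivativeE[OF g e2]) (rule that)
  have "\<bar>(f v - g v - (f u - g u)) / (v - u) - (L - K)\<bar> < e" if "\<bar>u - x\<bar> < min d1 d2" "\<bar>v - x\<bar> < min d1 d2" "u \<noteq> v" for u v
  proof -
    have "(f v - g v - (f u - g u)) / (v - u) = (f v - f u) / (v - u) - (g v - g u) / (v - u)" by (simp add: diff_divide_distrib)
    moreover have "\<bar>(f v - f u) / (v - u) - L\<bar> < e / 2" "\<bar>(g v - g u) / (v - u) - K\<bar> < e / 2"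
      using d1(2) d2(2) that by simp_all
    ultimately show ?thesis by linarith
  qed
  then show "\<exists>d>0. \<forall>u v. \<bar>u - x\<bar> < d \<and> \<bar>v - x\<bar> < d \<and> u \<noteq> v \<longrightarrow> \<bar>(f v - g v - (f u - g u)) / (v - u) - (L - K)\<bar> < e"
    using d1(1) d2(1) by (intro exI[of _ "min d1 d2"]) auto
qed

lemma strict_derivative_imp_DERIV:
  assumes "strict_derivative f L x" shows "(f has_real_derivative L) (at x)"
  unfolding DERIV_def LIM_def
proof (intro allI impI)
  fix e :: real assume e: "0 < e"
  obtain d where d: "0 < d" "\<And>u v. \<bar>u - x\<bar> < d \<Longrightarrow> \<bar>v - x\<bar> < d \<Longrightarrow> u \<noteq> v \<Longrightarrow> \<bar>(f v - f u) / (v - u) - L\<bar> < e"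
    by (rule strict_derivativeE[OF assms e]) (rule that)
  show "\<exists>s>0. \<forall>h. h \<noteq> 0 \<and> dist h 0 < s \<longrightarrow> dist ((f (x + h) - f x) / h) L < e"
    using d(1) d(2)[of x "x + h" for h] by (intro exI[of _ d]) (auto simp: dist_real_def)
qed

text \<open>Strict differentiability is what controls an infimum over pairs with both points free.
  \<open>D\<close> is the right derivative, and every slope over \<open>[u, v]\<close> lies between
  \<open>D u\<close> and \<open>D v\<close>. Hence the derivative is strict wherever the monotone
  function \<open>D\<close> is continuous, which excludes only countably many points.\<close>

lemma convex_strict_derivative:
  fixes f :: "real \<Rightarrow> real"
  assumes J: "open J" and f: "convex_on J f"
  shows "\<exists>N. countable N \<and> (\<forall>x\<in>J - N. \<exists>L. strict_derivative f L x)"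
proof -
  define S where "S x = {(f y - f x) / (y - x) | y. y \<in> J \<and> x < y}" for x
  define D where "D x = Inf (S x)" for x
  have slope: "(f x - f t) / (x - t) \<le> (f t - f y) / (t - y)" if "x \<in> J" "y \<in> J" "x < t" "t < y" for x t y
    using convex_on_slope_le[OF f that] by linarith
  have flip: "(f u - f v) / (u - v) = (f v - f u) / (v - u)" for u v by (metis minus_diff_eq minus_divide_divide)
  have Sne: "S x \<noteq> {}" if x: "x \<in> J" for x
  proof -
    obtain e where "0 < e" "ball x e \<subseteq> J" using J x openE by blast
    then have "x + e / 2 \<in> J" by (auto simp: subset_eq dist_real_def)
    then have "(f (x + e / 2) - f x) / ((x + e / 2) - x) \<in> S x" using \<open>0 < e\<close> unfolding S_def by force
    then show ?thesis by blast
  qed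
  have Slow: "(f x - f u) / (x - u) \<le> z" if "u \<in> J" "u < x" "z \<in> S x" for u x z
    using that slope[of u _ x] flip unfolding S_def by auto
  have bdd: "bdd_below (S x)" if x: "x \<in> J" for x
  proof -
    obtain e where "0 < e" "ball x e \<subseteq> J" using J x openE by blast
    then have "x - e / 2 \<in> J" by (auto simp: subset_eq dist_real_def)
    then show ?thesis using Slow[of "x - e / 2" x] \<open>0 < e\<close> by (intro bdd_belowI) auto
  qed
  have D1: "D u \<le> (f v - f u) / (v - u)" if "u \<in> J" "v \<in> J" "u < v" for u v
    unfolding D_def by (rule cInf_lower[OF _ bdd]) (use that in \<open>auto simp: S_def\<close>)
  have D2: "(f v - f u) / (v - u) \<le> D v" if "u \<in> J" "v \<in> J" "u < v" for u v
    unfolding D_def by (rule cInf_greatest[OF Sne[OF that(2)] Slow[OF that(1,3)]])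
  have "mono_on J D"
  proof (rule mono_onI)
    fix u v assume "u \<in> J" "v \<in> J" "u \<le> v"
    then show "D u \<le> D v" using D1[of u v] D2[of u v] by (cases "u = v") auto
  qed
  then have "countable {x\<in>J. \<not> isCont D x}" by (rule mono_on_ctble_discont_open[OF J])
  moreover have "strict_derivative f (D x) x" if x: "x \<in> J" "isCont D x" for x
  proof (rule strict_derivativeI_less)
    fix e :: real assume e: "0 < e"
    obtain d1 where d1: "0 < d1" "ball x d1 \<subseteq> J" using J x openE by blast
    obtain d2 where d2: "0 < d2" "\<And>y. dist y x < d2 \<Longrightarrow> dist (D y) (D x) < e"
      using x(2) e unfolding continuous_at_eps_delta by blast
    have "\<bar>(f v - f u) / (v - u) - D x\<bar> < e" if uv: "\<bar>u - x\<bar> < min d1 d2" "\<bar>v - x\<bar> < min d1 d2" "u < v" for u v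
    proof -
      have "u \<in> J" "v \<in> J" using d1(2) uv by (auto simp: subset_eq dist_real_def abs_minus_commute)
      then have "D u \<le> (f v - f u) / (v - u)" "(f v - f u) / (v - u) \<le> D v" using D1 D2 uv(3) by blast+
      moreover have "\<bar>D u - D x\<bar> < e" "\<bar>D v - D x\<bar> < e" using d2(2)[of u] d2(2)[of v] uv by (simp_all add: dist_real_def)
      ultimately show ?thesis by linarith
    qed
    then show "\<exists>d>0. \<forall>u v. \<bar>u - x\<bar> < d \<and> \<bar>v - x\<bar> < d \<and> u < v \<longrightarrow> \<bar>(f v - f u) / (v - u) - D x\<bar> < e"
      using d1(1) d2(1) by (intro exI[of _ "min d1 d2"]) auto
  qed
  ultimately show ?thesis by (intro exI[of _ "{x\<in>J. \<not> isCont D x}"]) auto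
qed

lemma strict_derivative_cong:
  assumes J: "open J" "x \<in> J" and eq: "\<And>y. y \<in> J \<Longrightarrow> f y = g y" and f: "strict_derivative f L x"
  shows "strict_derivative g L x"
  unfolding strict_derivative_def
proof (intro allI impI)
  fix e :: real assume e: "0 < e"
  obtain d where d: "0 < d" "\<And>u v. \<bar>u - x\<bar> < d \<Longrightarrow> \<bar>v - x\<bar> < d \<Longrightarrow> u \<noteq> v \<Longrightarrow> \<bar>(f v - f u) / (v - u) - L\<bar> < e"
    by (rule strict_derivativeE[OF f e]) (rule that)
  obtain h where h: "0 < h" "ball x h \<subseteq> J" using J openE by blast
  have "\<bar>(g v - g u) / (v - u) - L\<bar> < e" if uv: "\<bar>u - x\<bar> < min d h" "\<bar>v - x\<bar> < min d h" "u \<noteq> v" for u v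
  proof -
    have "u \<in> J" "v \<in> J" using h(2) uv by (auto simp: subset_eq dist_real_def abs_minus_commute)
    then show ?thesis using d(2)[of u v] uv by (simp add: eq[symmetric])
  qed
  then show "\<exists>d>0. \<forall>u v. \<bar>u - x\<bar> < d \<and> \<bar>v - x\<bar> < d \<and> u \<noteq> v \<longrightarrow> \<bar>(g v - g u) / (v - u) - L\<bar> < e"
    using d(1) h(1) by (intro exI[of _ "min d h"]) auto
qed

text \<open>Where both convex parts are strictly differentiable, so is \<open>g\<close>; outside
  \<open>N0\<close> uniqueness of the derivative identifies the value as \<open>g'\<close>.\<close>

lemma difference_of_convex_strict_derivative:
  assumes J: "open J" and g: "difference_of_convex_on J g"
    and g': "countable N0" "\<And>x. x \<in> J - N0 \<Longrightarrow> (g has_real_derivative g' x) (at x)"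
  obtains N where "countable N" "\<And>x. x \<in> J - N \<Longrightarrow> strict_derivative g (g' x) x"
proof -
  obtain g1 g2 where c: "convex_on J g1" "convex_on J g2" and eq: "\<And>x. x \<in> J \<Longrightarrow> g x = g1 x - g2 x"
    using g unfolding difference_of_convex_on_def by blast
  obtain N1 where N1: "countable N1" "\<And>x. x \<in> J - N1 \<Longrightarrow> \<exists>L. strict_derivative g1 L x" using convex_strict_derivative[OF J c(1)] by blast
  obtain N2 where N2: "countable N2" "\<And>x. x \<in> J - N2 \<Longrightarrow> \<exists>L. strict_derivative g2 L x" using convex_strict_derivative[OF J c(2)] by blast
  show thesis
  proof (rule that[of "N0 \<union> (N1 \<union> N2)"])
    fix x assume x: "x \<in> J - (N0 \<union> (N1 \<union> N2))"
    obtain L1 L2 where "strict_derivative g1 L1 x" "strict_derivative g2 L2 x" using N1(2)[of x] N2(2)[of x] x by blast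
    from strict_derivative_diff[OF this] have s: "strict_derivative g (L1 - L2) x"
      by (rule strict_derivative_cong[OF J, rotated 2]) (use x eq in auto)
    have "L1 - L2 = g' x" by (rule DERIV_unique[OF strict_derivative_imp_DERIV[OF s] g'(2)]) (use x in auto)
    then show "strict_derivative g (g' x) x" using s by simp
  qed (use g' N1 N2 in auto)
qed

lemma difference_of_convex_continuous:
  assumes J: "open J" and g: "difference_of_convex_on J g" shows "continuous_on J g"
proof -
  obtain g1 g2 where c: "convex_on J g1" "convex_on J g2" and eq: "\<And>x. x \<in> J \<Longrightarrow> g x = g1 x - g2 x"
    using g unfolding difference_of_convex_on_def by blast
  have "continuous_on J (\<lambda>x. g1 x - g2 x)" by (intro continuous_on_diff convex_on_continuous J c)
  then show ?thesis by (rule continuous_on_eq) (simp add: eq)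
qed

text \<open>Off \<open>N\<close> the derivative is a limit of difference quotients with steps
  \<open>1 / Suc n\<close>, and arbitrary values on a countable set do not affect measurability.
  Extending \<open>g\<close> by zero is harmless, because \<open>J\<close> is open and the shifted
  point is eventually in it.\<close>

lemma derivative_measurable:
  assumes J: "open J" and g: "continuous_on J g" and N: "countable N"
    and g': "\<And>x. x \<in> J - N \<Longrightarrow> (g has_real_derivative g' x) (at x)"
  shows "(\<lambda>x. indicator J x * g' x :: real) \<in> borel_measurable borel"
proof -
  have Jm: "J \<in> sets borel" using J by simp
  have Gm [measurable]: "(\<lambda>x. indicator J x * g x) \<in> borel_measurable borel"
    using borel_measurable_continuous_on_restrict[OF g] Jm by (subst (asm) borel_measurable_restrict_space_iff) auto
  have Nm: "N \<in> sets borel" using N by (rule sets.countable[rotated]) auto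
  have JN [measurable]: "J - N \<in> sets borel" using Jm Nm by blast
  have "(\<lambda>x. indicator (J - N) x * g' x) \<in> borel_measurable borel"
  proof (rule borel_measurable_LIMSEQ_real)
    let ?u = "\<lambda>n x. indicator (J - N) x * ((indicator J (x + 1 / real (Suc n)) * g (x + 1 / real (Suc n)) - indicator J x * g x) * real (Suc n))"
    have sh: "(\<lambda>x. indicator J (x + 1 / real (Suc n)) * g (x + 1 / real (Suc n))) \<in> borel_measurable borel" for n
      by (rule measurable_compose[OF _ Gm]) simp
    show "?u n \<in> borel_measurable borel" for n
      by (intro borel_measurable_times borel_measurable_diff sh Gm borel_measurable_indicator JN borel_measurable_const)
    fix x :: real
    show "(\<lambda>n. ?u n x) \<longlonglongrightarrow> indicator (J - N) x * g' x"
    proof (cases "x \<in> J - N")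
      case True
      obtain h where h: "0 < h" "ball x h \<subseteq> J" using J True openE by blast
      note z = inverse_Suc_tendsto_0
      have "(\<lambda>n. (g (x + 1 / real (Suc n)) - g x) / (1 / real (Suc n))) \<longlonglongrightarrow> g' x"
      proof (rule filterlim_compose[of "\<lambda>h. (g (x + h) - g x) / h" _ "at 0"])
        show "((\<lambda>h. (g (x + h) - g x) / h) \<longlongrightarrow> g' x) (at 0)" using g'[OF True] by (simp add: DERIV_def)
        show "filterlim (\<lambda>n. 1 / real (Suc n)) (at 0) sequentially" using z by (auto simp: filterlim_at)
      qed
      moreover have "\<forall>\<^sub>F n in sequentially. (g (x + 1 / real (Suc n)) - g x) / (1 / real (Suc n)) = ?u n x"
      proof -
        have "\<forall>\<^sub>F n in sequentially. 1 / real (Suc n) < h" using order_tendstoD(2)[OF z h(1)] .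
        then show ?thesis
        proof eventually_elim
          case (elim n)
          then have "x + 1 / real (Suc n) \<in> ball x h" by (simp add: dist_real_def)
          then have "x + 1 / real (Suc n) \<in> J" using h(2) by blast
          then show ?case using True by simp
        qed
      qed
      ultimately have "(\<lambda>n. ?u n x) \<longlonglongrightarrow> g' x" by (rule Lim_transform_eventually)
      then show ?thesis using True by simp
    qed simp
  qed
  then show ?thesis by (rule measurable_discrete_difference[OF _ N]) (auto simp: indicator_def)
qed

text \<open>By the mean value theorem the quotient is a value of \<open>rho\<close> between the two
  points.\<close>

lemma integral_strict_derivative:
  fixes rho :: "real \<Rightarrow> real"
  assumes rho: "continuous_on {a..b} rho" and x: "a < x" "x < b"
  shows "strict_derivative (\<lambda>x. integral {a..x} rho) (rho x) x"
proof (rule strict_derivativeI_less)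
  fix e :: real assume e: "0 < e"
  have "isCont rho x" by (rule continuous_on_interior[OF rho]) (use x in simp)
  then obtain d where d: "0 < d" "\<And>y. dist y x < d \<Longrightarrow> dist (rho y) (rho x) < e"
    using e unfolding continuous_at_eps_delta by blast
  have "\<bar>(integral {a..v} rho - integral {a..u} rho) / (v - u) - rho x\<bar> < e"
    if uv: "\<bar>u - x\<bar> < min d (min (x - a) (b - x))" "\<bar>v - x\<bar> < min d (min (x - a) (b - x))" "u < v" for u v
  proof -
    have "\<exists>z. u < z \<and> z < v \<and> integral {a..v} rho - integral {a..u} rho = (v - u) * rho z"
    proof (rule MVT2[OF uv(3)])
      fix z assume z: "u \<le> z" "z \<le> v"
      then have ab: "a < z" "z < b" using uv by auto
      then have "((\<lambda>x. integral {a..x} rho) has_real_derivative rho z) (at z within {a..b})"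
        by (intro integral_has_real_derivative[OF rho]) auto
      then show "((\<lambda>x. integral {a..x} rho) has_real_derivative rho z) (at z)" by (simp add: at_within_Icc_at[OF ab])
    qed
    then obtain z where z: "u < z" "z < v" "integral {a..v} rho - integral {a..u} rho = (v - u) * rho z" by blast
    then have "\<bar>z - x\<bar> < d" using uv by linarith
    then have "\<bar>rho z - rho x\<bar> < e" using d(2)[of z] by (simp add: dist_real_def)
    then show ?thesis using z uv(3) by simp
  qed
  then show "\<exists>d>0. \<forall>u v. \<bar>u - x\<bar> < d \<and> \<bar>v - x\<bar> < d \<and> u < v \<longrightarrow> \<bar>(integral {a..v} rho - integral {a..u} rho) / (v - u) - rho x\<bar> < e"
    using d(1) x by (intro exI[of _ "min d (min (x - a) (b - x))"]) auto
qed

text \<open>Strict differentiability brings the quotients of all nearby pairs close to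
  \<open>L / R\<close>, so the infimum of their squares is not much below \<open>(L / R)^2\<close>,
  and the cap \<open>real n\<close> is eventually out of the way. A lower bound is all that Fatou's
  lemma requires.\<close>

lemma local_slope_lower:
  fixes s g :: "real \<Rightarrow> real"
  assumes g: "strict_derivative g L x" and s: "strict_derivative s R x" and R: "0 < R" and y: "y < (L / R)\<^sup>2"
  shows "\<forall>\<^sub>F n in sequentially. y \<le> local_slope a b (1 / real (Suc n)) (real n) s g x"
proof -
  have "((\<lambda>z. (fst z / snd z)\<^sup>2) \<longlongrightarrow> (fst (L, R) / snd (L, R))\<^sup>2) (nhds (L, R))"
    using R by (intro tendsto_intros filterlim_ident) auto
  then have "\<forall>\<^sub>F z in nhds (L, R). y < (fst z / snd z)\<^sup>2" using y by (intro order_tendstoD) auto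
  then obtain e where e: "0 < e" "\<And>p q. dist (p, q) (L, R) < e \<Longrightarrow> y < (p / q)\<^sup>2"
    unfolding eventually_nhds_metric by auto
  then have e2: "0 < e / 2" by simp
  obtain d1 where d1: "0 < d1" "\<And>u v. \<bar>u - x\<bar> < d1 \<Longrightarrow> \<bar>v - x\<bar> < d1 \<Longrightarrow> u \<noteq> v \<Longrightarrow> \<bar>(g v - g u) / (v - u) - L\<bar> < e / 2"
    by (rule strict_derivativeE[OF g e2]) (rule that)
  obtain d2 where d2: "0 < d2" "\<And>u v. \<bar>u - x\<bar> < d2 \<Longrightarrow> \<bar>v - x\<bar> < d2 \<Longrightarrow> u \<noteq> v \<Longrightarrow> \<bar>(s v - s u) / (v - u) - R\<bar> < e / 2"
    by (rule strict_derivativeE[OF s e2]) (rule that)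
  note z = inverse_Suc_tendsto_0
  have "\<forall>\<^sub>F n in sequentially. 1 / real (Suc n) < min d1 d2" using order_tendstoD(2)[OF z, of "min d1 d2"] d1(1) d2(1) by simp
  moreover have "\<forall>\<^sub>F n in sequentially. y \<le> real n"
    using eventually_ge_at_top[of "nat \<lceil>y\<rceil>"] by eventually_elim linarith
  ultimately show ?thesis
  proof eventually_elim
    case (elim n)
    show ?case
    proof (rule local_slope_greatest[OF elim(2)])
      fix u v assume uv: "u \<noteq> v" "\<bar>u - x\<bar> < 1 / real (Suc n)" "\<bar>v - x\<bar> < 1 / real (Suc n)"
      let ?p = "(g v - g u) / (v - u)" and ?q = "(s v - s u) / (v - u)"
      have "\<bar>?p - L\<bar> < e / 2" "\<bar>?q - R\<bar> < e / 2" using d1(2)[of u v] d2(2)[of u v] uv elim(1) by auto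
      moreover have "dist (?p, ?q) (L, R) \<le> \<bar>?p - L\<bar> + \<bar>?q - R\<bar>"
        using sqrt_sum_squares_le_sum_abs[of "?p - L" "?q - R"] by (simp add: dist_Pair_Pair dist_real_def)
      ultimately have "y < (?p / ?q)\<^sup>2" by (intro e(2)) linarith
      moreover have "v - u \<noteq> 0" using uv(1) by simp
      moreover have "?p / ?q = (g v - g u) / (s v - s u)" using calculation(2) by simp
      ultimately show "y \<le> ((g v - g u) / (s v - s u))\<^sup>2" by simp
    qed
  qed
qed

lemma liminf_mult_lower:
  fixes f :: "nat \<Rightarrow> real"
  assumes q: "\<And>y. y < q \<Longrightarrow> \<forall>\<^sub>F n in sequentially. y \<le> f n" and k: "0 \<le> k"
  shows "ennreal (q * k) \<le> liminf (\<lambda>n. ennreal (f n * k))"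
  unfolding le_Liminf_iff
proof (intro allI impI)
  fix y assume y: "y < ennreal (q * k)"
  then have qk: "0 < q * k" by (metis ennreal_neg not_less zero_le leI)
  then have k0: "0 < k" using k by (cases "k = 0") auto
  obtain y' where y': "y = ennreal y'" "0 \<le> y'" using y by (cases y) auto
  then have "y' < q * k" using y by (simp add: ennreal_less_iff)
  then have "y' / k < q" using k0 by (simp add: pos_divide_less_eq)
  then obtain c where c: "y' / k < c" "c < q" using dense by blast
  from q[OF c(2)] show "\<forall>\<^sub>F n in sequentially. y < ennreal (f n * k)"
  proof eventually_elim
    case (elim n)
    have "y' < c * k" using c(1) k0 by (simp add: pos_divide_less_eq)
    also have "\<dots> \<le> f n * k" using elim k by (rule mult_right_mono)
    finally show ?case using y' by (simp add: ennreal_less_iff)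
  qed
qed

context exiting_sde begin

text \<open>Fatou's lemma in the uniform bound along \<open>d = 1 / Suc n\<close> and
  \<open>m = real n\<close>. The limit inferior of the integrands is at least twice the claimed one,
  and the factor \<open>2\<close> is given away.\<close>

lemma energy_integral_bound:
  assumes c: "c \<in> einterval l r" and g: "difference_of_convex_on (einterval l r) g"
    and lim: "((\<lambda>x. g (real_of_ereal x)) \<longlongrightarrow> gl) (at_right l)"
    and ex: "exits_at M Y l r l" and Z: "semimartingale M F (\<lambda>t om. extend_at_left l r g gl (Y t om))"
    and N0: "countable N0" "\<And>x. x \<in> einterval l r - N0 \<Longrightarrow> (g has_real_derivative g' x) (at x)"
  defines "rho \<equiv> scale_density \<mu> \<sigma> c"
  obtains E :: real where "\<And>a. l < ereal a \<Longrightarrow> a < x0 \<Longrightarrow>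
     (\<integral>\<^sup>+u\<in>{a<..<x0}. ennreal (integral {a..u} rho * ((g' u)\<^sup>2 / rho u)) \<partial>lborel) \<le> ennreal E"
proof -
  have J: "open (einterval l r)" by (rule open_einterval)
  have gc: "continuous_on (einterval l r) g" by (rule difference_of_convex_continuous[OF J g])
  obtain N where N: "countable N" "\<And>x. x \<in> einterval l r - N \<Longrightarrow> strict_derivative g (g' x) x"
    by (rule difference_of_convex_strict_derivative[OF J g N0(1)], erule N0(2), rule that)
  show thesis
  proof (rule uniform_energy_bound[OF c gc lim ex Z, folded rho_def], goal_cases)
    case (1 b E)
    note b = 1(1,2) and E = 1(3)
    show thesis
    proof (rule that)
    fix a :: real assume a: "l < ereal a" "a < x0"
    have rho_cont: "continuous_on {a..b} rho" unfolding rho_def by (rule scale_density_continuous[OF c a(1) b(2)])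
    have rho_pos: "0 < rho x" for x by (simp add: rho_def scale_density_def)
    have sub: "{a..b} \<subseteq> einterval l r" by (rule subinterval[OF a(1) b(2)])
    have CP: "concave_potential a b x0 (1 / real (Suc n)) (real n) rho" for n by standard (use a b rho_cont rho_pos in auto)
    let ?s = "\<lambda>x. integral {a..x} rho"
    let ?f = "\<lambda>n. local_slope a b (1 / real (Suc n)) (real n) ?s g"
    let ?u = "\<lambda>n u. ennreal (?f n u * (2 * ?s u * rho u)) * indicator {a..x0} u"
    have um: "?u n \<in> borel_measurable lborel" and ui: "(\<integral>\<^sup>+u. ?u n u \<partial>lborel) \<le> ennreal E" for n
    proof -
      interpret C: concave_potential a b x0 "1 / real (Suc n)" "real n" rho g by (rule CP)
      show "?u n \<in> borel_measurable lborel" using C.energy_eq(1) unfolding C.f_def C.sc_def[abs_def] .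
      have "(\<integral>\<^sup>+u. ?u n u \<partial>lborel) = ennreal (- C.V a)" using C.energy_eq(2) unfolding C.f_def C.sc_def[abs_def] .
      also have "- C.V a \<le> E" unfolding C.V_left C.f_def C.sc_def[abs_def] by (rule E[OF a]) auto
      finally show "(\<integral>\<^sup>+u. ?u n u \<partial>lborel) \<le> ennreal E" by (simp add: ennreal_leI)
    qed
    have s0: "0 \<le> ?s u" if "u \<in> {a..b}" for u
      by (rule integral_nonneg[OF integrable_on_subinterval[OF integrable_continuous_real[OF rho_cont]]]) (use that rho_pos in \<open>auto simp: less_imp_le\<close>)
    have "(\<integral>\<^sup>+u\<in>{a<..<x0}. ennreal (?s u * ((g' u)\<^sup>2 / rho u)) \<partial>lborel) \<le> (\<integral>\<^sup>+u. liminf (\<lambda>n. ?u n u) \<partial>lborel)"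
    proof (rule nn_integral_mono_AE)
      have "AE u in lborel. u \<notin> N" by (rule AE_not_in[OF countable_imp_null_set_lborel[OF N(1)]])
      then show "AE u in lborel. ennreal (?s u * ((g' u)\<^sup>2 / rho u)) * indicator {a<..<x0} u \<le> liminf (\<lambda>n. ?u n u)"
      proof eventually_elim
        case (elim u)
        show ?case
        proof (cases "u \<in> {a<..<x0}")
          case True
          then have ub: "a < u" "u < b" "u \<in> {a..b}" using b by auto
          have sg: "strict_derivative g (g' u) u" by (rule N(2)) (use ub sub elim in auto)
          have "ennreal ((g' u / rho u)\<^sup>2 * (2 * ?s u * rho u)) \<le> liminf (\<lambda>n. ennreal (?f n u * (2 * ?s u * rho u)))"
            by (rule liminf_mult_lower[OF local_slope_lower[OF sg integral_strict_derivative[OF rho_cont ub(1,2)] rho_pos]])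
              (use s0[OF ub(3)] rho_pos[of u] in auto)
          moreover have "?s u * ((g' u)\<^sup>2 / rho u) \<le> (g' u / rho u)\<^sup>2 * (2 * ?s u * rho u)"
          proof -
            have "(g' u / rho u)\<^sup>2 * (2 * ?s u * rho u) = 2 * (?s u * ((g' u)\<^sup>2 / rho u))"
              using rho_pos[of u] by (simp add: power2_eq_square field_simps)
            moreover have "0 \<le> ?s u * ((g' u)\<^sup>2 / rho u)" using s0[OF ub(3)] rho_pos[of u] by simp
            ultimately show ?thesis by linarith
          qed
          ultimately show ?thesis using True by (auto intro: order_trans[OF ennreal_leI])
        qed simp
      qed
    qed
    also have "\<dots> \<le> liminf (\<lambda>n. (\<integral>\<^sup>+u. ?u n u \<partial>lborel))" by (rule nn_integral_liminf[OF um])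
    also have "\<dots> \<le> ennreal E"
    proof -
      have "liminf (\<lambda>n. (\<integral>\<^sup>+u. ?u n u \<partial>lborel)) \<le> liminf (\<lambda>n::nat. ennreal E)" by (intro Liminf_mono always_eventually allI ui)
      then show ?thesis by (simp add: Liminf_const)
    qed
    finally show "(\<integral>\<^sup>+u\<in>{a<..<x0}. ennreal (?s u * ((g' u)\<^sup>2 / rho u)) \<partial>lborel) \<le> ennreal E" .
    qed
  qed
qed

end

section \<open>The scale function at the left end, and the conclusion\<close>

lemma scale_function_minus_left:
  fixes y c :: real
  assumes y: "l < ereal y" and c: "l < ereal c"
    and fin: "\<And>u v. l < ereal u \<Longrightarrow> u \<le> max c y \<Longrightarrow> (\<integral>\<^sup>+z\<in>{u..max c y}. ennreal (scale_density \<mu> \<sigma> c z) \<partial>lborel) < \<infinity>"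
    and m: "(\<lambda>z. ennreal (scale_density \<mu> \<sigma> c z) * indicator (einterval l (max c y)) z) \<in> borel_measurable lborel"
  shows "scale_function \<mu> \<sigma> c (ereal y) - scale_function \<mu> \<sigma> c l
    = enn2ereal (\<integral>\<^sup>+z\<in>einterval l (ereal y). ennreal (scale_density \<mu> \<sigma> c z) \<partial>lborel)"
proof -
  let ?d = "\<lambda>z. ennreal (scale_density \<mu> \<sigma> c z)"
  let ?I = "\<lambda>p q. (\<integral>\<^sup>+z\<in>einterval p q. ?d z \<partial>lborel)"
  have add: "?I l (ereal v) = ?I l (ereal u) + ?I (ereal u) (ereal v)" if u: "l < ereal u" "u \<le> v" and v: "v = max c y" for u v
  proof -
    let ?h = "\<lambda>z. ?d z * indicator (einterval l (ereal v)) z"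
    have hm: "?h \<in> borel_measurable lborel" unfolding v by (rule m)
    have e1: "?d z * indicator (einterval l (ereal u)) z = ?h z * indicator {z. z < u} z" for z
      using u by (auto simp: einterval_def indicator_def)
    have e2: "?d z * indicator (einterval (ereal u) (ereal v)) z = ?h z * indicator {z. u < z} z" for z
      using u by (auto simp: einterval_def indicator_def intro: less_trans[of l "ereal u"])
    have "?I l (ereal v) = (\<integral>\<^sup>+z. ?h z * indicator {z. z < u} z + ?h z * indicator {z. u < z} z \<partial>lborel)"
    proof (rule nn_integral_cong_AE)
      show "AE z in lborel. ?d z * indicator (einterval l (ereal v)) z = ?h z * indicator {z. z < u} z + ?h z * indicator {z. u < z} z"
        using AE_lborel_singleton[of u] by eventually_elim (auto simp: indicator_def)
    qed
    also have "\<dots> = (\<integral>\<^sup>+z. ?h z * indicator {z. z < u} z \<partial>lborel) + (\<integral>\<^sup>+z. ?h z * indicator {z. u < z} z \<partial>lborel)"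
      by (rule nn_integral_add; intro borel_measurable_times_ennreal hm borel_measurable_indicator) auto
    finally show ?thesis by (simp only: e1 e2)
  qed
  have "\<not> ereal c \<le> l" using c by simp
  then have sl: "scale_function \<mu> \<sigma> c l = - enn2ereal (?I l (ereal c))" by (simp add: scale_function_def)
  show ?thesis
  proof (cases "c \<le> y")
    case True
    have eq: "?I l (ereal y) = ?I l (ereal c) + ?I (ereal c) (ereal y)" by (rule add) (use c True in auto)
    have sy: "scale_function \<mu> \<sigma> c (ereal y) = enn2ereal (?I (ereal c) (ereal y))" using True by (simp add: scale_function_def)
    show ?thesis unfolding sl sy eq plus_ennreal.rep_eq by (simp only: minus_ereal_def ereal_uminus_uminus add.commute)
  next
    case False
    have eq: "?I l (ereal c) = ?I l (ereal y) + ?I (ereal y) (ereal c)" by (rule add) (use y False in auto)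
    \<comment> \<open>For \<open>y < c\<close> the part between \<open>y\<close> and
      \<open>c\<close> is subtracted from an integral that may be infinite, so this part has to be
      finite before the terms can be cancelled.\<close>
    have "?I (ereal y) (ereal c) \<le> (\<integral>\<^sup>+z\<in>{y..max c y}. ?d z \<partial>lborel)"
      using False by (intro nn_integral_mono mult_left_mono) (auto simp: indicator_def einterval_def max_def)
    also have "\<dots> < \<infinity>" by (rule fin[OF y]) simp
    finally obtain A where A: "?I (ereal y) (ereal c) = ennreal A" "0 \<le> A" by (cases "?I (ereal y) (ereal c)") auto
    have sy: "scale_function \<mu> \<sigma> c (ereal y) = - enn2ereal (?I (ereal y) (ereal c))" using False by (simp add: scale_function_def)
    have "scale_function \<mu> \<sigma> c (ereal y) - scale_function \<mu> \<sigma> c l = - ereal A + (enn2ereal (?I l (ereal y)) + ereal A)"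
      unfolding sl sy eq plus_ennreal.rep_eq A(1) enn2ereal_ennreal[OF A(2)] by (simp only: minus_ereal_def ereal_uminus_uminus)
    also have "\<dots> = enn2ereal (?I l (ereal y))" by (cases "enn2ereal (?I l (ereal y))") auto
    finally show ?thesis .
  qed
qed

text \<open>The infinite case matters because \<open>s l\<close> is not assumed to be finite; for
  \<open>q = 0\<close> both sides are then \<open>0\<close>, as \<open>\<infinity> * 0 = 0\<close>
  in both types.\<close>

lemma enn2ereal_quotient_times:
  assumes "0 < R" "0 \<le> q"
  shows "enn2ereal S / ereal R * ereal q = enn2ereal (S * ennreal (q / R))"
proof (cases S)
  case (real x)
  then show ?thesis using assms by (simp add: enn2ereal_ennreal ennreal_mult[symmetric])
next
  case top
  then show ?thesis using assms by (cases "q = 0") (auto simp: ennreal_top_mult zero_ereal_def[symmetric] zero_ennreal.rep_eq)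
qed

theorem theorem3p12:
  fixes M :: "'a measure" and F :: "real \<Rightarrow> 'a measure" and W :: "real \<Rightarrow> 'a \<Rightarrow> real"
    and Y :: "real \<Rightarrow> 'a \<Rightarrow> ereal"
    and l r :: ereal and \<mu> \<sigma> g g' :: "real \<Rightarrow> real" and x\<^sub>0 c gl :: real
  defines "J \<equiv> einterval l r"
  defines "\<rho> \<equiv> scale_density \<mu> \<sigma> c" and "s \<equiv> scale_function \<mu> \<sigma> c"
  assumes "l < r"
    and "\<mu> \<in> borel_measurable (restrict_space borel J)"
    and "\<sigma> \<in> borel_measurable (restrict_space borel J)"
    and "\<And>x. x \<in> J \<Longrightarrow> \<sigma> x \<noteq> 0"
    and "locally_integrable_on (\<lambda>x. 1 / (\<sigma> x)\<^sup>2) J"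
    and "locally_integrable_on (\<lambda>x. \<mu> x / (\<sigma> x)\<^sup>2) J"
    and "x\<^sub>0 \<in> J" and "c \<in> J"
    and "filtered_prob_space M F"
    and "brownian_motion M F W"
    and "sde_solution_with_exit M F W \<mu> \<sigma> l r x\<^sub>0 Y"
    and "difference_of_convex_on J g"
    and "\<exists>N. countable N \<and> (\<forall>x\<in>J - N. (g has_real_derivative g' x) (at x))"
    and "exits_at M Y l r l"
    and "((\<lambda>x. g (real_of_ereal x)) \<longlongrightarrow> gl) (at_right l)"
    and "\<not> exits_at M Y l r r"
    and "semimartingale M F (\<lambda>t \<omega>. extend_at_left l r g gl (Y t \<omega>))"
  shows "(\<lambda>y. (s (ereal y) - s l) / ereal (\<rho> y) * ereal ((g' y)\<^sup>2)) \<in> L1_loc_right l r"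
proof -
  interpret filtered_prob_space M F by fact
  interpret exiting_sde M F W Y l r \<mu> \<sigma> x\<^sub>0 by standard (use assms in \<open>auto simp: J_def\<close>)
  have cJ: "c \<in> einterval l r" and J: "open J" using \<open>c \<in> J\<close> by (auto simp: J_def)
  have lc: "l < ereal c" and lx: "l < ereal x\<^sub>0" and xr: "ereal x\<^sub>0 < r" using cJ x0 by (auto simp: einterval_def)
  obtain N where N: "countable N" "\<forall>x\<in>J - N. (g has_real_derivative g' x) (at x)"
    using \<open>\<exists>N. countable N \<and> (\<forall>x\<in>J - N. (g has_real_derivative g' x) (at x))\<close> by blast
  have gc: "continuous_on J g" by (rule difference_of_convex_continuous[OF J \<open>difference_of_convex_on J g\<close>])
  have g'm: "(\<lambda>x. indicator J x * g' x) \<in> borel_measurable borel" by (rule derivative_measurable[OF J gc N(1)]) (use N(2) in blast)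
  have rc: "continuous_on {a..b} \<rho>" if "l < ereal a" "ereal b < r" for a b
    unfolding \<rho>_def by (rule scale_density_continuous[OF cJ that])
  have rpos: "0 < \<rho> x" for x by (simp add: \<rho>_def scale_density_def)
  have rJ: "continuous_on J \<rho>"
  proof (rule continuous_at_imp_continuous_on, rule ballI)
    fix x assume "x \<in> J"
    then obtain a b where ab: "l < ereal a" "a < x" "x < b" "ereal b < r"
      using ereal_dense2[of l "ereal x"] ereal_dense2[of "ereal x" r] by (auto simp: J_def einterval_def)
    show "isCont \<rho> x" by (rule continuous_on_interior[OF rc[OF ab(1,4)]]) (use ab in simp)
  qed
  have rm: "(\<lambda>x. indicator J x * \<rho> x) \<in> borel_measurable borel"
    using borel_measurable_continuous_on_restrict[OF rJ] J by (subst (asm) borel_measurable_restrict_space_iff) auto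
  \<comment> \<open>The difference of the scale function at \<open>y\<close> and at
    \<open>l\<close>, possibly infinite. Kept in \<open>ennreal\<close>, it can be approximated by
    monotone convergence without knowing that it is finite.\<close>
  define S where "S y = (\<integral>\<^sup>+z\<in>einterval l (ereal y). ennreal (\<rho> z) \<partial>lborel)" for y
  have fin: "(\<integral>\<^sup>+z\<in>{u..v}. ennreal (\<rho> z) \<partial>lborel) = ennreal (integral {u..v} \<rho>)" if "l < ereal u" "ereal v < r" for u v
  proof -
    have I: "set_integrable lborel {u..v} \<rho>" by (rule borel_integrable_atLeastAtMost'[OF rc[OF that]])
    have "(\<integral>\<^sup>+z\<in>{u..v}. ennreal (\<rho> z) \<partial>lborel) = (\<integral>\<^sup>+z. ennreal (indicator {u..v} z *\<^sub>R \<rho> z) \<partial>lborel)"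
      by (intro nn_integral_cong) (auto simp: indicator_def)
    also have "\<dots> = ennreal (LINT z:{u..v}|lborel. \<rho> z)" unfolding set_lebesgue_integral_def using I unfolding set_integrable_def
      by (rule nn_integral_eq_integral) (use rpos in \<open>auto simp: less_imp_le\<close>)
    finally show ?thesis by (simp add: set_borel_integral_eq_integral(2)[OF I])
  qed
  have hm: "(\<lambda>z. ennreal (\<rho> z) * indicator (einterval l (ereal v)) z) \<in> borel_measurable borel" if v: "ereal v \<le> r" for v
  proof -
    have "(\<lambda>z. ennreal (indicator J z * \<rho> z) * indicator (einterval l (ereal v)) z) \<in> borel_measurable borel"
      by (intro borel_measurable_times_ennreal measurable_compose[OF rm measurable_ennreal] borel_measurable_indicator) simp
    also have "(\<lambda>z. ennreal (indicator J z * \<rho> z) * indicator (einterval l (ereal v)) z) = (\<lambda>z. ennreal (\<rho> z) * indicator (einterval l (ereal v)) z)"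
      using v by (auto simp: fun_eq_iff indicator_def J_def einterval_def intro: less_le_trans[of _ "ereal v"])
    finally show ?thesis .
  qed
  have sdiff: "s (ereal y) - s l = enn2ereal (S y)" if y: "y \<in> J" for y unfolding s_def S_def \<rho>_def
  proof (rule scale_function_minus_left[OF _ lc])
    have mr: "ereal (max c y) < r" using y cJ by (auto simp: J_def einterval_def max_def)
    show "l < ereal y" using y by (simp add: J_def einterval_def)
    show "(\<lambda>z. ennreal (scale_density \<mu> \<sigma> c z) * indicator (einterval l (max c y)) z) \<in> borel_measurable lborel"
      using hm[OF less_imp_le[OF mr]] by (simp add: \<rho>_def)
    show "(\<integral>\<^sup>+z\<in>{u..max c y}. ennreal (scale_density \<mu> \<sigma> c z) \<partial>lborel) < \<infinity>" if "l < ereal u" for u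
      using fin[OF that mr] by (simp add: \<rho>_def)
  qed
  define q where "q y = (g' y)\<^sup>2 / \<rho> y" for y
  have expr: "(s (ereal y) - s l) / ereal (\<rho> y) * ereal ((g' y)\<^sup>2) = enn2ereal (S y * ennreal (q y))" if "y \<in> J" for y
    unfolding sdiff[OF that] q_def by (rule enn2ereal_quotient_times[OF rpos]) simp
  have Jm: "J \<in> sets borel" using J by simp
  \<comment> \<open>\<open>S\<close> is an integral over a kernel that is jointly measurable in
    \<open>y\<close> and \<open>z\<close>; the indicator of \<open>J\<close> makes the kernel
    measurable on the whole line.\<close>
  have Sm: "(\<lambda>y. indicator J y * S y) \<in> borel_measurable borel"
  proof -
    let ?k = "\<lambda>y z. ennreal (indicator J z * \<rho> z) * indicator {p. l < ereal (snd p) \<and> snd p < fst p} (y, z)"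
    let ?K = "\<lambda>y. \<integral>\<^sup>+z. ?k y z \<partial>lborel"
    let ?L = "\<lambda>y. indicator J y * ?K y"
    note [measurable] = rm Jm
    have "?K \<in> borel_measurable borel" by measurable
    then have "?L \<in> borel_measurable borel" by measurable
    also have "?L = (\<lambda>y. indicator J y * S y)"
    proof
      fix y
      show "indicator J y * ?K y = indicator J y * S y"
      proof (cases "y \<in> J")
        case True
        then have "?k y z = ennreal (\<rho> z) * indicator (einterval l (ereal y)) z" for z
          by (auto simp: indicator_def J_def einterval_def intro: less_trans[of _ "ereal y"])
        then show ?thesis by (simp only: S_def)
      qed simp
    qed
    finally show ?thesis .
  qed
  have qm: "(\<lambda>y. indicator J y * ennreal (q y)) \<in> borel_measurable borel"
  proof -
    let ?k = "\<lambda>y. ennreal ((indicator J y * g' y)\<^sup>2 / (indicator J y * \<rho> y))"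
    have "?k \<in> borel_measurable borel"
      by (intro measurable_compose[OF _ measurable_ennreal] borel_measurable_divide borel_measurable_power g'm rm)
    also have "?k = (\<lambda>y. indicator J y * ennreal (q y))" by (auto simp: fun_eq_iff indicator_def q_def)
    finally show ?thesis .
  qed
  show ?thesis unfolding L1_loc_right_def
  \<comment> \<open>The starting point serves as \<open>z\<close>, since the energy bound is over
    intervals ending there.\<close>
  proof (intro CollectI conjI bexI[of _ x\<^sub>0])
    show "x\<^sub>0 \<in> einterval l r" by (rule x0)
    let ?Sq = "\<lambda>y. enn2ereal ((indicator J y * S y) * (indicator J y * ennreal (q y)))"
    have "?Sq \<in> borel_measurable borel" by (intro measurable_compose[OF _ measurable_enn2ereal] borel_measurable_times_ennreal Sm qm)
    then have "?Sq \<in> borel_measurable (restrict_space borel J)" by (rule measurable_restrict_space1)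
    moreover have "?Sq y = (s (ereal y) - s l) / ereal (\<rho> y) * ereal ((g' y)\<^sup>2)"
      if "y \<in> J" for y unfolding expr[OF that] using that by simp
    ultimately show "(\<lambda>y. (s (ereal y) - s l) / ereal (\<rho> y) * ereal ((g' y)\<^sup>2)) \<in> borel_measurable (restrict_space borel (einterval l r))"
      unfolding J_def[symmetric] using Jm by (subst measurable_cong[symmetric]) (auto simp: space_restrict_space)
    obtain E :: real where E0: "\<And>a. l < ereal a \<Longrightarrow> a < x\<^sub>0 \<Longrightarrow>
        (\<integral>\<^sup>+u\<in>{a<..<x\<^sub>0}. ennreal (integral {a..u} (scale_density \<mu> \<sigma> c) * ((g' u)\<^sup>2 / scale_density \<mu> \<sigma> c u)) \<partial>lborel) \<le> ennreal E"
      by (rule energy_integral_bound[OF cJ \<open>difference_of_convex_on J g\<close>[unfolded J_def] assms(18,17,20) N(1), of g'],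
          rule N(2)[rule_format, unfolded J_def], assumption, rule that)
    note E = E0[folded \<rho>_def, folded q_def]
    \<comment> \<open>Left end points decreasing to \<open>l\<close>. The integrals of
      \<open>\<rho>\<close> over \<open>[A i, y]\<close> increase to \<open>S y\<close>, and
      monotone convergence carries the energy bound, uniform in the left end point, down to
      \<open>l\<close>.\<close>
    obtain A :: "nat \<Rightarrow> real" where A: "decseq A" "\<And>i. l < ereal (A i)" "\<And>i. ereal (A i) < ereal x\<^sub>0" "(\<lambda>i. ereal (A i)) \<longlonglongrightarrow> l"
      by (rule ereal_decseq_approx[OF lx]) (rule that)
    define C where "C i y = (\<integral>\<^sup>+z\<in>{A i..y}. ennreal (\<rho> z) \<partial>lborel)" for i y
    define h where "h i y = C i y * ennreal (q y) * indicator {..<x\<^sub>0} y" for i y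
    have C_mono: "C i y \<le> C j y" if "i \<le> j" for i j y
      unfolding C_def using decseqD[OF A(1) that] by (intro nn_integral_mono mult_left_mono) (auto simp: indicator_def)
    have q0: "0 \<le> q y" for y using rpos[of y] by (simp add: q_def)
    have h_eq: "h i y = ennreal (integral {A i..y} \<rho> * q y) * indicator {A i<..<x\<^sub>0} y" for i y
    proof (cases "A i < y \<and> y < x\<^sub>0")
      case True
      then have "ereal y < r" using xr by (auto intro: less_trans[of _ "ereal x\<^sub>0"])
      from fin[OF A(2) this] True show ?thesis by (simp add: h_def C_def ennreal_mult'' q0)
    next
      case False
      have "C i y = 0" if "y \<le> A i"
      proof -
        have "C i y = (\<integral>\<^sup>+(z::real). 0 \<partial>lborel)" unfolding C_def
        proof (rule nn_integral_cong_AE)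
          show "AE z in lborel. ennreal (\<rho> z) * indicator {A i..y} z = 0"
            using AE_lborel_singleton[of "A i"] by eventually_elim (use that in \<open>auto simp: indicator_def\<close>)
        qed
        then show ?thesis by simp
      qed
      then show ?thesis using False by (auto simp: h_def)
    qed
    have hmeas: "h i \<in> borel_measurable lborel" for i
    proof -
      let ?h = "\<lambda>y. ennreal (indicator {A i..x\<^sub>0} y *\<^sub>R integral {A i..y} \<rho>) * (indicator J y * ennreal (q y)) * indicator {A i<..<x\<^sub>0} y"
      have "continuous_on {A i..x\<^sub>0} (\<lambda>y. integral {A i..y} \<rho>)"
        by (rule indefinite_integral_continuous_1[OF integrable_continuous_real[OF rc[OF A(2) xr]]])
      then have "(\<lambda>y. indicator {A i..x\<^sub>0} y *\<^sub>R integral {A i..y} \<rho>) \<in> borel_measurable borel"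
        by (intro borel_measurable_restrict_space_iff[THEN iffD1] borel_measurable_continuous_on_restrict) simp_all
      then have "?h \<in> borel_measurable borel"
        by (intro borel_measurable_times_ennreal qm borel_measurable_indicator measurable_compose[OF _ measurable_ennreal]) auto
      also have "?h = h i"
      proof
        fix y
        have "y \<in> J" if "A i < y" "y < x\<^sub>0" using subinterval[OF A(2) xr, of i] that by (auto simp: J_def)
        then show "?h y = h i y" unfolding h_eq by (cases "A i < y \<and> y < x\<^sub>0") (auto simp: ennreal_mult'' q0)
      qed
      finally show ?thesis by simp
    qed
    have S_sup: "S y = (SUP i. C i y)" if y: "y \<in> J" for y
    proof -
      let ?k = "\<lambda>i z. ennreal (\<rho> z) * indicator {A i..y} z"
      have yr: "ereal y < r" using y by (simp add: J_def einterval_def)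
      have pt: "ennreal (\<rho> z) * indicator (einterval l (ereal y)) z = (SUP i. ?k i z)" if "z \<noteq> y" for z
      proof (cases "z \<in> einterval l (ereal y)")
        case True
        then have "l < ereal z" by (simp add: einterval_def)
        then have "\<forall>\<^sub>F i in sequentially. ereal (A i) < ereal z" by (rule order_tendstoD(2)[OF A(4)])
        then obtain i where i: "A i < z" unfolding eventually_sequentially by auto
        show ?thesis
        proof (rule antisym)
          show "ennreal (\<rho> z) * indicator (einterval l (ereal y)) z \<le> (SUP i. ?k i z)"
            using True i by (intro SUP_upper2[of i]) (auto simp: einterval_def)
          show "(SUP i. ?k i z) \<le> ennreal (\<rho> z) * indicator (einterval l (ereal y)) z"
            using True by (intro SUP_least) (auto simp: indicator_def)
        qed
      next
        case False
        then have "z \<notin> {A i..y}" for i using that A(2)[of i] by (auto simp: einterval_def intro: less_le_trans[of l "ereal (A i)"])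
        then show ?thesis using False by simp
      qed
      have "S y = (\<integral>\<^sup>+z. (SUP i. ?k i z) \<partial>lborel)" unfolding S_def
      proof (rule nn_integral_cong_AE)
        show "AE z in lborel. ennreal (\<rho> z) * indicator (einterval l (ereal y)) z = (SUP i. ?k i z)"
          using AE_lborel_singleton[of y] by eventually_elim (rule pt)
      qed
      also have "\<dots> = (SUP i. C i y)" unfolding C_def
      proof (rule nn_integral_monotone_convergence_SUP)
        show "incseq ?k" using decseqD[OF A(1)] by (auto simp: incseq_def le_fun_def indicator_def intro: order_trans)
        show "?k i \<in> borel_measurable lborel" for i
        proof -
          have "(\<lambda>z. ennreal (indicator J z * \<rho> z) * indicator {A i..y} z) \<in> borel_measurable borel"
            by (intro borel_measurable_times_ennreal measurable_compose[OF rm measurable_ennreal] borel_measurable_indicator) simp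
          also have "(\<lambda>z. ennreal (indicator J z * \<rho> z) * indicator {A i..y} z) = ?k i"
            using subinterval[OF A(2) yr, of i] by (auto simp: fun_eq_iff indicator_def J_def)
          finally show ?thesis by simp
        qed
      qed
      finally show ?thesis .
    qed
    have "(\<integral>\<^sup>+y\<in>einterval l (ereal x\<^sub>0). e2ennreal \<bar>(s (ereal y) - s l) / ereal (\<rho> y) * ereal ((g' y)\<^sup>2)\<bar> \<partial>lborel)
       = (\<integral>\<^sup>+y. (SUP i. h i y) \<partial>lborel)"
    proof (rule nn_integral_cong)
      fix y
      show "e2ennreal \<bar>(s (ereal y) - s l) / ereal (\<rho> y) * ereal ((g' y)\<^sup>2)\<bar> * indicator (einterval l (ereal x\<^sub>0)) y = (SUP i. h i y)"
      proof (cases "y \<in> einterval l (ereal x\<^sub>0)")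
        case True
        then have y: "y \<in> J" "y < x\<^sub>0" using xr by (auto simp: J_def einterval_def intro: less_trans[of _ "ereal x\<^sub>0"])
        have "e2ennreal \<bar>(s (ereal y) - s l) / ereal (\<rho> y) * ereal ((g' y)\<^sup>2)\<bar> = S y * ennreal (q y)"
          unfolding expr[OF y(1)] by simp
        also have "\<dots> = (SUP i. C i y * ennreal (q y))" unfolding S_sup[OF y(1)] by (rule SUP_mult_right_ennreal)
        finally show ?thesis using True y(2) by (simp add: h_def)
      next
        case False
        have "h i y = 0" for i
          unfolding h_eq using False A(2)[of i] by (auto simp: einterval_def indicator_def intro: less_trans[of l "ereal (A i)"])
        then show ?thesis using False by simp
      qed
    qed
    also have "\<dots> = (SUP i. (\<integral>\<^sup>+y. h i y \<partial>lborel))"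
    proof (rule nn_integral_monotone_convergence_SUP[OF _ hmeas])
      show "incseq h" unfolding incseq_def le_fun_def h_def by (auto intro!: mult_right_mono C_mono)
    qed
    also have "\<dots> \<le> ennreal E"
    proof (rule SUP_least)
      fix i
      have "A i < x\<^sub>0" using A(3)[of i] by simp
      from E[OF A(2) this] show "(\<integral>\<^sup>+y. h i y \<partial>lborel) \<le> ennreal E" by (simp only: h_eq)
    qed
    also have "\<dots> < \<infinity>" by simp
    finally show "(\<integral>\<^sup>+y\<in>einterval l (ereal x\<^sub>0). e2ennreal \<bar>(s (ereal y) - s l) / ereal (\<rho> y) * ereal ((g' y)\<^sup>2)\<bar> \<partial>lborel) < \<infinity>" .
  qed
qed

end
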